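(* Let $A$ and $B$ be simple C*-algebras. (1) If $A$ and $B$ are stably isomorphic (that is, $A\otimes\mathcal{K}\cong B\otimes\mathcal{K}$), and $A$ is tracially $\mathcal{Z}$-absorbing, then so is $B$. (2) If $A$ and $B$ are $\sigma$-unital and Morita equivalent, and $A$ is tracially $\mathcal{Z}$-absorbing, then so is $B$.
   Context: C*-algebras are not assumed unital. $\mathcal{K}=K(\ell^2)$ is the algebra of compact operators on $\ell^2$. Morita equivalence is (strong) Morita equivalence of C*-algebras in the sense of Rieffel. For positive elements $a,b$ of a C*-algebra $A$, $a \precsim b$ (Cuntz subequivalence) means there is a sequence $(v_n)$ in $A$ with $\|a - v_n b v_n^*\| \to 0$. For self-adjoint $c$ and $\varepsilon>0$, $(c-\varepsilon)_+$ is obtained by applying $t \mapsto \max(t-\varepsilon,0)$. $M_n=M_n(\mathbb{C})$, $[y,z]=yz-zy$. A completely positive contractive (c.p.c.) map $\varphi$ has order zero if $\varphi(y)\varphi(z)=0$ whenever $y,z$ are positive with $yz=0$. A simple C*-algebra $A$ is tracially $\mathcal{Z}$-absorbing if $A \not\cong \mathbb{C}$ and for every $x,a \in A_+$ with $a \neq 0$, every finite set $F \subseteq A$, every $\varepsilon>0$, and every $n \in \mathbb{N}$, there is a c.p.c. order zero map $\varphi\colon M_n \to A$ such that (i) $(x^2 - x\varphi(1)x - \varepsilon)_+ \precsim a$, and (ii) $\|[\varphi(z),b]\| < \varepsilon$ for all $z \in M_n$ with $\|z\| \le 1$ and all $b \in F$. *)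

theory Defs
  imports
    "HOL-Analysis.Analysis"
    "Jordan_Normal_Form.Matrix"
    "Jordan_Normal_Form.Schur_Decomposition"
begin

section \<open>C*-algebras\<close>

text \<open>
  A C*-algebra is a type of class \<open>cstar_algebra\<close> below; it need not be unital, and the zero
  algebra is allowed.  Properties of a C*-algebra are predicates on \<open>'a itself\<close> and are applied to
  \<open>TYPE('a)\<close>.
\<close>

class complex_normed_vector = real_normed_vector +
  fixes scaleC :: "complex \<Rightarrow> 'a \<Rightarrow> 'a"  (infixr \<open>*\<^sub>C\<close> 75)
  assumes scaleC_add_right: "c *\<^sub>C (x + y) = c *\<^sub>C x + c *\<^sub>C y"
    and scaleC_add_left: "(c + d) *\<^sub>C x = c *\<^sub>C x + d *\<^sub>C x"
    and scaleC_scaleC: "c *\<^sub>C (d *\<^sub>C x) = (c * d) *\<^sub>C x"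
    and scaleC_of_real: "complex_of_real r *\<^sub>C x = r *\<^sub>R x"
    and norm_scaleC: "norm (c *\<^sub>C x) = cmod c * norm x"

class complex_banach = complex_normed_vector + banach

class cstar_algebra = complex_banach + real_normed_algebra +
  fixes star :: "'a \<Rightarrow> 'a"
  assumes scaleC_mult_left: "(c *\<^sub>C x) * y = c *\<^sub>C (x * y)"
    and scaleC_mult_right: "x * (c *\<^sub>C y) = c *\<^sub>C (x * y)"
    and star_star: "star (star x) = x"
    and star_add: "star (x + y) = star x + star y"
    and star_scaleC: "star (c *\<^sub>C x) = cnj c *\<^sub>C star x"
    and star_mult: "star (x * y) = star y * star x"
    and cstar_identity: "norm (star x * x) = (norm x)\<^sup>2"

instantiation complex :: complex_normed_vector
begin
definition scaleC_complex :: "complex \<Rightarrow> complex \<Rightarrow> complex"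
  where "scaleC_complex c x = c * x"
instance
  by standard (auto simp: scaleC_complex_def algebra_simps norm_mult scaleR_conv_of_real)
end

instance complex :: complex_banach ..

instantiation complex :: cstar_algebra
begin
definition star_complex :: "complex \<Rightarrow> complex"
  where "star_complex x = cnj x"
instance
  by standard
    (auto simp: scaleC_complex_def star_complex_def norm_mult power2_eq_square)
end

definition star_hom :: "('a::cstar_algebra \<Rightarrow> 'b::cstar_algebra) \<Rightarrow> bool" where
  "star_hom \<pi> \<longleftrightarrow>
     (\<forall>x y. \<pi> (x + y) = \<pi> x + \<pi> y) \<and> (\<forall>c x. \<pi> (c *\<^sub>C x) = c *\<^sub>C \<pi> x) \<and>
     (\<forall>x y. \<pi> (x * y) = \<pi> x * \<pi> y) \<and> (\<forall>x. \<pi> (star x) = star (\<pi> x))"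

definition cstar_isomorphic :: "'a::cstar_algebra itself \<Rightarrow> 'b::cstar_algebra itself \<Rightarrow> bool" where
  "cstar_isomorphic _ _ \<longleftrightarrow> (\<exists>\<pi>::'a \<Rightarrow> 'b. star_hom \<pi> \<and> bij \<pi>)"

definition closed_ideal :: "'a::cstar_algebra set \<Rightarrow> bool" where
  "closed_ideal I \<longleftrightarrow> closed I \<and> 0 \<in> I \<and> (\<forall>x\<in>I. \<forall>y\<in>I. x + y \<in> I) \<and>
     (\<forall>x\<in>I. \<forall>c. c *\<^sub>C x \<in> I) \<and> (\<forall>x\<in>I. \<forall>a. a * x \<in> I \<and> x * a \<in> I)"

definition simple_cstar :: "'a::cstar_algebra itself \<Rightarrow> bool" where
  "simple_cstar _ \<longleftrightarrow> (\<forall>I::'a set. closed_ideal I \<longrightarrow> I = {0} \<or> I = UNIV)"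

definition positive :: "'a::cstar_algebra \<Rightarrow> bool" where
  "positive a \<longleftrightarrow> (\<exists>x. a = star x * x)"

definition sigma_unital :: "'a::cstar_algebra itself \<Rightarrow> bool" where
  "sigma_unital _ \<longleftrightarrow>
     (\<exists>e::nat \<Rightarrow> 'a. (\<forall>n. positive (e n) \<and> norm (e n) \<le> 1) \<and>
        (\<forall>a. (\<lambda>n. e n * a) \<longlonglongrightarrow> a \<and> (\<lambda>n. a * e n) \<longlonglongrightarrow> a))"

definition cuntz_sub :: "'a::cstar_algebra \<Rightarrow> 'a \<Rightarrow> bool"  (infix \<open>\<precsim>\<close> 50) where
  "a \<precsim> b \<longleftrightarrow> (\<exists>v::nat \<Rightarrow> 'a. (\<lambda>n. norm (a - v n * b * star (v n))) \<longlonglongrightarrow> 0)"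


section \<open>Continuous functional calculus\<close>

text \<open>
  Without a unit, \<open>1 - a\<close> is invertible in the unitization iff \<open>a\<close> has a quasi-inverse \<open>b\<close>,
  the inverse being \<open>1 - b\<close>.  The set \<open>spectrum_cstar a\<close> is the spectrum of \<open>a\<close> in the
  unitization, with \<open>0\<close> adjoined also when the algebra is itself unital.
\<close>

definition quasi_invertible :: "'a::cstar_algebra \<Rightarrow> bool" where
  "quasi_invertible a \<longleftrightarrow> (\<exists>b. a + b = a * b \<and> a + b = b * a)"

definition spectrum_cstar :: "'a::cstar_algebra \<Rightarrow> complex set" where
  "spectrum_cstar a = {z. z = 0 \<or> \<not> quasi_invertible (inverse z *\<^sub>C a)}"

text \<open>\<open>pow_Suc a k\<close> is the power of \<open>a\<close> with exponent \<open>k + 1\<close>.\<close>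

primrec pow_Suc :: "'a::cstar_algebra \<Rightarrow> nat \<Rightarrow> 'a" where
  "pow_Suc a 0 = a"
| "pow_Suc a (Suc k) = pow_Suc a k * a"

text \<open>The value at \<open>a\<close> of the polynomial \<open>t * p t\<close>, which has no constant term.\<close>

definition poly_cstar :: "real poly \<Rightarrow> 'a::cstar_algebra \<Rightarrow> 'a" where
  "poly_cstar p a = (\<Sum>k\<le>degree p. coeff p k *\<^sub>R pow_Suc a k)"

text \<open>
  For \<open>a\<close> self-adjoint and \<open>f\<close> continuous with \<open>f 0 = 0\<close>: the element \<open>f a\<close> is the norm limit of
  \<open>q\<^sub>n a\<close> for every sequence of polynomials \<open>q\<^sub>n t = t * p\<^sub>n t\<close> converging to \<open>f\<close> uniformly on the
  spectrum of \<open>a\<close>.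
\<close>

definition cfc :: "(real \<Rightarrow> real) \<Rightarrow> 'a::cstar_algebra \<Rightarrow> 'a" where
  "cfc f a = (THE y. \<forall>p :: nat \<Rightarrow> real poly.
     uniform_limit {t. complex_of_real t \<in> spectrum_cstar a} (\<lambda>n t. t * poly (p n) t) f sequentially
       \<longrightarrow> (\<lambda>n. poly_cstar (p n) a) \<longlonglongrightarrow> y)"

definition cut_down :: "'a::cstar_algebra \<Rightarrow> real \<Rightarrow> 'a" where
  "cut_down c \<epsilon> = cfc (\<lambda>t. max (t - \<epsilon>) 0) c"


section \<open>Completely positive maps of order zero on matrix algebras\<close>

text \<open>
  The C*-algebra of complex \<open>n \<times> n\<close> matrices is the carrier \<open>carrier_mat n n\<close>, with the operator
  norm \<open>mat_opnorm\<close>.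
\<close>

definition mat_opnorm :: "complex mat \<Rightarrow> real" where
  "mat_opnorm Z = Sup {sqrt (Re ((Z *\<^sub>v v) \<bullet>c (Z *\<^sub>v v))) | v.
     v \<in> carrier_vec (dim_col Z) \<and> Re (v \<bullet>c v) \<le> 1}"

definition mat_positive :: "nat \<Rightarrow> complex mat \<Rightarrow> bool" where
  "mat_positive n Z \<longleftrightarrow> (\<exists>X\<in>carrier_mat n n. Z = mat_adjoint X * X)"

text \<open>The \<open>(i, j)\<close> block of size \<open>n \<times> n\<close> of a matrix of size \<open>kn \<times> kn\<close>, identifying
  \<open>M\<^sub>k(M\<^sub>n)\<close> with \<open>M\<^sub>k\<^sub>n\<close>.\<close>

definition mat_block :: "nat \<Rightarrow> complex mat \<Rightarrow> nat \<Rightarrow> nat \<Rightarrow> complex mat" where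
  "mat_block n Z i j = mat n n (\<lambda>(p, q). Z $$ (i * n + p, j * n + q))"

text \<open>Positivity in \<open>M\<^sub>k(A)\<close>, whose elements are given by their entries with indices below \<open>k\<close>.\<close>

definition amp_positive :: "nat \<Rightarrow> (nat \<Rightarrow> nat \<Rightarrow> 'a::cstar_algebra) \<Rightarrow> bool" where
  "amp_positive k Y \<longleftrightarrow>
     (\<exists>X :: nat \<Rightarrow> nat \<Rightarrow> 'a. \<forall>i<k. \<forall>j<k. Y i j = (\<Sum>l<k. star (X l i) * X l j))"

definition linear_on_mat :: "nat \<Rightarrow> (complex mat \<Rightarrow> 'a::cstar_algebra) \<Rightarrow> bool" where
  "linear_on_mat n \<phi> \<longleftrightarrow>
     (\<forall>y\<in>carrier_mat n n. \<forall>z\<in>carrier_mat n n. \<phi> (y + z) = \<phi> y + \<phi> z) \<and>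
     (\<forall>c. \<forall>z\<in>carrier_mat n n. \<phi> (c \<cdot>\<^sub>m z) = c *\<^sub>C \<phi> z)"

definition cpc :: "nat \<Rightarrow> (complex mat \<Rightarrow> 'a::cstar_algebra) \<Rightarrow> bool" where
  "cpc n \<phi> \<longleftrightarrow> linear_on_mat n \<phi> \<and>
     (\<forall>k Z. mat_positive (k * n) Z \<longrightarrow> amp_positive k (\<lambda>i j. \<phi> (mat_block n Z i j))) \<and>
     (\<forall>z\<in>carrier_mat n n. norm (\<phi> z) \<le> mat_opnorm z)"

definition cpc_order_zero :: "nat \<Rightarrow> (complex mat \<Rightarrow> 'a::cstar_algebra) \<Rightarrow> bool" where
  "cpc_order_zero n \<phi> \<longleftrightarrow> cpc n \<phi> \<and>
     (\<forall>y z. mat_positive n y \<longrightarrow> mat_positive n z \<longrightarrow> y * z = 0\<^sub>m n n \<longrightarrow> \<phi> y * \<phi> z = 0)"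

definition tracially_Z_absorbing :: "'a::cstar_algebra itself \<Rightarrow> bool" where
  "tracially_Z_absorbing _ \<longleftrightarrow>
     \<not> cstar_isomorphic TYPE('a) TYPE(complex) \<and>
     (\<forall>(x::'a) (a::'a) (F::'a set) (\<epsilon>::real) (n::nat).
        positive x \<longrightarrow> positive a \<longrightarrow> a \<noteq> 0 \<longrightarrow> finite F \<longrightarrow> \<epsilon> > 0 \<longrightarrow> n \<ge> 1 \<longrightarrow>
        (\<exists>\<phi> :: complex mat \<Rightarrow> 'a. cpc_order_zero n \<phi> \<and>
           cut_down (x * x - x * \<phi> (1\<^sub>m n) * x) \<epsilon> \<precsim> a \<and>
           (\<forall>z\<in>carrier_mat n n. mat_opnorm z \<le> 1 \<longrightarrow>
              (\<forall>b\<in>F. norm (\<phi> z * b - b * \<phi> z) < \<epsilon>))))"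


section \<open>Compact operators on \<open>\<ell>\<^sup>2\<close>\<close>

typedef ell2 = "{x :: nat \<Rightarrow> complex. summable (\<lambda>n. (cmod (x n))\<^sup>2)}"
  morphisms ell2_nth Abs_ell2
  by (rule exI[of _ "\<lambda>_. 0"]) simp

setup_lifting type_definition_ell2

lemma ell2_add:
  fixes x y :: "nat \<Rightarrow> complex"
  assumes x: "summable (\<lambda>n. (cmod (x n))\<^sup>2)" and y: "summable (\<lambda>n. (cmod (y n))\<^sup>2)"
  shows "summable (\<lambda>n. (cmod (x n + y n))\<^sup>2)"
    and "sqrt (\<Sum>n. (cmod (x n + y n))\<^sup>2) \<le> sqrt (\<Sum>n. (cmod (x n))\<^sup>2) + sqrt (\<Sum>n. (cmod (y n))\<^sup>2)"
proof -
  let ?B = "sqrt (\<Sum>n. (cmod (x n))\<^sup>2) + sqrt (\<Sum>n. (cmod (y n))\<^sup>2)"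
  have B: "(\<Sum>n<N. (cmod (x n + y n))\<^sup>2) \<le> ?B\<^sup>2" for N
  proof -
    have "sqrt (\<Sum>n<N. (cmod (x n + y n))\<^sup>2) \<le> sqrt (\<Sum>n<N. (cmod (x n) + cmod (y n))\<^sup>2)"
      by (intro real_sqrt_le_mono sum_mono power_mono norm_triangle_ineq) auto
    also have "\<dots> \<le> sqrt (\<Sum>n<N. (cmod (x n))\<^sup>2) + sqrt (\<Sum>n<N. (cmod (y n))\<^sup>2)"
      using L2_set_triangle_ineq[of "\<lambda>n. cmod (x n)" "\<lambda>n. cmod (y n)" "{..<N}"]
      by (simp add: L2_set_def)
    also have "\<dots> \<le> ?B"
      by (intro add_mono real_sqrt_le_mono sum_le_suminf x y) auto
    finally have "sqrt (\<Sum>n<N. (cmod (x n + y n))\<^sup>2) \<le> ?B" .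
    then show ?thesis
      by (rule sqrt_le_D)
  qed
  show s: "summable (\<lambda>n. (cmod (x n + y n))\<^sup>2)"
    by (rule summableI_nonneg_bounded[OF _ B]) simp
  have "(\<Sum>n. (cmod (x n + y n))\<^sup>2) \<le> ?B\<^sup>2"
    by (rule suminf_le_const[OF s B])
  moreover have "?B \<ge> 0"
    by (intro add_nonneg_nonneg real_sqrt_ge_zero suminf_nonneg x y) auto
  ultimately show "sqrt (\<Sum>n. (cmod (x n + y n))\<^sup>2) \<le> ?B"
    by (rule real_le_lsqrt[rotated])
qed

lemma ell2_scale:
  fixes x :: "nat \<Rightarrow> complex"
  assumes x: "summable (\<lambda>n. (cmod (x n))\<^sup>2)"
  shows "summable (\<lambda>n. (cmod (c * x n))\<^sup>2)"
    and "sqrt (\<Sum>n. (cmod (c * x n))\<^sup>2) = cmod c * sqrt (\<Sum>n. (cmod (x n))\<^sup>2)"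
proof -
  show "summable (\<lambda>n. (cmod (c * x n))\<^sup>2)"
    by (simp add: norm_mult power_mult_distrib summable_mult x)
  show "sqrt (\<Sum>n. (cmod (c * x n))\<^sup>2) = cmod c * sqrt (\<Sum>n. (cmod (x n))\<^sup>2)"
    by (simp add: norm_mult power_mult_distrib suminf_mult x real_sqrt_mult)
qed

instantiation ell2 :: complex_normed_vector
begin

lift_definition zero_ell2 :: ell2 is "\<lambda>_. 0" by simp
lift_definition plus_ell2 :: "ell2 \<Rightarrow> ell2 \<Rightarrow> ell2" is "\<lambda>x y n. x n + y n"
  by (rule ell2_add)
lift_definition scaleC_ell2 :: "complex \<Rightarrow> ell2 \<Rightarrow> ell2" is "\<lambda>c x n. c * x n"
  by (rule ell2_scale)
lift_definition norm_ell2 :: "ell2 \<Rightarrow> real" is "\<lambda>x. sqrt (\<Sum>n. (cmod (x n))\<^sup>2)" .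

definition scaleR_ell2 :: "real \<Rightarrow> ell2 \<Rightarrow> ell2" where "scaleR_ell2 r x = complex_of_real r *\<^sub>C x"
definition uminus_ell2 :: "ell2 \<Rightarrow> ell2" where "uminus_ell2 x = (- 1) *\<^sub>C x"
definition minus_ell2 :: "ell2 \<Rightarrow> ell2 \<Rightarrow> ell2" where "minus_ell2 x y = x + (- y)"
definition dist_ell2 :: "ell2 \<Rightarrow> ell2 \<Rightarrow> real" where "dist_ell2 x y = norm (x - y)"
definition sgn_ell2 :: "ell2 \<Rightarrow> ell2" where "sgn_ell2 x = inverse (norm x) *\<^sub>R x"
definition uniformity_ell2 :: "(ell2 \<times> ell2) filter"
  where "uniformity_ell2 = (INF e\<in>{0<..}. principal {(x, y). dist x y < e})"
definition open_ell2 :: "ell2 set \<Rightarrow> bool"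
  where "open_ell2 U = (\<forall>x\<in>U. eventually (\<lambda>(x', y). x' = x \<longrightarrow> y \<in> U) uniformity)"

instance
proof
  fix x y z :: ell2 and r s :: real and c d :: complex and U :: "ell2 set"
  show "x + y + z = x + (y + z)" by transfer (simp add: add.assoc)
  show "x + y = y + x" by transfer (simp add: add.commute)
  show "0 + x = x" by transfer simp
  show "- x + x = 0" unfolding uminus_ell2_def by transfer simp
  show "x - y = x + - y" by (rule minus_ell2_def)
  show cadd: "c *\<^sub>C (x + y) = c *\<^sub>C x + c *\<^sub>C y" for c and x y :: ell2
    by transfer (simp add: distrib_left)
  show cadd': "(c + d) *\<^sub>C x = c *\<^sub>C x + d *\<^sub>C x" for c d and x :: ell2
    by transfer (simp add: distrib_right)
  show cc: "c *\<^sub>C (d *\<^sub>C x) = (c * d) *\<^sub>C x" for c d and x :: ell2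
    by transfer (simp add: mult.assoc)
  show cn: "norm (c *\<^sub>C x) = cmod c * norm x" for c and x :: ell2
    by transfer (rule ell2_scale)
  show "complex_of_real r *\<^sub>C x = r *\<^sub>R x" by (simp add: scaleR_ell2_def)
  show "r *\<^sub>R (x + y) = r *\<^sub>R x + r *\<^sub>R y" by (simp add: scaleR_ell2_def cadd)
  show "(r + s) *\<^sub>R x = r *\<^sub>R x + s *\<^sub>R x" by (simp add: scaleR_ell2_def cadd')
  show "r *\<^sub>R s *\<^sub>R x = (r * s) *\<^sub>R x" by (simp add: scaleR_ell2_def cc)
  show "1 *\<^sub>R x = x" unfolding scaleR_ell2_def by transfer simp
  show "norm (r *\<^sub>R x) = \<bar>r\<bar> * norm x" by (simp add: scaleR_ell2_def cn)
  show "dist x y = norm (x - y)" by (rule dist_ell2_def)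
  show "sgn x = inverse (norm x) *\<^sub>R x" by (rule sgn_ell2_def)
  show "(uniformity :: (ell2 \<times> ell2) filter) = (INF e\<in>{0<..}. principal {(x, y). dist x y < e})"
    by (rule uniformity_ell2_def)
  show "open U = (\<forall>x\<in>U. eventually (\<lambda>(x', y). x' = x \<longrightarrow> y \<in> U) uniformity)"
    by (rule open_ell2_def)
  show "norm (x + y) \<le> norm x + norm y" by transfer (rule ell2_add)
  show "(norm x = 0) = (x = 0)"
    by transfer (auto simp: suminf_eq_zero_iff fun_eq_iff)
qed

end

definition ell2_inner :: "ell2 \<Rightarrow> ell2 \<Rightarrow> complex" where
  "ell2_inner x y = (\<Sum>n. ell2_nth x n * cnj (ell2_nth y n))"

text \<open>
  Complex scalar multiplication on bounded real-linear maps, so that the complex-linear maps in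
  \<open>ell2 \<Rightarrow>\<^sub>L ell2\<close> are the bounded operators on \<open>\<ell>\<^sup>2\<close>, with composition \<open>o\<^sub>L\<close> and the operator norm.
\<close>

lemma bounded_linear_scaleC: "bounded_linear (\<lambda>x :: 'a::complex_normed_vector. c *\<^sub>C x)"
proof (rule bounded_linear_intro[where K = "cmod c"])
  show "c *\<^sub>C (r *\<^sub>R x) = r *\<^sub>R (c *\<^sub>C x)" for r and x :: 'a
    by (simp flip: scaleC_of_real add: scaleC_scaleC mult.commute)
qed (simp_all add: scaleC_add_right norm_scaleC mult.commute)

instantiation blinfun :: (real_normed_vector, complex_normed_vector) complex_normed_vector
begin

lift_definition scaleC_blinfun :: "complex \<Rightarrow> ('a \<Rightarrow>\<^sub>L 'b) \<Rightarrow> ('a \<Rightarrow>\<^sub>L 'b)" is "\<lambda>c T x. c *\<^sub>C T x"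
  by (rule bounded_linear_compose[OF bounded_linear_scaleC])

instance
proof
  fix S T :: "'a \<Rightarrow>\<^sub>L 'b" and c d :: complex and r :: real
  show "c *\<^sub>C (S + T) = c *\<^sub>C S + c *\<^sub>C T" by transfer (simp add: scaleC_add_right)
  show "(c + d) *\<^sub>C T = c *\<^sub>C T + d *\<^sub>C T" by transfer (simp add: scaleC_add_left)
  show "c *\<^sub>C (d *\<^sub>C T) = (c * d) *\<^sub>C T" by transfer (simp add: scaleC_scaleC)
  show "complex_of_real r *\<^sub>C T = r *\<^sub>R T" by transfer (simp add: scaleC_of_real)
  have le: "norm (c *\<^sub>C T) \<le> cmod c * norm T" for c and T :: "'a \<Rightarrow>\<^sub>L 'b"
  proof (rule norm_blinfun_bound)
    show "norm (blinfun_apply (c *\<^sub>C T) x) \<le> cmod c * norm T * norm x" for x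
      by (simp add: scaleC_blinfun.rep_eq norm_scaleC mult.assoc mult_left_mono norm_blinfun)
  qed simp
  show "norm (c *\<^sub>C T) = cmod c * norm T"
  proof (cases "c = 0")
    case True
    then show ?thesis using le[of 0 T] by simp
  next
    case False
    have one: "inverse c *\<^sub>C (c *\<^sub>C T) = T"
    proof (rule blinfun_eqI)
      show "blinfun_apply (inverse c *\<^sub>C (c *\<^sub>C T)) x = blinfun_apply T x" for x
        using False scaleC_of_real[of 1 "blinfun_apply T x"]
        by (simp add: scaleC_blinfun.rep_eq scaleC_scaleC)
    qed
    have "cmod c * norm T \<le> cmod c * (cmod (inverse c) * norm (c *\<^sub>C T))"
      using le[of "inverse c" "c *\<^sub>C T"] by (simp only: one mult_left_mono norm_ge_zero)
    also have "\<dots> = norm (c *\<^sub>C T)"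
      using False by (simp add: norm_inverse)
    finally show ?thesis using le[of c T] by simp
  qed
qed

end

definition compact_ops :: "(ell2 \<Rightarrow>\<^sub>L ell2) set" where
  "compact_ops = {T. (\<forall>c x. blinfun_apply T (c *\<^sub>C x) = c *\<^sub>C blinfun_apply T x) \<and>
     compact (closure (blinfun_apply T ` cball 0 1))}"

definition op_adjoint :: "(ell2 \<Rightarrow>\<^sub>L ell2) \<Rightarrow> (ell2 \<Rightarrow>\<^sub>L ell2)" where
  "op_adjoint T = (THE S. \<forall>x y. ell2_inner (blinfun_apply T x) y = ell2_inner x (blinfun_apply S y))"


section \<open>Stable isomorphism\<close>

text \<open>
  \<open>is_stabilization t\<close> says that the C*-algebra \<open>'c\<close>, with elementary tensors \<open>a \<otimes> T = t a T\<close>, is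
  the tensor product of \<open>'a\<close> with the compact operators: it is the completion of the algebraic
  tensor product, as a *-algebra, in a C*-norm.  The compact operators being nuclear, this
  C*-norm is unique.  The fifth clause says that the map from the algebraic tensor product
  induced by the bilinear map \<open>t\<close> is injective.
\<close>

definition is_stabilization :: "('a::cstar_algebra \<Rightarrow> (ell2 \<Rightarrow>\<^sub>L ell2) \<Rightarrow> 'c::cstar_algebra) \<Rightarrow> bool" where
  "is_stabilization t \<longleftrightarrow>
     (\<forall>a b. \<forall>T\<in>compact_ops. t (a + b) T = t a T + t b T) \<and>
     (\<forall>a. \<forall>S\<in>compact_ops. \<forall>T\<in>compact_ops. t a (S + T) = t a S + t a T) \<and>
     (\<forall>c a. \<forall>T\<in>compact_ops. t (c *\<^sub>C a) T = c *\<^sub>C t a T \<and> t a (c *\<^sub>C T) = c *\<^sub>C t a T) \<and>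
     (\<forall>a b. \<forall>S\<in>compact_ops. \<forall>T\<in>compact_ops. t a S * t b T = t (a * b) (S o\<^sub>L T)) \<and>
     (\<forall>(n::nat) a T. (\<forall>i<n. T i \<in> compact_ops) \<longrightarrow>
        (\<forall>c :: nat \<Rightarrow> complex. (\<Sum>i<n. c i *\<^sub>C T i) = 0 \<longrightarrow> (\<forall>i<n. c i = 0)) \<longrightarrow>
        (\<Sum>i<n. t (a i) (T i)) = 0 \<longrightarrow> (\<forall>i<n. a i = 0)) \<and>
     (\<forall>a. \<forall>T\<in>compact_ops. star (t a T) = t (star a) (op_adjoint T)) \<and>
     closure (span {t a T | a T. T \<in> compact_ops}) = UNIV"

text \<open>
  HOL has no quantification over types inside a formula, so the types carrying the two
  stabilizations are parameters.  As type variables in the hypothesis of a theorem they express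
  an existential quantification over all C*-algebras.
\<close>

definition stably_isomorphic ::
  "'c::cstar_algebra itself \<Rightarrow> 'd::cstar_algebra itself \<Rightarrow>
   'a::cstar_algebra itself \<Rightarrow> 'b::cstar_algebra itself \<Rightarrow> bool" where
  "stably_isomorphic _ _ _ _ \<longleftrightarrow>
     (\<exists>(s :: 'a \<Rightarrow> (ell2 \<Rightarrow>\<^sub>L ell2) \<Rightarrow> 'c) (t :: 'b \<Rightarrow> (ell2 \<Rightarrow>\<^sub>L ell2) \<Rightarrow> 'd).
        is_stabilization s \<and> is_stabilization t \<and> cstar_isomorphic TYPE('c) TYPE('d))"


section \<open>Morita equivalence\<close>

text \<open>
  Hilbert modules over a C*-algebra, with the module a Banach space for the norm coming from the
  inner product.  The inner product is linear in the first variable for left modules and in the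
  second variable for right modules.
\<close>

definition left_hilbert_module ::
  "('a::cstar_algebra \<Rightarrow> 'x::complex_banach \<Rightarrow> 'x) \<Rightarrow> ('x \<Rightarrow> 'x \<Rightarrow> 'a) \<Rightarrow> bool" where
  "left_hilbert_module act ip \<longleftrightarrow>
     (\<forall>a b x. act (a + b) x = act a x + act b x) \<and> (\<forall>a x y. act a (x + y) = act a x + act a y) \<and>
     (\<forall>c a x. act (c *\<^sub>C a) x = c *\<^sub>C act a x \<and> act a (c *\<^sub>C x) = c *\<^sub>C act a x) \<and>
     (\<forall>a b x. act (a * b) x = act a (act b x)) \<and>
     (\<forall>x y z. ip (x + y) z = ip x z + ip y z) \<and> (\<forall>c x y. ip (c *\<^sub>C x) y = c *\<^sub>C ip x y) \<and>
     (\<forall>a x y. ip (act a x) y = a * ip x y) \<and> (\<forall>x y. star (ip x y) = ip y x) \<and>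
     (\<forall>x. positive (ip x x)) \<and> (\<forall>x. norm x = sqrt (norm (ip x x)))"

definition right_hilbert_module ::
  "('x::complex_banach \<Rightarrow> 'b::cstar_algebra \<Rightarrow> 'x) \<Rightarrow> ('x \<Rightarrow> 'x \<Rightarrow> 'b) \<Rightarrow> bool" where
  "right_hilbert_module act ip \<longleftrightarrow>
     (\<forall>x a b. act x (a + b) = act x a + act x b) \<and> (\<forall>x y b. act (x + y) b = act x b + act y b) \<and>
     (\<forall>c x b. act x (c *\<^sub>C b) = c *\<^sub>C act x b \<and> act (c *\<^sub>C x) b = c *\<^sub>C act x b) \<and>
     (\<forall>x a b. act x (a * b) = act (act x a) b) \<and>
     (\<forall>x y z. ip x (y + z) = ip x y + ip x z) \<and> (\<forall>c x y. ip x (c *\<^sub>C y) = c *\<^sub>C ip x y) \<and>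
     (\<forall>x y b. ip x (act y b) = ip x y * b) \<and> (\<forall>x y. star (ip x y) = ip y x) \<and>
     (\<forall>x. positive (ip x x)) \<and> (\<forall>x. norm x = sqrt (norm (ip x x)))"

text \<open>Full: the inner products span a dense subspace.  The real span of the set of inner products
  is already a complex subspace.\<close>

definition full_ip :: "('x \<Rightarrow> 'x \<Rightarrow> 'a::cstar_algebra) \<Rightarrow> bool" where
  "full_ip ip \<longleftrightarrow> closure (span {ip x y | x y. True}) = UNIV"

text \<open>
  That the norms of the left and the right Hilbert module structure agree is no restriction:
  it follows from the other conditions.
\<close>

definition imprimitivity_bimodule ::
  "('a::cstar_algebra \<Rightarrow> 'x::complex_banach \<Rightarrow> 'x) \<Rightarrow> ('x \<Rightarrow> 'b::cstar_algebra \<Rightarrow> 'x) \<Rightarrow>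
   ('x \<Rightarrow> 'x \<Rightarrow> 'a) \<Rightarrow> ('x \<Rightarrow> 'x \<Rightarrow> 'b) \<Rightarrow> bool" where
  "imprimitivity_bimodule la ra lip rip \<longleftrightarrow>
     left_hilbert_module la lip \<and> full_ip lip \<and>
     right_hilbert_module ra rip \<and> full_ip rip \<and>
     (\<forall>a x b. ra (la a x) b = la a (ra x b)) \<and>
     (\<forall>a x y. rip (la a x) y = rip x (la (star a) y)) \<and>
     (\<forall>b x y. lip (ra x b) y = lip x (ra y (star b))) \<and>
     (\<forall>x y z. la (lip x y) z = ra x (rip y z))"

text \<open>The type \<open>'x\<close> carrying the bimodule is a parameter for the same reason as in the definition of
  \<open>stably_isomorphic\<close>.\<close>

definition morita_equivalent ::
  "'x::complex_banach itself \<Rightarrow> 'a::cstar_algebra itself \<Rightarrow> 'b::cstar_algebra itself \<Rightarrow> bool" where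
  "morita_equivalent _ _ _ \<longleftrightarrow>
     (\<exists>(la :: 'a \<Rightarrow> 'x \<Rightarrow> 'x) (ra :: 'x \<Rightarrow> 'b \<Rightarrow> 'x) (lip :: 'x \<Rightarrow> 'x \<Rightarrow> 'a) (rip :: 'x \<Rightarrow> 'x \<Rightarrow> 'b).
        imprimitivity_bimodule la ra lip rip)"

end

theory Submission
  imports Defs
begin

text \<open>
  An order zero map on \<open>M\<^sub>n\<close> amounts to a column of elements \<open>r\<^sub>i\<close> with \<open>r\<^sub>i\<^sup>* r\<^sub>j = \<delta>\<^sub>i\<^sub>j g\<^sup>2\<close>: such a
  column gives the map \<open>e\<^sub>i\<^sub>j \<mapsto> r\<^sub>i g r\<^sub>j\<^sup>*\<close>, and \<open>r\<^sub>i = \<phi>(e\<^sub>i\<^sub>0)\<close> is one, with \<open>\<Sum> r\<^sub>i r\<^sub>i\<^sup>* = \<phi>(1)\<^sup>2\<close>.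
  Almost orthogonal columns can be corrected to exact ones, so tracial \<open>\<Z>\<close>-absorption only asks for
  almost orthogonal, almost central columns.

  Let \<open>X\<close> be an \<open>A\<close>-\<open>B\<close>-bimodule with compatible inner products, and \<open>x\<^sub>k \<in> X\<close> such that
  \<open>e = \<Sum> \<langle>x\<^sub>k, x\<^sub>k\<rangle>\<close> is almost a unit for a given finite subset of \<open>B\<close>.  The positive map
  \<open>\<theta>(u) = \<Sum> \<langle>x\<^sub>k, u x\<^sub>k\<rangle>\<close> satisfies \<open>\<theta>(u)\<theta>(v) \<approx> \<theta>(uv)e\<close> when \<open>v\<close> almost commutes with all
  \<open>\<langle>x\<^sub>k, x\<^sub>l\<rangle> \<in> A\<close>, hence takes columns in \<open>A\<close> to almost orthogonal columns in \<open>B\<close>.  For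
  \<open>\<theta>(1 - \<phi>(1))\<close> to be Cuntz below a given \<open>a \<in> B\<close>, let \<open>1 - \<phi>(1)\<close> be Cuntz below an element of
  \<open>A\<close> that has \<open>N\<close> orthogonal copies in the hereditary subalgebra of \<open>\<langle>\<xi>a, \<xi>a\<rangle>\<close>, where \<open>N\<close> is the
  number of the \<open>x\<^sub>k\<close>.  It exists because \<open>A\<close> has no minimal projections.

  For stably isomorphic algebras take \<open>X = (A \<otimes> p) C (B \<otimes> p)\<close> with \<open>C\<close> the common stabilization and
  \<open>p\<close> a rank one projection.  That \<open>X \<noteq> 0\<close> needs the continuity of \<open>T \<mapsto> a \<otimes> T\<close> along the finite rank
  truncations of a compact \<open>T\<close>, which follows from the positivity of this map.
\<close>

section \<open>Unital C*-algebras\<close>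

text \<open>Positive linear maps such as \<theta> need not respect Cuntz subequivalence. The
  condition on \<open>cut_down\<close> is therefore replaced by an order inequality y \<preceq>
  \<epsilon> + w a (star w) in the unitization, which such maps do preserve;
  \<open>cuntz_cut_down_ple\<close> and \<open>ple_cuntz_cut_down\<close> translate at the two ends.
  Likewise \<theta>, being only almost multiplicative, cannot carry over an order zero map, but it
  carries over the finitely many relations of a column up to a small error.

  The sum of r_i (star r_i) is the square of \<phi>(1) in A, and the map rebuilt in B has its value
  at 1 close to a power of the corresponding sum. Both discrepancies cost only a constant: 1 - h^2
  \<le> 2 (1 - h), and 1 - H^N \<le> N (1 - H) by Bernoulli.

  Without polar decomposition inside the algebra, columns can be made exactly orthogonal only after
  multiplication by functions of their common modulus; this is where the powers come from.

  The x_k and the finite subset of A are fixed before a sequence of better and better columns is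
  chosen, so that approximate relations become relations modulo null sequences.\<close>

lemma scaleC_one [simp]: "1 *\<^sub>C (x :: 'a::complex_normed_vector) = x"
  using scaleC_of_real[of 1 x] by simp

lemma scaleC_zero_right [simp]: "c *\<^sub>C (0 :: 'a::complex_normed_vector) = 0"
  using bounded_linear.linear[OF bounded_linear_scaleC] linear_0 by blast

lemma scaleC_zero_left [simp]: "0 *\<^sub>C (x :: 'a::complex_normed_vector) = 0"
  using scaleC_of_real[of 0 x] by simp

lemma scaleC_minus_left: "(- c) *\<^sub>C (x :: 'a::complex_normed_vector) = - (c *\<^sub>C x)"
  using scaleC_add_left[of "- c" c x] by (simp add: eq_neg_iff_add_eq_0)

lemma scaleC_minus_right: "c *\<^sub>C (- x :: 'a::complex_normed_vector) = - (c *\<^sub>C x)"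
  using scaleC_add_right[of c "- x" x] by (simp add: eq_neg_iff_add_eq_0)

lemma scaleC_diff_right: "c *\<^sub>C (x - y :: 'a::complex_normed_vector) = c *\<^sub>C x - c *\<^sub>C y"
  using scaleC_add_right[of c x "- y"] by (simp add: scaleC_minus_right)

lemma scaleC_diff_left: "(c - d) *\<^sub>C (x :: 'a::complex_normed_vector) = c *\<^sub>C x - d *\<^sub>C x"
  using scaleC_add_left[of c "- d" x] by (simp add: scaleC_minus_left)

lemma scaleC_sum_right: "c *\<^sub>C (\<Sum>i\<in>I. f i :: 'a::complex_normed_vector) = (\<Sum>i\<in>I. c *\<^sub>C f i)"
  by (induction I rule: infinite_finite_induct) (auto simp: scaleC_add_right)

lemma scaleC_scaleR: "c *\<^sub>C (r *\<^sub>R x :: 'a::complex_normed_vector) = r *\<^sub>R (c *\<^sub>C x)"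
  by (simp flip: scaleC_of_real add: scaleC_scaleC mult.commute)

lemma star_zero [simp]: "star (0 :: 'a::cstar_algebra) = 0"
  using star_add[of "0::'a" 0] by simp

lemma star_uminus [simp]: "star (- x :: 'a::cstar_algebra) = - star x"
  using star_add[of x "- x"] by (simp add: eq_neg_iff_add_eq_0 add.commute)

lemma star_diff: "star (x - y :: 'a::cstar_algebra) = star x - star y"
  using star_add[of x "- y"] by simp

lemma star_scaleR [simp]: "star (r *\<^sub>R x :: 'a::cstar_algebra) = r *\<^sub>R star x"
  by (simp flip: scaleC_of_real add: star_scaleC)

lemma star_sum: "star (\<Sum>i\<in>I. f i :: 'a::cstar_algebra) = (\<Sum>i\<in>I. star (f i))"
  by (induction I rule: infinite_finite_induct) (auto simp: star_add)

lemma norm_star [simp]: "norm (star (x :: 'a::cstar_algebra)) = norm x"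
proof -
  have le: "norm x \<le> norm (star x)" for x :: 'a
  proof (cases "x = 0")
    case False
    have "(norm x)\<^sup>2 \<le> norm (star x) * norm x"
      using cstar_identity[of x] norm_mult_ineq[of "star x" x] by simp
    then show ?thesis using False by (simp add: power2_eq_square)
  qed simp
  show ?thesis using le[of x] le[of "star x"] by (simp add: star_star)
qed

lemma cstar_identity': "norm (x * star (x :: 'a::cstar_algebra)) = (norm x)\<^sup>2"
  using cstar_identity[of "star x"] by (simp add: star_star)

lemma star_mult_self_eq_0_iff [simp]: "star x * (x :: 'a::cstar_algebra) = 0 \<longleftrightarrow> x = 0"
  by (metis cstar_identity mult_zero_right norm_eq_zero power_eq_0_iff)

lemma mult_star_self_eq_0_iff [simp]: "x * star (x :: 'a::cstar_algebra) = 0 \<longleftrightarrow> x = 0"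
  by (metis cstar_identity' mult_zero_left norm_eq_zero power_eq_0_iff)

lemma star_star_simp [simp]: "star (star (x :: 'a::cstar_algebra)) = x"
  by (rule star_star)

lemma bounded_linear_star: "bounded_linear (star :: 'a::cstar_algebra \<Rightarrow> 'a)"
  by (rule bounded_linear_intro[where K = 1]) (auto simp: star_add)

lemmas tendsto_star = bounded_linear.tendsto[OF bounded_linear_star]

lemma selfadjoint_limit:
  fixes X :: "nat \<Rightarrow> 'a::cstar_algebra"
  assumes "X \<longlonglongrightarrow> x" "\<And>n. star (X n) = X n"
  shows "star x = x"
  using tendsto_star[OF assms(1)] assms LIMSEQ_unique by simp blast

text \<open>Spectral theory is developed for unital algebras only. The unitization \<open>uz\<close>
  is an instance of this class, and through it every result reaches the general case.\<close>

class cstar_algebra_1 = cstar_algebra + real_normed_algebra_1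

lemma star_one [simp]: "star (1 :: 'u::cstar_algebra_1) = 1"
  by (metis mult.left_neutral mult.right_neutral star_mult star_star)

lemma scaleC_one_mult [simp]: "(c *\<^sub>C (1::'u::cstar_algebra_1)) * x = c *\<^sub>C x" "x * (c *\<^sub>C (1::'u)) = c *\<^sub>C x"
  by (simp_all add: scaleC_mult_left scaleC_mult_right)

section \<open>Invertible elements and the spectrum of self-adjoint elements\<close>

definition inv_el :: "'u::cstar_algebra_1 \<Rightarrow> bool" where
  "inv_el a \<longleftrightarrow> (\<exists>b. a * b = 1 \<and> b * a = 1)"

lemma inv_el_mult:
  assumes "inv_el a" "inv_el b" shows "inv_el (a * b)"
proof -
  obtain c d where c: "a * c = 1" "c * a = 1" and d: "b * d = 1" "d * b = 1"
    using assms unfolding inv_el_def by auto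
  have "(a * b) * (d * c) = a * (b * d) * c" "(d * c) * (a * b) = d * (c * a) * b"
    by (simp_all only: mult.assoc)
  then show ?thesis unfolding inv_el_def using c d by auto
qed

lemma inv_el_scaleC:
  assumes "c \<noteq> 0" shows "inv_el (c *\<^sub>C a) \<longleftrightarrow> inv_el (a :: 'u::cstar_algebra_1)"
proof -
  have *: "inv_el (c *\<^sub>C a)" if "inv_el a" "c \<noteq> 0" for c and a :: 'u
  proof -
    obtain b where "a * b = 1" "b * a = 1" using \<open>inv_el a\<close> unfolding inv_el_def by auto
    then have "(c *\<^sub>C a) * (inverse c *\<^sub>C b) = 1" "(inverse c *\<^sub>C b) * (c *\<^sub>C a) = 1"
      using \<open>c \<noteq> 0\<close> by (simp_all add: scaleC_mult_left scaleC_mult_right scaleC_scaleC)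
    then show ?thesis unfolding inv_el_def by blast
  qed
  from *[of a c] *[of "c *\<^sub>C a" "inverse c"] assms show ?thesis
    by (auto simp: scaleC_scaleC)
qed

lemma inv_el_uminus: "inv_el (- a) \<longleftrightarrow> inv_el (a :: 'u::cstar_algebra_1)"
  using inv_el_scaleC[of "- 1" a] by (simp add: scaleC_minus_left)

lemma inv_el_one_minus:
  fixes x :: "'u::cstar_algebra_1"
  assumes "norm x < 1" shows "inv_el (1 - x)"
proof -
  have s: "summable (\<lambda>n. x ^ n)" using assms by (rule complete_algebra_summable_geometric)
  let ?S = "\<Sum>n. x ^ n"
  have "(\<Sum>n. x ^ Suc n) = ?S - 1" using suminf_split_head[OF s] by simp
  moreover have "(\<Sum>n. x ^ Suc n) = x * ?S"
    using suminf_mult[OF s, of x] by simp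
  moreover have "(\<Sum>n. x ^ Suc n) = ?S * x"
    using suminf_mult2[OF s, of x] by (simp only: power_Suc2)
  ultimately show ?thesis unfolding inv_el_def
    by (intro exI[of _ ?S]) (simp add: algebra_simps)
qed

text \<open>If \<open>b\<close> is the inverse of \<open>1 - x * y\<close>, the formal geometric
  series suggests \<open>1 + y * b * x\<close> as the inverse of \<open>1 - y * x\<close>. This is
  the source of the equality of the nonzero spectra of \<open>x * y\<close> and
  \<open>y * x\<close>.\<close>

lemma inv_el_one_minus_mult_commute:
  fixes x y :: "'u::cstar_algebra_1"
  assumes "inv_el (1 - x * y)" shows "inv_el (1 - y * x)"
proof -
  obtain b where b: "(1 - x * y) * b = 1" "b * (1 - x * y) = 1" using assms unfolding inv_el_def by auto
  have 1: "x * y * b = b - 1" "b * (x * y) = b - 1" using b by (simp_all add: algebra_simps)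
  have e1: "y * x * (y * b * x) = y * (x * y * b) * x" by (simp only: mult.assoc)
  have e2: "(y * b * x) * (y * x) = y * (b * (x * y)) * x" by (simp only: mult.assoc)
  have "(1 - y * x) * (1 + y * b * x) = 1 + y * b * x - y * x - y * x * (y * b * x)"
    "(1 + y * b * x) * (1 - y * x) = 1 + y * b * x - y * x - (y * b * x) * (y * x)"
    by (simp_all add: algebra_simps)
  moreover have "y * x * (y * b * x) = y * b * x - y * x" "(y * b * x) * (y * x) = y * b * x - y * x"
    unfolding e1 e2 1 by (simp_all add: algebra_simps)
  ultimately have "(1 - y * x) * (1 + y * b * x) = 1" "(1 + y * b * x) * (1 - y * x) = 1"
    by simp_all
  then show ?thesis unfolding inv_el_def by blast
qed

definition spec :: "'u::cstar_algebra_1 \<Rightarrow> complex set" where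
  "spec a = {z. \<not> inv_el (z *\<^sub>C 1 - a)}"

definition rspec :: "'u::cstar_algebra_1 \<Rightarrow> real set" where
  "rspec a = {t. complex_of_real t \<in> spec a}"

lemma rspec_iff: "t \<in> rspec a \<longleftrightarrow> \<not> inv_el (t *\<^sub>R 1 - a)"
  by (simp add: rspec_def spec_def scaleC_of_real)

lemma spec_norm_le:
  assumes "z \<in> spec a" shows "cmod z \<le> norm a"
proof (rule ccontr)
  assume "\<not> ?thesis"
  then have z: "norm a < cmod z" and nz: "z \<noteq> 0"
    using norm_ge_zero[of a] by (auto simp del: norm_ge_zero)
  have "norm (inverse z *\<^sub>C a) < 1"
    using z nz by (simp add: norm_scaleC norm_inverse) (simp add: field_simps)
  then have "inv_el (1 - inverse z *\<^sub>C a)" by (rule inv_el_one_minus)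
  then have "inv_el (z *\<^sub>C (1 - inverse z *\<^sub>C a))" using nz by (simp add: inv_el_scaleC)
  moreover have "z *\<^sub>C (1 - inverse z *\<^sub>C a) = z *\<^sub>C 1 - a"
    using nz by (simp add: scaleC_diff_right scaleC_scaleC)
  ultimately show False using assms by (simp add: spec_def)
qed

lemma rspec_le: "t \<in> rspec a \<Longrightarrow> \<bar>t\<bar> \<le> norm a"
  using spec_norm_le[of "complex_of_real t" a] by (simp add: rspec_def)

text \<open>Arens' argument: adding \<i> s to \<open>a\<close> shifts the spectrum, while the
  C*-identity bounds the squared norm of the shifted element by norm(a)^2 + s^2. The square of |z +
  \<i> s| contains the linear term 2 s Im(z), which exceeds this bound for a suitable s.\<close>

lemma spec_real:
  fixes a :: "'u::cstar_algebra_1"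
  assumes sa: "star a = a" and z: "z \<in> spec a" shows "Im z = 0"
proof (rule ccontr)
  assume b: "Im z \<noteq> 0"
  have *: "(cmod (z + \<i> * of_real s))\<^sup>2 \<le> (norm a)\<^sup>2 + s\<^sup>2" for s
  proof -
    let ?w = "\<i> * complex_of_real s"
    let ?b = "a + ?w *\<^sub>C 1"
    have eq: "(z + ?w) *\<^sub>C 1 - ?b = z *\<^sub>C 1 - a" by (simp add: scaleC_add_left)
    have "z + ?w \<in> spec ?b" using z unfolding spec_def mem_Collect_eq eq .
    then have "cmod (z + ?w) \<le> norm ?b" by (rule spec_norm_le)
    then have "(cmod (z + ?w))\<^sup>2 \<le> (norm ?b)\<^sup>2" by (intro power_mono) auto
    also have "\<dots> = norm (star ?b * ?b)" by (simp add: cstar_identity)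
    also have "star ?b * ?b = a * a + (complex_of_real (s\<^sup>2)) *\<^sub>C 1"
      by (simp add: sa star_add star_scaleC algebra_simps scaleC_scaleC scaleC_minus_left power2_eq_square
          scaleC_mult_left scaleC_mult_right scaleC_diff_right)
    also have "norm \<dots> \<le> norm (a * a) + norm (complex_of_real (s\<^sup>2) *\<^sub>C (1::'u))" by (rule norm_triangle_ineq)
    also have "norm (complex_of_real (s\<^sup>2) *\<^sub>C (1::'u)) = s\<^sup>2" by (simp add: norm_scaleC norm_power)
    also have "norm (a * a) = (norm a)\<^sup>2" using cstar_identity[of a] sa by simp
    finally show ?thesis .
  qed
  \<comment> \<open>Chosen so that the linear term 2 s Im(z) equals norm(a)^2 + 1.\<close>
  let ?s = "((norm a)\<^sup>2 + 1) / (2 * Im z)"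
  have "(Re z)\<^sup>2 + (Im z + ?s)\<^sup>2 \<le> (norm a)\<^sup>2 + ?s\<^sup>2"
    using *[of ?s] by (simp add: cmod_power2)
  moreover have "(Im z + ?s)\<^sup>2 = (Im z)\<^sup>2 + ?s\<^sup>2 + ((norm a)\<^sup>2 + 1)"
    using b by (simp add: power2_sum)
  moreover have "(Re z)\<^sup>2 \<ge> 0" "(Im z)\<^sup>2 \<ge> 0" by auto
  ultimately show False by linarith
qed

text \<open>The iteration \<open>y \<mapsto> (d + y\<^sup>2) / 2\<close> converges to \<open>1 - sqrt (1 - d)\<close>; its increments are dominated
  by those of the same iteration started with the number \<open>1\<close> instead of \<open>d\<close>.\<close>

lemma sqrt_one_minus_exists:
  fixes d :: "'u::cstar_algebra_1"
  assumes nd: "norm d \<le> 1"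
  obtains q where "q * q = 1 - d" "\<And>c. c * d = d * c \<Longrightarrow> c * q = q * c" "star d = d \<Longrightarrow> star q = q"
proof -
  define y where "y = rec_nat (0::'u) (\<lambda>_ y. (1/2) *\<^sub>R (d + y * y))"
  define s where "s = rec_nat (0::real) (\<lambda>_ y. (1/2) * (1 + y * y))"
  have y0: "y 0 = 0" and yS: "\<And>n. y (Suc n) = (1/2) *\<^sub>R (d + y n * y n)" by (simp_all add: y_def)
  have s0: "s 0 = 0" and sS: "\<And>n. s (Suc n) = (1/2) * (1 + s n * s n)" by (simp_all add: s_def)
  have s01: "0 \<le> s n \<and> s n \<le> 1" for n
  proof (induction n)
    case (Suc n)
    have "s n * s n \<le> 1 * 1" using Suc by (intro mult_mono) auto
    then show ?case using Suc by (simp add: sS)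
  qed (simp add: s0)
  have ny: "norm (y n) \<le> s n" for n
  proof (induction n)
    case (Suc n)
    have "norm (d + y n * y n) \<le> norm d + norm (y n) * norm (y n)"
      by (meson add_left_mono norm_mult_ineq norm_triangle_ineq order_trans)
    also have "\<dots> \<le> 1 + s n * s n"
      using nd Suc s01[of n] by (intro add_mono mult_mono) auto
    finally show ?case by (simp add: yS sS)
  qed (simp add: y0 s0)
  have comm: "c * y n = y n * c" if c: "c * d = d * c" for c n
  proof (induction n)
    case (Suc n)
    have "c * (y n * y n) = y n * y n * c" by (metis Suc mult.assoc)
    then show ?case using c by (simp add: yS algebra_simps)
  qed (simp add: y0)
  have yy: "y m * y n = y n * y m" for m n by (metis comm)
  have inc: "norm (y (Suc n) - y n) \<le> s (Suc n) - s n" for n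
  proof (induction n)
    case 0 show ?case using nd by (simp add: y0 s0 yS sS)
  next
    case (Suc n)
    have "y (Suc (Suc n)) - y (Suc n) = (1/2) *\<^sub>R ((y (Suc n) + y n) * (y (Suc n) - y n))"
      using yy[of n "Suc n"] by (simp only: yS[of "Suc n"] yS[of n] flip: scaleR_diff_right)
        (simp add: algebra_simps)
    also have "norm \<dots> \<le> (1/2) * (norm (y (Suc n) + y n) * norm (y (Suc n) - y n))"
      by (simp add: norm_mult_ineq)
    also have "\<dots> \<le> (1/2) * ((s (Suc n) + s n) * (s (Suc n) - s n))"
      using Suc s01[of n] s01[of "Suc n"] norm_triangle_le[of "y (Suc n)" "y n" "s (Suc n) + s n"] ny[of n] ny[of "Suc n"]
      by (intro mult_left_mono mult_mono) auto
    also have "\<dots> = s (Suc (Suc n)) - s (Suc n)"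
      by (simp only: sS[of "Suc n"] sS[of n]) (simp add: algebra_simps)
    finally show ?case .
  qed
  have inc_s: "s n \<le> s (Suc n)" for n using inc[of n] norm_ge_zero[of "y (Suc n) - y n"] by linarith
  have "incseq s" using inc_s by (rule incseq_SucI)
  then obtain L where "s \<longlonglongrightarrow> L" using s01 by (metis incseq_convergent)
  then have cs: "Cauchy s" by (rule LIMSEQ_imp_Cauchy)
  have dist: "norm (y (n + k) - y n) \<le> s (n + k) - s n" for n k
  proof (induction k)
    case (Suc k)
    have "norm (y (n + Suc k) - y n) \<le> norm (y (Suc (n + k)) - y (n + k)) + norm (y (n + k) - y n)"
      using norm_triangle_ineq[of "y (Suc (n + k)) - y (n + k)" "y (n + k) - y n"] by simp
    then show ?case using Suc inc[of "n + k"] by simp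
  qed simp
  have "Cauchy y"
  proof (rule CauchyI)
    fix e :: real assume "e > 0"
    then obtain M where M: "\<And>m n. m \<ge> M \<Longrightarrow> n \<ge> M \<Longrightarrow> norm (s m - s n) < e" using CauchyD[OF cs] by blast
    have *: "norm (y m - y n) < e" if "m \<ge> n" "n \<ge> M" for m n
      using dist[of n "m - n"] M[of m n] that by auto
    have "norm (y m - y n) < e" if "m \<ge> M" "n \<ge> M" for m n
      using *[of m n] *[of n m] that by (cases "m \<ge> n") (auto simp: norm_minus_commute)
    then show "\<exists>M. \<forall>m\<ge>M. \<forall>n\<ge>M. norm (y m - y n) < e" by blast
  qed
  then obtain l where l: "y \<longlonglongrightarrow> l" using Cauchy_convergent_iff convergent_def by blast
  have "(\<lambda>n. y (Suc n)) \<longlonglongrightarrow> (1/2) *\<^sub>R (d + l * l)" unfolding yS by (intro tendsto_intros l)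
  then have "l = (1/2) *\<^sub>R (d + l * l)" using LIMSEQ_Suc[OF l] LIMSEQ_unique by blast
  then have "2 *\<^sub>R l = d + l * l" by (metis divide_self_if real_vector.scale_one scaleR_scaleR zero_neq_numeral times_divide_eq_right mult.right_neutral)
  then have ll: "l * l = l + l - d" by (simp add: scaleR_2 algebra_simps)
  show ?thesis
  proof
    show "(1 - l) * (1 - l) = 1 - d" using ll by (simp add: algebra_simps)
    show "c * (1 - l) = (1 - l) * c" if "c * d = d * c" for c
    proof -
      have "(\<lambda>n. c * y n) \<longlonglongrightarrow> c * l" "(\<lambda>n. y n * c) \<longlonglongrightarrow> l * c" by (intro tendsto_intros l)+
      then have "c * l = l * c" using comm[OF that] LIMSEQ_unique by auto
      then show ?thesis by (simp add: algebra_simps)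
    qed
    show "star (1 - l) = 1 - l" if "star d = d"
    proof -
      have "star (y n) = y n" for n by (induction n) (auto simp: y0 yS star_add star_mult that)
      then show ?thesis using selfadjoint_limit[OF l] by (simp add: star_diff)
    qed
  qed
qed

lemma inverse_selfadjoint:
  fixes a :: "'u::cstar_algebra_1"
  assumes "star a = a" "a * b = 1" "b * a = 1" shows "star b = b"
proof -
  have "star b * a = 1" using assms by (metis star_mult star_one)
  then show ?thesis using assms by (metis mult.assoc mult.left_neutral mult.right_neutral)
qed

lemma commute_inverse:
  fixes a :: "'u::cstar_algebra_1"
  assumes "a * b = 1" "b * a = 1" "c * a = a * c" shows "c * b = b * c"
  using assms by (metis mult.assoc mult.left_neutral mult.right_neutral)

text \<open>If \<open>1 - b\<^sup>2 = q\<^sup>2\<close> were invertible, then \<open>q\<^sup>2 - m\<close> would have a square root \<open>r\<close> for a small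
  \<open>m > 0\<close>, and \<open>b + \<i> r\<close> would be \<open>sqrt (1 - m)\<close> times a unitary, so \<open>norm b < 1\<close>.\<close>

lemma norm_selfadjoint_combination:
  fixes b r :: "'u::cstar_algebra_1"
  assumes b: "star b = b" and r: "star r = r" and c: "b * r = r * b"
  shows "(norm b)\<^sup>2 \<le> norm (b * b + r * r)"
proof -
  \<comment> \<open>\<open>?u\<close> is normal with real part \<open>b\<close> and
    \<open>star ?u * ?u = b * b + r * r\<close>; taking the real part does not increase the
    norm.\<close>
  let ?u = "b + \<i> *\<^sub>C r"
  have su: "star ?u = b - \<i> *\<^sub>C r" using b r by (simp add: star_add star_scaleC scaleC_minus_left)
  have "star ?u * ?u = b * b + r * r"
    unfolding su using c by (simp add: algebra_simps scaleC_mult_left scaleC_mult_right scaleC_scaleC scaleC_minus_left scaleC_diff_right)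
  then have n: "norm (b * b + r * r) = (norm ?u)\<^sup>2" by (metis cstar_identity)
  have "2 *\<^sub>R b = ?u + star ?u" unfolding su by (simp add: scaleR_2)
  then have "2 * norm b \<le> norm ?u + norm (star ?u)" using norm_triangle_ineq[of ?u "star ?u"]
    by (metis norm_scaleR abs_numeral)
  then have "norm b \<le> norm ?u" by simp
  then show ?thesis unfolding n by (intro power_mono) auto
qed

lemma not_inv_el_one_minus_square:
  fixes b :: "'u::cstar_algebra_1"
  assumes b: "star b = b" and nb: "norm b = 1" shows "\<not> inv_el (1 - b * b)"
proof
  let ?d = "b * b"
  assume "inv_el (1 - ?d)"
  then obtain R where R: "(1 - ?d) * R = 1" "R * (1 - ?d) = 1" unfolding inv_el_def by auto
  have sd: "star ?d = ?d" using b by (simp add: star_mult)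
  have nd: "norm ?d \<le> 1" using nb norm_mult_ineq[of b b] by simp
  obtain q where q: "q * q = 1 - ?d" "\<And>c. c * ?d = ?d * c \<Longrightarrow> c * q = q * c" "star q = q"
    using sqrt_one_minus_exists[OF nd] sd by metis
  have sR: "star R = R" using inverse_selfadjoint[OF _ R] sd by (simp add: star_diff)
  have R0: "R \<noteq> 0" using R by auto
  \<comment> \<open>The largest scalar for which \<open>m *\<^sub>R R\<close> has norm at most 1, so
    that \<open>1 - m *\<^sub>R R\<close> has a square root \<open>w\<close>; the square of
    \<open>q * w\<close> is then q^2 - m.\<close>
  define m where "m = 1 / norm R"
  have m: "m > 0" using R0 by (simp add: m_def)
  have nm: "norm (m *\<^sub>R R) \<le> 1" using R0 by (simp add: m_def)
  obtain w where w: "w * w = 1 - m *\<^sub>R R" "\<And>c. c * (m *\<^sub>R R) = (m *\<^sub>R R) * c \<Longrightarrow> c * w = w * c" "star w = w"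
    using sqrt_one_minus_exists[OF nm] sR by (metis star_scaleR)
  have bR: "b * R = R * b" by (rule commute_inverse[OF R]) (simp add: algebra_simps)
  have bq: "b * q = q * b" by (rule q(2)) (simp add: mult.assoc)
  have qd: "q * (1 - ?d) = (1 - ?d) * q" using q(1) by (metis mult.assoc)
  have qR: "q * R = R * q" by (rule commute_inverse[OF R qd])
  have bw: "b * w = w * b" by (rule w(2)) (simp add: bR)
  have qw: "q * w = w * q" by (rule w(2)) (simp add: qR)
  have "(q * w) * (q * w) = q * q * (w * w)" by (metis qw mult.assoc)
  also have "\<dots> = (1 - ?d) - m *\<^sub>R ((1 - ?d) * R)" by (simp only: q w right_diff_distrib mult_1_right mult_scaleR_right)
  also have "\<dots> = (1 - ?d) - m *\<^sub>R 1" by (simp only: R)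
  finally have e: "b * b + (q * w) * (q * w) = (1 - m) *\<^sub>R 1" by (simp add: algebra_simps)
  have "(norm b)\<^sup>2 \<le> norm (b * b + (q * w) * (q * w))"
  proof (rule norm_selfadjoint_combination[OF b])
    show "star (q * w) = q * w" by (metis q(3) w(3) qw star_mult)
    show "b * (q * w) = q * w * b" by (metis bq bw mult.assoc)
  qed
  then have le: "1 \<le> \<bar>1 - m\<bar>" unfolding e by (simp add: nb)
  \<comment> \<open>Since 1 - b^2 has norm at most 1, its inverse \<open>R\<close> has norm at least
    1. Hence 0 < m \<le> 1, which contradicts 1 \<le> |1 - m|.\<close>
  have "norm (1 - ?d) \<le> 1"
  proof -
    have "(norm q)\<^sup>2 \<le> norm (q * q + b * b)"
      by (rule norm_selfadjoint_combination[OF q(3) b bq[symmetric]])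
    then have "(norm q)\<^sup>2 \<le> 1" by (simp add: q(1))
    moreover have "(norm q)\<^sup>2 = norm (1 - ?d)" by (metis cstar_identity q(1,3))
    ultimately show ?thesis by simp
  qed
  then have "1 \<le> norm R"
    using R norm_mult_ineq[of "1 - ?d" R] mult_right_mono[of "norm (1 - ?d)" 1 "norm R"] by simp
  then have "m \<le> 1" using R0 by (simp add: m_def divide_le_eq_1)
  then show False using le m by linarith
qed

section \<open>Continuous functional calculus in a unital C*-algebra\<close>

text \<open>Horner evaluation. Complex coefficients serve to split a polynomial into linear factors;
  the functional calculus itself runs on the real version \<open>rpeval\<close>.\<close>

definition cpeval :: "complex poly \<Rightarrow> 'u::cstar_algebra_1 \<Rightarrow> 'u" where
  "cpeval p a = fold_coeffs (\<lambda>c v. c *\<^sub>C 1 + a * v) p 0"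

definition rpeval :: "real poly \<Rightarrow> 'u::cstar_algebra_1 \<Rightarrow> 'u" where
  "rpeval p a = fold_coeffs (\<lambda>c v. c *\<^sub>R 1 + a * v) p 0"

lemma cpeval_0 [simp]: "cpeval 0 a = 0"
  by (simp add: cpeval_def)

lemma cpeval_pCons [simp]: "cpeval (pCons c p) a = c *\<^sub>C 1 + a * cpeval p a"
  by (cases "c = 0 \<and> p = 0") (auto simp: cpeval_def)

lemma rpeval_0 [simp]: "rpeval 0 a = 0"
  by (simp add: rpeval_def)

lemma rpeval_pCons [simp]: "rpeval (pCons c p) a = c *\<^sub>R 1 + a * rpeval p a"
  by (cases "c = 0 \<and> p = 0") (auto simp: rpeval_def)

lemma cpeval_add: "cpeval (p + q) a = cpeval p a + cpeval q a"
  by (induction p q rule: poly_induct2) (auto simp: scaleC_add_left algebra_simps)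

lemma cpeval_smult: "cpeval (Polynomial.smult c p) a = c *\<^sub>C cpeval p a"
  by (induction p) (auto simp: scaleC_add_right scaleC_mult_right scaleC_scaleC)

lemma cpeval_mult: "cpeval (p * q) a = cpeval p a * cpeval q a"
  by (induction p) (auto simp: cpeval_add cpeval_smult algebra_simps scaleC_mult_left)

lemma rpeval_add: "rpeval (p + q) a = rpeval p a + rpeval q a"
  by (induction p q rule: poly_induct2) (auto simp: algebra_simps)

lemma rpeval_smult: "rpeval (Polynomial.smult c p) a = c *\<^sub>R rpeval p a"
  by (induction p) (auto simp: algebra_simps)

lemma rpeval_mult: "rpeval (p * q) a = rpeval p a * rpeval q a"
  by (induction p) (auto simp: rpeval_add rpeval_smult algebra_simps)

lemma rpeval_diff: "rpeval (p - q) a = rpeval p a - rpeval q a"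
  using rpeval_add[of p "- q" a] rpeval_smult[of "- 1" q a] by simp

lemma rpeval_1 [simp]: "rpeval 1 a = 1"
  by (simp add: one_pCons)

lemma rpeval_eq_cpeval: "rpeval p a = cpeval (map_poly complex_of_real p) a"
  by (induction p) (simp_all add: map_poly_pCons scaleC_of_real)

lemma poly_map_of_real: "poly (map_poly complex_of_real p) (of_real t) = of_real (poly p t)"
  by (induction p) (simp_all add: map_poly_pCons)

lemma rpeval_intertwine:
  assumes "a * x = x * b" shows "rpeval p a * x = x * rpeval p b"
proof (induction p)
  case (pCons c p)
  have "a * rpeval p a * x = a * x * rpeval p b" by (simp add: mult.assoc pCons)
  then show ?case using assms by (simp add: algebra_simps)
qed simp

lemma star_rpeval:
  assumes "star a = a" shows "star (rpeval p a) = rpeval p a"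
proof (induction p)
  case (pCons c p)
  have "a * rpeval p a = rpeval p a * a" using rpeval_intertwine[of a a a p] by simp
  then show ?case by (simp add: star_add star_mult assms pCons)
qed simp

text \<open>The half of the spectral mapping theorem that is needed: a product of invertible linear
  factors is invertible, so some factor z - a fails to be invertible at a root z.\<close>

lemma cpeval_not_inv_el:
  assumes "\<not> inv_el (cpeval p a)" "p \<noteq> 0" shows "\<exists>z\<in>spec a. poly p z = 0"
  using assms
proof (induction "degree p" arbitrary: p)
  case 0
  then obtain c where c: "p = [:c:]" "c \<noteq> 0" by (metis degree_eq_zeroE pCons_0_0)
  have "inv_el (1::'a)" unfolding inv_el_def by auto
  then show ?case using 0 c inv_el_scaleC[of c "1::'a"] by simp
next
  case (Suc n)
  have "\<not> constant (poly p)" using Suc(2) by (simp add: constant_degree)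
  then obtain z where z: "poly p z = 0" using fundamental_theorem_of_algebra by blast
  then obtain q where q: "p = [:- z, 1:] * q" by (metis dvdE poly_eq_0_iff_dvd)
  have q0: "q \<noteq> 0" using q Suc(4) by auto
  have "degree q = n" using Suc(2) q0 degree_mult_eq[of "[:- z, 1:]" q] unfolding q by auto
  show ?case
  proof (cases "inv_el (cpeval q a)")
    case True
    have "cpeval p a = (a - z *\<^sub>C 1) * cpeval q a" unfolding q cpeval_mult by (simp add: scaleC_minus_left)
    then have "\<not> inv_el (a - z *\<^sub>C 1)" using Suc(3) True inv_el_mult by metis
    then have "\<not> inv_el (z *\<^sub>C 1 - a)" using inv_el_uminus[of "a - z *\<^sub>C 1"] by simp
    then show ?thesis using z by (auto simp: spec_def)
  next
    case False
    then obtain y where "y \<in> spec a" "poly q y = 0" using Suc(1)[of q] q0 \<open>degree q = n\<close> by auto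
    then show ?thesis unfolding q by (intro bexI[of _ y]) auto
  qed
qed

lemma rpeval_not_inv_el:
  assumes sa: "star a = a" and "\<not> inv_el (rpeval p a)" "p \<noteq> 0" shows "\<exists>t\<in>rspec a. poly p t = 0"
proof -
  have "map_poly complex_of_real p \<noteq> 0" using \<open>p \<noteq> 0\<close> by (simp add: map_poly_eq_0_iff)
  then obtain z where z: "z \<in> spec a" "poly (map_poly complex_of_real p) z = 0"
    using cpeval_not_inv_el assms(2) unfolding rpeval_eq_cpeval by blast
  have e: "z = of_real (Re z)" using spec_real[OF sa z(1)] by (simp add: complex_eq_iff)
  then have "of_real (poly p (Re z)) = (0::complex)" using z poly_map_of_real by metis
  then show ?thesis using z e by (intro bexI[of _ "Re z"]) (auto simp: rspec_def)
qed

text \<open>With b = a / norm(a), the element 1 - b^2 is a polynomial in \<open>a\<close> that is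
  not invertible, so the polynomial has a zero in the spectrum. No analytic function theory is
  involved.\<close>

lemma rspec_nonempty:
  assumes sa: "star a = a" shows "rspec a \<noteq> {}"
proof (cases "a = 0")
  case True
  then have "0 \<in> rspec a" by (simp add: rspec_iff inv_el_def)
  then show ?thesis by auto
next
  case False
  let ?b = "(1 / norm a) *\<^sub>R a"
  have n: "\<not> inv_el (1 - ?b * ?b)" using False sa by (intro not_inv_el_one_minus_square) auto
  let ?p = "1 - [:0, 1 / norm a:] * [:0, 1 / norm a:]"
  have "rpeval ?p a = 1 - ?b * ?b" unfolding rpeval_diff rpeval_mult by simp
  moreover have "?p \<noteq> 0"
  proof
    assume "?p = 0"
    then have "poly ?p 0 = 0" by simp
    then show False by simp
  qed
  ultimately show ?thesis using rpeval_not_inv_el[OF sa, of ?p] n by auto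
qed

text \<open>The norm of a polynomial in \<open>a\<close> is attained on the spectrum: for the
  normalized value r(a), the element 1 - r(a)^2 is not invertible, so |r(t)| = 1 at some spectral
  point t. This replaces the spectral radius formula.\<close>

lemma norm_rpeval_le:
  assumes sa: "star a = a" and M: "\<And>t. t \<in> rspec a \<Longrightarrow> \<bar>poly p t\<bar> \<le> M"
  shows "norm (rpeval p a) \<le> M"
proof (cases "rpeval p a = 0")
  case True
  then show ?thesis using rspec_nonempty[OF sa] M by fastforce
next
  case False
  let ?c = "norm (rpeval p a)"
  define r where "r = Polynomial.smult (1 / ?c) p"
  have r: "rpeval r a = (1 / ?c) *\<^sub>R rpeval p a" by (simp add: r_def rpeval_smult)
  have "\<not> inv_el (1 - rpeval r a * rpeval r a)"
    using False star_rpeval[OF sa] by (intro not_inv_el_one_minus_square) (auto simp: r)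
  then have n: "\<not> inv_el (rpeval (1 - r * r) a)" by (simp add: rpeval_diff rpeval_mult)
  have "\<exists>t\<in>rspec a. poly (1 - r * r) t = 0"
    using rpeval_not_inv_el[OF sa n] rspec_nonempty[OF sa] by (cases "1 - r * r = 0") auto
  then obtain t where t: "t \<in> rspec a" "poly r t * poly r t = 1" by auto
  then have "\<bar>poly r t\<bar> = 1" by (metis abs_1 abs_eq_iff square_eq_1_iff)
  then have "\<bar>poly p t\<bar> = ?c" using False by (simp add: r_def field_simps abs_mult)
  then show ?thesis using M[OF t(1)] by simp
qed

lemma poly_approx:
  fixes f :: "real \<Rightarrow> real"
  assumes f: "continuous_on UNIV f"
  shows "\<exists>p. uniform_limit {-R..R} (\<lambda>n t. poly (p n) t) f sequentially"
proof -
  have "\<exists>p. \<forall>t\<in>{-R..R}. \<bar>f t - poly p t\<bar> < 1 / real (Suc n)" for n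
  proof -
    obtain g where g: "real_polynomial_function g" "\<And>x. x \<in> {-R..R} \<Longrightarrow> \<bar>f x - g x\<bar> < 1 / real (Suc n)"
      using Stone_Weierstrass_real_polynomial_function[of "{-R..R}" f "1 / real (Suc n)"] continuous_on_subset[OF f]
      by (metis compact_Icc of_nat_0_less_iff subset_UNIV zero_less_Suc zero_less_divide_1_iff)
    then obtain a m where "g = (\<lambda>x. \<Sum>i\<le>m. a i * x ^ i)" using real_polynomial_function_iff_sum by blast
    then have e: "g = poly (\<Sum>i\<le>m. monom (a i) i)" by (auto simp: poly_sum poly_monom)
    show ?thesis using g(2) unfolding e by blast
  qed
  then obtain p where p: "\<And>n t. t \<in> {-R..R} \<Longrightarrow> \<bar>f t - poly (p n) t\<bar> < 1 / real (Suc n)" by metis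
  have "uniform_limit {-R..R} (\<lambda>n t. poly (p n) t) f sequentially"
  proof (rule uniform_limitI)
    fix e :: real assume "e > 0"
    then obtain N where N: "1 / real (Suc N) < e" by (metis nat_approx_posE)
    have "dist (poly (p n) t) (f t) < e" if "n \<ge> N" "t \<in> {-R..R}" for n t
    proof -
      have "1 / real (Suc n) \<le> 1 / real (Suc N)" using that by (simp add: frac_le)
      then show ?thesis using p[OF that(2), of n] N by (simp add: dist_real_def)
    qed
    then show "\<forall>\<^sub>F n in sequentially. \<forall>t\<in>{-R..R}. dist (poly (p n) t) (f t) < e"
      unfolding eventually_sequentially by blast
  qed
  then show ?thesis by blast
qed

lemma rpeval_diff_tendsto:
  assumes sa: "star a = a"
    and p: "uniform_limit (rspec a) (\<lambda>n t. poly (p n) t) f sequentially"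
    and q: "uniform_limit (rspec a) (\<lambda>n t. poly (q n) t) f sequentially"
  shows "(\<lambda>n. rpeval (p n) a - rpeval (q n) a) \<longlonglongrightarrow> 0"
proof (rule tendstoI)
  fix e :: real assume e: "e > 0"
  have "\<forall>\<^sub>F n in sequentially. \<forall>t\<in>rspec a. dist (poly (p n) t) (f t) < e/3"
    "\<forall>\<^sub>F n in sequentially. \<forall>t\<in>rspec a. dist (poly (q n) t) (f t) < e/3"
    by (rule uniform_limitD[OF p] uniform_limitD[OF q], use e in simp)+
  then show "\<forall>\<^sub>F n in sequentially. dist (rpeval (p n) a - rpeval (q n) a) 0 < e"
  proof eventually_elim
    case (elim n)
    have "norm (rpeval (p n - q n) a) \<le> 2 * e / 3"
    proof (rule norm_rpeval_le[OF sa])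
      fix t assume "t \<in> rspec a"
      then have "dist (poly (p n) t) (f t) < e/3" "dist (poly (q n) t) (f t) < e/3" using elim by auto
      then show "\<bar>poly (p n - q n) t\<bar> \<le> 2 * e / 3"
        unfolding dist_real_def poly_diff by linarith
    qed
    then show ?case using e by (simp add: rpeval_diff)
  qed
qed

lemma rpeval_convergent:
  assumes sa: "star a = a"
    and p: "uniform_limit (rspec a) (\<lambda>n t. poly (p n) t) f sequentially"
  shows "convergent (\<lambda>n. rpeval (p n) a)"
proof -
  have "Cauchy (\<lambda>n. rpeval (p n) a)"
  proof (rule CauchyI)
    fix e :: real assume e: "e > 0"
    have "\<forall>\<^sub>F n in sequentially. \<forall>t\<in>rspec a. dist (poly (p n) t) (f t) < e/3"
      by (rule uniform_limitD[OF p]) (use e in simp)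
    then obtain N where N: "\<And>n t. n \<ge> N \<Longrightarrow> t \<in> rspec a \<Longrightarrow> \<bar>poly (p n) t - f t\<bar> < e/3"
      unfolding eventually_sequentially dist_real_def by blast
    have "norm (rpeval (p m) a - rpeval (p n) a) < e" if "m \<ge> N" "n \<ge> N" for m n
    proof -
      have "norm (rpeval (p m - p n) a) \<le> 2 * e / 3"
      proof (rule norm_rpeval_le[OF sa])
        fix t assume "t \<in> rspec a"
        then show "\<bar>poly (p m - p n) t\<bar> \<le> 2 * e / 3"
          using N[OF that(1), of t] N[OF that(2), of t] unfolding poly_diff by linarith
      qed
      then show ?thesis using e by (simp add: rpeval_diff)
    qed
    then show "\<exists>M. \<forall>m\<ge>M. \<forall>n\<ge>M. norm (rpeval (p m) a - rpeval (p n) a) < e" by blast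
  qed
  then show ?thesis by (simp add: Cauchy_convergent_iff)
qed

text \<open>Some polynomial approximation on an interval containing the spectrum is chosen;
  \<open>ucfc_tendsto\<close> shows that every approximation on the spectrum gives the same limit.
  The lemmas ask for continuity on the whole line, so functions needed only for t \<ge> 0 are
  extended below by absolute values or \<open>max\<close>.\<close>

definition ucfc :: "(real \<Rightarrow> real) \<Rightarrow> 'u::cstar_algebra_1 \<Rightarrow> 'u" where
  "ucfc f a = lim (\<lambda>n. rpeval ((SOME p. uniform_limit {- norm a..norm a} (\<lambda>n t. poly (p n) t) f sequentially) n) a)"

lemma rspec_subset: "rspec a \<subseteq> {- norm a..norm a}"
  using rspec_le by (force simp: abs_le_iff)

lemma ucfc_tendsto:
  assumes sa: "star a = a" and f: "continuous_on UNIV f"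
    and p: "uniform_limit (rspec a) (\<lambda>n t. poly (p n) t) f sequentially"
  shows "(\<lambda>n. rpeval (p n) a) \<longlonglongrightarrow> ucfc f a"
proof -
  define q where "q = (SOME p. uniform_limit {- norm a..norm a} (\<lambda>n t. poly (p n) t) f sequentially)"
  have "uniform_limit {- norm a..norm a} (\<lambda>n t. poly (q n) t) f sequentially"
    unfolding q_def using poly_approx[OF f] by (rule someI_ex)
  then have q: "uniform_limit (rspec a) (\<lambda>n t. poly (q n) t) f sequentially"
    using rspec_subset uniform_limit_on_subset by blast
  have "(\<lambda>n. rpeval (q n) a) \<longlonglongrightarrow> ucfc f a"
    using rpeval_convergent[OF sa q] unfolding ucfc_def q_def convergent_LIMSEQ_iff by simp
  from tendsto_add[OF rpeval_diff_tendsto[OF sa p q] this] show ?thesis by simp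
qed

lemma ucfc_tendsto_Icc:
  assumes sa: "star a = a" and f: "continuous_on UNIV f" and R: "norm a \<le> R"
    and p: "uniform_limit {-R..R} (\<lambda>n t. poly (p n) t) f sequentially"
  shows "(\<lambda>n. rpeval (p n) a) \<longlonglongrightarrow> ucfc f a"
proof (rule ucfc_tendsto[OF sa f])
  have "rspec a \<subseteq> {-R..R}" using rspec_subset[of a] R by (meson atLeastatMost_subset_iff neg_le_iff_le order_trans)
  then show "uniform_limit (rspec a) (\<lambda>n t. poly (p n) t) f sequentially"
    using p uniform_limit_on_subset by blast
qed

lemma ucfc_approx:
  assumes sa: "star a = a" and f: "continuous_on UNIV f"
  obtains p where "uniform_limit {- norm a..norm a} (\<lambda>n t. poly (p n) t) f sequentially"
    "(\<lambda>n. rpeval (p n) a) \<longlonglongrightarrow> ucfc f a"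
  using poly_approx[OF f] ucfc_tendsto_Icc[OF sa f order_refl] by metis

lemma ucfc_poly:
  assumes "star a = a" shows "ucfc (poly p) a = rpeval p a"
proof -
  have "continuous_on UNIV (poly p)" by (rule continuous_at_imp_continuous_on) simp
  then have "(\<lambda>n. rpeval p a) \<longlonglongrightarrow> ucfc (poly p) a"
    using ucfc_tendsto[of a "poly p" "\<lambda>_. p"] assms by (simp add: uniform_limit_iff)
  then show ?thesis by (simp add: LIMSEQ_const_iff)
qed

lemma ucfc_id: "star a = a \<Longrightarrow> ucfc (\<lambda>t. t) a = a"
  using ucfc_poly[of a "[:0, 1:]"] by (simp add: poly_pCons[abs_def])

lemma ucfc_const: "star a = a \<Longrightarrow> ucfc (\<lambda>_. c) a = c *\<^sub>R 1"
  using ucfc_poly[of a "[:c:]"] by (simp add: poly_pCons[abs_def])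

lemma ucfc_cong:
  assumes sa: "star a = a" and f: "continuous_on UNIV f" and g: "continuous_on UNIV g"
    and eq: "\<And>t. t \<in> rspec a \<Longrightarrow> f t = g t"
  shows "ucfc f a = ucfc g a"
proof -
  obtain p where p: "uniform_limit {- norm a..norm a} (\<lambda>n t. poly (p n) t) f sequentially"
    "(\<lambda>n. rpeval (p n) a) \<longlonglongrightarrow> ucfc f a"
    using ucfc_approx[OF sa f] by blast
  have "uniform_limit (rspec a) (\<lambda>n t. poly (p n) t) f sequentially"
    using uniform_limit_on_subset[OF p(1) rspec_subset] .
  then have "uniform_limit (rspec a) (\<lambda>n t. poly (p n) t) g sequentially"
    using eq by (simp add: uniform_limit_iff)
  then have "(\<lambda>n. rpeval (p n) a) \<longlonglongrightarrow> ucfc g a" by (rule ucfc_tendsto[OF sa g])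
  with p(2) show ?thesis using LIMSEQ_unique by blast
qed

lemma ucfc_norm_le:
  assumes sa: "star a = a" and f: "continuous_on UNIV f"
    and M: "\<And>t. t \<in> rspec a \<Longrightarrow> \<bar>f t\<bar> \<le> M"
  shows "norm (ucfc f a) \<le> M"
proof (rule field_le_epsilon)
  fix e :: real assume e: "e > 0"
  obtain p where p: "uniform_limit {- norm a..norm a} (\<lambda>n t. poly (p n) t) f sequentially"
    "(\<lambda>n. rpeval (p n) a) \<longlonglongrightarrow> ucfc f a"
    using ucfc_approx[OF sa f] by blast
  have "\<forall>\<^sub>F n in sequentially. \<forall>t\<in>rspec a. dist (poly (p n) t) (f t) < e"
    using uniform_limit_on_subset[OF p(1) rspec_subset] e by (auto simp: uniform_limit_iff)
  then have "\<forall>\<^sub>F n in sequentially. norm (rpeval (p n) a) \<le> M + e"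
  proof eventually_elim
    case (elim n)
    show ?case
    proof (rule norm_rpeval_le[OF sa])
      fix t assume t: "t \<in> rspec a"
      then show "\<bar>poly (p n) t\<bar> \<le> M + e" using elim M[OF t] by (fastforce simp: dist_real_def)
    qed
  qed
  then show "norm (ucfc f a) \<le> M + e"
    using tendsto_upperbound[OF tendsto_norm[OF p(2)]] by simp
qed

text \<open>One polynomial sequence serves both elements, on an interval containing both spectra.
  The case a \<noteq> b is the one used in \<open>orthogonalize_column\<close>, where W T = T h^2
  yields f(W) T = T f(h^2).\<close>

lemma ucfc_intertwine:
  assumes sa: "star a = a" and sb: "star b = b" and f: "continuous_on UNIV f" and ab: "a * x = x * b"
  shows "ucfc f a * x = x * ucfc f b"
proof -
  define R where "R = max (norm a) (norm b)"
  obtain p where p: "uniform_limit {-R..R} (\<lambda>n t. poly (p n) t) f sequentially"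
    using poly_approx[OF f] by blast
  have "(\<lambda>n. rpeval (p n) a * x) \<longlonglongrightarrow> ucfc f a * x"
    using ucfc_tendsto_Icc[OF sa f _ p] by (intro tendsto_mult tendsto_const) (simp add: R_def)
  moreover have "(\<lambda>n. x * rpeval (p n) b) \<longlonglongrightarrow> x * ucfc f b"
    using ucfc_tendsto_Icc[OF sb f _ p] by (intro tendsto_mult tendsto_const) (simp add: R_def)
  ultimately show ?thesis using rpeval_intertwine[OF ab] LIMSEQ_unique by auto
qed

lemma ucfc_commute:
  assumes "star a = a" "continuous_on UNIV f" "x * a = a * x"
  shows "x * ucfc f a = ucfc f a * x"
  using ucfc_intertwine[of a a f x] assms by simp

lemma star_ucfc:
  assumes sa: "star a = a" and f: "continuous_on UNIV f" shows "star (ucfc f a) = ucfc f a"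
  using ucfc_approx[OF sa f] selfadjoint_limit star_rpeval[OF sa] by metis

lemma ucfc_add:
  assumes sa: "star a = a" and f: "continuous_on UNIV f" and g: "continuous_on UNIV g"
  shows "ucfc (\<lambda>t. f t + g t) a = ucfc f a + ucfc g a"
proof -
  obtain p where p: "uniform_limit {- norm a..norm a} (\<lambda>n t. poly (p n) t) f sequentially"
    "(\<lambda>n. rpeval (p n) a) \<longlonglongrightarrow> ucfc f a" using ucfc_approx[OF sa f] by blast
  obtain q where q: "uniform_limit {- norm a..norm a} (\<lambda>n t. poly (q n) t) g sequentially"
    "(\<lambda>n. rpeval (q n) a) \<longlonglongrightarrow> ucfc g a" using ucfc_approx[OF sa g] by blast
  have "uniform_limit {- norm a..norm a} (\<lambda>n t. poly (p n + q n) t) (\<lambda>t. f t + g t) sequentially"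
    using uniform_limit_add[OF p(1) q(1)] by simp
  then have "(\<lambda>n. rpeval (p n + q n) a) \<longlonglongrightarrow> ucfc (\<lambda>t. f t + g t) a"
    by (intro ucfc_tendsto_Icc[OF sa _ order_refl] continuous_intros f g)
  moreover have "(\<lambda>n. rpeval (p n + q n) a) \<longlonglongrightarrow> ucfc f a + ucfc g a"
    unfolding rpeval_add by (intro tendsto_intros p q)
  ultimately show ?thesis using LIMSEQ_unique by blast
qed

lemma ucfc_mult:
  assumes sa: "star a = a" and f: "continuous_on UNIV f" and g: "continuous_on UNIV g"
  shows "ucfc (\<lambda>t. f t * g t) a = ucfc f a * ucfc g a"
proof -
  obtain p where p: "uniform_limit {- norm a..norm a} (\<lambda>n t. poly (p n) t) f sequentially"
    "(\<lambda>n. rpeval (p n) a) \<longlonglongrightarrow> ucfc f a" using ucfc_approx[OF sa f] by blast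
  obtain q where q: "uniform_limit {- norm a..norm a} (\<lambda>n t. poly (q n) t) g sequentially"
    "(\<lambda>n. rpeval (q n) a) \<longlonglongrightarrow> ucfc g a" using ucfc_approx[OF sa g] by blast
  have b: "bounded (h ` {- norm a..norm a})" if "continuous_on UNIV h" for h :: "real \<Rightarrow> real"
    using that by (meson compact_Icc compact_continuous_image compact_imp_bounded continuous_on_subset subset_UNIV)
  have "uniform_limit {- norm a..norm a} (\<lambda>n t. poly (p n * q n) t) (\<lambda>t. f t * g t) sequentially"
    using uniform_lim_mult[OF p(1) q(1) b[OF f] b[OF g]] by simp
  then have "(\<lambda>n. rpeval (p n * q n) a) \<longlonglongrightarrow> ucfc (\<lambda>t. f t * g t) a"
    by (intro ucfc_tendsto_Icc[OF sa _ order_refl] continuous_intros f g)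
  moreover have "(\<lambda>n. rpeval (p n * q n) a) \<longlonglongrightarrow> ucfc f a * ucfc g a"
    unfolding rpeval_mult by (intro tendsto_intros p q)
  ultimately show ?thesis using LIMSEQ_unique by blast
qed

lemma ucfc_scaleR:
  assumes sa: "star a = a" and f: "continuous_on UNIV f"
  shows "ucfc (\<lambda>t. c * f t) a = c *\<^sub>R ucfc f a"
  using ucfc_mult[OF sa _ f, of "\<lambda>_. c"] ucfc_const[OF sa] by simp

lemma ucfc_diff:
  assumes sa: "star a = a" and f: "continuous_on UNIV f" and g: "continuous_on UNIV g"
  shows "ucfc (\<lambda>t. f t - g t) a = ucfc f a - ucfc g a"
  using ucfc_add[OF sa f, of "\<lambda>t. (-1) * g t"] ucfc_scaleR[OF sa g, of "-1"] g
  by (simp add: continuous_on_minus)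

lemma ucfc_diff_norm_le:
  assumes sa: "star a = a" and f: "continuous_on UNIV f" and g: "continuous_on UNIV g"
    and M: "\<And>t. t \<in> rspec a \<Longrightarrow> \<bar>f t - g t\<bar> \<le> M"
  shows "norm (ucfc f a - ucfc g a) \<le> M"
  unfolding ucfc_diff[OF sa f g, symmetric]
  by (rule ucfc_norm_le[OF sa]) (use M f g in \<open>auto intro: continuous_on_diff\<close>)

section \<open>Positive elements\<close>

lemma star_positive: "positive x \<Longrightarrow> star x = x"
  by (auto simp: positive_def star_mult)

lemma positive_star_mult [simp]: "positive (star x * x)"
  by (auto simp: positive_def)

lemma positive_mult_star [simp]: "positive (x * star x)"
  using positive_star_mult[of "star x"] by simp

lemma positive_square: "star x = x \<Longrightarrow> positive (x * x)"
  by (metis positive_star_mult)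

lemma positive_0 [simp]: "positive 0"
  by (auto simp: positive_def intro!: exI[of _ 0])

lemma positive_1 [simp]: "positive (1::'u::cstar_algebra_1)"
  by (auto simp: positive_def intro!: exI[of _ 1])

lemma positive_conj: "positive x \<Longrightarrow> positive (star c * x * c)"
  unfolding positive_def by (metis mult.assoc star_mult)

lemma positive_conj': "positive x \<Longrightarrow> positive (c * x * star c)"
  using positive_conj[of x "star c"] by simp

lemma positive_scaleR:
  assumes "positive x" "r \<ge> 0" shows "positive (r *\<^sub>R x)"
proof -
  obtain y where "x = star y * y" using assms by (auto simp: positive_def)
  then have "r *\<^sub>R x = star (sqrt r *\<^sub>R y) * (sqrt r *\<^sub>R y)" using assms(2) by simp
  then show ?thesis by (metis positive_star_mult)
qed

text \<open>A description of the positive cone from which its convexity is immediate.\<close>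

definition npos :: "'u::cstar_algebra_1 \<Rightarrow> bool" where
  "npos x \<longleftrightarrow> star x = x \<and> (\<exists>t\<ge>0. norm (t *\<^sub>R 1 - x) \<le> t)"

lemma npos_sqrt:
  assumes "npos x"
  obtains q where "star q = q" "q * q = x"
proof -
  obtain t where x: "star x = x" and t: "t \<ge> 0" "norm (t *\<^sub>R 1 - x) \<le> t" using assms by (auto simp: npos_def)
  show ?thesis
  proof (cases "t = 0")
    case True
    then have "x = 0" using t by simp
    then show ?thesis using that[of 0] by simp
  next
    case False
    let ?d = "1 - (1 / t) *\<^sub>R x"
    have "?d = (1 / t) *\<^sub>R (t *\<^sub>R 1 - x)" using False by (simp add: scaleR_diff_right)
    then have "norm ?d \<le> 1" using t False by (simp add: divide_le_eq_1)
    then obtain q where q: "q * q = 1 - ?d" "star ?d = ?d \<Longrightarrow> star q = q" using sqrt_one_minus_exists by metis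
    have "star q = q" using q x by (simp add: star_diff)
    then show ?thesis using that[of "sqrt t *\<^sub>R q"] q t False by simp
  qed
qed

lemma npos_imp_positive: "npos x \<Longrightarrow> positive x"
  by (metis npos_sqrt positive_square)

text \<open>After scaling to norm at most 1, write 1 - x^2 = q^2 with q self-adjoint and commuting
  with x. Then q^2 + x^2 = 1 forces norm(q) \<le> 1, which is the required bound with t =
  norm(x)^2.\<close>

lemma npos_square:
  assumes x: "star x = x" shows "npos (x * x)"
proof (cases "x = 0")
  case True then show ?thesis by (auto simp: npos_def)
next
  case False
  let ?b = "(1 / norm x) *\<^sub>R x"
  let ?d = "?b * ?b"
  have b: "star ?b = ?b" using x by simp
  have "norm ?b \<le> 1" using False by simp
  then have "norm ?d \<le> 1" by (metis norm_mult_ineq order_trans mult_le_one norm_ge_zero)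
  then obtain q where q: "q * q = 1 - ?d" "\<And>c. c * ?d = ?d * c \<Longrightarrow> c * q = q * c" "star ?d = ?d \<Longrightarrow> star q = q"
    using sqrt_one_minus_exists by metis
  have sq: "star q = q" by (rule q(3)) (simp add: star_mult x)
  have bq: "?b * q = q * ?b" by (rule q(2)) (simp add: mult.assoc)
  have "(norm q)\<^sup>2 \<le> norm (q * q + ?b * ?b)" by (rule norm_selfadjoint_combination[OF sq b bq[symmetric]])
  then have "norm (1 - ?d) \<le> 1" by (metis cstar_identity diff_add_cancel norm_one q(1) sq)
  then have "(norm x)\<^sup>2 * norm (1 - ?d) \<le> (norm x)\<^sup>2 * 1" by (intro mult_left_mono) auto
  then have "norm ((norm x)\<^sup>2 *\<^sub>R (1 - ?d)) \<le> (norm x)\<^sup>2" by (simp only: norm_scaleR) simp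
  moreover have "(norm x)\<^sup>2 *\<^sub>R (1 - ?d) = (norm x)\<^sup>2 *\<^sub>R 1 - x * x"
    using False by (simp add: scaleR_diff_right power2_eq_square)
  ultimately have "norm ((norm x)\<^sup>2 *\<^sub>R 1 - x * x) \<le> (norm x)\<^sup>2" by (simp only:)
  then show ?thesis unfolding npos_def using x by (intro conjI exI[of _ "(norm x)\<^sup>2"]) (simp_all add: star_mult)
qed

lemma npos_add: "npos x \<Longrightarrow> npos y \<Longrightarrow> npos (x + y)"
proof -
  assume "npos x" "npos y"
  then obtain s t where st: "s \<ge> 0" "norm (s *\<^sub>R 1 - x) \<le> s" "t \<ge> 0" "norm (t *\<^sub>R 1 - y) \<le> t"
    and "star x = x" "star y = y" by (auto simp: npos_def)
  moreover have "norm ((s + t) *\<^sub>R 1 - (x + y)) \<le> s + t"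
    using norm_triangle_mono[OF st(2) st(4)] by (simp add: algebra_simps)
  ultimately show ?thesis unfolding npos_def by (intro conjI exI[of _ "s + t"]) (auto simp: star_add)
qed

lemma npos_rspec:
  assumes "npos x" "t \<in> rspec x" shows "t \<ge> 0"
proof -
  obtain s where s: "s \<ge> 0" "norm (s *\<^sub>R 1 - x) \<le> s" using assms by (auto simp: npos_def)
  have "(s - t) *\<^sub>R 1 - (s *\<^sub>R 1 - x) = - (t *\<^sub>R 1 - x)" by (simp add: algebra_simps)
  then have "s - t \<in> rspec (s *\<^sub>R 1 - x)" using assms(2) by (simp only: rspec_iff inv_el_uminus simp_thms)
  then have "\<bar>s - t\<bar> \<le> s" using rspec_le s by fastforce
  then show ?thesis by simp
qed

lemma npos_ucfc:
  assumes sa: "star a = a" and f: "continuous_on UNIV f" and pos: "\<And>t. t \<in> rspec a \<Longrightarrow> f t \<ge> 0"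
  shows "npos (ucfc f a)"
proof -
  let ?g = "\<lambda>t. sqrt \<bar>f t\<bar>"
  have g: "continuous_on UNIV ?g" using f by (intro continuous_intros)
  have "ucfc f a = ucfc (\<lambda>t. ?g t * ?g t) a"
    by (rule ucfc_cong[OF sa f]) (use pos f in \<open>auto intro!: continuous_intros\<close>)
  also have "\<dots> = ucfc ?g a * ucfc ?g a" by (rule ucfc_mult[OF sa g g])
  finally show ?thesis using npos_square[OF star_ucfc[OF sa g]] by simp
qed

lemma rspec_mult_commute:
  assumes "t \<in> rspec (x * y)" "t \<noteq> 0" shows "t \<in> rspec (y * x)"
proof -
  have *: "t *\<^sub>R 1 - u * v = of_real t *\<^sub>C (1 - ((1 / t) *\<^sub>R u) * v)" for u v :: 'a
    using assms(2) by (simp add: scaleC_of_real scaleR_diff_right)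
  have "\<not> inv_el (1 - ((1 / t) *\<^sub>R x) * y)" using assms unfolding rspec_iff * by (simp add: inv_el_scaleC)
  then have "\<not> inv_el (1 - y * ((1 / t) *\<^sub>R x))" using inv_el_one_minus_mult_commute by blast
  then have "\<not> inv_el (1 - ((1 / t) *\<^sub>R y) * x)" by simp
  then show ?thesis using assms(2) unfolding rspec_iff * by (simp add: inv_el_scaleC)
qed

text \<open>\<open>u\<close> and \<open>v\<close> are the real and imaginary parts of
  \<open>y\<close>. The identity shows that if \<open>star y * y\<close> is negative then
  \<open>y * star y\<close>, a sum of squares minus a negative element, is positive.\<close>

lemma cartesian_square_sum:
  fixes y :: "'u::cstar_algebra_1"
  obtains u v where "star u = u" "star v = v" "star y * y + y * star y = 2 *\<^sub>R (u * u + v * v)"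
proof
  let ?u = "(1/2) *\<^sub>R (y + star y)" and ?v = "(1/2) *\<^sub>R (\<i> *\<^sub>C (star y - y))"
  show "star ?u = ?u" by (simp add: star_add add.commute)
  show "star ?v = ?v" by (simp add: star_scaleC star_diff scaleC_minus_left scaleC_diff_right)
  have "(\<i> *\<^sub>C (star y - y)) * (\<i> *\<^sub>C (star y - y)) = - ((star y - y) * (star y - y))"
    by (simp add: scaleC_mult_left scaleC_mult_right scaleC_scaleC scaleC_minus_left)
  moreover have "(y + star y) * (y + star y) - (star y - y) * (star y - y)
      = 2 *\<^sub>R (star y * y + y * star y)"
    by (simp add: algebra_simps scaleR_2)
  ultimately show "star y * y + y * star y = 2 *\<^sub>R (?u * ?u + ?v * ?v)"
    by (simp add: scaleR_diff_right) (simp flip: scaleR_diff_right)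
qed

text \<open>Let m be the negative part of \<open>a\<close> and y = x m, so that
  \<open>star y * y\<close> is -m^3. It is negative, hence \<open>y * star y\<close> is positive;
  the two have the same nonzero spectrum, so both vanish and m^3 = 0. This identifies elements of
  the form \<open>star x * x\<close> with those of the convex cone \<open>npos\<close>.\<close>

lemma negative_part_zero:
  fixes x :: "'u::cstar_algebra_1"
  defines "a \<equiv> star x * x"
  shows "ucfc (\<lambda>t. max (- t) 0) a = 0"
proof -
  let ?n = "\<lambda>t::real. max (- t) 0"
  define m where "m = ucfc ?n a"
  have sa: "star a = a" by (simp add: a_def star_mult)
  have n: "continuous_on UNIV ?n" by (intro continuous_intros)
  have sm: "star m = m" unfolding m_def by (rule star_ucfc[OF sa n])
  define y where "y = x * m"
  have "star y * y = m * a * m" by (simp add: y_def star_mult sm a_def mult.assoc)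
  also have "\<dots> = ucfc (\<lambda>t. ?n t * t * ?n t) a"
    unfolding m_def using n by (simp add: ucfc_mult[OF sa] ucfc_id[OF sa] continuous_intros)
  also have "\<dots> = ucfc (\<lambda>t. (-1) * (?n t * ?n t * ?n t)) a"
    by (rule ucfc_cong[OF sa]; (intro continuous_intros)?) (auto simp: max_def)
  also have "\<dots> = - ucfc (\<lambda>t. ?n t * ?n t * ?n t) a"
    by (subst ucfc_scaleR[OF sa]) (auto intro!: continuous_intros)
  finally have yy: "star y * y = - ucfc (\<lambda>t. ?n t * ?n t * ?n t) a" .
  have p: "npos (- (star y * y))" unfolding yy minus_minus
    by (rule npos_ucfc[OF sa]) (auto intro!: continuous_intros)
  obtain u v where uv: "star u = u" "star v = v" "star y * y + y * star y = 2 *\<^sub>R (u * u + v * v)"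
    using cartesian_square_sum by blast
  have "npos (u * u + v * v)" by (intro npos_add npos_square uv)
  then have "npos ((u * u + v * v) + (u * u + v * v) + - (star y * y))" by (rule npos_add[OF npos_add p]) fact+
  moreover have "(u * u + v * v) + (u * u + v * v) + - (star y * y) = y * star y"
    using uv(3) by (simp add: scaleR_2 algebra_simps)
  ultimately have q: "npos (y * star y)" by simp
  have "t = 0" if t: "t \<in> rspec (star y * y)" for t
  proof (rule ccontr)
    assume "t \<noteq> 0"
    then have "t \<in> rspec (y * star y)" using t rspec_mult_commute by blast
    then have "t \<ge> 0" using npos_rspec q by blast
    have "(- t) *\<^sub>R 1 - - (star y * y) = - (t *\<^sub>R 1 - star y * y)" by simp
    then have "- t \<in> rspec (- (star y * y))" using t by (simp only: rspec_iff inv_el_uminus simp_thms)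
    then have "- t \<ge> 0" using npos_rspec p by blast
    with \<open>t \<ge> 0\<close> \<open>t \<noteq> 0\<close> show False by simp
  qed
  then have "norm (ucfc (\<lambda>t. t) (star y * y)) \<le> 0"
    by (intro ucfc_norm_le) (auto simp: star_mult intro: continuous_on_id)
  then have "star y * y = 0" by (subst (asm) ucfc_id) (auto simp: star_mult)
  then have 0: "ucfc (\<lambda>t. ?n t * ?n t * ?n t) a = 0" using yy by simp
  have "m * m * m = 0"
    using n 0 unfolding m_def by (simp add: ucfc_mult[OF sa] continuous_intros)
  then have "(m * m) * star (m * m) = 0" by (simp add: star_mult sm mult.assoc)
  then have "m * star m = 0" by (simp add: sm del: mult_star_self_eq_0_iff) (metis mult_star_self_eq_0_iff)
  then show ?thesis unfolding m_def[symmetric] by simp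
qed

lemma positive_iff_npos: "positive x \<longleftrightarrow> npos x"
proof
  assume "positive x"
  then obtain y where y: "x = star y * y" by (auto simp: positive_def)
  have sa: "star x = x" by (simp add: y star_mult)
  have "npos (ucfc (\<lambda>t. max t 0) x)" by (rule npos_ucfc[OF sa]) (auto intro!: continuous_intros)
  also have "ucfc (\<lambda>t. max t 0) x = ucfc (\<lambda>t. t + max (- t) 0) x"
    by (rule ucfc_cong[OF sa]; (intro continuous_intros)?) (auto simp: max_def)
  also have "\<dots> = x"
    using negative_part_zero[of y] by (subst ucfc_add[OF sa]) (auto intro!: continuous_intros simp: y ucfc_id star_mult)
  finally show "npos x" .
qed (rule npos_imp_positive)

lemma positive_add: "positive x \<Longrightarrow> positive y \<Longrightarrow> positive (x + y :: 'u::cstar_algebra_1)"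
  by (simp add: positive_iff_npos npos_add)

lemma positive_sum: "(\<And>i. i \<in> I \<Longrightarrow> positive (f i)) \<Longrightarrow> positive (\<Sum>i\<in>I. f i :: 'u::cstar_algebra_1)"
  by (induction I rule: infinite_finite_induct) (auto intro: positive_add)

lemma positive_rspec: "positive (x :: 'u::cstar_algebra_1) \<Longrightarrow> t \<in> rspec x \<Longrightarrow> t \<ge> 0"
  by (simp add: positive_iff_npos npos_rspec)

lemma positive_ucfc:
  "star a = a \<Longrightarrow> continuous_on UNIV f \<Longrightarrow> (\<And>t. t \<in> rspec a \<Longrightarrow> f t \<ge> 0) \<Longrightarrow> positive (ucfc f a)"
  by (simp add: positive_iff_npos npos_ucfc)

section \<open>The order defined by positive elements, and positive square roots\<close>

definition ple :: "'u::cstar_algebra \<Rightarrow> 'u \<Rightarrow> bool" (infix "\<preceq>" 50) where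
  "x \<preceq> y \<longleftrightarrow> positive (y - x)"

lemma ple_refl [simp]: "x \<preceq> x"
  by (simp add: ple_def)

lemma ple_trans [trans]: "x \<preceq> y \<Longrightarrow> y \<preceq> z \<Longrightarrow> x \<preceq> (z :: 'u::cstar_algebra_1)"
  unfolding ple_def using positive_add[of "z - y" "y - x"] by simp

lemma ple_eq_trans [trans]: "x \<preceq> y \<Longrightarrow> y = z \<Longrightarrow> x \<preceq> z" "x = y \<Longrightarrow> y \<preceq> z \<Longrightarrow> x \<preceq> z"
  by simp_all

lemma ple_add_mono: "x \<preceq> y \<Longrightarrow> u \<preceq> v \<Longrightarrow> x + u \<preceq> y + (v :: 'u::cstar_algebra_1)"
  unfolding ple_def using positive_add[of "y - x" "v - u"] by (simp add: algebra_simps)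

lemma ple_conj: "x \<preceq> y \<Longrightarrow> star c * x * c \<preceq> star c * y * c"
  unfolding ple_def using positive_conj[of "y - x" c] by (simp add: algebra_simps)

lemma ple_scaleR: "x \<preceq> y \<Longrightarrow> r \<ge> 0 \<Longrightarrow> r *\<^sub>R x \<preceq> r *\<^sub>R y"
  unfolding ple_def using positive_scaleR[of "y - x" r] by (simp add: algebra_simps)

lemma ple_scaleR_left: "positive x \<Longrightarrow> r \<le> s \<Longrightarrow> r *\<^sub>R x \<preceq> s *\<^sub>R x"
  unfolding ple_def using positive_scaleR[of x "s - r"] by (simp add: algebra_simps)

lemma ple_norm:
  fixes a :: "'u::cstar_algebra_1"
  assumes sa: "star a = a" and M: "norm a \<le> M" shows "a \<preceq> M *\<^sub>R 1"
proof -
  have "positive (ucfc (\<lambda>t. M - t) a)"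
    by (rule positive_ucfc[OF sa]) (use rspec_le[of _ a] M in \<open>force intro: continuous_intros\<close>)+
  then show ?thesis unfolding ple_def
    by (simp add: ucfc_diff[OF sa] ucfc_id[OF sa] ucfc_const[OF sa])
qed

lemma norm_le_of_ple:
  fixes a :: "'u::cstar_algebra_1"
  assumes a: "positive a" and M: "a \<preceq> M *\<^sub>R 1" shows "norm a \<le> M"
proof -
  have sa: "star a = a" using a by (rule star_positive)
  have "norm (ucfc (\<lambda>t. t) a) \<le> M"
  proof (rule ucfc_norm_le[OF sa])
    fix t assume t: "t \<in> rspec a"
    have "(M - t) *\<^sub>R 1 - (M *\<^sub>R 1 - a) = - (t *\<^sub>R 1 - a)" by (simp add: algebra_simps)
    then have "M - t \<in> rspec (M *\<^sub>R 1 - a)" using t by (simp only: rspec_iff inv_el_uminus simp_thms)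
    then have "t \<le> M" using positive_rspec M unfolding ple_def by fastforce
    then show "\<bar>t\<bar> \<le> M" using positive_rspec[OF a t] by simp
  qed (rule continuous_on_id)
  then show ?thesis by (simp add: ucfc_id[OF sa])
qed

lemma norm_mono:
  fixes a :: "'u::cstar_algebra_1"
  assumes "positive a" "a \<preceq> b" shows "norm a \<le> norm b"
proof (rule norm_le_of_ple[OF assms(1)])
  have "positive b" using positive_add[of a "b - a"] assms by (simp add: ple_def)
  then show "a \<preceq> norm b *\<^sub>R 1" using ple_trans[OF assms(2) ple_norm] star_positive by blast
qed

lemma positive_antisym:
  fixes a :: "'u::cstar_algebra_1"
  assumes "positive a" "positive (- a)" shows "a = 0"
  using norm_mono[of a 0] assms by (simp add: ple_def)

lemma positive_add_eq_0:
  fixes a :: "'u::cstar_algebra_1"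
  assumes "positive a" "positive b" "a + b = 0" shows "a = 0"
  using positive_antisym[of a] assms by (metis add.inverse_unique)

definition psqrt :: "'u::cstar_algebra_1 \<Rightarrow> 'u" where
  "psqrt a = ucfc sqrt a"

lemma continuous_on_sqrt_UNIV: "continuous_on UNIV sqrt"
  by (simp add: continuous_at_imp_continuous_on isCont_real_sqrt)

lemma psqrt:
  assumes a: "positive a"
  shows psqrt_square: "psqrt a * psqrt a = a" and positive_psqrt: "positive (psqrt a)"
    and star_psqrt: "star (psqrt a) = psqrt a" and psqrt_commute: "x * a = a * x \<Longrightarrow> x * psqrt a = psqrt a * x"
proof -
  have sa: "star a = a" using a by (rule star_positive)
  note c = continuous_on_sqrt_UNIV
  have "psqrt a * psqrt a = ucfc (\<lambda>t. sqrt t * sqrt t) a" unfolding psqrt_def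
    by (rule ucfc_mult[OF sa c c, symmetric])
  also have "\<dots> = ucfc (\<lambda>t. t) a"
    by (rule ucfc_cong[OF sa]; (intro continuous_intros c)?) (use positive_rspec[OF a] in auto)
  finally show "psqrt a * psqrt a = a" by (simp add: ucfc_id[OF sa])
  show "positive (psqrt a)" unfolding psqrt_def
    by (rule positive_ucfc[OF sa c]) (use positive_rspec[OF a] in auto)
  then show "star (psqrt a) = psqrt a" by (rule star_positive)
  show "x * a = a * x \<Longrightarrow> x * psqrt a = psqrt a * x"
    unfolding psqrt_def by (rule ucfc_commute[OF sa c])
qed

lemma positive_mult_commute:
  fixes a b :: "'u::cstar_algebra_1"
  assumes "positive a" "positive b" "a * b = b * a" shows "positive (a * b)"
proof -
  have "a * b = psqrt a * (psqrt a * b)" by (simp add: psqrt_square assms(1) flip: mult.assoc)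
  also have "psqrt a * b = b * psqrt a" using psqrt_commute[OF assms(1), of b] assms(3) by simp
  finally have "a * b = star (psqrt a) * b * psqrt a" by (simp add: star_psqrt assms(1) mult.assoc)
  then show ?thesis using positive_conj[OF assms(2)] by metis
qed

text \<open>For d = a - b the positive elements d a d and d b d add up to d (a^2 - b^2) = 0, so both
  vanish and d^3, their difference, is 0.\<close>

lemma positive_square_unique:
  fixes a b :: "'u::cstar_algebra_1"
  assumes a: "positive a" and b: "positive b" and ab: "a * b = b * a" and sq: "a * a = b * b" shows "a = b"
proof -
  let ?d = "a - b"
  have sd: "star ?d = ?d" using a b by (simp add: star_diff star_positive)
  have "?d * (a + b) = 0" using ab sq by (simp add: algebra_simps)
  then have "?d * a * ?d + ?d * b * ?d = 0" by (metis distrib_left distrib_right mult_zero_left)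
  then have 0: "?d * a * ?d = 0" "?d * b * ?d = 0"
    using positive_add_eq_0 positive_conj[OF a, of ?d] positive_conj[OF b, of ?d] sd
    by (metis add.commute)+
  have "?d * ?d * ?d = ?d * a * ?d - ?d * b * ?d" by (simp add: algebra_simps)
  then have "?d * ?d * ?d = 0" using 0 by simp
  then have "(?d * ?d) * star (?d * ?d) = 0" by (simp add: star_mult sd) (metis mult.assoc mult_zero_right)
  then have "?d * star ?d = 0" by (metis mult_star_self_eq_0_iff sd)
  then show ?thesis by simp
qed

lemma psqrt_mult_self: "positive a \<Longrightarrow> psqrt (a * a) = (a :: 'u::cstar_algebra_1)"
  by (rule positive_square_unique)
    (auto simp: psqrt_square positive_psqrt positive_square star_positive psqrt_commute mult.assoc)

section \<open>Bounded sequences modulo null sequences\<close>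

text \<open>Equality in the quotient of the bounded sequences by the null sequences. Boundedness is
  part of the relation, so that \<open>asym_mult\<close> has no side conditions.\<close>

definition asym :: "(nat \<Rightarrow> 'a::real_normed_vector) \<Rightarrow> (nat \<Rightarrow> 'a) \<Rightarrow> bool" (infix "\<asymp>" 50) where
  "X \<asymp> Y \<longleftrightarrow> Bseq X \<and> Bseq Y \<and> (\<lambda>n. X n - Y n) \<longlonglongrightarrow> 0"

lemma asym_refl: "Bseq X \<Longrightarrow> X \<asymp> X"
  by (simp add: asym_def)

lemma asym_const: "(\<lambda>_. c) \<asymp> (\<lambda>_. c)"
  by (rule asym_refl) (rule Bfun_const)

lemma asym_sym: "X \<asymp> Y \<Longrightarrow> Y \<asymp> X"
  unfolding asym_def using tendsto_minus[of "\<lambda>n. X n - Y n" 0 sequentially] by simp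

lemma asym_trans [trans]: "X \<asymp> Y \<Longrightarrow> Y \<asymp> Z \<Longrightarrow> X \<asymp> Z"
  unfolding asym_def using tendsto_add[of "\<lambda>n. X n - Y n" 0 sequentially "\<lambda>n. Y n - Z n" 0] by simp

lemma asym_eq_trans [trans]: "X \<asymp> Y \<Longrightarrow> Y = Z \<Longrightarrow> X \<asymp> Z" "X = Y \<Longrightarrow> Y \<asymp> Z \<Longrightarrow> X \<asymp> Z"
  by simp_all

lemma Bseq_plus:
  assumes "Bseq X" "Bseq Y" shows "Bseq (\<lambda>n. X n + Y n :: 'a::real_normed_vector)"
proof -
  obtain K L where "\<And>n. norm (X n) \<le> K" "\<And>n. norm (Y n) \<le> L" using assms by (meson BseqE)
  then have "norm (X n + Y n) \<le> K + L" for n by (intro norm_triangle_mono)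
  then show ?thesis by (rule BseqI')
qed

lemma asym_add: "X \<asymp> Y \<Longrightarrow> U \<asymp> V \<Longrightarrow> (\<lambda>n. X n + U n) \<asymp> (\<lambda>n. Y n + V n)"
  unfolding asym_def
  using tendsto_add[of "\<lambda>n. X n - Y n" 0 sequentially "\<lambda>n. U n - V n" 0]
  by (auto simp: algebra_simps intro: Bseq_plus)

lemma asym_uminus: "X \<asymp> Y \<Longrightarrow> (\<lambda>n. - X n) \<asymp> (\<lambda>n. - Y n)"
  unfolding asym_def using tendsto_minus[of "\<lambda>n. X n - Y n" 0 sequentially] by (simp add: Bseq_minus_iff)

lemma asym_bounded_linear:
  assumes h: "bounded_linear h" and "X \<asymp> Y" shows "(\<lambda>n. h (X n)) \<asymp> (\<lambda>n. h (Y n))"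
proof -
  interpret bounded_linear h by fact
  have B: "Bseq (\<lambda>n. h (Z n))" if "Bseq Z" for Z
  proof -
    obtain K where "\<And>n. norm (Z n) \<le> K" using \<open>Bseq Z\<close> by (meson BseqE)
    moreover obtain L where "L \<ge> 0" "\<And>x. norm (h x) \<le> norm x * L" using nonneg_bounded by blast
    ultimately have "norm (h (Z n)) \<le> K * L" for n by (meson mult_right_mono order_trans)
    then show ?thesis by (rule BseqI')
  qed
  have "(\<lambda>n. h (X n - Y n)) \<longlonglongrightarrow> h 0" using assms(2) by (intro tendsto) (simp add: asym_def)
  then show ?thesis using assms(2) B by (simp add: asym_def zero diff)
qed

lemmas asym_star = asym_bounded_linear[OF bounded_linear_star]

lemma asym_sum:
  "(\<And>i. i \<in> I \<Longrightarrow> X i \<asymp> Y i) \<Longrightarrow> (\<lambda>n. \<Sum>i\<in>I. X i n) \<asymp> (\<lambda>n. \<Sum>i\<in>I. Y i n)"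
  by (induction I rule: infinite_finite_induct) (auto intro: asym_add asym_const)

lemma Bseq_mult_algebra:
  fixes X :: "nat \<Rightarrow> 'a::real_normed_algebra"
  assumes "Bseq X" "Bseq Y" shows "Bseq (\<lambda>n. X n * Y n)"
proof -
  obtain K L where K: "K > 0" "\<And>n. norm (X n) \<le> K" and L: "L > 0" "\<And>n. norm (Y n) \<le> L" using assms by (meson BseqE)
  have "norm (X n * Y n) \<le> K * L" for n
    by (rule order_trans[OF norm_mult_ineq mult_mono[OF K(2) L(2)]]) (use K in auto)
  then show ?thesis by (rule BseqI')
qed

lemma null_mult_Bseq:
  fixes X :: "nat \<Rightarrow> 'a::real_normed_algebra"
  assumes X: "X \<longlonglongrightarrow> 0" and Y: "Bseq Y"
  shows "(\<lambda>n. X n * Y n) \<longlonglongrightarrow> 0" "(\<lambda>n. Y n * X n) \<longlonglongrightarrow> 0"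
proof -
  obtain L where L: "\<And>n. norm (Y n) \<le> L" using Y by (meson BseqE)
  have l: "(\<lambda>n. norm (X n) * L) \<longlonglongrightarrow> 0" by (rule tendsto_mult_left_zero) (rule tendsto_norm_zero[OF X])
  have le: "norm (X n * Y n) \<le> norm (X n) * L" "norm (Y n * X n) \<le> norm (X n) * L" for n
    using norm_mult_ineq[of "X n" "Y n"] norm_mult_ineq[of "Y n" "X n"] mult_left_mono[OF L[of n], of "norm (X n)"]
    by (auto simp: mult.commute)
  show "(\<lambda>n. X n * Y n) \<longlonglongrightarrow> 0" "(\<lambda>n. Y n * X n) \<longlonglongrightarrow> 0"
    by (rule Lim_null_comparison[OF _ l], simp add: le)+
qed

lemma asym_mult:
  fixes X :: "nat \<Rightarrow> 'a::real_normed_algebra"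
  assumes "X \<asymp> Y" "U \<asymp> V" shows "(\<lambda>n. X n * U n) \<asymp> (\<lambda>n. Y n * V n)"
proof -
  have "(\<lambda>n. (X n - Y n) * U n + Y n * (U n - V n)) \<longlonglongrightarrow> 0 + 0"
    using assms by (intro tendsto_add null_mult_Bseq) (auto simp: asym_def)
  then show ?thesis using assms by (auto simp: asym_def algebra_simps intro: Bseq_mult_algebra)
qed

lemma asym_power:
  fixes X :: "nat \<Rightarrow> 'a::real_normed_algebra_1"
  assumes "X \<asymp> Y" shows "(\<lambda>n. X n ^ k) \<asymp> (\<lambda>n. Y n ^ k)"
  by (induction k) (auto intro: asym_mult asym_const assms)

lemma asym_null: "X \<asymp> (\<lambda>_. 0) \<longleftrightarrow> X \<longlonglongrightarrow> 0"
  by (auto simp: asym_def intro: Bfun_const convergent_imp_Bseq convergentI)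

lemma asym_rpeval: "X \<asymp> Y \<Longrightarrow> (\<lambda>n. rpeval p (X n)) \<asymp> (\<lambda>n. rpeval p (Y n))"
  by (induction p) (auto intro: asym_add asym_mult asym_const)

text \<open>Approximate \<open>f\<close> by a single polynomial, uniformly on an interval that
  contains the spectra of all \<open>X n\<close> and \<open>Y n\<close>; for a polynomial the claim
  is algebra.\<close>

lemma asym_ucfc:
  assumes XY: "X \<asymp> Y" and sX: "\<And>n. star (X n) = X n" and sY: "\<And>n. star (Y n) = Y n"
    and f: "continuous_on UNIV f"
  shows "(\<lambda>n. ucfc f (X n)) \<asymp> (\<lambda>n. ucfc f (Y n))"
proof -
  obtain K where K: "\<And>n. norm (X n) \<le> K" using XY by (meson BseqE asym_def)
  obtain L where L: "\<And>n. norm (Y n) \<le> L" using XY by (meson BseqE asym_def)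
  define R where "R = max K L"
  have R: "norm (X n) \<le> R" "norm (Y n) \<le> R" for n
    using K[of n] L[of n] by (auto simp: R_def)
  have rs: "rspec Z \<subseteq> {-R..R}" if "norm Z \<le> R" for Z :: 'a
    using rspec_subset[of Z] that by (meson atLeastatMost_subset_iff neg_le_iff_le order_trans)
  obtain q where q: "uniform_limit {-R..R} (\<lambda>n t. poly (q n) t) f sequentially" using poly_approx[OF f] by blast
  have "bounded (f ` {-R..R})"
    using f by (meson compact_Icc compact_continuous_image compact_imp_bounded continuous_on_subset subset_UNIV)
  then obtain M where M: "\<forall>x\<in>{-R..R}. \<bar>f x\<bar> \<le> M" unfolding bounded_iff by auto
  have B: "Bseq (\<lambda>n. ucfc f (Z n))" if "\<And>n. norm (Z n) \<le> R" "\<And>n. star (Z n) = Z n" for Z :: "nat \<Rightarrow> 'a"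
  proof (rule BseqI')
    show "norm (ucfc f (Z n)) \<le> M" for n using M rs[OF that(1)] by (intro ucfc_norm_le that f) auto
  qed
  have "(\<lambda>n. ucfc f (X n) - ucfc f (Y n)) \<longlonglongrightarrow> 0"
  proof (rule tendstoI)
    fix e :: real assume e: "e > 0"
    have "\<forall>\<^sub>F n in sequentially. \<forall>t\<in>{-R..R}. dist (poly (q n) t) (f t) < e/4"
      by (rule uniform_limitD[OF q]) (use e in simp)
    then obtain N where N: "\<And>t. t \<in> {-R..R} \<Longrightarrow> \<bar>f t - poly (q N) t\<bar> \<le> e/4"
      unfolding eventually_sequentially dist_real_def by (metis abs_minus_commute less_imp_le order_refl)
    have d: "norm (ucfc f Z - rpeval (q N) Z) \<le> e/4" if "norm Z \<le> R" "star Z = Z" for Z :: 'a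
      unfolding ucfc_poly[OF that(2), symmetric]
      by (rule ucfc_diff_norm_le[OF that(2) f])
        (use rs[OF that(1)] N in \<open>auto intro!: continuous_at_imp_continuous_on\<close>)
    have "(\<lambda>n. rpeval (q N) (X n) - rpeval (q N) (Y n)) \<longlonglongrightarrow> 0"
      using asym_rpeval[OF XY] by (simp add: asym_def)
    then have "\<forall>\<^sub>F n in sequentially. dist (rpeval (q N) (X n) - rpeval (q N) (Y n)) 0 < e/4"
      by (rule tendstoD) (use e in simp)
    then show "\<forall>\<^sub>F n in sequentially. dist (ucfc f (X n) - ucfc f (Y n)) 0 < e"
    proof eventually_elim
      case (elim n)
      have "ucfc f (X n) - ucfc f (Y n) = (ucfc f (X n) - rpeval (q N) (X n))
        + (rpeval (q N) (X n) - rpeval (q N) (Y n)) - (ucfc f (Y n) - rpeval (q N) (Y n))" by simp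
      also have "norm \<dots> \<le> norm (ucfc f (X n) - rpeval (q N) (X n))
        + norm (rpeval (q N) (X n) - rpeval (q N) (Y n)) + norm (ucfc f (Y n) - rpeval (q N) (Y n))"
        by (rule order_trans[OF norm_triangle_ineq4 add_right_mono[OF norm_triangle_ineq]])
      also have "\<dots> \<le> e/4 + norm (rpeval (q N) (X n) - rpeval (q N) (Y n)) + e/4"
        by (intro add_mono d R sX sY order_refl)
      finally show ?case using elim e by simp
    qed
  qed
  then show ?thesis using B R sX sY by (simp add: asym_def)
qed

lemma asym_psqrt:
  assumes "X \<asymp> Y" "\<And>n. positive (X n)" "\<And>n. positive (Y n)"
  shows "(\<lambda>n. psqrt (X n)) \<asymp> (\<lambda>n. psqrt (Y n))"
  unfolding psqrt_def using assms by (intro asym_ucfc continuous_on_sqrt_UNIV) (auto intro: star_positive)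

section \<open>Unitization\<close>

datatype 'a uz = Uz (ubase: 'a) (uscal: complex)

definition lmul :: "'a::cstar_algebra uz \<Rightarrow> 'a \<Rightarrow> 'a" where
  "lmul u b = ubase u * b + uscal u *\<^sub>C b"

lemma bounded_linear_lmul: "bounded_linear (lmul u)"
  unfolding lmul_def by (intro bounded_linear_add bounded_linear_mult_right bounded_linear_scaleC)

instantiation uz :: (cstar_algebra) "{complex_normed_vector, real_normed_algebra_1}"
begin

definition zero_uz :: "'a uz" where "zero_uz = Uz 0 0"
definition one_uz :: "'a uz" where "one_uz = Uz 0 1"
definition plus_uz :: "'a uz \<Rightarrow> 'a uz \<Rightarrow> 'a uz" where "plus_uz u v = Uz (ubase u + ubase v) (uscal u + uscal v)"
definition minus_uz :: "'a uz \<Rightarrow> 'a uz \<Rightarrow> 'a uz" where "minus_uz u v = Uz (ubase u - ubase v) (uscal u - uscal v)"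
definition uminus_uz :: "'a uz \<Rightarrow> 'a uz" where "uminus_uz u = Uz (- ubase u) (- uscal u)"
definition times_uz :: "'a uz \<Rightarrow> 'a uz \<Rightarrow> 'a uz" where
  "times_uz u v = Uz (ubase u * ubase v + uscal u *\<^sub>C ubase v + uscal v *\<^sub>C ubase u) (uscal u * uscal v)"
definition scaleC_uz :: "complex \<Rightarrow> 'a uz \<Rightarrow> 'a uz" where "scaleC_uz c u = Uz (c *\<^sub>C ubase u) (c * uscal u)"
definition scaleR_uz :: "real \<Rightarrow> 'a uz \<Rightarrow> 'a uz" where "scaleR_uz r u = Uz (r *\<^sub>R ubase u) (of_real r * uscal u)"
text \<open>If the algebra already has a unit e, then \<open>Uz (- e) 1\<close> acts as 0 by left
  multiplication, so the operator norm alone would only be a seminorm. Each of the two terms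
  satisfies the C*-identity, hence so does their maximum.\<close>

definition norm_uz :: "'a uz \<Rightarrow> real" where "norm_uz u = max (cmod (uscal u)) (onorm (lmul u))"
definition dist_uz :: "'a uz \<Rightarrow> 'a uz \<Rightarrow> real" where "dist_uz u v = norm (u - v)"
definition sgn_uz :: "'a uz \<Rightarrow> 'a uz" where "sgn_uz u = inverse (norm u) *\<^sub>R u"
definition uniformity_uz :: "('a uz \<times> 'a uz) filter"
  where "uniformity_uz = (INF e\<in>{0<..}. principal {(x, y). dist x y < e})"
definition open_uz :: "'a uz set \<Rightarrow> bool"
  where "open_uz U = (\<forall>x\<in>U. eventually (\<lambda>(x', y). x' = x \<longrightarrow> y \<in> U) uniformity)"

lemmas uz_defs = zero_uz_def one_uz_def plus_uz_def minus_uz_def uminus_uz_def times_uz_def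
  scaleC_uz_def scaleR_uz_def

lemma scaleC_mult_of_real:
  "(c * complex_of_real r) *\<^sub>C x = r *\<^sub>R c *\<^sub>C (x :: 'b::complex_normed_vector)"
  "(complex_of_real r * c) *\<^sub>C x = r *\<^sub>R c *\<^sub>C x"
  by (simp_all flip: scaleC_of_real add: scaleC_scaleC mult.commute)

lemma lmul_simps:
  "lmul (u + v) = (\<lambda>b. lmul u b + lmul v b)" "lmul (u * v) = lmul u \<circ> lmul v"
  "lmul (c *\<^sub>C u) = (\<lambda>b. c *\<^sub>C lmul u b)" "lmul (1::'a uz) = (\<lambda>b. b)"
  for u v :: "'a uz"
  by (auto simp: lmul_def uz_defs fun_eq_iff algebra_simps scaleC_add_left scaleC_add_right scaleC_mult_left
      scaleC_mult_right scaleC_scaleC)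

lemma norm_lmul_le: "norm (lmul u b) \<le> onorm (lmul u) * norm b"
  by (rule onorm[OF bounded_linear_lmul])

lemma onorm_lmul_nonneg: "onorm (lmul u) \<ge> 0"
  by (rule onorm_pos_le[OF bounded_linear_lmul])

lemma onorm_lmul_mult: "onorm (lmul (u * v)) \<le> onorm (lmul u) * onorm (lmul v)" for u v :: "'a uz"
  unfolding lmul_simps using onorm_compose[OF bounded_linear_lmul bounded_linear_lmul] by (simp add: o_def)

text \<open>Evaluate the multiplication operator at \<open>star (ubase u)\<close> and apply the
  C*-identity. Consequently Cauchy sequences in the unitization have Cauchy components.\<close>

lemma norm_ubase_le: "norm (ubase u) \<le> onorm (lmul u) + cmod (uscal u)" for u :: "'a uz"
proof (cases "ubase u = 0")
  case False
  let ?b = "star (ubase u)"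
  have "ubase u * ?b = lmul u ?b - uscal u *\<^sub>C ?b" by (simp add: lmul_def)
  then have "(norm (ubase u))\<^sup>2 = norm (lmul u ?b - uscal u *\<^sub>C ?b)" by (metis cstar_identity')
  also have "\<dots> \<le> norm (lmul u ?b) + norm (uscal u *\<^sub>C ?b)" by (rule norm_triangle_ineq4)
  also have "\<dots> \<le> (onorm (lmul u) + cmod (uscal u)) * norm (ubase u)"
    using norm_lmul_le[of u ?b] by (simp add: norm_scaleC algebra_simps)
  finally show ?thesis using False by (simp add: power2_eq_square)
qed (simp add: onorm_lmul_nonneg)

lemma norm_ubase_le': "norm (ubase u) \<le> 2 * norm u" "cmod (uscal u) \<le> norm u" for u :: "'a uz"
  using norm_ubase_le[of u] by (auto simp: norm_uz_def)

lemma norm_uz_le: "norm u \<le> norm (ubase u) + cmod (uscal u)" for u :: "'a uz"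
proof -
  have "norm (lmul u b) \<le> (norm (ubase u) + cmod (uscal u)) * norm b" for b
    unfolding lmul_def using norm_triangle_mono[OF norm_mult_ineq[of "ubase u" b] order_refl[of "norm (uscal u *\<^sub>C b)"]]
    by (simp add: norm_scaleC algebra_simps)
  then have "onorm (lmul u) \<le> norm (ubase u) + cmod (uscal u)" by (intro onorm_bound) auto
  then show ?thesis by (simp add: norm_uz_def)
qed

instance
proof
  fix x y z :: "'a uz" and r s :: real and c d :: complex and U :: "'a uz set"
  show "x + y + z = x + (y + z)" "x + y = y + x" "0 + x = x" "- x + x = 0" "x - y = x + - y"
    "r *\<^sub>R (x + y) = r *\<^sub>R x + r *\<^sub>R y" "(r + s) *\<^sub>R x = r *\<^sub>R x + s *\<^sub>R x" "r *\<^sub>R s *\<^sub>R x = (r * s) *\<^sub>R x"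
    "1 *\<^sub>R x = x" "x * y * z = x * (y * z)" "(x + y) * z = x * z + y * z" "x * (y + z) = x * y + x * z"
    "r *\<^sub>R x * y = r *\<^sub>R (x * y)" "x * r *\<^sub>R y = r *\<^sub>R (x * y)" "1 * x = x" "x * 1 = x" "(0::'a uz) \<noteq> 1"
    "c *\<^sub>C (x + y) = c *\<^sub>C x + c *\<^sub>C y" "(c + d) *\<^sub>C x = c *\<^sub>C x + d *\<^sub>C x" "c *\<^sub>C d *\<^sub>C x = (c * d) *\<^sub>C x"
    "complex_of_real r *\<^sub>C x = r *\<^sub>R x"
    by (auto simp: uz_defs scaleC_of_real scaleC_scaleC scaleC_add_left scaleC_add_right scaleC_mult_left
        scaleC_mult_right star_add star_mult star_scaleC scaleC_scaleR algebra_simps uz.expand scaleC_mult_of_real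
        scaleR_conv_of_real)
  show "dist x y = norm (x - y)" by (rule dist_uz_def)
  show "sgn x = inverse (norm x) *\<^sub>R x" by (rule sgn_uz_def)
  show "(uniformity :: ('a uz \<times> 'a uz) filter) = (INF e\<in>{0<..}. principal {(x, y). dist x y < e})"
    by (rule uniformity_uz_def)
  show "open U = (\<forall>x\<in>U. eventually (\<lambda>(x', y). x' = x \<longrightarrow> y \<in> U) uniformity)"
    by (rule open_uz_def)
  show "(norm x = 0) = (x = 0)"
    using norm_ubase_le'[of x] norm_uz_le[of x] onorm_lmul_nonneg[of x]
    by (auto simp: zero_uz_def uz.expand)
  show "norm (x + y) \<le> norm x + norm y"
    using onorm_triangle[OF bounded_linear_lmul[of x] bounded_linear_lmul[of y]] norm_triangle_ineq[of "uscal x" "uscal y"]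
    by (auto simp: norm_uz_def lmul_simps) (auto simp: plus_uz_def)
  show cn: "norm (c *\<^sub>C x) = cmod c * norm x" for c and x :: "'a uz"
  proof -
    have le: "onorm (lmul (c *\<^sub>C x)) \<le> cmod c * onorm (lmul x)" for c and x :: "'a uz"
      using norm_lmul_le[of x]
      by (intro onorm_bound) (auto simp: lmul_simps norm_scaleC onorm_lmul_nonneg mult.assoc mult_left_mono)
    have "onorm (lmul (c *\<^sub>C x)) = cmod c * onorm (lmul x)"
    proof (cases "c = 0")
      case True then show ?thesis using le[of c x] onorm_lmul_nonneg[of "c *\<^sub>C x"] by simp
    next
      case False
      have "inverse c *\<^sub>C (c *\<^sub>C x) = x" using False by (simp add: scaleC_uz_def scaleC_scaleC uz.expand)
      then have "onorm (lmul x) \<le> cmod (inverse c) * onorm (lmul (c *\<^sub>C x))" by (metis le)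
      then have "cmod c * onorm (lmul x) \<le> onorm (lmul (c *\<^sub>C x))"
        using False by (simp add: norm_inverse) (simp add: field_simps)
      then show ?thesis using le[of c x] by simp
    qed
    then show ?thesis by (simp add: norm_uz_def scaleC_uz_def norm_mult max_mult_distrib_left)
  qed
  have "r *\<^sub>R x = complex_of_real r *\<^sub>C x" by (simp add: uz_defs scaleC_of_real)
  then show "norm (r *\<^sub>R x) = \<bar>r\<bar> * norm x" by (simp add: cn)
  show "norm (x * y) \<le> norm x * norm y"
  proof -
    have nn: "0 \<le> norm u" for u :: "'a uz"
      using norm_ubase_le'(2)[of u] norm_ge_zero[of "uscal u"] by linarith
    have "cmod (uscal (x * y)) \<le> norm x * norm y"
      unfolding times_uz_def uz.sel norm_mult
      by (intro mult_mono norm_ubase_le' nn) simp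
    moreover have "onorm (lmul (x * y)) \<le> norm x * norm y"
      by (rule order_trans[OF onorm_lmul_mult mult_mono[OF _ _ nn onorm_lmul_nonneg]]) (simp_all add: norm_uz_def)
    ultimately show ?thesis unfolding norm_uz_def[of "x * y"] by simp
  qed
  show "norm (1::'a uz) = 1"
    using onorm_bound[of 1 "\<lambda>b::'a. b"] unfolding norm_uz_def lmul_simps by (simp add: one_uz_def max_def)
qed

end

instantiation uz :: (cstar_algebra) cstar_algebra_1
begin

definition star_uz :: "'a uz \<Rightarrow> 'a uz" where "star_uz u = Uz (star (ubase u)) (cnj (uscal u))"

lemma star_lmul_mult: "star (lmul u b) * lmul u b = star b * lmul (star u * u) b" for u :: "'a uz"
  by (simp add: lmul_def uz_defs star_uz_def star_add star_mult star_scaleC algebra_simps scaleC_add_left scaleC_add_right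
      scaleC_mult_left scaleC_mult_right scaleC_scaleC)

lemma onorm_lmul_square_le: "(onorm (lmul u))\<^sup>2 \<le> onorm (lmul (star u * u))" for u :: "'a uz"
proof -
  let ?N = "onorm (lmul (star u * u))"
  have "norm (lmul u b) \<le> sqrt ?N * norm b" for b
  proof -
    have "(norm (lmul u b))\<^sup>2 = norm (star b * lmul (star u * u) b)"
      by (simp flip: cstar_identity add: star_lmul_mult)
    also have "\<dots> \<le> norm b * (?N * norm b)"
      using norm_mult_ineq[of "star b" "lmul (star u * u) b"]
        mult_left_mono[OF norm_lmul_le[of "star u * u" b], of "norm b"] by simp
    also have "\<dots> = (sqrt ?N * norm b)\<^sup>2"
      by (simp add: power2_eq_square onorm_lmul_nonneg)
    finally show ?thesis by (rule power2_le_imp_le) (simp add: onorm_lmul_nonneg)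
  qed
  then have "onorm (lmul u) \<le> sqrt ?N" by (intro onorm_bound) (auto simp: onorm_lmul_nonneg)
  then have "(onorm (lmul u))\<^sup>2 \<le> (sqrt ?N)\<^sup>2" by (intro power_mono onorm_lmul_nonneg)
  then show ?thesis by (simp add: onorm_lmul_nonneg)
qed

lemma onorm_lmul_star_le: "onorm (lmul u) \<le> onorm (lmul (star u))" for u :: "'a uz"
proof (cases "onorm (lmul u) = 0")
  case False
  then have "onorm (lmul u) > 0" using onorm_lmul_nonneg[of u] by simp
  moreover have "onorm (lmul u) * onorm (lmul u) \<le> onorm (lmul (star u)) * onorm (lmul u)"
    using onorm_lmul_square_le[of u] onorm_lmul_mult[of "star u" u] by (simp add: power2_eq_square)
  ultimately show ?thesis by simp
qed (simp add: onorm_lmul_nonneg)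

instance
proof
  fix x y :: "'a uz" and c :: complex
  show "c *\<^sub>C x * y = c *\<^sub>C (x * y)" "x * c *\<^sub>C y = c *\<^sub>C (x * y)"
    "star (star x) = x" "star (x + y) = star x + star y" "star (c *\<^sub>C x) = cnj c *\<^sub>C star x"
    "star (x * y) = star y * star x"
    by (auto simp: uz_defs star_uz_def scaleC_scaleC scaleC_add_right scaleC_mult_left
        scaleC_mult_right star_add star_mult star_scaleC algebra_simps)
  show "norm (star x * x) = (norm x)\<^sup>2"
  proof -
    have "onorm (lmul (star x)) = onorm (lmul x)"
      using onorm_lmul_star_le[of x] onorm_lmul_star_le[of "star x"] by (simp add: star_uz_def star_star)
    then have "onorm (lmul (star x * x)) = (onorm (lmul x))\<^sup>2"
      using onorm_lmul_square_le[of x] onorm_lmul_mult[of "star x" x] by (simp add: power2_eq_square)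
    moreover have "cmod (uscal (star x * x)) = (cmod (uscal x))\<^sup>2"
      by (simp add: uz_defs star_uz_def norm_mult power2_eq_square)
    ultimately show ?thesis using onorm_lmul_nonneg[of x] by (auto simp: norm_uz_def max_def power2_le_iff_abs_le abs_le_square_iff
          intro!: antisym)
  qed
next
  fix X :: "nat \<Rightarrow> 'a uz" assume X: "Cauchy X"
  have d: "ubase (x - y) = ubase x - ubase y" "uscal (x - y) = uscal x - uscal y" for x y :: "'a uz"
    by (simp_all add: minus_uz_def)
  have "Cauchy (\<lambda>n. ubase (X n))"
  proof (rule metric_CauchyI)
    fix e :: real assume "e > 0"
    then obtain M where M: "\<forall>m\<ge>M. \<forall>n\<ge>M. dist (X m) (X n) < e / 2" using metric_CauchyD[OF X, of "e/2"] by auto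
    have "dist (ubase (X m)) (ubase (X n)) < e" if "m \<ge> M" "n \<ge> M" for m n
      using M[rule_format, OF that] norm_ubase_le'(1)[of "X m - X n"] by (simp add: d dist_norm)
    then show "\<exists>M. \<forall>m\<ge>M. \<forall>n\<ge>M. dist (ubase (X m)) (ubase (X n)) < e" by blast
  qed
  then obtain a where a: "(\<lambda>n. ubase (X n)) \<longlonglongrightarrow> a" using Cauchy_convergent_iff convergent_def by blast
  have "Cauchy (\<lambda>n. uscal (X n))"
  proof (rule metric_CauchyI)
    fix e :: real assume "e > 0"
    then obtain M where M: "\<forall>m\<ge>M. \<forall>n\<ge>M. dist (X m) (X n) < e" using metric_CauchyD[OF X, of e] by auto
    have "dist (uscal (X m)) (uscal (X n)) < e" if "m \<ge> M" "n \<ge> M" for m n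
      using M[rule_format, OF that] norm_ubase_le'(2)[of "X m - X n"] by (simp add: d dist_norm)
    then show "\<exists>M. \<forall>m\<ge>M. \<forall>n\<ge>M. dist (uscal (X m)) (uscal (X n)) < e" by blast
  qed
  then obtain z where z: "(\<lambda>n. uscal (X n)) \<longlonglongrightarrow> z" using Cauchy_convergent_iff convergent_def by blast
  have "(\<lambda>n. norm (ubase (X n) - a) + cmod (uscal (X n) - z)) \<longlonglongrightarrow> 0 + 0"
    by (intro tendsto_add tendsto_norm_zero LIM_zero a z)
  then have l: "(\<lambda>n. norm (ubase (X n) - a) + cmod (uscal (X n) - z)) \<longlonglongrightarrow> 0" by simp
  have "X n - Uz a z = Uz (ubase (X n) - a) (uscal (X n) - z)" for n by (simp add: minus_uz_def)
  then have "norm (X n - Uz a z) \<le> norm (ubase (X n) - a) + cmod (uscal (X n) - z)" for n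
    using norm_uz_le[of "X n - Uz a z"] by simp
  then have "(\<lambda>n. X n - Uz a z) \<longlonglongrightarrow> 0"
    by (intro Lim_null_comparison[OF _ l] always_eventually) simp
  then have "X \<longlonglongrightarrow> Uz a z" by (simp add: LIM_zero_iff)
  then show "convergent X" unfolding convergent_def by blast
qed

end

definition emb :: "'a::cstar_algebra \<Rightarrow> 'a uz" where
  "emb a = Uz a 0"

lemma emb_simps:
  "emb (a + b) = emb a + emb b" "emb (a - b) = emb a - emb b" "emb (- a) = - emb a" "emb 0 = 0"
  "emb (a * b) = emb a * emb b" "emb (c *\<^sub>C a) = c *\<^sub>C emb a" "emb (r *\<^sub>R a) = r *\<^sub>R emb a"
  "emb (star a) = star (emb a)"
  by (simp_all add: emb_def uz_defs star_uz_def)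

lemma emb_inject [simp]: "emb a = emb b \<longleftrightarrow> a = b"
  by (simp add: emb_def)

lemma emb_eq_0_iff [simp]: "emb a = 0 \<longleftrightarrow> a = 0"
  by (metis emb_inject emb_simps(4))

lemma emb_sum: "emb (\<Sum>i\<in>I. f i) = (\<Sum>i\<in>I. emb (f i))"
  by (induction I rule: infinite_finite_induct) (auto simp: emb_simps)

lemma ubase_emb [simp]: "ubase (emb a) = a" and uscal_emb [simp]: "uscal (emb a) = 0"
  by (simp_all add: emb_def)

lemma norm_emb [simp]: "norm (emb a) = norm a"
proof (cases "a = 0")
  case False
  have "norm (emb a) \<le> norm a" using norm_uz_le[of "emb a"] by simp
  moreover have "norm a \<le> norm (emb a)" using norm_ubase_le[of "emb a"] by (simp add: norm_uz_def)
  ultimately show ?thesis by simp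
qed (simp add: emb_simps)

lemma bounded_linear_emb: "bounded_linear emb"
  by (rule bounded_linear_intro[where K = 1]) (auto simp: emb_simps)

lemma uscal_simps [simp]:
  "uscal (u + v) = uscal u + uscal v" "uscal (u - v) = uscal u - uscal v" "uscal (- u) = - uscal u" "uscal 0 = 0"
  "uscal (u * v) = uscal u * uscal v" "uscal (c *\<^sub>C u) = c * uscal u" "uscal (r *\<^sub>R u) = of_real r * uscal u"
  "uscal (star u) = cnj (uscal u)" "uscal 1 = 1"
  by (simp_all add: uz_defs star_uz_def)

lemma bounded_linear_uscal: "bounded_linear (uscal :: 'a::cstar_algebra uz \<Rightarrow> complex)"
  by (rule bounded_linear_intro[where K = 1]) (auto simp: norm_ubase_le' scaleR_conv_of_real[where 'a = complex])

lemma uz_decompose: "u = emb (ubase u) + uscal u *\<^sub>C 1"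
  by (simp add: emb_def uz_defs)

lemma uscal_eq_0_iff: "uscal u = 0 \<longleftrightarrow> (\<exists>a. u = emb a)"
  using uz_decompose[of u] by auto

lemma star_emb_iff: "star (emb a) = emb a \<longleftrightarrow> star a = a"
  by (metis emb_inject emb_simps(8))

lemma ubase_linear:
  "ubase (u + v) = ubase u + ubase v" "ubase (u - v) = ubase u - ubase v" "ubase (c *\<^sub>C u) = c *\<^sub>C ubase u"
  "ubase (r *\<^sub>R u) = r *\<^sub>R ubase u" "ubase (star u) = star (ubase u)" "ubase (- u) = - ubase u" "ubase 0 = 0"
  by (simp_all add: uz_defs star_uz_def)

lemma bounded_linear_ubase: "bounded_linear (ubase :: 'a::cstar_algebra uz \<Rightarrow> 'a)"
  by (rule bounded_linear_intro[where K = 2]) (use norm_ubase_le' in \<open>auto simp: ubase_linear mult.commute\<close>)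

lemma uscal_rpeval: "uscal (rpeval p u) = poly (map_poly of_real p) (uscal u)"
  by (induction p) (simp_all add: map_poly_pCons)

text \<open>The scalar part is a character that kills \<open>emb a\<close>, so it sends f(emb a) to
  f(0). Functions with f(0) = 0 therefore stay inside the algebra.\<close>

lemma uscal_ucfc:
  assumes sa: "star (emb a) = emb a" and f: "continuous_on UNIV f" shows "uscal (ucfc f (emb a)) = of_real (f 0)"
proof -
  obtain p where p: "uniform_limit {- norm (emb a)..norm (emb a)} (\<lambda>n t. poly (p n) t) f sequentially"
    "(\<lambda>n. rpeval (p n) (emb a)) \<longlonglongrightarrow> ucfc f (emb a)" using ucfc_approx[OF sa f] by blast
  have "(\<lambda>n. poly (p n) 0) \<longlonglongrightarrow> f 0"
    by (rule tendsto_uniform_limitI[OF p(1)]) auto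
  then have "(\<lambda>n. of_real (poly (p n) 0)) \<longlonglongrightarrow> (of_real (f 0) :: complex)" by (rule tendsto_of_real)
  moreover have "uscal (rpeval (p n) (emb a)) = of_real (poly (p n) 0)" for n
    using poly_map_of_real[of "p n" 0] by (simp add: uscal_rpeval)
  ultimately show ?thesis using bounded_linear.tendsto[OF bounded_linear_uscal p(2)] LIMSEQ_unique by simp
qed

lemma uscal_psqrt_emb: "positive (emb a) \<Longrightarrow> uscal (psqrt (emb a)) = 0"
  unfolding psqrt_def by (subst uscal_ucfc) (auto simp: star_positive continuous_on_sqrt_UNIV)

lemma positive_emb_iff: "positive (emb a) \<longleftrightarrow> positive a"
proof
  assume p: "positive (emb a)"
  then obtain b where b: "psqrt (emb a) = emb b" using uscal_psqrt_emb uscal_eq_0_iff by blast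
  have "emb a = star (emb b) * emb b" using psqrt_square[OF p] star_psqrt[OF p] unfolding b by simp
  then show "positive a" unfolding positive_def by (metis emb_inject emb_simps(5,8))
next
  assume "positive a"
  then show "positive (emb a)" by (auto simp: positive_def emb_simps)
qed

lemma positive_add_cstar: "positive x \<Longrightarrow> positive y \<Longrightarrow> positive (x + y :: 'a::cstar_algebra)"
  by (metis emb_simps(1) positive_emb_iff positive_add)

lemma positive_sum_cstar: "(\<And>i. i \<in> I \<Longrightarrow> positive (f i)) \<Longrightarrow> positive (\<Sum>i\<in>I. f i :: 'a::cstar_algebra)"
  by (induction I rule: infinite_finite_induct) (auto intro: positive_add_cstar)

section \<open>The non-unital functional calculus and Cuntz subequivalence\<close>

lemma quasi_invertible_iff: "quasi_invertible a \<longleftrightarrow> inv_el (1 - emb a)"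
proof
  assume "quasi_invertible a"
  then obtain b where "a + b = a * b" "a + b = b * a" by (auto simp: quasi_invertible_def)
  then have "emb a + emb b = emb a * emb b" "emb a + emb b = emb b * emb a" by (metis emb_simps(1,5))+
  then show "inv_el (1 - emb a)" unfolding inv_el_def by (intro exI[of _ "1 - emb b"]) (simp add: algebra_simps)
next
  assume "inv_el (1 - emb a)"
  then obtain w where w: "(1 - emb a) * w = 1" "w * (1 - emb a) = 1" by (auto simp: inv_el_def)
  have "uscal ((1 - emb a) * w) = 1" using w by simp
  then have "uscal (1 - w) = 0" by simp
  then obtain b where "1 - w = emb b" using uscal_eq_0_iff by blast
  then have "w = 1 - emb b" by (simp add: algebra_simps)
  from w[unfolded this] have "emb a + emb b = emb a * emb b" "emb a + emb b = emb b * emb a"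
    by (simp_all add: algebra_simps)
  then show "quasi_invertible a" unfolding quasi_invertible_def by (metis emb_inject emb_simps(1,5))
qed

lemma zero_in_rspec_emb: "0 \<in> rspec (emb a)"
proof -
  have False if "- emb a * w = 1" for w
  proof -
    have "uscal (- emb a * w) = 1" using that by simp
    then show False by simp
  qed
  then show ?thesis by (auto simp: rspec_iff inv_el_def)
qed

lemma rspec_emb: "rspec (emb a) = {t. complex_of_real t \<in> spectrum_cstar a}"
proof (rule Set.set_eqI)
  fix t
  show "t \<in> rspec (emb a) \<longleftrightarrow> t \<in> {t. complex_of_real t \<in> spectrum_cstar a}"
  proof (cases "t = 0")
    case True then show ?thesis by (simp add: zero_in_rspec_emb spectrum_cstar_def)
  next
    case False
    have "t *\<^sub>R 1 - emb a = of_real t *\<^sub>C (1 - emb (inverse (of_real t) *\<^sub>C a))"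
      using False by (simp add: scaleC_diff_right scaleC_of_real emb_simps scaleC_scaleC)
    then show ?thesis using False by (simp add: rspec_iff inv_el_scaleC spectrum_cstar_def quasi_invertible_iff)
  qed
qed

lemma rpeval_as_sum: "degree p \<le> n \<Longrightarrow> rpeval p a = (\<Sum>k\<le>n. coeff p k *\<^sub>R a ^ k)"
proof (induction p arbitrary: n)
  case (pCons c p)
  show ?case
  proof (cases n)
    case 0
    then have "p = 0" using pCons(3) by (metis degree_pCons_eq_if le_zero_eq nat.simps(3))
    then show ?thesis using 0 by simp
  next
    case (Suc m)
    have "degree p \<le> m" using pCons(3) Suc by (cases "p = 0") (auto simp: degree_pCons_eq_if)
    then show ?thesis using pCons(2)[of m] unfolding Suc sum.atMost_Suc_shift
      by (simp add: sum_distrib_left mult_scaleR_right)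
  qed
qed simp

lemma emb_pow_Suc: "emb (pow_Suc a k) = emb a * emb a ^ k"
  by (induction k) (auto simp: emb_simps mult.assoc power_commutes)

lemma emb_poly_cstar: "emb (poly_cstar p a) = rpeval (pCons 0 p) (emb a)"
  using rpeval_as_sum[of p "degree p" "emb a"]
  by (simp add: poly_cstar_def emb_sum emb_simps emb_pow_Suc sum_distrib_left)

text \<open>Justifies the definite description in \<open>cfc\<close>. Polynomials without constant
  term that approximate \<open>f\<close> exist: from an arbitrary approximating sequence subtract
  the values at 0, which tend to f(0) = 0. Uniqueness follows from applying two candidate limits to
  this one sequence.\<close>

lemma emb_cfc:
  fixes c :: "'a::cstar_algebra"
  assumes sc: "star c = c" and f: "continuous_on UNIV f" and f0: "f 0 = 0"
  shows "emb (cfc f c) = ucfc f (emb c)"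
proof -
  let ?S = "{t. complex_of_real t \<in> spectrum_cstar c}"
  have sa: "star (emb c) = emb c" using sc by (simp add: star_emb_iff)
  have "uscal (ucfc f (emb c)) = 0" using uscal_ucfc[OF sa f] f0 by simp
  then obtain y where y: "ucfc f (emb c) = emb y" using uscal_eq_0_iff by blast
  have lim: "(\<lambda>n. poly_cstar (p n) c) \<longlonglongrightarrow> y"
    if "uniform_limit ?S (\<lambda>n t. t * poly (p n) t) f sequentially" for p
  proof -
    have "uniform_limit (rspec (emb c)) (\<lambda>n t. poly (pCons 0 (p n)) t) f sequentially"
      using that by (simp add: rspec_emb)
    then have "(\<lambda>n. emb (poly_cstar (p n) c)) \<longlonglongrightarrow> emb y"
      unfolding emb_poly_cstar y[symmetric] by (rule ucfc_tendsto[OF sa f])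
    from bounded_linear.tendsto[OF bounded_linear_ubase this] show ?thesis by simp
  qed
  obtain q where q: "uniform_limit {- norm (emb c)..norm (emb c)} (\<lambda>n t. poly (q n) t) f sequentially"
    using ucfc_approx[OF sa f] by blast
  have q0: "(\<lambda>n. poly (q n) 0) \<longlonglongrightarrow> 0"
    using tendsto_uniform_limitI[OF q, of 0] f0 by simp
  have "\<exists>p. \<forall>t. poly (q n) t = poly (q n) 0 + t * poly p t" for n
    by (cases "q n") auto
  then obtain p where p: "\<And>n t. poly (q n) t = poly (q n) 0 + t * poly (p n) t" by metis
  have "uniform_limit ?S (\<lambda>n t. poly (q n) t - poly (q n) 0) (\<lambda>t. f t - 0) sequentially"
  proof (rule uniform_limit_minus)
    show "uniform_limit ?S (\<lambda>n t. poly (q n) t) f sequentially"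
      using uniform_limit_on_subset[OF q rspec_subset] unfolding rspec_emb .
    show "uniform_limit ?S (\<lambda>n t. poly (q n) 0) (\<lambda>t. 0) sequentially"
      using q0 by (auto simp: uniform_limit_iff tendsto_iff)
  qed
  then have ex: "uniform_limit ?S (\<lambda>n t. t * poly (p n) t) f sequentially"
  proof -
    have "poly (q n) t - poly (q n) 0 = t * poly (p n) t" for n t using p[of n t] by linarith
    then show ?thesis using \<open>uniform_limit ?S (\<lambda>n t. poly (q n) t - poly (q n) 0) _ _\<close> by simp
  qed
  have "cfc f c = y" unfolding cfc_def
  proof (rule the_equality)
    fix z assume "\<forall>p. uniform_limit ?S (\<lambda>n t. t * poly (p n) t) f sequentially \<longrightarrow> (\<lambda>n. poly_cstar (p n) c) \<longlonglongrightarrow> z"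
    then show "z = y" using ex lim[OF ex] LIMSEQ_unique by blast
  qed (use lim in blast)
  then show ?thesis using y by simp
qed

lemma emb_cut_down:
  assumes "star c = c" "\<epsilon> \<ge> 0" shows "emb (cut_down c \<epsilon>) = ucfc (\<lambda>t. max (t - \<epsilon>) 0) (emb c)"
  unfolding cut_down_def using assms by (intro emb_cfc) (auto intro!: continuous_intros)

section \<open>Cuntz subequivalence expressed by order inequalities\<close>

lemma cuntz_subI:
  assumes "\<And>\<delta>. \<delta> > 0 \<Longrightarrow> \<exists>v. norm (a - v * b * star v) \<le> \<delta>" shows "a \<precsim> b"
proof -
  have "\<exists>v. norm (a - v * b * star v) \<le> 1 / real (Suc n)" for n by (rule assms) simp
  then obtain v where v: "\<And>n. norm (a - v n * b * star (v n)) \<le> 1 / real (Suc n)" by metis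
  have "(\<lambda>n. norm (a - v n * b * star (v n))) \<longlonglongrightarrow> 0"
    by (rule Lim_null_comparison[OF _ LIMSEQ_inverse_real_of_nat])
      (use v in \<open>simp add: inverse_eq_divide\<close>)
  then show ?thesis unfolding cuntz_sub_def by blast
qed

text \<open>y is at most \<epsilon> plus its cut-down, and the cut-down is within \<delta> of some v
  a (star v). Unlike the Cuntz relation, the resulting inequality can be pushed through positive
  linear maps and added to others.\<close>

lemma cuntz_cut_down_ple:
  fixes y :: "'a::cstar_algebra"
  assumes sy: "star y = y" and a: "positive a" and e: "\<epsilon> > 0" "\<delta> > 0" and sub: "cut_down y \<epsilon> \<precsim> a"
  obtains v where "emb y \<preceq> (\<epsilon> + \<delta>) *\<^sub>R 1 + emb (v * a * star v)"
proof -
  have sa: "star (emb y) = emb y" using sy by (simp add: star_emb_iff)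
  let ?c = "cut_down y \<epsilon>" and ?f = "\<lambda>t. max (t - \<epsilon>) 0"
  have c: "emb ?c = ucfc ?f (emb y)" using emb_cut_down[OF sy] e by simp
  obtain v where v: "(\<lambda>n. norm (?c - v n * a * star (v n))) \<longlonglongrightarrow> 0" using sub unfolding cuntz_sub_def by blast
  then obtain n where n: "norm (?c - v n * a * star (v n)) < \<delta>"
    using order_tendstoD(2)[OF v e(2)] unfolding eventually_sequentially by blast
  let ?w = "v n * a * star (v n)"
  have f: "continuous_on UNIV ?f" by (intro continuous_intros)
  have "positive (ucfc (\<lambda>t. (\<epsilon> + ?f t) - t) (emb y))"
    by (rule positive_ucfc[OF sa]) (auto intro!: continuous_intros)
  then have 1: "emb y \<preceq> \<epsilon> *\<^sub>R 1 + emb ?c"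
    unfolding ple_def c by (simp add: ucfc_diff[OF sa] ucfc_add[OF sa] ucfc_id[OF sa] ucfc_const[OF sa] continuous_intros f)
  have "star (emb (?c - ?w)) = emb (?c - ?w)"
    using star_ucfc[OF sa f] a by (simp add: emb_simps c star_diff star_mult star_positive positive_emb_iff mult.assoc)
  then have "emb (?c - ?w) \<preceq> \<delta> *\<^sub>R 1" using n by (intro ple_norm) auto
  from ple_add_mono[OF this ple_refl[of "emb ?w"]] have "emb ?c \<preceq> \<delta> *\<^sub>R 1 + emb ?w" by (simp add: emb_simps)
  from ple_trans[OF 1 ple_add_mono[OF ple_refl this]] have "emb y \<preceq> (\<epsilon> + \<delta>) *\<^sub>R 1 + emb ?w"
    by (simp add: algebra_simps)
  then show ?thesis by (rule that)
qed

text \<open>If \<open>X \<le> m\<^sup>* m =: G\<close> then \<open>X\<close> is the limit of \<open>X\<^sup>1\<^sup>/\<^sup>2 k(G) X\<^sup>1\<^sup>/\<^sup>2\<close> with \<open>k(t) = t\<^sup>2 / (t + \<tau>)\<^sup>2\<close>.\<close>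

lemma ple_imp_approx_conj:
  fixes X :: "'u::cstar_algebra_1"
  assumes X: "positive X" and G: "positive G" and le: "X \<preceq> G" and t: "\<tau> > 0"
  shows "\<exists>F. star F = F \<and> norm (X - psqrt X * F * G * F * psqrt X) \<le> 2 * \<tau>"
proof -
  have sG: "star G = G" using G by (rule star_positive)
  let ?f = "\<lambda>t. sqrt \<bar>t\<bar> / (\<bar>t\<bar> + \<tau>)"
  let ?k = "\<lambda>t. ?f t * t * ?f t"
  let ?h = "\<lambda>t. sqrt \<bar>1 - ?k t\<bar>"
  have nz: "\<bar>s\<bar> + \<tau> \<noteq> 0" for s :: real using t by (metis abs_ge_zero add_nonneg_pos less_irrefl)
  have f: "continuous_on UNIV ?f" by (intro continuous_intros) (simp add: nz)
  have k: "continuous_on UNIV ?k" by (intro continuous_intros f)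
  have h: "continuous_on UNIV ?h" by (intro continuous_intros k)
  have k1: "?k s = (s / (s + \<tau>))\<^sup>2" if "s \<ge> 0" for s
    using that by (simp add: power2_eq_square)
  have k01: "0 \<le> ?k s \<and> ?k s \<le> 1" if "s \<ge> 0" for s
  proof -
    have "0 \<le> s / (s + \<tau>)" "s / (s + \<tau>) \<le> 1" using that t by auto
    then show ?thesis unfolding k1[OF that] by (simp add: power_le_one)
  qed
  let ?R = "psqrt X"
  define F where "F = ucfc ?f G"
  define H where "H = ucfc ?h G"
  have sF: "star F = F" unfolding F_def by (rule star_ucfc[OF sG f])
  have FGF: "F * G * F = ucfc ?k G" unfolding F_def
    by (simp only: ucfc_mult[OF sG continuous_on_mult[OF f continuous_on_id] f]
        ucfc_mult[OF sG f continuous_on_id] ucfc_id[OF sG])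
  have HH: "H * H = 1 - ucfc ?k G"
  proof -
    have "H * H = ucfc (\<lambda>t. ?h t * ?h t) G" unfolding H_def by (rule ucfc_mult[OF sG h h, symmetric])
    also have "\<dots> = ucfc (\<lambda>t. 1 - ?k t) G"
    proof (rule ucfc_cong[OF sG])
      show "?h s * ?h s = 1 - ?k s" if "s \<in> rspec G" for s
        using k01[OF positive_rspec[OF G that]] by simp
    qed (intro continuous_intros h k)+
    also have "\<dots> = 1 - ucfc ?k G" by (simp only: ucfc_diff[OF sG continuous_on_const k] ucfc_const[OF sG]) simp
    finally show ?thesis .
  qed
  have sH: "star H = H" unfolding H_def by (rule star_ucfc[OF sG h])
  note R = psqrt_square[OF X] star_psqrt[OF X]
  have "X - ?R * F * G * F * ?R = X - ?R * (F * G * F) * ?R" by (simp only: mult.assoc)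
  also have "\<dots> = ?R * (H * H) * ?R" unfolding FGF HH by (simp add: algebra_simps R)
  finally have e: "X - ?R * F * G * F * ?R = ?R * (H * H) * ?R" .
  \<comment> \<open>The C*-identity moves \<open>H\<close> to the outside: the norm of R H^2 R is
    that of H X H, where X may be replaced by the larger G. What remains is a function of G
    alone.\<close>
  have "norm (?R * (H * H) * ?R) = norm (star (H * ?R) * (H * ?R))" by (simp only: star_mult sH R(2) mult.assoc)
  also have "\<dots> = norm ((H * ?R) * star (H * ?R))" by (simp only: cstar_identity cstar_identity')
  also have "\<dots> = norm (H * (?R * ?R) * H)" by (simp only: star_mult sH R(2) mult.assoc)
  also have "\<dots> = norm (H * X * H)" by (simp only: R(1))
  also have "norm (H * X * H) \<le> norm (H * G * H)"
    using ple_conj[OF le, of H] positive_conj[OF X, of H] by (intro norm_mono) (auto simp: sH)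
  finally have le1: "norm (?R * (H * H) * ?R) \<le> norm (H * G * H)" .
  have HGH: "H * G * H = ucfc (\<lambda>t. ?h t * t * ?h t) G"
    unfolding H_def
    by (simp only: ucfc_mult[OF sG continuous_on_mult[OF h continuous_on_id] h]
        ucfc_mult[OF sG h continuous_on_id] ucfc_id[OF sG])
  have hk: "continuous_on UNIV (\<lambda>t. ?h t * t * ?h t)"
    by (rule continuous_on_mult[OF continuous_on_mult[OF h continuous_on_id] h])
  have b: "\<bar>?h s * s * ?h s\<bar> \<le> 2 * \<tau>" if "s \<in> rspec G" for s
  proof -
    have s: "s \<ge> 0" using positive_rspec[OF G that] .
    have "?h s * s * ?h s = s * (1 - ?k s)" using k01[OF s] by (simp add: algebra_simps)
    also have "\<dots> = s * ((2 * s + \<tau>) * \<tau>) / (s + \<tau>)\<^sup>2"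
    proof -
      have "1 - (s / (s + \<tau>))\<^sup>2 = ((s + \<tau>)\<^sup>2 - s\<^sup>2) / (s + \<tau>)\<^sup>2"
        using s t by (simp add: power_divide diff_divide_distrib)
      also have "(s + \<tau>)\<^sup>2 - s\<^sup>2 = (2 * s + \<tau>) * \<tau>" by (simp add: power2_eq_square algebra_simps)
      finally show ?thesis unfolding k1[OF s] by simp
    qed
    also have "\<dots> \<le> 2 * \<tau>"
    proof -
      have "s * ((2 * s + \<tau>) * \<tau>) \<le> 2 * \<tau> * (s + \<tau>)\<^sup>2"
        using s t by (simp add: power2_eq_square algebra_simps mult_nonneg_nonneg)
      then show ?thesis using s t by (simp add: divide_le_eq)
    qed
    finally have 1: "?h s * s * ?h s \<le> 2 * \<tau>" .
    have "0 \<le> ?h s * s * ?h s" using s by simp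
    from abs_of_nonneg[OF this] 1 show ?thesis by (rule ord_eq_le_trans)
  qed
  have f2: "norm (H * G * H) \<le> 2 * \<tau>" unfolding HGH by (rule ucfc_norm_le[OF sG hk b])
  have "norm (X - ?R * F * G * F * ?R) \<le> 2 * \<tau>"
    using order_trans[OF le1 f2] by (simp only: e)
  then show ?thesis using sF by blast
qed

text \<open>Conjugating y - \<epsilon>/2 \<preceq> w a (star w) with a function u of y turns the
  left side into the cut-down of y at \<epsilon>, without losing the conjugate form of the right
  side; then \<open>ple_imp_approx_conj\<close> produces the conjugating elements.\<close>

lemma ple_cuntz_cut_down:
  fixes y :: "'a::cstar_algebra"
  assumes sy: "star y = y" and a: "positive a" and e: "\<epsilon> > 0"
    and le: "emb y \<preceq> (\<epsilon> / 2) *\<^sub>R 1 + emb (w * a * star w)"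
  shows "cut_down y \<epsilon> \<precsim> a"
proof (rule cuntz_subI)
  fix \<delta> :: real assume \<delta>: "\<delta> > 0"
  have sa: "star (emb y) = emb y" using sy by (simp add: star_emb_iff)
  \<comment> \<open>For t > \<epsilon> the denominator is t - \<epsilon>/2, so g(t)^2 (t -
    \<epsilon>/2) = t - \<epsilon>; for t \<le> \<epsilon> the numerator is 0. The inner
    \<open>max\<close> only keeps the quotient continuous.\<close>
  let ?g = "\<lambda>t. sqrt (max (t - \<epsilon>) 0 / max (t - \<epsilon> / 2) (\<epsilon> / 2))"
  have pos: "max (t - \<epsilon> / 2) (\<epsilon> / 2) > 0" for t using e by (simp add: less_max_iff_disj)
  have g: "continuous_on UNIV ?g" by (intro continuous_intros) (metis pos less_irrefl)
  define u where "u = ucfc ?g (emb y)"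
  have su: "star u = u" unfolding u_def by (rule star_ucfc[OF sa g])
  define X where "X = emb (cut_down y \<epsilon>)"
  have Xc: "X = ucfc (\<lambda>t. max (t - \<epsilon>) 0) (emb y)" unfolding X_def using emb_cut_down[OF sy] e by simp
  have X: "positive X" unfolding Xc by (rule positive_ucfc[OF sa]) (auto intro!: continuous_intros)
  define G where "G = u * emb (w * a * star w) * u"
  have G: "positive G" unfolding G_def
    using positive_conj[of "emb (w * a * star w)" u] positive_conj'[OF a, of w] by (simp add: su positive_emb_iff)
  have "X = ucfc (\<lambda>t. ?g t * (t - \<epsilon> / 2) * ?g t) (emb y)" unfolding Xc
  proof (rule ucfc_cong[OF sa])
    fix t
    show "max (t - \<epsilon>) 0 = ?g t * (t - \<epsilon> / 2) * ?g t"
    proof (cases "t > \<epsilon>")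
      case True
      then have "?g t * (t - \<epsilon> / 2) * ?g t = (?g t)\<^sup>2 * (t - \<epsilon> / 2)"
        by (simp only: power2_eq_square ac_simps)
      also have "(?g t)\<^sup>2 = (t - \<epsilon>) / (t - \<epsilon> / 2)" using True e by (subst real_sqrt_pow2) (auto simp: max_def)
      finally show ?thesis using True e by (simp add: max_def)
    qed (simp add: max_def)
  qed (intro continuous_intros g)+
  also have "\<dots> = u * (emb y - (\<epsilon> / 2) *\<^sub>R 1) * u" unfolding u_def
    by (simp add: ucfc_mult[OF sa] ucfc_diff[OF sa] ucfc_id[OF sa] ucfc_const[OF sa] g continuous_intros)
  finally have Xu: "X = u * (emb y - (\<epsilon> / 2) *\<^sub>R 1) * u" .
  have "emb y - (\<epsilon> / 2) *\<^sub>R 1 \<preceq> emb (w * a * star w)" using le by (simp add: ple_def algebra_simps)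
  from ple_conj[OF this, of u] have "X \<preceq> G" unfolding Xu G_def su .
  from ple_imp_approx_conj[OF X G this, of "\<delta> / 2"] \<delta>
  obtain F where F: "norm (X - psqrt X * F * G * F * psqrt X) \<le> \<delta>" "star F = F"
    by auto
  let ?v = "psqrt X * F * u * emb w"
  have "uscal ?v = 0" by simp
  then obtain v where v: "?v = emb v" using uscal_eq_0_iff by blast
  have "psqrt X * F * G * F * psqrt X = ?v * emb a * star ?v"
    by (simp add: G_def star_mult star_psqrt[OF X] F su emb_simps mult.assoc)
  also have "\<dots> = emb (v * a * star v)" unfolding v by (simp add: emb_simps)
  finally have "norm (emb (cut_down y \<epsilon> - v * a * star v)) \<le> \<delta>" using F(1) by (simp add: emb_simps X_def)
  then show "\<exists>v. norm (cut_down y \<epsilon> - v * a * star v) \<le> \<delta>" by auto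
qed

section \<open>Order zero maps on matrix algebras\<close>

lemma adjoint_mult_self_index:
  assumes "X \<in> carrier_mat m m" "i < m" "j < m"
  shows "(mat_adjoint X * X) $$ (i, j) = (\<Sum>r<m. cnj (X $$ (r, i)) * X $$ (r, j))"
  using assms by (auto simp: mat_adjoint_def scalar_prod_def lessThan_atLeast0 intro!: sum.cong)

lemma adjoint_mult_self_carrier:
  assumes "X \<in> carrier_mat m m" shows "mat_adjoint X * X \<in> carrier_mat m m"
  using assms by (auto simp: mat_adjoint_def)

definition rank_one :: "nat \<Rightarrow> (nat \<Rightarrow> complex) \<Rightarrow> complex mat" where
  "rank_one m v = mat m m (\<lambda>(p, q). v p * cnj (v q))"

definition mat_unit :: "nat \<Rightarrow> nat \<Rightarrow> nat \<Rightarrow> complex mat" where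
  "mat_unit n i j = mat n n (\<lambda>(p, q). if p = i \<and> q = j then 1 else 0)"

lemma rank_one_carrier [simp]: "rank_one m v \<in> carrier_mat m m"
  and mat_unit_carrier [simp]: "mat_unit n i j \<in> carrier_mat n n"
  by (simp_all add: rank_one_def mat_unit_def)

lemma mat_positive_rank_one:
  assumes "m \<ge> 1" shows "mat_positive m (rank_one m v)"
proof -
  define X where "X = mat m m (\<lambda>(p, q). if p = 0 then cnj (v q) else 0)"
  have X: "X \<in> carrier_mat m m" by (simp add: X_def)
  have "rank_one m v = mat_adjoint X * X"
  proof (rule eq_matI)
    fix i j assume "i < dim_row (mat_adjoint X * X)" "j < dim_col (mat_adjoint X * X)"
    then have ij: "i < m" "j < m" using adjoint_mult_self_carrier[OF X] by auto
    have "(\<Sum>r<m. cnj (X $$ (r, i)) * X $$ (r, j)) = (\<Sum>r<m. if r = 0 then v i * cnj (v j) else 0)"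
      using ij by (intro sum.cong) (auto simp: X_def)
    also have "\<dots> = v i * cnj (v j)" using assms by simp
    finally show "rank_one m v $$ (i, j) = (mat_adjoint X * X) $$ (i, j)"
      unfolding adjoint_mult_self_index[OF X ij] using ij by (simp add: rank_one_def)
  qed (use adjoint_mult_self_carrier[OF X] in \<open>auto simp: rank_one_def\<close>)
  then show ?thesis using X unfolding mat_positive_def by blast
qed

lemma linear_on_mat_expand:
  assumes lin: "linear_on_mat n \<phi>" and Z: "Z \<in> carrier_mat n n"
  shows "\<phi> Z = (\<Sum>i<n. \<Sum>j<n. Z $$ (i, j) *\<^sub>C \<phi> (mat_unit n i j))"
proof -
  have add: "\<phi> (y + z) = \<phi> y + \<phi> z" if "y \<in> carrier_mat n n" "z \<in> carrier_mat n n" for y z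
    using lin that by (auto simp: linear_on_mat_def)
  have scal: "\<phi> (c \<cdot>\<^sub>m z) = c *\<^sub>C \<phi> z" if "z \<in> carrier_mat n n" for c z
    using lin that by (auto simp: linear_on_mat_def)
  have *: "\<phi> (mat n n (\<lambda>pq. if pq \<in> S then Z $$ pq else 0)) = (\<Sum>pq\<in>S. Z $$ pq *\<^sub>C \<phi> (mat_unit n (fst pq) (snd pq)))"
    if "finite S" for S
    using that
  proof (induction S)
    case empty
    have "mat n n (\<lambda>pq. if pq \<in> {} then Z $$ pq else 0) = 0 \<cdot>\<^sub>m mat_unit n 0 0"
      by (rule eq_matI) (auto simp: mat_unit_def)
    then show ?case using scal[of "mat_unit n 0 0" 0] by simp
  next
    case (insert pq S)
    have "mat n n (\<lambda>rs. if rs \<in> insert pq S then Z $$ rs else 0)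
        = (Z $$ pq \<cdot>\<^sub>m mat_unit n (fst pq) (snd pq)) + mat n n (\<lambda>rs. if rs \<in> S then Z $$ rs else 0)"
      using insert(2) by (intro eq_matI) (auto simp: mat_unit_def)
    also have "\<phi> \<dots> = \<phi> (Z $$ pq \<cdot>\<^sub>m mat_unit n (fst pq) (snd pq)) + \<phi> (mat n n (\<lambda>rs. if rs \<in> S then Z $$ rs else 0))"
      by (rule add) auto
    finally show ?case using insert scal by simp
  qed
  have "Z = mat n n (\<lambda>pq. if pq \<in> {..<n} \<times> {..<n} then Z $$ pq else 0)"
    using Z by (intro eq_matI) auto
  then have "\<phi> Z = (\<Sum>pq\<in>{..<n} \<times> {..<n}. Z $$ pq *\<^sub>C \<phi> (mat_unit n (fst pq) (snd pq)))"
    using *[of "{..<n} \<times> {..<n}"] by simp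
  then show ?thesis by (simp add: sum.cartesian_product case_prod_unfold)
qed

lemma positive_sum_eq_0:
  fixes f :: "nat \<Rightarrow> 'a::cstar_algebra"
  assumes "finite I" "\<And>i. i \<in> I \<Longrightarrow> positive (f i)" "(\<Sum>i\<in>I. f i) = 0" "i \<in> I"
  shows "f i = 0"
proof -
  have "emb (f i) + emb (\<Sum>j\<in>I - {i}. f j) = emb 0"
    using assms by (simp flip: emb_simps add: sum.remove)
  moreover have "positive (emb (\<Sum>j\<in>I - {i}. f j))" "positive (emb (f i))"
    using assms by (auto simp: positive_emb_iff intro!: positive_sum_cstar)
  ultimately have "emb (f i) = 0" using positive_add_eq_0 by (metis emb_simps(4))
  then show ?thesis by simp
qed

text \<open>Multiplying the hypothesis by \<open>star w\<close> on the right exhibits 0 as a sum of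
  the positive elements \<open>(w * star (x l)) * star (w * star (x l))\<close>.\<close>

lemma sum_star_mult_annihilate:
  fixes x :: "nat \<Rightarrow> 'a::cstar_algebra"
  assumes "w * (\<Sum>l<k. star (x l) * x l) = 0" "l < k"
  shows "w * star (x l) = 0"
proof -
  have "(\<Sum>l<k. (w * star (x l)) * star (w * star (x l))) = w * (\<Sum>l<k. star (x l) * x l) * star w"
    by (simp add: sum_distrib_left sum_distrib_right star_mult mult.assoc)
  then have "(\<Sum>l<k. (w * star (x l)) * star (w * star (x l))) = 0" using assms by simp
  from positive_sum_eq_0[OF _ _ this, of l] assms(2)
  have "(w * star (x l)) * star (w * star (x l)) = 0" by (simp only: finite_lessThan positive_mult_star lessThan_iff simp_thms)
  then show ?thesis by (simp only: mult_star_self_eq_0_iff)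
qed

text \<open>What is needed about order zero maps on matrices is derived from the matrix units
  themselves: 2-positivity, together with orthogonality of the images of orthogonal rank one
  matrices.\<close>

locale order_zero =
  fixes n :: nat and \<phi> :: "complex mat \<Rightarrow> 'a::cstar_algebra"
  assumes oz: "cpc_order_zero n \<phi>"
begin

definition f where "f i j = \<phi> (mat_unit n i j)"

lemma linear: "linear_on_mat n \<phi>"
  and amp: "mat_positive (k * n) Z \<Longrightarrow> amp_positive k (\<lambda>i j. \<phi> (mat_block n Z i j))"
  and contractive: "z \<in> carrier_mat n n \<Longrightarrow> norm (\<phi> z) \<le> mat_opnorm z"
  and order_zero: "mat_positive n y \<Longrightarrow> mat_positive n z \<Longrightarrow> y * z = 0\<^sub>m n n \<Longrightarrow> \<phi> y * \<phi> z = 0"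
  using oz by (auto simp: cpc_order_zero_def cpc_def)

text \<open>Complete positivity applied to the rank one matrix in \<open>M\<^sub>2(M\<^sub>n)\<close> with blocks
  \<open>e\<^sub>i\<^sub>i, e\<^sub>i\<^sub>k, e\<^sub>k\<^sub>i, e\<^sub>k\<^sub>k\<close>.\<close>

lemma two_positive:
  assumes "i < n" "k < n"
  obtains x y :: "nat \<Rightarrow> 'a" where "f i i = (\<Sum>l<2. star (x l) * x l)" "f i k = (\<Sum>l<2. star (x l) * y l)"
    "f k i = (\<Sum>l<2. star (y l) * x l)" "f k k = (\<Sum>l<2. star (y l) * y l)"
proof -
  define v where "v p = (if p < n then (if p = i then 1 else 0) else (if p = n + k then 1 else 0 :: complex))" for p
  define Z where "Z = rank_one (2 * n) v"
  have "mat_positive (2 * n) Z" unfolding Z_def using assms by (intro mat_positive_rank_one) auto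
  from amp[OF this] obtain X where "\<forall>a<2. \<forall>b<2. \<phi> (mat_block n Z a b) = (\<Sum>l<(2::nat). star (X l a) * X l b)"
    unfolding amp_positive_def by (elim exE)
  then have X: "\<phi> (mat_block n Z a b) = (\<Sum>l<2. star (X l a) * X l b)" if "a < 2" "b < 2" for a b
    using that by simp
  have B: "mat_block n Z 0 0 = mat_unit n i i" "mat_block n Z 0 1 = mat_unit n i k"
    "mat_block n Z 1 0 = mat_unit n k i" "mat_block n Z 1 1 = mat_unit n k k"
    by (auto simp: mat_block_def Z_def rank_one_def v_def mat_unit_def)
  show ?thesis
    by (rule that[of "\<lambda>l. X l 0" "\<lambda>l. X l 1"]) (use X[of 0 0] X[of 0 1] X[of 1 0] X[of 1 1] B in \<open>auto simp: f_def\<close>)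
qed

lemma star_f: "i < n \<Longrightarrow> k < n \<Longrightarrow> star (f i k) = f k i"
  by (rule two_positive[of i k]) (auto simp: star_sum star_mult)

lemma positive_f: "i < n \<Longrightarrow> positive (f i i)"
  by (rule two_positive[of i i]) (auto intro!: positive_sum_cstar)

text \<open>By 2-positivity \<open>f i i\<close> and \<open>f i k\<close> have the same left factors
  \<open>star (x l)\<close>, and \<open>w\<close> kills each of these.\<close>

lemma annihilate:
  assumes "i < n" "k < n" "w * f i i = 0" shows "w * f i k = 0"
proof -
  obtain x y :: "nat \<Rightarrow> 'a" where xy: "f i i = (\<Sum>l<2. star (x l) * x l)" "f i k = (\<Sum>l<2. star (x l) * y l)"
    by (rule two_positive[OF assms(1,2)], rule that)
  have 0: "w * star (x l) = 0" if "l < 2" for l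
    using sum_star_mult_annihilate[of w x 2 l] assms(3) that unfolding xy by blast
  have "w * f i k = (\<Sum>l<2. (w * star (x l)) * y l)" unfolding xy by (simp add: sum_distrib_left mult.assoc)
  also have "\<dots> = 0" using 0 by (intro sum.neutral) auto
  finally show ?thesis .
qed

lemma phi_rank_one:
  "\<phi> (rank_one n v) = (\<Sum>i<n. \<Sum>j<n. (v i * cnj (v j)) *\<^sub>C f i j)"
  by (subst linear_on_mat_expand[OF linear]) (auto simp: rank_one_def f_def intro!: sum.cong)

lemma phi_one: "\<phi> (1\<^sub>m n) = (\<Sum>i<n. f i i)"
proof -
  have "\<phi> (1\<^sub>m n) = (\<Sum>i<n. \<Sum>j<n. (if j = i then f i i else 0))"
    by (subst linear_on_mat_expand[OF linear], simp, intro sum.cong refl) (auto simp: f_def)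
  then show ?thesis by simp
qed

lemma positive_phi_one: "positive (\<phi> (1\<^sub>m n))"
  unfolding phi_one by (intro positive_sum_cstar positive_f) auto

lemma f_orthogonal:
  assumes "i < n" "j < n" "i \<noteq> j" shows "f i i * f j j = 0"
proof -
  have e: "mat_unit n i i = rank_one n (\<lambda>p. if p = i then 1 else 0)" for i
    by (rule eq_matI) (auto simp: mat_unit_def rank_one_def)
  have "mat_unit n i i * mat_unit n j j = 0\<^sub>m n n"
    using assms by (intro eq_matI) (auto simp: mat_unit_def scalar_prod_def intro!: sum.neutral)
  then show ?thesis unfolding f_def using assms mat_positive_rank_one[of n]
    by (intro order_zero) (auto simp: e)
qed

lemma f_diag_mult: "i < n \<Longrightarrow> j < n \<Longrightarrow> k < n \<Longrightarrow> i \<noteq> j \<Longrightarrow> f i i * f j k = 0"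
  by (rule annihilate[OF _ _ f_orthogonal])

lemma sum_two:
  fixes g :: "nat \<Rightarrow> 'a"
  assumes "i < n" "j < n" "i \<noteq> j" "\<And>k. k \<noteq> i \<Longrightarrow> k \<noteq> j \<Longrightarrow> g k = 0"
  shows "(\<Sum>k<n. g k) = g i + g j"
proof -
  have "(\<Sum>k<n. g k) = (\<Sum>k\<in>{i, j}. g k)" using assms by (intro sum.mono_neutral_right) auto
  then show ?thesis using assms(3) by simp
qed

text \<open>Orthogonality of the images of the rank one matrices given by \<open>e\<^sub>i \<plusminus> c e\<^sub>j\<close> with \<open>|c| = 1\<close>.\<close>

lemma square_relation:
  assumes ij: "i < n" "j < n" "i \<noteq> j" and c: "c * cnj c = 1"
  shows "(f i i + f j j) * (f i i + f j j)
    = (cnj c *\<^sub>C f i j + c *\<^sub>C f j i) * (cnj c *\<^sub>C f i j + c *\<^sub>C f j i)" (is "?S * ?S = ?M * ?M")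
proof -
  define v where "v s p = (if p = i then 1 else if p = j then s * c else 0)" for s :: complex and p
  have im: "\<phi> (rank_one n (v s)) = f i i + (cnj s * cnj c) *\<^sub>C f i j + ((s * c) *\<^sub>C f j i + (s * cnj s) *\<^sub>C f j j)" for s
  proof -
    have vi: "v s i = 1" and vj: "v s j = s * c" using ij(3) by (simp_all add: v_def)
    have sc: "s * c * cnj (s * c) = s * cnj s" using c by (simp add: ac_simps)
    have "\<phi> (rank_one n (v s)) = (\<Sum>p<n. (v s p * cnj (v s i)) *\<^sub>C f p i + (v s p * cnj (v s j)) *\<^sub>C f p j)"
      unfolding phi_rank_one by (intro sum.cong refl sum_two[OF ij]) (auto simp: v_def)
    also have "\<dots> = ((v s i * cnj (v s i)) *\<^sub>C f i i + (v s i * cnj (v s j)) *\<^sub>C f i j)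
        + ((v s j * cnj (v s i)) *\<^sub>C f j i + (v s j * cnj (v s j)) *\<^sub>C f j j)"
      by (rule sum_two[OF ij]) (auto simp: v_def)
    also have "v s j * cnj (v s j) = s * cnj s" using ij(3) unfolding sc[symmetric] by (simp add: v_def)
    finally show ?thesis using vi vj by simp
  qed
  have 0: "\<phi> (rank_one n (v s)) * \<phi> (rank_one n (v (- s))) = 0" if s: "s * cnj s = 1" for s
  proof (rule order_zero)
    show "rank_one n (v s) * rank_one n (v (- s)) = 0\<^sub>m n n"
    proof (rule eq_matI)
      fix p q assume pq: "p < dim_row (0\<^sub>m n n)" "q < dim_col (0\<^sub>m n n)"
      have "(rank_one n (v s) * rank_one n (v (- s))) $$ (p, q)
          = (\<Sum>r<n. (v s p * cnj (v s r)) * (v (- s) r * cnj (v (- s) q)))"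
        using pq by (auto simp: rank_one_def scalar_prod_def lessThan_atLeast0 intro!: sum.cong)
      also have "\<dots> = v s p * (\<Sum>r<n. cnj (v s r) * v (- s) r) * cnj (v (- s) q)"
        by (simp add: sum_distrib_left sum_distrib_right ac_simps)
      also have "(\<Sum>r<n. cnj (v s r) * v (- s) r) = (\<Sum>r\<in>{i, j}. cnj (v s r) * v (- s) r)"
        using ij by (intro sum.mono_neutral_right) (auto simp: v_def)
      also have "\<dots> = 1 - (s * cnj s) * (c * cnj c)"
        using ij(3) by (simp add: v_def ac_simps)
      also have "\<dots> = 0" using s c by simp
      finally show "(rank_one n (v s) * rank_one n (v (- s))) $$ (p, q) = 0\<^sub>m n n $$ (p, q)" using pq by simp
    qed (auto simp: rank_one_def)
  qed (use ij mat_positive_rank_one in auto)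
  \<comment> \<open>The two signs of \<open>s\<close> give this product in both orders; adding them
    cancels the commutator of S and M and leaves S^2 = M^2.\<close>
  have "(?S + ?M) * (?S - ?M) = 0" using 0[of 1] unfolding im
    by (simp add: algebra_simps scaleC_minus_left)
  moreover have "(?S - ?M) * (?S + ?M) = 0" using 0[of "-1"] unfolding im
    by (simp add: algebra_simps scaleC_minus_left)
  ultimately have "(?S + ?M) * (?S - ?M) + (?S - ?M) * (?S + ?M) = 0" by simp
  moreover have "(?S + ?M) * (?S - ?M) + (?S - ?M) * (?S + ?M) = 2 *\<^sub>R (?S * ?S - ?M * ?M)"
    unfolding distrib_left distrib_right left_diff_distrib right_diff_distrib
    by (simp only: scaleR_2 scaleR_diff_right) (simp add: algebra_simps)
  ultimately show ?thesis by simp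
qed

text \<open>Averaging the square relations for c = 1 and c = \<i> gives f_ii^2 + f_jj^2 = f_ij f_ji
  + f_ji f_ij. Written in its two forms, the difference w = f_ij f_ji - f_ii^2 annihilates f_ii and
  hence f_ij, so w (star w) = 0.\<close>

lemma f_mult_swap:
  assumes "i < n" "j < n" shows "f i j * f j i = f i i * f i i"
proof (cases "i = j")
  case False
  note ij = assms False
  let ?x = "f i j * f j i" and ?y = "f j i * f i j"
  have ort: "f i i * f j j = 0" "f j j * f i i = 0" using f_orthogonal[of i j] f_orthogonal[of j i] ij by auto
  have 1: "(f i i + f j j) * (f i i + f j j) = (f i j + f j i) * (f i j + f j i)"
    using square_relation[OF ij, of 1] by simp
  have 2: "(f i i + f j j) * (f i i + f j j)
      = ((- \<i>) *\<^sub>C f i j + \<i> *\<^sub>C f j i) * ((- \<i>) *\<^sub>C f i j + \<i> *\<^sub>C f j i)"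
    using square_relation[OF ij, of \<i>] by simp
  also have "\<dots> = ?x + ?y - f i j * f i j - f j i * f j i"
    by (simp add: algebra_simps scaleC_mult_left scaleC_mult_right scaleC_scaleC scaleC_minus_left scaleC_diff_right)
  finally have 3: "(f i i + f j j) * (f i i + f j j) = ?x + ?y - f i j * f i j - f j i * f j i" .
  have S: "(f i i + f j j) * (f i i + f j j) = f i i * f i i + f j j * f j j"
    using ort by (simp add: algebra_simps)
  have "2 *\<^sub>R (f i i * f i i + f j j * f j j)
      = (f i j + f j i) * (f i j + f j i) + (?x + ?y - f i j * f i j - f j i * f j i)"
    unfolding scaleR_2 by (intro arg_cong2[where f = "(+)"]) (simp_all only: S[symmetric] 1 3[symmetric])
  also have "\<dots> = 2 *\<^sub>R (?x + ?y)" by (simp add: scaleR_2 algebra_simps)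
  finally have xy: "f i i * f i i + f j j * f j j = ?x + ?y" by simp
  define w where "w = ?x - f i i * f i i"
  have w2: "w = f j j * f j j - ?y" using xy by (simp add: w_def algebra_simps)
  have sw: "star w = w" using ij by (simp add: w_def star_diff star_mult star_f star_positive positive_f)
  have "f i i * w = (f i i * f j j) * f j j - (f i i * f j i) * f i j" unfolding w2 by (simp add: algebra_simps)
  also have "\<dots> = 0" using f_diag_mult[of i j i] ij ort by simp
  finally have "star (f i i * w) = 0" by simp
  then have wf: "w * f i i = 0" using ij by (simp add: star_mult sw star_f)
  have "w * f i j = 0" using annihilate[OF _ _ wf] ij by simp
  then have wx: "w * ?x = 0" by (simp flip: mult.assoc)
  have wff: "w * (f i i * f i i) = 0" using wf by (simp flip: mult.assoc)
  have "w * star w = w * (?x - f i i * f i i)" unfolding sw by (subst (2) w_def) (rule refl)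
  also have "\<dots> = 0" unfolding right_diff_distrib wx wff by simp
  finally have "w = 0" by simp
  then show ?thesis unfolding w_def by (simp only: right_minus_eq)
qed (simp only:)

text \<open>For i \<noteq> j the product z = f_0i f_j0 satisfies z (star z) = f_0i f_jj^2 f_i0, and
  f_jj f_i0 = 0.\<close>

lemma column_orthogonal:
  assumes "i < n" "j < n" "0 < n"
  shows "star (f i 0) * f j 0 = (if i = j then f 0 0 * f 0 0 else 0)"
proof (cases "i = j")
  case True
  have "star (f i 0) * f i 0 = f 0 0 * f 0 0"
    unfolding star_f[OF assms(1,3)] by (rule f_mult_swap[OF assms(3,1)])
  then show ?thesis using True by simp
next
  case False
  let ?z = "f 0 i * f j 0"
  have "?z * star ?z = f 0 i * (f j 0 * f 0 j) * f i 0" using assms by (simp add: star_mult star_f mult.assoc)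
  also have "f j 0 * f 0 j = f j j * f j j" by (rule f_mult_swap[OF assms(2,3)])
  also have "f 0 i * (f j j * f j j) * f i 0 = f 0 i * f j j * (f j j * f i 0)" by (simp add: mult.assoc)
  also have "\<dots> = 0" using f_diag_mult[of j i 0] assms False by simp
  finally have "?z = 0" by simp
  then show ?thesis using False assms by (simp add: star_f)
qed

lemma column_sum:
  assumes "0 < n"
  shows "(\<Sum>i<n. f i 0 * star (f i 0)) = \<phi> (1\<^sub>m n) * \<phi> (1\<^sub>m n)"
proof -
  have "\<phi> (1\<^sub>m n) * \<phi> (1\<^sub>m n) = (\<Sum>i<n. \<Sum>j<n. f i i * f j j)"
    unfolding phi_one by (rule sum_product)
  also have "\<dots> = (\<Sum>i<n. \<Sum>j<n. if j = i then f i i * f i i else 0)"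
    using f_orthogonal by (intro sum.cong refl) auto
  also have "\<dots> = (\<Sum>i<n. f i i * f i i)" by simp
  also have "\<dots> = (\<Sum>i<n. f i 0 * star (f i 0))"
  proof (rule sum.cong)
    show "f i i * f i i = f i 0 * star (f i 0)" if "i \<in> {..<n}" for i
      using f_mult_swap[of i 0] that assms by (simp only: star_f lessThan_iff)
  qed simp
  finally show ?thesis by simp
qed

end

section \<open>Operator norms of matrices, and the order zero map of a column\<close>

lemma mat_opnorm_le_1:
  assumes Z: "Z \<in> carrier_mat n n"
    and le: "\<And>v. v \<in> carrier_vec n \<Longrightarrow> Re (v \<bullet>c v) \<le> 1 \<Longrightarrow> Re ((Z *\<^sub>v v) \<bullet>c (Z *\<^sub>v v)) \<le> 1"
  shows "mat_opnorm Z \<le> 1"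
  unfolding mat_opnorm_def
proof (rule cSup_least)
  have "0\<^sub>v n \<in> carrier_vec (dim_col Z) \<and> Re (0\<^sub>v n \<bullet>c 0\<^sub>v n) \<le> 1" using Z by simp
  then show "{sqrt (Re ((Z *\<^sub>v v) \<bullet>c (Z *\<^sub>v v))) |v. v \<in> carrier_vec (dim_col Z) \<and> Re (v \<bullet>c v) \<le> 1} \<noteq> {}" by blast
qed (use Z le in auto)

lemma cscalar_prod_self:
  "v \<in> carrier_vec n \<Longrightarrow> Re (v \<bullet>c v) = (\<Sum>i<n. (cmod (v $ i))\<^sup>2)"
  by (simp add: scalar_prod_def lessThan_atLeast0 cmod_power2 sum.distrib flip: power2_eq_square)

lemma mat_opnorm_one: "mat_opnorm (1\<^sub>m n) \<le> 1"
  by (rule mat_opnorm_le_1[of _ n]) auto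

lemma mat_opnorm_mat_unit:
  assumes "i < n" "j < n" shows "mat_opnorm (mat_unit n i j) \<le> 1"
proof (rule mat_opnorm_le_1[of _ n])
  fix v :: "complex vec" assume v: "v \<in> carrier_vec n" "Re (v \<bullet>c v) \<le> 1"
  have u: "mat_unit n i j *\<^sub>v v = vec n (\<lambda>p. if p = i then v $ j else 0)"
  proof (rule eq_vecI)
    fix p assume "p < dim_vec (vec n (\<lambda>p. if p = i then v $ j else 0))"
    then have p: "p < n" by simp
    then have "(mat_unit n i j *\<^sub>v v) $ p = (\<Sum>q<n. if q = j then (if p = i then v $ j else 0) else 0)"
    proof -
      have "(mat_unit n i j *\<^sub>v v) $ p = (\<Sum>q<n. mat_unit n i j $$ (p, q) * v $ q)"
        using v p by (simp add: scalar_prod_def lessThan_atLeast0 mat_unit_def)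
      also have "\<dots> = (\<Sum>q<n. if q = j then (if p = i then v $ j else 0) else 0)"
        using p by (intro sum.cong) (auto simp: mat_unit_def)
      finally show ?thesis .
    qed
    then show "(mat_unit n i j *\<^sub>v v) $ p = vec n (\<lambda>p. if p = i then v $ j else 0) $ p" using p assms by simp
  qed (simp add: mat_unit_def)
  have "Re ((mat_unit n i j *\<^sub>v v) \<bullet>c (mat_unit n i j *\<^sub>v v)) = (\<Sum>p<n. if p = i then (cmod (v $ j))\<^sup>2 else 0)"
    unfolding u by (subst cscalar_prod_self[of _ n], simp, intro sum.cong refl) auto
  also have "\<dots> = (cmod (v $ j))\<^sup>2" using assms by simp
  also have "\<dots> \<le> (\<Sum>q<n. (cmod (v $ q))\<^sup>2)" using assms by (intro member_le_sum) auto
  also have "\<dots> \<le> 1" using v cscalar_prod_self by simp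
  finally show "Re ((mat_unit n i j *\<^sub>v v) \<bullet>c (mat_unit n i j *\<^sub>v v)) \<le> 1" .
qed simp

definition mlin :: "nat \<Rightarrow> (nat \<Rightarrow> nat \<Rightarrow> 'a) \<Rightarrow> (nat \<Rightarrow> nat \<Rightarrow> complex) \<Rightarrow> 'a::cstar_algebra" where
  "mlin n c F = (\<Sum>i<n. \<Sum>j<n. F i j *\<^sub>C c i j)"

lemma mlin_mult:
  assumes c: "\<And>i j k l. i < n \<Longrightarrow> j < n \<Longrightarrow> k < n \<Longrightarrow> l < n \<Longrightarrow> c i j * c' k l = (if j = k then c'' i l else 0)"
  shows "mlin n c F * mlin n c' G = mlin n c'' (\<lambda>i l. \<Sum>p<n. F i p * G p l)"
proof -
  have "mlin n c F * mlin n c' G = (\<Sum>i<n. \<Sum>j<n. F i j *\<^sub>C c i j * mlin n c' G)"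
    by (simp add: mlin_def sum_distrib_right)
  also have "\<dots> = (\<Sum>i<n. \<Sum>j<n. \<Sum>l<n. (F i j * G j l) *\<^sub>C c'' i l)"
  proof (intro sum.cong refl)
    fix i j assume ij: "i \<in> {..<n}" "j \<in> {..<n}"
    have "F i j *\<^sub>C c i j * mlin n c' G = (\<Sum>k<n. \<Sum>l<n. (F i j * G k l) *\<^sub>C (c i j * c' k l))"
      by (simp add: mlin_def sum_distrib_left scaleC_mult_left scaleC_mult_right scaleC_scaleC scaleC_sum_right)
        (simp add: mult.commute)
    also have "\<dots> = (\<Sum>k<n. if k = j then (\<Sum>l<n. (F i j * G j l) *\<^sub>C c'' i l) else 0)"
    proof (intro sum.cong refl)
      fix k assume k: "k \<in> {..<n}"
      show "(\<Sum>l<n. (F i j * G k l) *\<^sub>C (c i j * c' k l)) = (if k = j then (\<Sum>l<n. (F i j * G j l) *\<^sub>C c'' i l) else 0)"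
        using ij k by (auto simp: c intro!: sum.cong sum.neutral)
    qed
    also have "\<dots> = (\<Sum>l<n. (F i j * G j l) *\<^sub>C c'' i l)" using ij by simp
    finally show "F i j *\<^sub>C c i j * mlin n c' G = (\<Sum>l<n. (F i j * G j l) *\<^sub>C c'' i l)" .
  qed
  also have "\<dots> = (\<Sum>i<n. \<Sum>l<n. \<Sum>j<n. (F i j * G j l) *\<^sub>C c'' i l)"
    by (rule sum.cong[OF refl]) (rule sum.swap)
  also have "\<dots> = mlin n c'' (\<lambda>i l. \<Sum>p<n. F i p * G p l)"
  proof -
    have "(\<Sum>j<n. h j *\<^sub>C x) = (\<Sum>j<n. h j) *\<^sub>C (x :: 'a)" for h x
      by (induction n) (auto simp: scaleC_add_left)
    then show ?thesis by (simp add: mlin_def)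
  qed
  finally show ?thesis .
qed

lemma star_mlin:
  assumes "\<And>i j. i < n \<Longrightarrow> j < n \<Longrightarrow> star (c i j) = c j i"
  shows "star (mlin n c F) = mlin n c (\<lambda>i j. cnj (F j i))"
proof -
  have "star (mlin n c F) = (\<Sum>i<n. \<Sum>j<n. cnj (F i j) *\<^sub>C c j i)"
    unfolding mlin_def star_sum by (intro sum.cong refl) (simp add: star_scaleC assms)
  then show ?thesis unfolding mlin_def by (subst sum.swap) simp
qed

lemma norm_mlin_le:
  assumes "\<And>i j. i < n \<Longrightarrow> j < n \<Longrightarrow> norm (c i j) \<le> 1" "\<And>i j. i < n \<Longrightarrow> j < n \<Longrightarrow> cmod (F i j) \<le> M"
  shows "norm (mlin n c F) \<le> real (n * n) * M"
proof -
  have "norm (mlin n c F) \<le> (\<Sum>i<n. \<Sum>j<n. M)"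
    unfolding mlin_def
  proof (intro sum_norm_le)
    fix i j assume ij: "i \<in> {..<n}" "j \<in> {..<n}"
    have "cmod (F i j) * norm (c i j) \<le> M * 1"
      using assms ij order_trans[OF norm_ge_zero assms(2)[of i j]] by (intro mult_mono) auto
    then show "norm (F i j *\<^sub>C c i j) \<le> M" by (simp add: norm_scaleC)
  qed
  then show ?thesis by simp
qed

text \<open>A bound for the operator norm in terms of coefficient functions, so that products and
  adjoints can be estimated without matrix carriers.\<close>

definition opbound :: "nat \<Rightarrow> (nat \<Rightarrow> nat \<Rightarrow> complex) \<Rightarrow> real \<Rightarrow> bool" where
  "opbound n F b \<longleftrightarrow> b \<ge> 0 \<and> (\<forall>v. (\<Sum>i<n. (cmod (\<Sum>j<n. F i j * v j))\<^sup>2) \<le> b\<^sup>2 * (\<Sum>j<n. (cmod (v j))\<^sup>2))"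

lemma opbound_mult:
  assumes "opbound n F b" "opbound n G d" shows "opbound n (\<lambda>i l. \<Sum>p<n. F i p * G p l) (b * d)"
  unfolding opbound_def
proof (intro conjI allI)
  fix v :: "nat \<Rightarrow> complex"
  let ?w = "\<lambda>p. \<Sum>l<n. G p l * v l"
  have e: "(\<Sum>l<n. (\<Sum>p<n. F i p * G p l) * v l) = (\<Sum>p<n. F i p * ?w p)" for i
    unfolding sum_distrib_left sum_distrib_right by (subst sum.swap) (simp add: mult.assoc)
  have "(\<Sum>i<n. (cmod (\<Sum>p<n. F i p * ?w p))\<^sup>2) \<le> b\<^sup>2 * (\<Sum>p<n. (cmod (?w p))\<^sup>2)"
    using assms(1) by (auto simp: opbound_def)
  also have "\<dots> \<le> b\<^sup>2 * (d\<^sup>2 * (\<Sum>j<n. (cmod (v j))\<^sup>2))"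
    using assms(2) by (intro mult_left_mono) (auto simp: opbound_def)
  finally show "(\<Sum>i<n. (cmod (\<Sum>l<n. (\<Sum>p<n. F i p * G p l) * v l))\<^sup>2) \<le> (b * d)\<^sup>2 * (\<Sum>j<n. (cmod (v j))\<^sup>2)"
    unfolding e by (simp add: power_mult_distrib mult.assoc)
qed (use assms in \<open>auto simp: opbound_def\<close>)

lemma opbound_entry:
  assumes F: "opbound n F b" and ij: "i < n" "j < n" shows "cmod (F i j) \<le> b"
proof -
  let ?v = "\<lambda>k. if k = j then 1 else 0 :: complex"
  have e: "(\<Sum>k<n. F i k * ?v k) = F i j" for i
  proof -
    have "(\<Sum>k<n. F i k * ?v k) = (\<Sum>k<n. if k = j then F i j else 0)" by (intro sum.cong) auto
    then show ?thesis using ij by simp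
  qed
  have "(\<Sum>k<n. (cmod (?v k))\<^sup>2) = (\<Sum>k<n. if k = j then 1 else 0)" by (intro sum.cong) auto
  then have o: "(\<Sum>k<n. (cmod (?v k))\<^sup>2) = 1" using ij by simp
  have "(cmod (F i j))\<^sup>2 \<le> (\<Sum>i<n. (cmod (F i j))\<^sup>2)" using ij by (intro member_le_sum) auto
  also have "\<dots> \<le> b\<^sup>2 * (\<Sum>k<n. (cmod (?v k))\<^sup>2)"
    using F[unfolded opbound_def, THEN conjunct2, THEN spec, of ?v] unfolding e .
  finally have "(cmod (F i j))\<^sup>2 \<le> b\<^sup>2" unfolding o by simp
  then show ?thesis using F by (simp add: opbound_def power2_le_iff_abs_le)
qed

text \<open>For w the adjoint applied to v, the squared norm S of w is the inner product of F w with
  v, so S^2 \<le> b^2 S V by Cauchy-Schwarz, where V is the squared norm of v.\<close>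

lemma opbound_adjoint:
  assumes F: "opbound n F b" shows "opbound n (\<lambda>i j. cnj (F j i)) b"
  unfolding opbound_def
proof (intro conjI allI)
  fix v :: "nat \<Rightarrow> complex"
  define w where "w i = (\<Sum>j<n. cnj (F j i) * v j)" for i
  define S where "S = (\<Sum>i<n. (cmod (w i))\<^sup>2)"
  define V where "V = (\<Sum>j<n. (cmod (v j))\<^sup>2)"
  let ?u = "\<lambda>j. \<Sum>i<n. F j i * w i"
  have S0: "S \<ge> 0" by (simp add: S_def sum_nonneg)
  have "complex_of_real S = (\<Sum>i<n. cnj (w i) * w i)"
    by (simp add: S_def complex_norm_square mult.commute flip: of_real_power)
  also have "\<dots> = (\<Sum>i<n. \<Sum>j<n. cnj (F j i * w i) * v j)"
    by (subst (2) w_def) (simp add: sum_distrib_left ac_simps)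
  also have "\<dots> = (\<Sum>j<n. cnj (?u j) * v j)"
    by (subst sum.swap) (simp add: sum_distrib_right)
  finally have "S = cmod (\<Sum>j<n. cnj (?u j) * v j)" using S0 by (metis norm_of_real abs_of_nonneg)
  also have "\<dots> \<le> (\<Sum>j<n. cmod (?u j) * cmod (v j))"
    by (rule sum_norm_le) (simp only: norm_mult complex_mod_cnj order_refl)
  finally have "S\<^sup>2 \<le> (\<Sum>j<n. cmod (?u j) * cmod (v j))\<^sup>2" using S0 by (intro power_mono)
  also have "\<dots> \<le> (\<Sum>j<n. (cmod (?u j))\<^sup>2) * V" unfolding V_def by (rule Cauchy_Schwarz_ineq_sum)
  also have "\<dots> \<le> (b\<^sup>2 * S) * V"
    using F by (intro mult_right_mono) (auto simp: opbound_def S_def V_def sum_nonneg)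
  finally have "S * S \<le> S * (b\<^sup>2 * V)" by (simp add: power2_eq_square ac_simps)
  then have "S \<le> b\<^sup>2 * V" using S0 by (cases "S = 0") (auto simp: V_def sum_nonneg)
  then show "(\<Sum>i<n. (cmod (\<Sum>j<n. cnj (F j i) * v j))\<^sup>2) \<le> b\<^sup>2 * (\<Sum>j<n. (cmod (v j))\<^sup>2)"
    by (simp add: S_def V_def w_def)
qed (use F in \<open>simp add: opbound_def\<close>)

lemma opbound_mat_opnorm:
  assumes Z: "Z \<in> carrier_mat n n" shows "opbound n (\<lambda>i j. Z $$ (i, j)) (mat_opnorm Z)"
proof -
  let ?A = "{sqrt (Re ((Z *\<^sub>v v) \<bullet>c (Z *\<^sub>v v))) | v. v \<in> carrier_vec (dim_col Z) \<and> Re (v \<bullet>c v) \<le> 1}"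
  define N where "N v = (\<Sum>i<n. (cmod (\<Sum>j<n. Z $$ (i, j) * v j))\<^sup>2)" for v
  have Zv: "Re ((Z *\<^sub>v vec n v) \<bullet>c (Z *\<^sub>v vec n v)) = N v" for v
  proof -
    have "(Z *\<^sub>v vec n v) $ i = (\<Sum>j<n. Z $$ (i, j) * v j)" if "i < n" for i
      using that Z by (auto simp: scalar_prod_def lessThan_atLeast0 intro!: sum.cong)
    then show ?thesis unfolding N_def
      by (subst cscalar_prod_self[of _ n]) (use Z in \<open>auto intro!: sum.cong\<close>)
  qed
  have v: "Re (vec n v \<bullet>c vec n v) = (\<Sum>i<n. (cmod (v i))\<^sup>2)" for v
    by (subst cscalar_prod_self[of _ n]) auto
  have A: "?A = {sqrt (N v) | v. (\<Sum>i<n. (cmod (v i))\<^sup>2) \<le> 1}"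
  proof (intro Set.set_eqI iffI)
    fix r assume "r \<in> ?A"
    then obtain x where x: "r = sqrt (Re ((Z *\<^sub>v x) \<bullet>c (Z *\<^sub>v x)))" "x \<in> carrier_vec n" "Re (x \<bullet>c x) \<le> 1"
      using Z by auto
    have "x = vec n (\<lambda>i. x $ i)" using x(2) by auto
    then show "r \<in> {sqrt (N v) | v. (\<Sum>i<n. (cmod (v i))\<^sup>2) \<le> 1}" using x v Zv by (metis (mono_tags, lifting) mem_Collect_eq)
  next
    fix r assume "r \<in> {sqrt (N v) | v. (\<Sum>i<n. (cmod (v i))\<^sup>2) \<le> 1}"
    then obtain x where "r = sqrt (N x)" "(\<Sum>i<n. (cmod (x i))\<^sup>2) \<le> 1" by auto
    then show "r \<in> ?A" using v[of x] Zv[of x] Z by (intro CollectI exI[of _ "vec n x"]) auto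
  qed
  have bdd: "bdd_above ?A"
  proof (rule bdd_aboveI)
    fix r assume "r \<in> ?A"
    then obtain x where x: "r = sqrt (N x)" "(\<Sum>i<n. (cmod (x i))\<^sup>2) \<le> 1" unfolding A by auto
    have x1: "cmod (x j) \<le> 1" if "j < n" for j
    proof -
      have "(cmod (x j))\<^sup>2 \<le> (\<Sum>i<n. (cmod (x i))\<^sup>2)" using that by (intro member_le_sum) auto
      then have "(cmod (x j))\<^sup>2 \<le> 1\<^sup>2" using x(2) by simp
      then show ?thesis by (rule power2_le_imp_le) simp
    qed
    have "N x \<le> (\<Sum>i<n. (\<Sum>j<n. cmod (Z $$ (i, j)))\<^sup>2)" unfolding N_def
    proof (intro sum_mono power_mono)
      show "cmod (\<Sum>j<n. Z $$ (i, j) * x j) \<le> (\<Sum>j<n. cmod (Z $$ (i, j)))" for i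
        using x1 by (intro sum_norm_le) (auto simp: norm_mult intro: mult_left_le)
    qed simp
    then show "r \<le> sqrt (\<Sum>i<n. (\<Sum>j<n. cmod (Z $$ (i, j)))\<^sup>2)" by (simp add: x)
  qed
  have up: "sqrt (N v) \<le> mat_opnorm Z" if "(\<Sum>i<n. (cmod (v i))\<^sup>2) \<le> 1" for v
    unfolding mat_opnorm_def using that by (intro cSup_upper bdd) (auto simp: A)
  have N0: "N v \<ge> 0" for v by (simp add: N_def sum_nonneg)
  have "0 \<le> sqrt (N (\<lambda>_. 0))" using N0 by simp
  also have "\<dots> \<le> mat_opnorm Z" by (rule up) simp
  finally have op0: "mat_opnorm Z \<ge> 0" .
  show ?thesis unfolding opbound_def
  proof (intro conjI allI op0)
    fix v :: "nat \<Rightarrow> complex"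
    define s where "s = (\<Sum>j<n. (cmod (v j))\<^sup>2)"
    have s0: "s \<ge> 0" by (simp add: s_def sum_nonneg)
    have "N v \<le> (mat_opnorm Z)\<^sup>2 * s"
    proof (cases "s = 0")
      case True
      then have "v j = 0" if "j < n" for j
        using that unfolding s_def by (subst (asm) sum_nonneg_eq_0_iff) auto
      then show ?thesis using True by (simp add: N_def)
    next
      case False
      define u where "u j = v j / complex_of_real (sqrt s)" for j
      have "(\<Sum>j<n. (cmod (u j))\<^sup>2) = (\<Sum>j<n. (cmod (v j))\<^sup>2 / s)"
        using s0 by (simp add: u_def norm_divide power_divide)
      also have "\<dots> = 1" using False by (simp add: s_def flip: sum_divide_distrib)
      finally have "sqrt (N u) \<le> mat_opnorm Z" using up by simp
      then have "(sqrt (N u))\<^sup>2 \<le> (mat_opnorm Z)\<^sup>2" by (intro power_mono) (simp_all add: N0)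
      then have "N u \<le> (mat_opnorm Z)\<^sup>2" by (simp add: N0)
      moreover have "N u = N v / s"
        using s0 by (simp add: N_def u_def norm_divide power_divide flip: sum_divide_distrib)
      ultimately show ?thesis using s0 False by (simp add: divide_le_eq)
    qed
    then show "(\<Sum>i<n. (cmod (\<Sum>j<n. Z $$ (i, j) * v j))\<^sup>2) \<le> (mat_opnorm Z)\<^sup>2 * (\<Sum>j<n. (cmod (v j))\<^sup>2)"
      by (simp add: N_def s_def)
  qed
qed

text \<open>A fixed factor C disappears under roots of order 2^k. It lets the crude bound
  \<open>norm_mlin_le\<close>, off by n^2, yield an exact contraction.\<close>

lemma le_of_power_le:
  fixes r s C :: real
  assumes "s \<ge> 0" "\<And>k. r ^ (2 ^ k) \<le> C * s ^ (2 ^ k)" shows "r \<le> s"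
proof (rule ccontr)
  assume "\<not> r \<le> s"
  then have rs: "s < r" by simp
  show False
  proof (cases "s = 0")
    case True then show ?thesis using assms(2)[of 0] rs by simp
  next
    case False
    then have s: "s > 0" using assms(1) by simp
    have x: "1 < r / s" using rs s by simp
    obtain m where m: "C < (r / s) ^ m" using real_arch_pow[OF x] by blast
    have "(r / s) ^ m \<le> (r / s) ^ (2 ^ m)" using x by (intro power_increasing) auto
    also have "\<dots> \<le> C" using assms(2)[of m] s by (simp add: power_divide divide_le_eq)
    finally show False using m by simp
  qed
qed

lemma sum_blocks: "(\<Sum>r<k * n. h r) = (\<Sum>c<k. \<Sum>p<n. h (c * n + p))" for h :: "nat \<Rightarrow> 'b::comm_monoid_add"
proof -
  have "(\<Sum>p<n. h (c * n + p)) = sum h {c * n..<c * n + n}" for c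
    using sum.shift_bounds_nat_ivl[of h 0 "c * n" n] by (simp add: lessThan_atLeast0 add.commute)
  then show ?thesis using sum.nat_group[of h n k] by simp
qed

text \<open>The order zero map \<open>e\<^sub>i\<^sub>j \<mapsto> T\<^sub>i g T\<^sub>j\<^sup>*\<close>.  As \<open>\<phi>(XY) = q(X)q(Y)\<close> for \<open>q: e\<^sub>i\<^sub>j \<mapsto> T\<^sub>i T\<^sub>j\<^sup>*\<close>, it is completely
  positive with square roots in matrices of the same size.\<close>

lemma cpc_order_zero_of_columns:
  fixes T :: "nat \<Rightarrow> 'a::cstar_algebra"
  assumes T: "\<And>i j. i < n \<Longrightarrow> j < n \<Longrightarrow> star (T i) * T j = (if i = j then g else 0)"
    and g: "norm g \<le> 1" "star g = g"
  shows "cpc_order_zero n (\<lambda>Z. mlin n (\<lambda>i j. T i * g * star (T j)) (\<lambda>i j. Z $$ (i, j)))"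
proof -
  have prod: "(T i * a * star (T j)) * (T k * b * star (T l)) = (if j = k then T i * (a * g * b) * star (T l) else 0)"
    if "j < n" "k < n" for i j k l a b
  proof -
    have "(T i * a * star (T j)) * (T k * b * star (T l)) = T i * a * (star (T j) * T k) * b * star (T l)"
      by (simp only: mult.assoc)
    then show ?thesis using that by (simp add: T mult.assoc)
  qed
  have qprod: "(T i * star (T j)) * (T k * star (T l)) = (if j = k then T i * g * star (T l) else 0)"
    if "j < n" "k < n" for i j k l
  proof -
    have "(T i * star (T j)) * (T k * star (T l)) = T i * (star (T j) * T k) * star (T l)"
      by (simp only: mult.assoc)
    then show ?thesis using that by (simp add: T mult.assoc)
  qed
  \<comment> \<open>Maps of this form are closed under products: coefficients multiply as matrices
    and the middle entries a, b become \<open>a * g * b\<close>. With no middle entry,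
    \<open>Q\<close> serves as a square root of \<open>M g\<close>.\<close>
  define M where "M d F = mlin n (\<lambda>i j. T i * d * star (T j)) F" for d F
  define Q where "Q F = mlin n (\<lambda>i j. T i * star (T j)) F" for F
  have MM: "M a F * M b G = M (a * g * b) (\<lambda>i l. \<Sum>p<n. F i p * G p l)" for a b F G
    unfolding M_def by (rule mlin_mult) (rule prod)
  have QQ: "Q F * Q G = M g (\<lambda>i l. \<Sum>p<n. F i p * G p l)" for F G
    unfolding M_def Q_def by (rule mlin_mult) (rule qprod)
  have sM: "star (M d F) = M d (\<lambda>i j. cnj (F j i))" if "star d = d" for d F
    unfolding M_def by (rule star_mlin) (simp add: star_mult that mult.assoc)
  have sQ: "star (Q F) = Q (\<lambda>i j. cnj (F j i))" for F
    unfolding Q_def by (rule star_mlin) (simp add: star_mult)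
  define \<phi> where "\<phi> Z = M g (\<lambda>i j. Z $$ (i, j))" for Z :: "complex mat"
  have add: "M d (\<lambda>i j. F i j + G i j) = M d F + M d G" for d F G
    by (simp add: M_def mlin_def scaleC_add_left sum.distrib)
  have cong: "M d F = M d G" if "\<And>i j. i < n \<Longrightarrow> j < n \<Longrightarrow> F i j = G i j" for d F G
    unfolding M_def mlin_def using that by (intro sum.cong) auto
  have lin: "linear_on_mat n \<phi>" unfolding linear_on_mat_def
  proof (intro conjI ballI allI)
    fix y z :: "complex mat" assume yz: "y \<in> carrier_mat n n" "z \<in> carrier_mat n n"
    then show "\<phi> (y + z) = \<phi> y + \<phi> z" unfolding \<phi>_def add[symmetric] by (intro cong) auto
  next
    fix c and z :: "complex mat" assume z: "z \<in> carrier_mat n n"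
    have "\<phi> (c \<cdot>\<^sub>m z) = M g (\<lambda>i j. c * z $$ (i, j))" unfolding \<phi>_def using z by (intro cong) auto
    then show "\<phi> (c \<cdot>\<^sub>m z) = c *\<^sub>C \<phi> z" unfolding \<phi>_def
      by (simp add: M_def mlin_def scaleC_sum_right scaleC_scaleC)
  qed
  have cp: "amp_positive k (\<lambda>i j. \<phi> (mat_block n Z i j))" if Z: "mat_positive (k * n) Z" for k Z
  proof -
    obtain X where X: "X \<in> carrier_mat (k * n) (k * n)" "Z = mat_adjoint X * X" using Z unfolding mat_positive_def by auto
    \<comment> \<open>The blocks of \<open>X\<close>: block (a, b) of its Gram matrix is the sum
      over c of the adjoint of \<open>B c a\<close> times \<open>B c b\<close>, and
      \<open>QQ\<close> splits the image of each summand.\<close>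
    define B where "B c b i j = X $$ (c * n + i, b * n + j)" for c b i j
    have "\<phi> (mat_block n Z a b) = (\<Sum>c<k. star (Q (B c a)) * Q (B c b))" if ab: "a < k" "b < k" for a b
    proof -
      have lt: "a * n + i < k * n" if "a < k" "i < n" for a i
        using that by (metis add.commute add_less_mono1 less_le_trans mult.commute mult_Suc_right mult_le_mono2 Suc_leI)
      have "\<phi> (mat_block n Z a b) = M g (\<lambda>i j. \<Sum>c<k. \<Sum>p<n. cnj (B c a p i) * B c b p j)"
        unfolding \<phi>_def
      proof (rule cong)
        fix i j assume "i < n" "j < n"
        then show "mat_block n Z a b $$ (i, j) = (\<Sum>c<k. \<Sum>p<n. cnj (B c a p i) * B c b p j)"
          using ab adjoint_mult_self_index[OF X(1) lt lt, of a i b j] by (simp add: mat_block_def X(2) B_def sum_blocks)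
      qed
      also have "\<dots> = (\<Sum>c<k. M g (\<lambda>i j. \<Sum>p<n. cnj (B c a p i) * B c b p j))"
      proof (induction k)
        case (Suc k) then show ?case by (simp add: add)
      qed (simp add: M_def mlin_def)
      also have "\<dots> = (\<Sum>c<k. star (Q (B c a)) * Q (B c b))" by (simp add: sQ QQ)
      finally show ?thesis .
    qed
    then show ?thesis unfolding amp_positive_def by (intro exI[of _ "\<lambda>c a. Q (B c a)"]) auto
  qed
  have Tn: "norm (T i) \<le> 1" if "i < n" for i
  proof -
    have "(norm (T i))\<^sup>2 \<le> 1" using cstar_identity[of "T i"] T[OF that that] g by simp
    then show ?thesis by (simp add: abs_square_le_1)
  qed
  have nle: "norm (a * b) \<le> 1" if "norm a \<le> 1" "norm b \<le> 1" for a b :: 'a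
    using norm_mult_ineq[of a b] mult_le_one[OF that(1) norm_ge_zero that(2)] by linarith
  \<comment> \<open>By the C*-identity, repeated squaring of
    \<open>star (\<phi> Z) * \<phi> Z\<close> raises its norm to the power 2^k, while the square
    stays of the form \<open>M d F\<close> with \<open>d\<close> contractive and \<open>F\<close>
    bounded by the same power of the squared matrix norm. The factor n^2 lost in estimating
    \<open>M d F\<close> entrywise vanishes in the limit.\<close>
  have contr: "norm (\<phi> Z) \<le> mat_opnorm Z" if Z: "Z \<in> carrier_mat n n" for Z
  proof -
    let ?b = "mat_opnorm Z"
    have Zb: "opbound n (\<lambda>i j. Z $$ (i, j)) ?b" by (rule opbound_mat_opnorm[OF Z])
    then have b0: "?b \<ge> 0" by (simp add: opbound_def)
    define a where "a = rec_nat (star (\<phi> Z) * \<phi> Z) (\<lambda>_ x. x * x)"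
    have a0: "a 0 = star (\<phi> Z) * \<phi> Z" and aS: "a (Suc k) = a k * a k" for k by (simp_all add: a_def)
    have sa: "star (a k) = a k" for k by (induction k) (auto simp: a0 aS star_mult)
    have na: "norm (a k) = ((norm (\<phi> Z))\<^sup>2) ^ (2 ^ k)" for k
    proof (induction k)
      case (Suc k)
      have "norm (a (Suc k)) = (norm (a k))\<^sup>2" using cstar_identity[of "a k"] by (simp add: aS sa)
      then show ?case using Suc by (simp add: power2_eq_square mult_2 power_add)
    qed (simp add: a0 cstar_identity)
    have rep: "\<exists>d F. a k = M d F \<and> norm d \<le> 1 \<and> opbound n F ((?b\<^sup>2) ^ (2 ^ k))" for k
    proof (induction k)
      case 0
      have "a 0 = M (g * g * g) (\<lambda>i l. \<Sum>p<n. cnj (Z $$ (p, i)) * Z $$ (p, l))"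
        by (simp add: a0 \<phi>_def sM[OF g(2)] MM)
      moreover have "opbound n (\<lambda>i l. \<Sum>p<n. cnj (Z $$ (p, i)) * Z $$ (p, l)) (?b * ?b)"
        by (rule opbound_mult[OF opbound_adjoint[OF Zb] Zb])
      ultimately show ?case using g by (auto simp: power2_eq_square intro!: nle)
    next
      case (Suc k)
      then obtain d F where d: "a k = M d F" "norm d \<le> 1" "opbound n F ((?b\<^sup>2) ^ (2 ^ k))" by blast
      have r1: "a (Suc k) = M (d * g * d) (\<lambda>i l. \<Sum>p<n. F i p * F p l)" by (simp add: aS d MM)
      have r2: "opbound n (\<lambda>i l. \<Sum>p<n. F i p * F p l) ((?b\<^sup>2) ^ (2 ^ k) * (?b\<^sup>2) ^ (2 ^ k))"
        by (rule opbound_mult[OF d(3) d(3)])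
      have r3: "(?b\<^sup>2) ^ (2 ^ k) * (?b\<^sup>2) ^ (2 ^ k) = (?b\<^sup>2) ^ (2 ^ Suc k)" by (simp add: mult_2 power_add)
      show ?case
        by (intro exI[of _ "d * g * d"] exI[of _ "\<lambda>i l. \<Sum>p<n. F i p * F p l"] conjI r1 nle d(2) g(1))
          (subst r3[symmetric], rule r2)
    qed
    have "((norm (\<phi> Z))\<^sup>2) ^ (2 ^ k) \<le> real (n * n) * (?b\<^sup>2) ^ (2 ^ k)" for k
    proof -
      obtain d F where d: "a k = M d F" "norm d \<le> 1" "opbound n F ((?b\<^sup>2) ^ (2 ^ k))" using rep by blast
      have "norm (M d F) \<le> real (n * n) * (?b\<^sup>2) ^ (2 ^ k)" unfolding M_def
        by (rule norm_mlin_le) (use d Tn opbound_entry[OF d(3)] in \<open>auto intro!: nle\<close>)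
      then show ?thesis using na[of k] d(1) by simp
    qed
    then have "(norm (\<phi> Z))\<^sup>2 \<le> ?b\<^sup>2" by (rule le_of_power_le[rotated]) simp
    then show ?thesis using b0 by (simp add: power2_le_iff_abs_le)
  qed
  have oz: "\<phi> y * \<phi> z = 0" if "mat_positive n y" "mat_positive n z" "y * z = 0\<^sub>m n n" for y z
  proof -
    have c: "y \<in> carrier_mat n n" "z \<in> carrier_mat n n"
      using that adjoint_mult_self_carrier unfolding mat_positive_def by auto
    have "\<phi> y * \<phi> z = M (g * g * g) (\<lambda>i l. (y * z) $$ (i, l))" unfolding \<phi>_def MM
      using c by (intro cong) (auto simp: scalar_prod_def lessThan_atLeast0 intro!: sum.cong)
    also have "\<dots> = M (g * g * g) (\<lambda>i l. 0)" unfolding that(3) by (intro cong) auto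
    also have "\<dots> = 0" by (simp add: M_def mlin_def)
    finally show ?thesis .
  qed
  have "cpc_order_zero n \<phi>" using lin cp contr oz by (simp add: cpc_order_zero_def cpc_def)
  then show ?thesis by (simp add: \<phi>_def[abs_def] M_def)
qed

section \<open>Almost orthogonal columns\<close>

lemma asymI_ge:
  fixes X Y :: "nat \<Rightarrow> 'a::real_normed_vector"
  assumes "Bseq Y" "\<And>m. norm (X m - Y m) \<le> \<eta> m" "\<eta> \<longlonglongrightarrow> 0"
  shows "X \<asymp> Y"
proof -
  have l: "(\<lambda>m. X m - Y m) \<longlonglongrightarrow> 0" by (rule Lim_null_comparison[OF _ assms(3)]) (simp add: assms(2))
  then have "Bseq (\<lambda>m. X m - Y m)" using convergent_imp_Bseq convergentI by blast
  from Bseq_plus[OF this assms(1)] l assms(1) show ?thesis by (simp add: asym_def)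
qed

lemma positive_power: "positive K \<Longrightarrow> positive (K ^ k :: 'u::cstar_algebra_1)"
  by (induction k) (auto intro!: positive_mult_commute simp: power_commutes)

lemma asym_BseqD: "X \<asymp> Y \<Longrightarrow> Bseq X" "X \<asymp> Y \<Longrightarrow> Bseq Y"
  by (simp_all add: asym_def)

text \<open>The induction step: the new column is made exactly orthogonal to the old ones by means of a
  function of their range projection \<open>W\<close>, after the old ones have been cut down so that a
  function of \<open>W\<close> acts on them as a unit.  Then \<open>r = e h\<close> and \<open>q = h sqrt (h e h)\<close>
  satisfy \<open>r\<^sup>* h\<^sup>2 r = (h e h)\<^sup>2 = q\<^sup>* e q\<close>.\<close>

lemma orthogonalize_column:
  fixes T :: "nat \<Rightarrow> 'u::cstar_algebra_1"
  assumes T: "\<And>i j. i < k \<Longrightarrow> j < k \<Longrightarrow> star (T i) * T j = (if i = j then h * h else 0)"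
    and h: "positive h" and \<eta>: "\<eta> > 0" "norm ((\<Sum>i<k. T i * star (T i)) * y) \<le> \<eta>\<^sup>2"
  obtains G s where "positive G" "norm (G - h * h) \<le> \<eta>" "G * h = h * G" "norm (s - y) \<le> \<eta>"
    "\<exists>u. s = u * y" "\<And>i. i < k \<Longrightarrow> star s * (T i * G) = 0"
proof -
  define W where "W = (\<Sum>i<k. T i * star (T i))"
  have W: "positive W" unfolding W_def by (intro positive_sum) simp
  have sW: "star W = W" using W by (rule star_positive)
  have sh: "star h = h" using h by (rule star_positive)
  have shh: "star (h * h) = h * h" by (simp add: star_mult sh)
  have phh: "positive (h * h)" using sh by (rule positive_square)
  \<comment> \<open>f equals 1 where g is nonzero, so 1 - f(W) annihilates g(W). As |f(t)| \<le> |t|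
    / \<eta>, the norm of f(W) y is at most norm(W y) / \<eta>, hence at most \<eta>; this is why
    the hypothesis bounds norm(W y) by a square.\<close>
  define g where "g t = max (t - \<eta>) 0" for t :: real
  define f where "f t = min 1 (\<bar>t\<bar> / \<eta>)" for t :: real
  have g: "continuous_on UNIV g" unfolding g_def by (intro continuous_intros)
  have f: "continuous_on UNIV f" unfolding f_def using \<eta> by (intro continuous_intros) auto
  have WT: "W * T j = T j * (h * h)" if "j < k" for j
  proof -
    have "W * T j = (\<Sum>i<k. T i * (star (T i) * T j))" unfolding W_def by (simp add: sum_distrib_right mult.assoc)
    also have "\<dots> = (\<Sum>i<k. if i = j then T j * (h * h) else 0)" using T that by (intro sum.cong) auto
    finally show ?thesis using that by simp
  qed
  define G where "G = ucfc g (h * h)"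
  have gT: "ucfc g W * T j = T j * G" if "j < k" for j
    unfolding G_def by (rule ucfc_intertwine[OF sW shh g WT[OF that]])
  define u where "u = ucfc f W"
  have su: "star u = u" unfolding u_def by (rule star_ucfc[OF sW f])
  define s where "s = y - u * y"
  have ug: "(1 - u) * ucfc g W = 0"
  proof -
    have "(1 - u) * ucfc g W = ucfc g W - u * ucfc g W" by (simp add: algebra_simps)
    also have "\<dots> = ucfc (\<lambda>t. g t - f t * g t) W" unfolding u_def
      by (simp only: ucfc_diff[OF sW g continuous_on_mult[OF f g]] ucfc_mult[OF sW f g])
    also have "\<dots> = ucfc (\<lambda>_. 0) W"
    proof (rule ucfc_cong[OF sW])
      show "g t - f t * g t = 0" for t
        using \<eta>(1) by (cases "t > \<eta>") (auto simp: g_def f_def max_def min_def field_simps)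
    qed (intro continuous_intros f g)+
    also have "\<dots> = 0" by (simp add: ucfc_const[OF sW])
    finally show ?thesis .
  qed
  have nuy: "norm (u * y) \<le> norm (W * y) / \<eta>"
  proof -
    have "positive (ucfc (\<lambda>t. (1/\<eta>)\<^sup>2 * (t * t) - f t * f t) W)"
    proof (rule positive_ucfc[OF sW])
      fix t assume "t \<in> rspec W"
      have a: "0 \<le> f t" "f t \<le> \<bar>t\<bar> / \<eta>" using \<eta>(1) by (auto simp: f_def)
      then have "f t * f t \<le> (\<bar>t\<bar> / \<eta>) * (\<bar>t\<bar> / \<eta>)" by (intro mult_mono) auto
      then show "0 \<le> (1/\<eta>)\<^sup>2 * (t * t) - f t * f t" by (simp add: power2_eq_square)
    qed (intro continuous_intros f)
    also have "ucfc (\<lambda>t. (1/\<eta>)\<^sup>2 * (t * t) - f t * f t) W = ((1/\<eta>) *\<^sub>R W) * ((1/\<eta>) *\<^sub>R W) - u * u"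
      unfolding u_def
      by (subst ucfc_diff[OF sW _ continuous_on_mult[OF f f]], intro continuous_intros)
        (subst ucfc_scaleR[OF sW], intro continuous_intros,
          simp add: ucfc_mult[OF sW] ucfc_id[OF sW] f power2_eq_square continuous_on_id)
    finally have "u * u \<preceq> ((1/\<eta>) *\<^sub>R W) * ((1/\<eta>) *\<^sub>R W)" by (simp add: ple_def)
    from ple_conj[OF this, of y] have "star (u * y) * (u * y) \<preceq> star ((1/\<eta>) *\<^sub>R (W * y)) * ((1/\<eta>) *\<^sub>R (W * y))"
      by (simp add: star_mult su sW mult.assoc)
    then have "(norm (u * y))\<^sup>2 \<le> (norm ((1/\<eta>) *\<^sub>R (W * y)))\<^sup>2"
      unfolding cstar_identity[symmetric] by (intro norm_mono positive_star_mult)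
    then have "norm (u * y) \<le> norm ((1/\<eta>) *\<^sub>R (W * y))" by (rule power2_le_imp_le) simp
    then show ?thesis using \<eta>(1) by simp
  qed
  show ?thesis
  proof (rule that)
    show "positive G" unfolding G_def by (rule positive_ucfc[OF shh g]) (simp add: g_def)
    have "norm (ucfc g (h * h) - ucfc (\<lambda>t. t) (h * h)) \<le> \<eta>"
      by (rule ucfc_diff_norm_le[OF shh g continuous_on_id])
        (use positive_rspec[OF phh] \<eta>(1) in \<open>auto simp: g_def max_def\<close>)
    then show "norm (G - h * h) \<le> \<eta>" by (simp add: G_def ucfc_id[OF shh])
    show "G * h = h * G" unfolding G_def by (rule ucfc_commute[OF shh g, symmetric]) (simp add: mult.assoc)
    have "norm (u * y) \<le> \<eta>"
      using nuy \<eta> by (simp add: W_def divide_le_eq power2_eq_square) (meson divide_le_eq order_trans)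
    then show "norm (s - y) \<le> \<eta>" by (simp add: s_def)
    have "s = (1 - u) * y" by (simp add: s_def algebra_simps)
    then show "\<exists>u. s = u * y" by blast
    fix i assume i: "i < k"
    have "star s * (T i * G) = star y * ((1 - u) * ucfc g W) * T i"
      unfolding gT[OF i, symmetric] s_def by (simp add: star_diff star_mult su algebra_simps)
    then show "star s * (T i * G) = 0" by (simp add: ug)
  qed
qed

text \<open>The columns are corrected in the unitization, where units and square roots are at hand.
  Taking for J the range of \<open>emb\<close> records that they remain in the algebra.\<close>

definition mult_ideal :: "'u::cstar_algebra_1 set \<Rightarrow> bool" where
  "mult_ideal J \<longleftrightarrow> (\<forall>x\<in>J. \<forall>u. u * x \<in> J \<and> x * u \<in> J)"

text \<open>Every orthogonalization multiplies the columns by functions of their common modulus,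
  which are asymptotically powers of K. The limit is thus Y_i K^l rather than Y_i, with modulus h
  close to K^(l+1); the exponent \<open>l\<close> depends only on the number of steps and not on the
  sequence index.\<close>

lemma exact_columns:
  fixes Y :: "nat \<Rightarrow> nat \<Rightarrow> 'u::cstar_algebra_1"
  assumes J: "mult_ideal J" and YJ: "\<And>m i. i < n \<Longrightarrow> Y m i \<in> J"
    and B: "\<And>i. i < n \<Longrightarrow> Bseq (\<lambda>m. Y m i)"
    and D: "\<And>m. D m = star (Y m 0) * Y m 0"
    and ort: "\<And>i j. i < n \<Longrightarrow> j < n \<Longrightarrow> (\<lambda>m. star (Y m i) * Y m j) \<asymp> (\<lambda>m. if i = j then D m else 0)"
    and n: "n \<ge> 1"
  defines "K \<equiv> \<lambda>m. psqrt (D m)"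
  shows "1 \<le> k \<Longrightarrow> k \<le> n \<Longrightarrow> \<exists>l T h. (\<forall>m. positive (h m)) \<and> (\<forall>m. \<forall>i<k. T m i \<in> J) \<and>
    (\<forall>m. \<forall>i<k. \<forall>j<k. star (T m i) * T m j = (if i = j then h m * h m else 0)) \<and>
    (\<forall>i<k. (\<lambda>m. T m i) \<asymp> (\<lambda>m. Y m i * K m ^ l)) \<and> h \<asymp> (\<lambda>m. K m ^ Suc l)"
proof (induction k rule: nat_induct_at_least)
  case base
  have D': "positive (D m)" for m by (simp add: D)
  have BD: "Bseq D" using ort[of 0 0] n asym_BseqD(2) by fastforce
  have "D \<asymp> D" using BD by (rule asym_refl)
  from asym_psqrt[OF this] have KK: "K \<asymp> K" unfolding K_def using D' by simp
  show ?case
    by (rule exI[of _ 0], rule exI[of _ Y], rule exI[of _ K])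
      (use n B YJ KK D' in \<open>auto simp: K_def positive_psqrt psqrt_square D intro: asym_refl\<close>)
next
  case (Suc k)
  have D': "positive (D m)" for m by (simp add: D)
  have DD: "D \<asymp> D" using ort[of 0 0] n asym_BseqD(2) by (fastforce intro: asym_refl)
  from asym_psqrt[OF DD] have KK: "K \<asymp> K" unfolding K_def using D' by simp
  note Kp = asym_power[OF KK]
  have pK: "positive (K m)" for m unfolding K_def by (rule positive_psqrt[OF D'])
  have sKp: "star (K m ^ a) = K m ^ a" for m a by (rule star_positive[OF positive_power[OF pK]])
  have DK: "D m = K m * K m" for m unfolding K_def by (rule psqrt_square[OF D', symmetric])
  have kn: "k < n" "k \<ge> 1" using Suc by auto
  from Suc.IH[OF less_imp_le[OF kn(1)]] obtain l T h where H: "\<forall>m. positive (h m)" "\<forall>m. \<forall>i<k. T m i \<in> J"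
    "\<forall>m. \<forall>i<k. \<forall>j<k. star (T m i) * T m j = (if i = j then h m * h m else 0)"
    "\<forall>i<k. (\<lambda>m. T m i) \<asymp> (\<lambda>m. Y m i * K m ^ l)" and hK: "h \<asymp> (\<lambda>m. K m ^ Suc l)"
    by (elim exE conjE)
  have h: "positive (h m)" for m using H(1) by blast
  have TJ: "T m i \<in> J" if "i < k" for m i using H(2) that by blast
  have T: "star (T m i) * T m j = (if i = j then h m * h m else 0)" if "i < k" "j < k" for m i j
    using H(3) that by blast
  have TY: "(\<lambda>m. T m i) \<asymp> (\<lambda>m. Y m i * K m ^ l)" if "i < k" for i using H(4) that by blast
  let ?y = "\<lambda>m. Y m k"
  have yy: "?y \<asymp> ?y" using B[OF kn(1)] by (rule asym_refl)
  define W where "W m = (\<Sum>i<k. T m i * star (T m i)) * ?y m" for m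
  have "W \<asymp> (\<lambda>m. \<Sum>i<k. T m i * (star (T m i) * ?y m))"
  proof -
    have "(\<lambda>m. \<Sum>i<k. T m i * (star (T m i) * ?y m)) \<asymp> (\<lambda>m. \<Sum>i<k. T m i * (star (T m i) * ?y m))"
      by (intro asym_sum asym_mult asym_star yy asym_refl asym_BseqD(1)[OF TY]) auto
    then show ?thesis by (simp add: W_def[abs_def] sum_distrib_right mult.assoc)
  qed
  also have "\<dots> \<asymp> (\<lambda>m. \<Sum>i<k. T m i * 0)"
  proof (intro asym_sum asym_mult)
    fix i assume i: "i \<in> {..<k}"
    have "(\<lambda>m. star (T m i) * ?y m) \<asymp> (\<lambda>m. star (Y m i * K m ^ l) * ?y m)"
      using i by (intro asym_mult asym_star TY yy) auto
    also have "\<dots> = (\<lambda>m. K m ^ l * (star (Y m i) * ?y m))" by (simp add: star_mult sKp mult.assoc)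
    also have "\<dots> \<asymp> (\<lambda>m. K m ^ l * (if i = k then D m else 0))"
      using i kn by (intro asym_mult Kp ort) auto
    finally show "(\<lambda>m. star (T m i) * ?y m) \<asymp> (\<lambda>m. 0)" using i by simp
  qed (use asym_BseqD(1)[OF TY] in \<open>auto intro: asym_refl\<close>)
  finally have "W \<asymp> (\<lambda>m. 0)" by simp
  then have W0: "W \<longlonglongrightarrow> 0" by (simp add: asym_null)
  \<comment> \<open>The square root gives the bound \<eta>^2 that
    \<open>orthogonalize_column\<close> asks for; the second term keeps \<eta> positive.\<close>
  define \<eta> where "\<eta> m = sqrt (norm (W m)) + inverse (real (Suc m))" for m
  have \<eta>0: "\<eta> m > 0" for m by (simp add: \<eta>_def add_nonneg_pos)
  have "(\<lambda>m. sqrt (norm (W m)) + inverse (real (Suc m))) \<longlonglongrightarrow> sqrt 0 + 0"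
    by (intro tendsto_add tendsto_real_sqrt tendsto_norm_zero W0 LIMSEQ_inverse_real_of_nat)
  then have \<eta>lim: "\<eta> \<longlonglongrightarrow> 0" by (simp add: \<eta>_def[abs_def])
  have \<eta>W: "norm (W m) \<le> (\<eta> m)\<^sup>2" for m
  proof -
    have "(sqrt (norm (W m)))\<^sup>2 \<le> (\<eta> m)\<^sup>2" by (intro power_mono) (auto simp: \<eta>_def)
    then show ?thesis by simp
  qed
  have "\<exists>G s. positive G \<and> norm (G - h m * h m) \<le> \<eta> m \<and> G * h m = h m * G \<and> norm (s - ?y m) \<le> \<eta> m \<and>
    (\<exists>u. s = u * ?y m) \<and> (\<forall>i<k. star s * (T m i * G) = 0)" for m
    by (rule orthogonalize_column[of k "T m" "h m" "\<eta> m" "?y m", OF T h \<eta>0 \<eta>W[unfolded W_def]]) blast+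
  then obtain G s where G: "\<And>m. positive (G m)" "\<And>m. norm (G m - h m * h m) \<le> \<eta> m" "\<And>m. G m * h m = h m * G m"
    and s: "\<And>m. norm (s m - ?y m) \<le> \<eta> m" "\<And>m. \<exists>u. s m = u * ?y m"
    and sT: "\<And>m i. i < k \<Longrightarrow> star (s m) * (T m i * G m) = 0" by metis
  have hh: "(\<lambda>m. h m * h m) \<asymp> (\<lambda>m. K m ^ Suc l * K m ^ Suc l)" by (intro asym_mult hK)
  have "G \<asymp> (\<lambda>m. h m * h m)" by (rule asymI_ge[OF asym_BseqD(1)[OF hh] G(2) \<eta>lim])
  then have GK: "G \<asymp> (\<lambda>m. K m ^ Suc l * K m ^ Suc l)" using hh by (rule asym_trans)
  have sy: "s \<asymp> ?y" by (rule asymI_ge[OF B[OF kn(1)] s(1) \<eta>lim])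
  define p where "p m = h m * G m" for m
  have pp: "positive (p m)" for m unfolding p_def by (rule positive_mult_commute[OF h G(1) G(3)[symmetric]])
  have sp: "star (p m) = p m" for m by (rule star_positive[OF pp])
  define e where "e m = star (s m) * s m" for m
  have se: "star (e m) = e m" for m by (simp add: e_def star_mult)
  define h' where "h' m = p m * e m * p m" for m
  have ph': "positive (h' m)" for m unfolding h'_def using positive_conj[of "e m" "p m"] by (simp add: sp e_def)
  \<comment> \<open>Both forms have the same modulus, with p = h G and h' = p e p: an old column
    gives p e (G h) (h G) e p = h'^2, and the new one gives sqrt(h') p e p sqrt(h') = h'^2. The
    factor G makes the old columns orthogonal to \<open>s\<close>.\<close>
  define T' where "T' m i = (if i = k then s m * p m * psqrt (h' m) else T m i * G m * e m * p m)" for m i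
  have "e \<asymp> (\<lambda>m. star (?y m) * ?y m)" unfolding e_def by (intro asym_mult asym_star sy)
  also have "\<dots> \<asymp> (\<lambda>m. if k = k then D m else 0)" by (rule ort[OF kn(1) kn(1)])
  finally have eK: "e \<asymp> (\<lambda>m. K m * K m)" by (simp add: DK[abs_def])
  have pK': "p \<asymp> (\<lambda>m. K m ^ Suc l * (K m ^ Suc l * K m ^ Suc l))"
    unfolding p_def by (intro asym_mult hK GK)
  \<comment> \<open>Exponents of K: p has 3 (l+1) and e has 2, so h' has 6 l + 8 and its square root
    3 l + 4. The new column then carries 3 (l+1) + 3 l + 4, an old one l + 2 (l+1) + 2 + 3 (l+1);
    both are 6 l + 7.\<close>
  let ?a = "3 * l + 4"
  have "h' \<asymp> (\<lambda>m. (K m ^ Suc l * (K m ^ Suc l * K m ^ Suc l)) * (K m * K m) * (K m ^ Suc l * (K m ^ Suc l * K m ^ Suc l)))"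
    unfolding h'_def by (intro asym_mult pK' eK)
  also have "\<dots> = (\<lambda>m. K m ^ ?a * K m ^ ?a)"
  proof
    fix m
    have "K m ^ ?a * K m ^ ?a = K m ^ (Suc l + (Suc l + Suc l) + (1 + 1) + (Suc l + (Suc l + Suc l)))"
      unfolding power_add[symmetric] by (rule arg_cong) simp
    then show "K m ^ Suc l * (K m ^ Suc l * K m ^ Suc l) * (K m * K m) * (K m ^ Suc l * (K m ^ Suc l * K m ^ Suc l)) = K m ^ ?a * K m ^ ?a"
      by (simp only: power_add power_one_right)
  qed
  finally have h'K: "h' \<asymp> (\<lambda>m. K m ^ ?a * K m ^ ?a)" .
  have "(\<lambda>m. psqrt (h' m)) \<asymp> (\<lambda>m. psqrt (K m ^ ?a * K m ^ ?a))"
    by (rule asym_psqrt[OF h'K ph']) (metis positive_square sKp)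
  then have sqK: "(\<lambda>m. psqrt (h' m)) \<asymp> (\<lambda>m. K m ^ ?a)" by (simp only: psqrt_mult_self[OF positive_power[OF pK]])
  have "\<forall>m. \<forall>i<Suc k. T' m i \<in> J"
  proof (intro allI impI)
    fix m i assume i: "i < Suc k"
    show "T' m i \<in> J"
    proof (cases "i = k")
      case True
      obtain u where "s m = u * ?y m" using s(2) by blast
      then show ?thesis using True YJ[OF kn(1)] J by (simp add: T'_def mult_ideal_def)
    next
      case False
      then show ?thesis using TJ[of i m] i J by (simp add: T'_def mult_ideal_def)
    qed
  qed
  moreover have "\<forall>m. \<forall>i<Suc k. \<forall>j<Suc k. star (T' m i) * T' m j = (if i = j then h' m * h' m else 0)"
  proof (intro allI impI)
    fix m i j assume ij: "i < Suc k" "j < Suc k"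
    have sG: "star (G m) = G m" by (rule star_positive[OF G(1)])
    have sq: "star (psqrt (h' m)) = psqrt (h' m)" "psqrt (h' m) * psqrt (h' m) = h' m"
      by (rule star_psqrt[OF ph'] psqrt_square[OF ph'])+
    have zero: "star (T' m k) * T' m i = 0" if "i < k" for i
    proof -
      have "star (T' m k) * T' m i = psqrt (h' m) * p m * (star (s m) * (T m i * G m)) * e m * p m"
        using that by (simp add: T'_def star_mult sq sp mult.assoc)
      then show ?thesis using sT[OF that] by simp
    qed
    show "star (T' m i) * T' m j = (if i = j then h' m * h' m else 0)"
    proof (cases "i = k"; cases "j = k")
      assume "i = k" "j = k"
      have "star (T' m k) * T' m k = psqrt (h' m) * (p m * (star (s m) * s m) * p m) * psqrt (h' m)"
        by (simp add: T'_def star_mult sq sp mult.assoc)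
      also have "\<dots> = psqrt (h' m) * h' m * psqrt (h' m)" by (simp only: h'_def e_def)
      also have "\<dots> = psqrt (h' m) * (psqrt (h' m) * psqrt (h' m)) * psqrt (h' m)" by (simp only: sq)
      also have "\<dots> = (psqrt (h' m) * psqrt (h' m)) * (psqrt (h' m) * psqrt (h' m))" by (simp only: mult.assoc)
      also have "\<dots> = h' m * h' m" by (simp only: sq(2))
      finally show ?thesis using \<open>i = k\<close> \<open>j = k\<close> by simp
    next
      assume "i = k" "j \<noteq> k"
      then show ?thesis using zero[of j] ij by simp
    next
      assume "i \<noteq> k" "j = k"
      then have "star (star (T' m k) * T' m i) = 0" using zero[of i] ij by simp
      then show ?thesis using \<open>i \<noteq> k\<close> \<open>j = k\<close> by (simp add: star_mult)
    next
      assume "i \<noteq> k" "j \<noteq> k"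
      then have ij': "i < k" "j < k" using ij by auto
      have "star (T' m i) * T' m j = p m * e m * G m * (star (T m i) * T m j) * G m * e m * p m"
        using \<open>i \<noteq> k\<close> \<open>j \<noteq> k\<close> by (simp add: T'_def star_mult sG sp se mult.assoc)
      also have "\<dots> = (if i = j then p m * e m * (G m * h m) * (h m * G m) * e m * p m else 0)"
        by (simp add: T[OF ij'] mult.assoc)
      also have "\<dots> = (if i = j then h' m * h' m else 0)"
        unfolding G(3) p_def[symmetric] h'_def by (simp add: mult.assoc)
      finally show ?thesis .
    qed
  qed
  moreover have "\<forall>i<Suc k. (\<lambda>m. T' m i) \<asymp> (\<lambda>m. Y m i * K m ^ (6 * l + 7))"
  proof (intro allI impI)
    fix i assume i: "i < Suc k"
    show "(\<lambda>m. T' m i) \<asymp> (\<lambda>m. Y m i * K m ^ (6 * l + 7))"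
    proof (cases "i = k")
      case True
      have "(\<lambda>m. T' m k) \<asymp> (\<lambda>m. ?y m * (K m ^ Suc l * (K m ^ Suc l * K m ^ Suc l)) * K m ^ ?a)"
        unfolding T'_def if_P[OF refl] by (intro asym_mult sy pK' sqK)
      also have "\<dots> = (\<lambda>m. ?y m * K m ^ (6 * l + 7))"
      proof
        fix m
        have "6 * l + 7 = Suc l + (Suc l + Suc l) + ?a" by simp
        then show "?y m * (K m ^ Suc l * (K m ^ Suc l * K m ^ Suc l)) * K m ^ ?a = ?y m * K m ^ (6 * l + 7)"
          by (simp only: power_add mult.assoc)
      qed
      finally show ?thesis using True by simp
    next
      case False
      then have ik: "i < k" using i by simp
      have "(\<lambda>m. T' m i) \<asymp> (\<lambda>m. Y m i * K m ^ l * (K m ^ Suc l * K m ^ Suc l) * (K m * K m) * (K m ^ Suc l * (K m ^ Suc l * K m ^ Suc l)))"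
        unfolding T'_def if_not_P[OF False] by (intro asym_mult TY[OF ik] GK eK pK')
      also have "\<dots> = (\<lambda>m. Y m i * K m ^ (6 * l + 7))"
      proof
        fix m
        have "6 * l + 7 = l + (Suc l + Suc l) + (1 + 1) + (Suc l + (Suc l + Suc l))" by simp
        then show "Y m i * K m ^ l * (K m ^ Suc l * K m ^ Suc l) * (K m * K m) * (K m ^ Suc l * (K m ^ Suc l * K m ^ Suc l))
            = Y m i * K m ^ (6 * l + 7)"
          by (simp only: power_add power_one_right mult.assoc)
      qed
      finally show ?thesis .
    qed
  qed
  moreover have "h' \<asymp> (\<lambda>m. K m ^ Suc (6 * l + 7))"
  proof -
    have "(\<lambda>m. K m ^ ?a * K m ^ ?a) = (\<lambda>m. K m ^ Suc (6 * l + 7))"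
    proof
      fix m
      have "Suc (6 * l + 7) = ?a + ?a" by simp
      then show "K m ^ ?a * K m ^ ?a = K m ^ Suc (6 * l + 7)" by (simp only: power_add)
    qed
    then show ?thesis using h'K by simp
  qed
  ultimately show ?case using ph' by blast
qed

section \<open>An approximate form of tracial \<open>\<Z>\<close>-absorption\<close>

lemma rpeval_power: "rpeval (p ^ k) a = rpeval p a ^ k"
  by (induction k) (auto simp: rpeval_mult)

text \<open>The rebuilt order zero map has its value at 1 close to a power of H, while the
  hypothesis controls 1 - H only; the exponent becomes a constant factor, which is absorbed into
  \<open>w\<close>.\<close>

lemma bernoulli_ple:
  fixes H :: "'u::cstar_algebra_1"
  assumes H: "positive H" shows "1 - H ^ N \<preceq> real N *\<^sub>R (1 - H)"
proof -
  have sH: "star H = H" using H by (rule star_positive)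
  let ?p = "Polynomial.smult (real N) (1 - [:0, 1:]) - (1 - [:0, 1:] ^ N)"
  have "positive (ucfc (poly ?p) H)"
  proof (rule positive_ucfc[OF sH])
    show "continuous_on UNIV (poly ?p)" by (rule continuous_at_imp_continuous_on) simp
    fix t assume "t \<in> rspec H"
    then have "t \<ge> 0" using positive_rspec[OF H] by blast
    then have "1 + real N * (t - 1) \<le> (1 + (t - 1)) ^ N" by (intro Bernoulli_inequality) simp
    then show "0 \<le> poly ?p t" by (simp add: poly_power algebra_simps)
  qed
  then show ?thesis
    by (simp add: ucfc_poly[OF sH] ple_def rpeval_diff rpeval_smult rpeval_power)
qed

definition asym_commutes :: "(nat \<Rightarrow> 'a::real_normed_algebra) \<Rightarrow> 'a \<Rightarrow> bool" where
  "asym_commutes X b \<longleftrightarrow> (\<lambda>m. X m * b) \<asymp> (\<lambda>m. b * X m)"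

lemma asym_commutes_mult:
  assumes "asym_commutes X b" "asym_commutes Y b" "Bseq X" "Bseq Y"
  shows "asym_commutes (\<lambda>m. X m * Y m) b"
  unfolding asym_commutes_def
proof -
  have "(\<lambda>m. X m * (Y m * b)) \<asymp> (\<lambda>m. X m * (b * Y m))"
    by (rule asym_mult[OF asym_refl[OF assms(3)] assms(2)[unfolded asym_commutes_def]])
  also have "\<dots> = (\<lambda>m. (X m * b) * Y m)" by (simp add: mult.assoc)
  also have "\<dots> \<asymp> (\<lambda>m. (b * X m) * Y m)"
    by (rule asym_mult[OF assms(1)[unfolded asym_commutes_def] asym_refl[OF assms(4)]])
  finally show "(\<lambda>m. X m * Y m * b) \<asymp> (\<lambda>m. b * (X m * Y m))" by (simp add: mult.assoc)
qed

lemma asym_commutes_asym: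
  assumes "asym_commutes X b" "Z \<asymp> X" shows "asym_commutes Z b"
  unfolding asym_commutes_def
proof -
  have "(\<lambda>m. Z m * b) \<asymp> (\<lambda>m. X m * b)" by (intro asym_mult assms asym_const)
  also have "\<dots> \<asymp> (\<lambda>m. b * X m)" using assms by (simp add: asym_commutes_def)
  also have "\<dots> \<asymp> (\<lambda>m. b * Z m)" by (intro asym_mult asym_sym[OF assms(2)] asym_const)
  finally show "(\<lambda>m. Z m * b) \<asymp> (\<lambda>m. b * Z m)" .
qed

lemma asym_commutes_power:
  fixes X :: "nat \<Rightarrow> 'a::real_normed_algebra_1"
  assumes "asym_commutes X b" "Bseq X" shows "asym_commutes (\<lambda>m. X m ^ k) b"
proof (induction k)
  case 0 then show ?case by (simp add: asym_commutes_def asym_const)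
next
  case (Suc k)
  have "Bseq (\<lambda>m. X m ^ k)" using asym_power[OF asym_refl[OF assms(2)]] asym_BseqD by blast
  then show ?case using asym_commutes_mult[OF assms(1) Suc assms(2)] by simp
qed

lemma commutator_bound:
  fixes c :: "nat \<Rightarrow> nat \<Rightarrow> 'a::cstar_algebra"
  assumes "Z \<in> carrier_mat n n" "mat_opnorm Z \<le> 1"
  shows "norm (mlin n c (\<lambda>i j. Z $$ (i, j)) * b - b * mlin n c (\<lambda>i j. Z $$ (i, j)))
    \<le> (\<Sum>i<n. \<Sum>j<n. norm (c i j * b - b * c i j))"
proof -
  have "mlin n c (\<lambda>i j. Z $$ (i, j)) * b - b * mlin n c (\<lambda>i j. Z $$ (i, j))
      = (\<Sum>i<n. \<Sum>j<n. Z $$ (i, j) *\<^sub>C (c i j * b - b * c i j))"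
    by (simp add: mlin_def sum_distrib_left sum_distrib_right scaleC_mult_left scaleC_mult_right
        scaleC_diff_right sum_subtractf)
  also have "norm \<dots> \<le> (\<Sum>i<n. \<Sum>j<n. norm (c i j * b - b * c i j))"
  proof (intro sum_norm_le)
    fix i j assume "i \<in> {..<n}" "j \<in> {..<n}"
    then have "cmod (Z $$ (i, j)) \<le> 1"
      using opbound_entry[OF opbound_mat_opnorm[OF assms(1)], of i j] assms(2) by simp
    then show "norm (Z $$ (i, j) *\<^sub>C (c i j * b - b * c i j)) \<le> norm (c i j * b - b * c i j)"
      by (simp add: norm_scaleC mult_left_le_one_le)
  qed
  finally show ?thesis .
qed

lemma mult_ideal_range_emb: "mult_ideal (range emb)"
proof -
  have "u * emb a \<in> range emb \<and> emb a * u \<in> range emb" for u and a :: 'a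
    using uscal_eq_0_iff[of "u * emb a"] uscal_eq_0_iff[of "emb a * u"] by auto
  then show ?thesis unfolding mult_ideal_def by blast
qed

lemma mlin_one: "mlin n c (\<lambda>i j. 1\<^sub>m n $$ (i, j)) = (\<Sum>i<n. c i i)"
proof -
  have "mlin n c (\<lambda>i j. 1\<^sub>m n $$ (i, j)) = (\<Sum>i<n. \<Sum>j<n. if j = i then c i i else 0)"
    unfolding mlin_def by (intro sum.cong refl) auto
  then show ?thesis by simp
qed

text \<open>The smallness clause has sum of \<open>Y i * star (Y i)\<close> in the place of
  \<phi>(1), and is an order inequality. The norm is bounded for \<open>Y 0\<close> only: the first
  clause passes the bound on to the other entries up to an error.\<close>

definition almost_columns :: "nat \<Rightarrow> 'b::cstar_algebra \<Rightarrow> 'b \<Rightarrow> 'b set \<Rightarrow> real \<Rightarrow> (nat \<Rightarrow> 'b) \<Rightarrow> bool" where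
  "almost_columns n x a F \<epsilon> Y \<longleftrightarrow>
     (\<forall>i<n. \<forall>j<n. norm (star (Y i) * Y j - (if i = j then star (Y 0) * Y 0 else 0)) \<le> \<epsilon>) \<and>
     (\<forall>i<n. \<forall>b\<in>F. norm (Y i * b - b * Y i) \<le> \<epsilon>) \<and> norm (Y 0) \<le> 1 + \<epsilon> \<and>
     (\<exists>w. emb (x * x - x * (\<Sum>i<n. Y i * star (Y i)) * x) \<preceq> \<epsilon> *\<^sub>R 1 + emb (w * a * star w))"

theorem tracially_Z_absorbing_of_almost_columns:
  assumes nc: "\<not> cstar_isomorphic TYPE('b::cstar_algebra) TYPE(complex)"
    and crit: "\<And>(x::'b) a F \<epsilon> n. positive x \<Longrightarrow> positive a \<Longrightarrow> a \<noteq> 0 \<Longrightarrow> finite F \<Longrightarrow> \<epsilon> > 0 \<Longrightarrow> n \<ge> 1 \<Longrightarrow>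
      \<exists>Y. almost_columns n x a F \<epsilon> Y"
  shows "tracially_Z_absorbing TYPE('b)"
  unfolding tracially_Z_absorbing_def
proof (intro conjI nc allI impI)
  fix x a :: 'b and F :: "'b set" and \<epsilon> :: real and n :: nat
  assume x: "positive x" and a: "positive a" "a \<noteq> 0" and F: "finite F" and e: "\<epsilon> > 0" and n: "n \<ge> 1"
  define d where "d m = inverse (real (Suc m))" for m
  have d0: "d m > 0" for m by (simp add: d_def)
  have dlim: "d \<longlonglongrightarrow> 0" unfolding d_def by (rule LIMSEQ_inverse_real_of_nat)
  \<comment> \<open>The order zero map contains the adjoints of the columns, which almost commute
    with \<open>b\<close> when the columns almost commute with \<open>star b\<close>.\<close>
  have "\<exists>Y. almost_columns n x a (F \<union> star ` F) (d m) Y" for m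
    using crit[OF x a _ d0 n] F by simp
  then obtain y where y: "\<And>m. almost_columns n x a (F \<union> star ` F) (d m) (y m)" by metis
  define Y where "Y m i = emb (y m i)" for m i
  define D where "D m = star (Y m 0) * Y m 0" for m
  have nD: "norm (D m) \<le> 4" for m
  proof -
    have "norm (y m 0) \<le> 1 + d m" using y[of m] by (auto simp: almost_columns_def)
    also have "\<dots> \<le> 2" by (simp add: d_def inverse_le_1_iff)
    finally have "(norm (y m 0))\<^sup>2 \<le> 2\<^sup>2" by (intro power_mono) auto
    then show ?thesis by (simp add: D_def Y_def cstar_identity)
  qed
  have BD: "Bseq D" using nD by (rule BseqI')
  have ort: "(\<lambda>m. star (Y m i) * Y m j) \<asymp> (\<lambda>m. if i = j then D m else 0)" if "i < n" "j < n" for i j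
  proof (rule asymI_ge[OF _ _ dlim])
    show "Bseq (\<lambda>m. if i = j then D m else 0)" using BD by (cases "i = j") (simp_all add: Bfun_const)
    fix m
    have "star (Y m i) * Y m j - (if i = j then D m else 0)
      = emb (star (y m i) * y m j - (if i = j then star (y m 0) * y m 0 else 0))"
      by (simp add: Y_def D_def emb_simps)
    then show "norm (star (Y m i) * Y m j - (if i = j then D m else 0)) \<le> d m"
      using y[of m] that by (simp only: norm_emb) (simp add: almost_columns_def)
  qed
  have BY: "Bseq (\<lambda>m. Y m i)" if i: "i < n" for i
  proof (rule BseqI')
    fix m
    have "norm (star (Y m i) * Y m i - D m) \<le> 1"
    proof -
      have "star (Y m i) * Y m i - D m = emb (star (y m i) * y m i - (if i = i then star (y m 0) * y m 0 else 0))"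
        by (simp add: Y_def D_def emb_simps)
      then have "norm (star (Y m i) * Y m i - D m) \<le> d m"
        using y[of m] i by (simp only: norm_emb almost_columns_def)
      also have "\<dots> \<le> 1" by (simp add: d_def inverse_le_1_iff)
      finally show ?thesis .
    qed
    then have "norm (star (Y m i) * Y m i) \<le> 5"
      using nD[of m] norm_triangle_ineq[of "star (Y m i) * Y m i - D m" "D m"] by simp
    then have "(norm (Y m i))\<^sup>2 \<le> 3\<^sup>2" by (simp add: cstar_identity)
    then show "norm (Y m i) \<le> 3" by (rule power2_le_imp_le) simp
  qed
  define K where "K m = psqrt (D m)" for m
  have pD: "positive (D m)" for m by (simp add: D_def)
  have KK: "K m * K m = D m" for m unfolding K_def by (rule psqrt_square[OF pD])
  have sK: "star (K m) = K m" for m unfolding K_def by (rule star_psqrt[OF pD])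
  have nK: "norm (K m) \<le> 1 + d m" for m
  proof -
    have "(norm (K m))\<^sup>2 = norm (D m)" using cstar_identity[of "K m"] by (simp add: sK KK)
    also have "\<dots> = (norm (y m 0))\<^sup>2" by (simp add: D_def Y_def cstar_identity)
    finally have "norm (K m) = norm (y m 0)" by simp
    then show ?thesis using y[of m] by (simp add: almost_columns_def)
  qed
  from exact_columns[OF mult_ideal_range_emb _ BY D_def ort n, where k = n] n
  obtain l T h where H: "\<forall>m. positive (h m)" "\<forall>m. \<forall>i<n. T m i \<in> range emb"
    "\<forall>m. \<forall>i<n. \<forall>j<n. star (T m i) * T m j = (if i = j then h m * h m else 0)"
    "\<forall>i<n. (\<lambda>m. T m i) \<asymp> (\<lambda>m. Y m i * K m ^ l)" and hK: "h \<asymp> (\<lambda>m. K m ^ Suc l)"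
    unfolding K_def[abs_def] by (auto simp: Y_def)
  \<comment> \<open>\<open>cpc_order_zero_of_columns\<close> needs a contractive modulus. Since h is
    close to K^(l+1) and the norms of K have upper limit at most 1, the normalization tends to 1 and
    affects no asymptotic relation.\<close>
  define s where "s m = inverse (max 1 (norm (h m)))" for m
  have s01: "0 < s m" for m by (simp add: s_def)
  have slim: "s \<longlonglongrightarrow> 1"
  proof -
    have "(\<lambda>m. max 1 (norm (h m))) \<longlonglongrightarrow> 1"
    proof (rule tendsto_sandwich[of "\<lambda>_. 1" _ _ "\<lambda>m. max 1 ((1 + d m) ^ Suc l + norm (h m - K m ^ Suc l))"])
      have "norm (h m) \<le> (1 + d m) ^ Suc l + norm (h m - K m ^ Suc l)" for m
      proof -
        have "norm (K m ^ Suc l) \<le> norm (K m) ^ Suc l" by (rule norm_power_ineq)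
        also have "\<dots> \<le> (1 + d m) ^ Suc l" by (intro power_mono nK) simp
        finally show ?thesis using norm_triangle_ineq[of "K m ^ Suc l" "h m - K m ^ Suc l"] by simp
      qed
      then show "\<forall>\<^sub>F m in sequentially. max 1 (norm (h m)) \<le> max 1 ((1 + d m) ^ Suc l + norm (h m - K m ^ Suc l))"
        by (intro always_eventually allI max.mono order_refl)
      have "(\<lambda>m. max 1 ((1 + d m) ^ Suc l + norm (h m - K m ^ Suc l))) \<longlonglongrightarrow> max 1 ((1 + 0) ^ Suc l + 0)"
        using hK by (intro tendsto_intros dlim tendsto_norm_zero) (simp add: asym_def)
      then show "(\<lambda>m. max 1 ((1 + d m) ^ Suc l + norm (h m - K m ^ Suc l))) \<longlonglongrightarrow> 1" by simp
    qed (auto intro: tendsto_const)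
    from tendsto_inverse[OF this] show ?thesis by (simp add: s_def[abs_def])
  qed
  define t where "t m i = ubase (T m i)" for m i
  have t: "T m i = emb (t m i)" if "i < n" for m i using H(2)[rule_format, OF that, of m] by (auto simp: t_def)
  have th: "star (emb (t m i)) * emb (t m j) = (if i = j then h m * h m else 0)" if "i < n" "j < n" for m i j
    using H(3)[rule_format, OF that, of m] t[OF that(1), of m] t[OF that(2), of m] by simp
  define t' where "t' m i = s m *\<^sub>R t m i" for m i
  define g where "g m = star (t' m 0) * t' m 0" for m
  have eg: "emb (g m) = (s m * s m) *\<^sub>R (h m * h m)" for m
    using th[of 0 0 m] n by (simp add: g_def t'_def emb_simps)
  have t'ort: "star (t' m i) * t' m j = (if i = j then g m else 0)" if "i < n" "j < n" for m i j
  proof -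
    have "emb (star (t' m i) * t' m j) = emb (if i = j then g m else 0)"
      using th[OF that, of m] eg[of m] by (simp add: t'_def emb_simps)
    then show ?thesis by (simp only: emb_inject)
  qed
  have ng: "norm (g m) \<le> 1" for m
  proof -
    have "norm (g m) = norm (emb (g m))" by simp
    also have "\<dots> = s m * s m * norm (h m * h m)" using s01[of m] by (simp add: eg)
    also have "\<dots> \<le> (s m * norm (h m)) * (s m * norm (h m))"
      using norm_mult_ineq[of "h m" "h m"] s01[of m] by (simp add: mult_ac)
    also have "\<dots> \<le> 1"
    proof -
      have "s m * norm (h m) \<le> 1" by (simp add: s_def field_simps)
      moreover have "0 \<le> s m * norm (h m)" using s01[of m] by simp
      ultimately show ?thesis using mult_le_one by blast
    qed
    finally show ?thesis .
  qed
  have sg: "star (g m) = g m" for m by (simp add: g_def star_mult)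
  define c where "c m i j = t' m i * g m * star (t' m j)" for m i j
  define \<phi> where "\<phi> m Z = mlin n (c m) (\<lambda>i j. Z $$ (i, j))" for m Z
  have oz: "cpc_order_zero n (\<phi> m)" for m
    unfolding \<phi>_def[abs_def] c_def by (rule cpc_order_zero_of_columns[OF t'ort ng sg])
  \<comment> \<open>t'_i is close to Y_i K^l and g to K^l D K^l, so the coefficients are close to
    Y_i K^(4l+2) (star Y_j), and K^2 = D.\<close>
  let ?M = "2 * l + 1"
  have T'Y: "(\<lambda>m. emb (t' m i)) \<asymp> (\<lambda>m. Y m i * K m ^ l)" if i: "i < n" for i
  proof -
    have sT: "(\<lambda>m. s m *\<^sub>R (1::'b uz)) \<asymp> (\<lambda>m. 1)"
    proof -
      have "(\<lambda>m. s m *\<^sub>R (1::'b uz) - 1) \<longlonglongrightarrow> 1 *\<^sub>R 1 - 1" by (intro tendsto_intros slim)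
      moreover have "Bseq (\<lambda>m. s m *\<^sub>R (1::'b uz))"
        by (rule convergent_imp_Bseq, rule convergentI[of _ "1 *\<^sub>R 1"]) (intro tendsto_intros slim)
      ultimately show ?thesis by (simp add: asym_def Bfun_const)
    qed
    have "(\<lambda>m. (s m *\<^sub>R 1) * T m i) \<asymp> (\<lambda>m. 1 * (Y m i * K m ^ l))"
      using H(4) i by (intro asym_mult sT) auto
    then show ?thesis using t[OF i] by (simp add: t'_def emb_simps)
  qed
  have cY: "(\<lambda>m. emb (c m i j)) \<asymp> (\<lambda>m. Y m i * D m ^ ?M * star (Y m j))" if ij: "i < n" "j < n" for i j
  proof -
    have "(\<lambda>m. emb (t' m i) * (star (emb (t' m 0)) * emb (t' m 0)) * star (emb (t' m j)))
      \<asymp> (\<lambda>m. (Y m i * K m ^ l) * (star (Y m 0 * K m ^ l) * (Y m 0 * K m ^ l)) * star (Y m j * K m ^ l))"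
      using n ij by (intro asym_mult asym_star T'Y) auto
    also have "\<dots> = (\<lambda>m. Y m i * D m ^ ?M * star (Y m j))"
    proof
      fix m
      have sKl: "star (K m ^ l) = K m ^ l" by (rule star_positive, rule positive_power) (simp add: K_def positive_psqrt[OF pD])
      have DM: "D m ^ ?M = K m ^ l * (K m ^ l * ((K m * K m) * (K m ^ l * K m ^ l)))"
      proof -
        have "D m ^ ?M = (K m ^ 2) ^ ?M" by (simp add: KK power2_eq_square)
        also have "\<dots> = K m ^ (l + (l + ((1 + 1) + (l + l))))" unfolding power_mult[symmetric] by (rule arg_cong) simp
        finally show ?thesis by (simp only: power_add power_one_right)
      qed
      show "(Y m i * K m ^ l) * (star (Y m 0 * K m ^ l) * (Y m 0 * K m ^ l)) * star (Y m j * K m ^ l)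
        = Y m i * D m ^ ?M * star (Y m j)"
      proof -
        have "(Y m i * K m ^ l) * (star (Y m 0 * K m ^ l) * (Y m 0 * K m ^ l)) * star (Y m j * K m ^ l)
          = Y m i * (K m ^ l * (K m ^ l * ((star (Y m 0) * Y m 0) * (K m ^ l * K m ^ l)))) * star (Y m j)"
          by (simp only: star_mult sKl mult.assoc)
        then show ?thesis unfolding DM KK by (simp only: D_def)
      qed
    qed
    finally show ?thesis by (simp add: c_def g_def emb_simps mult.assoc)
  qed
  have DD: "D \<asymp> D" using BD by (rule asym_refl)
  have YY: "(\<lambda>m. Y m i) \<asymp> (\<lambda>m. Y m i)" if "i < n" for i using BY[OF that] by (rule asym_refl)
  have comY: "asym_commutes (\<lambda>m. Y m i) (emb b)" if i: "i < n" and b: "b \<in> F \<union> star ` F" for i b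
    unfolding asym_commutes_def
  proof (rule asymI_ge[OF _ _ dlim])
    show "Bseq (\<lambda>m. emb b * Y m i)" by (rule Bseq_mult_algebra[OF Bfun_const BY[OF i]])
    fix m
    have "Y m i * emb b - emb b * Y m i = emb (y m i * b - b * y m i)" by (simp add: Y_def emb_simps)
    then show "norm (Y m i * emb b - emb b * Y m i) \<le> d m"
      using y[of m] i b by (simp only: norm_emb almost_columns_def)
  qed
  have comY': "asym_commutes (\<lambda>m. star (Y m i)) (emb b)" if i: "i < n" and b: "b \<in> F" for i b
  proof -
    have "(\<lambda>m. Y m i * emb (star b)) \<asymp> (\<lambda>m. emb (star b) * Y m i)"
      using comY[OF i, of "star b"] b by (simp add: asym_commutes_def)
    from asym_sym[OF asym_star[OF this]] show ?thesis by (simp add: asym_commutes_def star_mult emb_simps)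
  qed
  have comc: "(\<lambda>m. norm (c m i j * b - b * c m i j)) \<longlonglongrightarrow> 0" if ij: "i < n" "j < n" and b: "b \<in> F" for i j b
  proof -
    have BYs: "Bseq (\<lambda>m. star (Y m i))" if "i < n" for i using asym_BseqD[OF asym_star[OF YY[OF that]]] by blast
    have comD: "asym_commutes D (emb b)" unfolding D_def[abs_def]
      using n b by (intro asym_commutes_mult comY comY' BY BYs) auto
    have BDM: "Bseq (\<lambda>m. D m ^ ?M)" using asym_BseqD[OF asym_power[OF DD]] by blast
    have "asym_commutes (\<lambda>m. Y m i * D m ^ ?M * star (Y m j)) (emb b)"
      using ij b by (intro asym_commutes_mult asym_commutes_power comY comY' comD BY BYs BD BDM Bseq_mult_algebra) auto
    from asym_commutes_asym[OF this cY[OF ij]]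
    have "(\<lambda>m. emb (c m i j) * emb b - emb b * emb (c m i j)) \<longlonglongrightarrow> 0" by (simp add: asym_commutes_def asym_def)
    then have "(\<lambda>m. emb (c m i j * b - b * c m i j)) \<longlonglongrightarrow> 0" by (simp add: emb_simps)
    from tendsto_norm_zero[OF this] show ?thesis by simp
  qed
  have "\<forall>\<^sub>F m in sequentially. (\<Sum>i<n. \<Sum>j<n. norm (c m i j * b - b * c m i j)) < \<epsilon>" if b: "b \<in> F" for b
  proof (rule order_tendstoD(2)[OF _ e])
    have "(\<lambda>m. \<Sum>i<n. \<Sum>j<n. norm (c m i j * b - b * c m i j)) \<longlonglongrightarrow> (\<Sum>i<n. \<Sum>j<n. 0)"
      using comc b by (intro tendsto_sum) auto
    then show "(\<lambda>m. \<Sum>i<n. \<Sum>j<n. norm (c m i j * b - b * c m i j)) \<longlonglongrightarrow> 0" by simp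
  qed
  then have ev1: "\<forall>\<^sub>F m in sequentially. \<forall>b\<in>F. (\<Sum>i<n. \<Sum>j<n. norm (c m i j * b - b * c m i j)) < \<epsilon>"
    using F by (simp add: eventually_ball_finite)
  define H' where "H' m = (\<Sum>i<n. Y m i * star (Y m i))" for m
  have pH: "positive (H' m)" for m unfolding H'_def by (intro positive_sum) simp
  have HH: "H' \<asymp> H'" unfolding H'_def[abs_def] by (intro asym_sum asym_mult asym_star YY) auto
  have HY: "(\<lambda>m. H' m * Y m j) \<asymp> (\<lambda>m. Y m j * D m)" if j: "j < n" for j
  proof -
    have "(\<lambda>m. H' m * Y m j) = (\<lambda>m. \<Sum>i<n. Y m i * (star (Y m i) * Y m j))"
      by (simp add: H'_def sum_distrib_right mult.assoc)
    also have "\<dots> \<asymp> (\<lambda>m. \<Sum>i<n. Y m i * (if i = j then D m else 0))"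
      using j by (intro asym_sum asym_mult YY ort) auto
    also have "\<dots> = (\<lambda>m. \<Sum>i<n. if i = j then Y m j * D m else 0)"
      by (intro ext sum.cong) auto
    finally show ?thesis using j by simp
  qed
  have HkY: "(\<lambda>m. H' m ^ k * Y m j) \<asymp> (\<lambda>m. Y m j * D m ^ k)" if j: "j < n" for j k
  proof (induction k)
    case 0 then show ?case using YY[OF j] by simp
  next
    case (Suc k)
    have "(\<lambda>m. H' m * (H' m ^ k * Y m j)) \<asymp> (\<lambda>m. H' m * (Y m j * D m ^ k))"
      by (intro asym_mult HH Suc)
    also have "\<dots> = (\<lambda>m. H' m * Y m j * D m ^ k)" by (simp add: mult.assoc)
    also have "\<dots> \<asymp> (\<lambda>m. Y m j * D m * D m ^ k)" by (intro asym_mult HY[OF j] asym_power DD)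
    finally show ?case by (simp add: mult.assoc)
  qed
  \<comment> \<open>H Y_j is close to Y_j D, so the powers of D inside the coefficients can be moved
    to the left as powers of H. Summing Y_i (star Y_i) contributes one more factor H.\<close>
  let ?N = "Suc ?M"
  define E where "E m = emb (\<phi> m (1\<^sub>m n)) - H' m ^ ?N" for m
  have "(\<lambda>m. emb (\<phi> m (1\<^sub>m n))) \<asymp> (\<lambda>m. H' m ^ ?N)"
  proof -
    have "(\<lambda>m. emb (\<phi> m (1\<^sub>m n))) = (\<lambda>m. \<Sum>i<n. emb (c m i i))" by (simp add: \<phi>_def mlin_one emb_sum)
    also have "\<dots> \<asymp> (\<lambda>m. \<Sum>i<n. Y m i * D m ^ ?M * star (Y m i))" by (intro asym_sum cY) auto
    also have "\<dots> \<asymp> (\<lambda>m. \<Sum>i<n. H' m ^ ?M * Y m i * star (Y m i))"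
      by (intro asym_sum asym_mult asym_star YY asym_sym[OF HkY]) auto
    also have "\<dots> = (\<lambda>m. H' m ^ ?M * H' m)" by (simp add: H'_def sum_distrib_left mult.assoc)
    finally show ?thesis by (simp only: power_Suc2)
  qed
  then have Elim: "E \<longlonglongrightarrow> 0" by (simp add: asym_def E_def[abs_def])
  let ?x = "emb x"
  have sx: "star ?x = ?x" using star_positive[OF x] by (simp add: star_emb_iff)
  define \<rho> where "\<rho> m = norm (?x * E m * ?x) + real ?N * d m" for m
  have "\<rho> \<longlonglongrightarrow> norm (?x * 0 * ?x) + real ?N * 0" unfolding \<rho>_def by (intro tendsto_intros Elim dlim)
  then have "\<rho> \<longlonglongrightarrow> 0" by simp
  then have ev2: "\<forall>\<^sub>F m in sequentially. \<rho> m < \<epsilon> / 2" by (rule order_tendstoD) (use e in simp)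
  obtain m where m: "\<forall>b\<in>F. (\<Sum>i<n. \<Sum>j<n. norm (c m i j * b - b * c m i j)) < \<epsilon>" "\<rho> m < \<epsilon> / 2"
    using eventually_happens'[OF _ eventually_conj[OF ev1 ev2]] by auto
  show "\<exists>\<phi>. cpc_order_zero n \<phi> \<and> cut_down (x * x - x * \<phi> (1\<^sub>m n) * x) \<epsilon> \<precsim> a \<and>
    (\<forall>z\<in>carrier_mat n n. mat_opnorm z \<le> 1 \<longrightarrow> (\<forall>b\<in>F. norm (\<phi> z * b - b * \<phi> z) < \<epsilon>))"
  proof (intro exI[of _ "\<phi> m"] conjI ballI impI oz)
    fix z b assume "z \<in> carrier_mat n n" "mat_opnorm z \<le> 1" "b \<in> F"
    then show "norm (\<phi> m z * b - b * \<phi> m z) < \<epsilon>"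
      unfolding \<phi>_def using commutator_bound[of z n "c m" b] m(1) by force
  next
    obtain w where w: "emb (x * x - x * (\<Sum>i<n. y m i * star (y m i)) * x) \<preceq> d m *\<^sub>R 1 + emb (w * a * star w)"
      using y[of m] by (auto simp: almost_columns_def)
    have e1: "emb (x * x - x * (\<Sum>i<n. y m i * star (y m i)) * x) = ?x * (1 - H' m) * ?x"
      by (simp add: emb_simps H'_def emb_sum Y_def algebra_simps)
    have s\<phi>: "star (emb (\<phi> m (1\<^sub>m n))) = emb (\<phi> m (1\<^sub>m n))"
    proof -
      have "star (\<phi> m (1\<^sub>m n)) = \<phi> m (1\<^sub>m n)"
        unfolding \<phi>_def mlin_one star_sum by (intro sum.cong refl) (simp add: c_def star_mult sg mult.assoc)
      then show ?thesis by (simp add: star_emb_iff)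
    qed
    have sHN: "star (H' m ^ ?N) = H' m ^ ?N" by (rule star_positive[OF positive_power[OF pH]])
    have sE: "star (E m) = E m" unfolding E_def star_diff s\<phi> sHN ..
    let ?y = "x * x - x * \<phi> m (1\<^sub>m n) * x"
    let ?w = "sqrt (real ?N) *\<^sub>R w"
    have "emb ?y = ?x * (1 - H' m ^ ?N) * ?x + - (?x * E m * ?x)"
      by (simp add: emb_simps E_def algebra_simps del: power_Suc)
    also have "\<dots> \<preceq> ?x * (real ?N *\<^sub>R (1 - H' m)) * ?x + norm (?x * E m * ?x) *\<^sub>R 1"
    proof (rule ple_add_mono)
      show "?x * (1 - H' m ^ ?N) * ?x \<preceq> ?x * (real ?N *\<^sub>R (1 - H' m)) * ?x"
        using ple_conj[OF bernoulli_ple[OF pH], of ?x] unfolding sx .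
      show "- (?x * E m * ?x) \<preceq> norm (?x * E m * ?x) *\<^sub>R 1"
        by (rule ple_norm) (simp_all add: star_mult sx sE mult.assoc)
    qed
    also have "?x * (real ?N *\<^sub>R (1 - H' m)) * ?x = real ?N *\<^sub>R (?x * (1 - H' m) * ?x)"
      by (simp only: mult_scaleR_right mult_scaleR_left)
    also have "real ?N *\<^sub>R (?x * (1 - H' m) * ?x) + norm (?x * E m * ?x) *\<^sub>R 1
      \<preceq> real ?N *\<^sub>R (d m *\<^sub>R 1 + emb (w * a * star w)) + norm (?x * E m * ?x) *\<^sub>R 1"
      using w unfolding e1 by (intro ple_add_mono ple_refl ple_scaleR) auto
    also have "\<dots> = \<rho> m *\<^sub>R 1 + emb (?w * a * star ?w)"
      by (simp add: \<rho>_def algebra_simps emb_simps del: of_nat_Suc)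
    also have "\<dots> \<preceq> (\<epsilon> / 2) *\<^sub>R 1 + emb (?w * a * star ?w)"
      using m(2) by (intro ple_add_mono ple_refl ple_scaleR_left) auto
    finally have "emb ?y \<preceq> (\<epsilon> / 2) *\<^sub>R 1 + emb (?w * a * star ?w)" .
    moreover have "star ?y = ?y"
    proof -
      have "star (\<phi> m (1\<^sub>m n)) = \<phi> m (1\<^sub>m n)" using s\<phi> by (simp add: star_emb_iff)
      then show ?thesis using star_positive[OF x] by (simp add: star_diff star_mult mult.assoc)
    qed
    ultimately show "cut_down ?y \<epsilon> \<precsim> a" using a e by (intro ple_cuntz_cut_down)
  qed
qed

text \<open>For an order zero map \<phi> these data are r_i = \<phi>(e_i0), g = \<phi>(e_00) and h =
  \<phi>(1). The columns sum to h^2, whereas the inequality concerns h; its 2 \<epsilon> consists of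
  the cut-down at \<epsilon> and the error of one Cuntz approximation.\<close>

definition exact_columns_for ::
  "nat \<Rightarrow> 'a::cstar_algebra \<Rightarrow> 'a \<Rightarrow> 'a set \<Rightarrow> real \<Rightarrow> (nat \<Rightarrow> 'a) \<Rightarrow> 'a \<Rightarrow> 'a \<Rightarrow> 'a \<Rightarrow> bool" where
  "exact_columns_for n x a F \<epsilon> r g h v \<longleftrightarrow>
     (\<forall>i<n. norm (r i) \<le> 1 \<and> (\<forall>b\<in>F. norm (r i * b - b * r i) \<le> \<epsilon>)) \<and>
     (\<forall>i<n. \<forall>j<n. star (r i) * r j = (if i = j then g * g else 0)) \<and> star g = g \<and> norm g \<le> 1 \<and>
     (\<Sum>i<n. r i * star (r i)) = h * h \<and> positive h \<and> norm h \<le> 1 \<and>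
     emb (x * x - x * h * x) \<preceq> (2 * \<epsilon>) *\<^sub>R 1 + emb (v * a * star v)"

lemma exact_columns_for_exists:
  fixes x a :: "'a::cstar_algebra"
  assumes tza: "tracially_Z_absorbing TYPE('a)"
    and "positive x" "positive a" "a \<noteq> 0" "finite F" "\<epsilon> > 0" "n \<ge> 1"
  shows "\<exists>r g h v. exact_columns_for n x a F \<epsilon> r g h v"
proof -
  obtain \<phi> :: "complex mat \<Rightarrow> 'a" where oz: "cpc_order_zero n \<phi>"
    and sub: "cut_down (x * x - x * \<phi> (1\<^sub>m n) * x) \<epsilon> \<precsim> a"
    and com: "\<And>z b. z \<in> carrier_mat n n \<Longrightarrow> mat_opnorm z \<le> 1 \<Longrightarrow> b \<in> F \<Longrightarrow> norm (\<phi> z * b - b * \<phi> z) < \<epsilon>"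
    using tza[unfolded tracially_Z_absorbing_def, THEN conjunct2, rule_format, OF assms(2-7)] by auto
  interpret order_zero n \<phi> by standard (rule oz)
  have n: "0 < n" using assms by simp
  have carr: "mat_unit n i j \<in> carrier_mat n n" for i j by (simp add: mat_unit_def)
  have sx: "star x = x" using assms star_positive by blast
  have sh: "star (\<phi> (1\<^sub>m n)) = \<phi> (1\<^sub>m n)" using positive_phi_one star_positive by blast
  have "star (x * x - x * \<phi> (1\<^sub>m n) * x) = x * x - x * \<phi> (1\<^sub>m n) * x"
    by (simp add: star_diff star_mult sx sh mult.assoc)
  from cuntz_cut_down_ple[OF this \<open>positive a\<close> \<open>\<epsilon> > 0\<close> \<open>\<epsilon> > 0\<close> sub] obtain v where
    v: "emb (x * x - x * \<phi> (1\<^sub>m n) * x) \<preceq> (\<epsilon> + \<epsilon>) *\<^sub>R 1 + emb (v * a * star v)" .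
  have nf: "norm (f i 0) \<le> 1" if "i < n" for i
    unfolding f_def using contractive[OF carr] mat_opnorm_mat_unit[OF that n] by (rule order_trans)
  have "exact_columns_for n x a F \<epsilon> (\<lambda>i. f i 0) (f 0 0) (\<phi> (1\<^sub>m n)) v"
    unfolding exact_columns_for_def
  proof (intro conjI allI impI ballI)
    fix i b assume "i < n" "b \<in> F"
    then show "norm (f i 0 * b - b * f i 0) \<le> \<epsilon>"
      unfolding f_def by (intro less_imp_le com carr mat_opnorm_mat_unit n)
  next
    show "norm (\<phi> (1\<^sub>m n)) \<le> 1" using contractive[of "1\<^sub>m n"] mat_opnorm_one[of n] by simp
  next
    show "emb (x * x - x * \<phi> (1\<^sub>m n) * x) \<preceq> (2 * \<epsilon>) *\<^sub>R 1 + emb (v * a * star v)" using v by simp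
  qed (use n nf column_orthogonal column_sum star_f positive_phi_one in auto)
  then show ?thesis by blast
qed

lemma asym_commutesI:
  assumes r: "\<And>m. norm (r m) \<le> 1" and com: "\<And>m. norm (r m * b - b * r m) \<le> inverse (real (Suc m))"
  shows "asym_commutes r (b :: 'a::cstar_algebra)"
  unfolding asym_commutes_def
proof (rule asymI_ge[OF _ com LIMSEQ_inverse_real_of_nat])
  show "Bseq (\<lambda>m. b * r m)" using r by (intro Bseq_mult_algebra Bfun_const BseqI')
qed

lemma asym_commutes_star:
  assumes "asym_commutes r (star b)" shows "asym_commutes (\<lambda>m. star (r m)) (b :: 'a::cstar_algebra)"
  using asym_sym[OF asym_star[OF assms[unfolded asym_commutes_def]]]
  by (simp add: asym_commutes_def star_mult)

section \<open>Simple C*-algebras without minimal projections\<close>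

lemma scaleC_cancel: "x \<noteq> 0 \<Longrightarrow> z *\<^sub>C x = w *\<^sub>C (x :: 'a::complex_normed_vector) \<longleftrightarrow> z = w"
proof -
  assume x: "x \<noteq> 0"
  have "norm (z *\<^sub>C x - w *\<^sub>C x) = cmod (z - w) * norm x"
    by (simp flip: scaleC_diff_left add: norm_scaleC)
  then show ?thesis using x by (metis eq_iff_diff_eq_0 mult_eq_0_iff norm_eq_zero)
qed

text \<open>The elements x with x c q = 0 for all c form a closed ideal. It is proper, since
  otherwise \<open>star q * q * star q * q\<close> would vanish, so simplicity makes it
  zero.\<close>

lemma simple_connecting:
  fixes p q :: "'a::cstar_algebra"
  assumes simple: "simple_cstar TYPE('a)" and p: "p \<noteq> 0" and q: "q \<noteq> 0"
  obtains c where "p * c * q \<noteq> 0"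
proof -
  define I where "I = {x :: 'a. \<forall>c. x * c * q = 0}"
  have "closed I"
  proof -
    have "I = (\<Inter>c. (\<lambda>x. x * c * q) -` {0})" by (auto simp: I_def)
    then show ?thesis by (auto intro!: closed_INT closed_vimage continuous_intros)
  qed
  moreover have "a * x \<in> I \<and> x * a \<in> I" if "x \<in> I" for a x
  proof -
    have "a * x * c * q = a * (x * c * q)" "x * a * c * q = x * (a * c) * q" for c by (simp_all only: mult.assoc)
    then show ?thesis using that by (simp add: I_def)
  qed
  ultimately have "closed_ideal I" unfolding closed_ideal_def
    by (auto simp: I_def distrib_right scaleC_mult_left)
  moreover have "I \<noteq> UNIV"
  proof
    assume "I = UNIV"
    then have "star q * (q * star q) * q = 0" by (auto simp: I_def)
    then have "(star q * q) * star (star q * q) = 0" by (simp add: star_mult mult.assoc)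
    then show False using q by (simp only: mult_star_self_eq_0_iff star_mult_self_eq_0_iff)
  qed
  ultimately have "I = {0}" using simple by (auto simp: simple_cstar_def)
  then have "p \<notin> I" using p by simp
  then show ?thesis using that by (auto simp: I_def)
qed

section \<open>Minimal projections contradict tracial absorption\<close>

definition minimal_projection :: "'a::cstar_algebra \<Rightarrow> bool" where
  "minimal_projection p \<longleftrightarrow> p \<noteq> 0 \<and> star p = p \<and> p * p = p \<and> (\<forall>a. \<exists>z. p * a * p = z *\<^sub>C p)"

lemma norm_projection:
  assumes "p \<noteq> 0" "star p = p" "p * p = (p :: 'a::cstar_algebra)" shows "norm p = 1"
  using cstar_identity[of p] assms by (simp add: power2_eq_square)

text \<open>\<open>star w * w\<close> lies in p A p and so is a multiple of \<open>p\<close>.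
  Dividing \<open>w\<close> by its norm therefore gives a partial isometry with source projection
  \<open>p\<close>.\<close>

lemma minimal_projection_positive:
  assumes p: "minimal_projection p" and w: "w * p = w"
  shows "star w * w = (norm w)\<^sup>2 *\<^sub>R (p :: 'a::cstar_algebra)"
proof -
  have p0: "p \<noteq> 0" and sp: "star p = p" and pp: "p * p = p" using p by (auto simp: minimal_projection_def)
  have "star w * w = p * (star w * w) * p" using w sp by (metis mult.assoc star_mult)
  then obtain z where z: "star w * w = z *\<^sub>C p" using p by (metis minimal_projection_def)
  have "cnj z *\<^sub>C p = z *\<^sub>C p" using z by (metis sp star_mult star_scaleC star_star)
  then have "cnj z = z" using scaleC_cancel[OF p0] by blast
  then have zr: "z = of_real (Re z)" by (simp add: complex_eq_iff)
  have zp: "star w * w = Re z *\<^sub>R p" using z zr by (metis scaleC_of_real)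
  have "Re z \<ge> 0"
  proof (rule ccontr)
    assume neg: "\<not> Re z \<ge> 0"
    have "positive (emb (Re z *\<^sub>R p))" unfolding zp[symmetric] positive_emb_iff by simp
    moreover have "positive (- emb (Re z *\<^sub>R p))"
    proof -
      have "positive ((- Re z) *\<^sub>R p)" using neg positive_square[OF sp] pp by (intro positive_scaleR) auto
      then show ?thesis by (metis emb_simps(3) positive_emb_iff scaleR_minus_left)
    qed
    ultimately have "emb (Re z *\<^sub>R p) = 0" by (rule positive_antisym)
    then show False using p0 neg by simp
  qed
  moreover have "(norm w)\<^sup>2 = \<bar>Re z\<bar>"
    using cstar_identity[of w] norm_projection[OF p0 sp pp] by (simp add: zp)
  ultimately show ?thesis using zp by simp
qed

lemma minimal_projection_corner:
  assumes p: "minimal_projection p" and all: "\<And>a. p * a * p = (a :: 'a::cstar_algebra)"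
  shows "cstar_isomorphic TYPE('a) TYPE(complex)"
proof -
  have p0: "p \<noteq> 0" and sp: "star p = p" and pp: "p * p = p" using p by (auto simp: minimal_projection_def)
  have "\<forall>a. \<exists>z. a = z *\<^sub>C p" using p all by (metis minimal_projection_def)
  then obtain \<pi> where \<pi>: "\<And>a. a = \<pi> a *\<^sub>C p" by metis
  have eq: "\<pi> a = z" if "a = z *\<^sub>C p" for a z using \<pi>[of a] that scaleC_cancel[OF p0] by metis
  have "star_hom \<pi>" unfolding star_hom_def
  proof (intro conjI allI)
    fix x y :: 'a and c
    show "\<pi> (x + y) = \<pi> x + \<pi> y" by (rule eq) (metis \<pi> scaleC_add_left)
    show "\<pi> (c *\<^sub>C x) = c *\<^sub>C \<pi> x" unfolding scaleC_complex_def by (rule eq) (metis \<pi> scaleC_scaleC)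
    show "\<pi> (x * y) = \<pi> x * \<pi> y"
      by (rule eq) (metis \<pi> pp scaleC_mult_left scaleC_mult_right scaleC_scaleC)
    show "\<pi> (star x) = star (\<pi> x)" unfolding star_complex_def by (rule eq) (metis \<pi> sp star_scaleC)
  qed
  moreover have "bij \<pi>"
  proof (rule bijI)
    show "inj \<pi>" by (rule injI) (metis \<pi>)
    show "surj \<pi>" by (rule surjI[of _ "\<lambda>z. z *\<^sub>C p"]) (rule eq, rule refl)
  qed
  ultimately show ?thesis unfolding cstar_isomorphic_def by blast
qed

text \<open>A unit vector in the plane orthogonal to (\<alpha>, \<beta>): it exists because one
  vector cannot span the plane.\<close>

lemma unit_annihilator:
  obtains \<gamma> \<kappa> :: complex where "(cmod \<gamma>)\<^sup>2 + (cmod \<kappa>)\<^sup>2 = 1" "cnj \<gamma> * \<alpha> + cnj \<kappa> * \<beta> = 0"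
proof (cases "\<alpha> = 0 \<and> \<beta> = 0")
  case True then show ?thesis using that[of 1 0] by simp
next
  case False
  define r where "r = sqrt ((cmod \<alpha>)\<^sup>2 + (cmod \<beta>)\<^sup>2)"
  have r2: "r\<^sup>2 = (cmod \<alpha>)\<^sup>2 + (cmod \<beta>)\<^sup>2" by (simp add: r_def)
  have r: "r > 0" using False by (auto simp: r_def add_pos_nonneg add_nonneg_pos)
  show ?thesis
  proof (rule that[of "cnj \<beta> / of_real r" "- cnj \<alpha> / of_real r"])
    show "(cmod (cnj \<beta> / of_real r))\<^sup>2 + (cmod (- cnj \<alpha> / of_real r))\<^sup>2 = 1"
    proof -
      have "(cmod (cnj \<beta> / of_real r))\<^sup>2 + (cmod (- cnj \<alpha> / of_real r))\<^sup>2 = ((cmod \<beta>)\<^sup>2 + (cmod \<alpha>)\<^sup>2) / r\<^sup>2"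
        by (simp add: norm_divide power_divide add_divide_distrib)
      also have "(cmod \<beta>)\<^sup>2 + (cmod \<alpha>)\<^sup>2 = r\<^sup>2" by (simp add: r2)
      finally show ?thesis using r by simp
    qed
    show "cnj (cnj \<beta> / of_real r) * \<alpha> + cnj (- cnj \<alpha> / of_real r) * \<beta> = 0" by simp
  qed
qed

text \<open>A minimal projection \<open>p\<close> together with a partial isometry \<open>u\<close> from \<open>p\<close> to an orthogonal
  projection: an order zero map on \<open>M\<^sub>2\<close> which almost commutes with \<open>p\<close> and \<open>u\<close> almost vanishes
  on \<open>x = p + u u\<^sup>*\<close>, and \<open>x\<close> has rank two.\<close>

lemma no_minimal_projection:
  assumes simple: "simple_cstar TYPE('a::cstar_algebra)" and tza: "tracially_Z_absorbing TYPE('a)"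
  shows "\<not> minimal_projection (p::'a)"
proof
  assume p: "minimal_projection p"
  have p0: "p \<noteq> 0" and sp: "star p = p" and pp: "p * p = p" using p by (auto simp: minimal_projection_def)
  have np: "norm p = 1" by (rule norm_projection[OF p0 sp pp])
  have "\<not> cstar_isomorphic TYPE('a) TYPE(complex)" using tza by (simp add: tracially_Z_absorbing_def)
  then obtain a where "p * a * p \<noteq> a" using minimal_projection_corner[OF p] by blast
  then have "a \<noteq> p * a \<or> star a \<noteq> p * star a" using sp by (metis mult.assoc star_mult star_star)
  then obtain b where b: "b - p * b \<noteq> 0" by auto
  \<comment> \<open>As A is not \<complex>, \<open>p\<close> is not a unit of A and some (1 - p) b
    is nonzero. Connecting it to \<open>p\<close> gives w with p w = 0 and w p = w, whose
    normalization is the partial isometry \<open>u\<close>.\<close>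
  obtain c where c: "(b - p * b) * c * p \<noteq> 0" using simple_connecting[OF simple b p0] by blast
  define w where "w = (b - p * b) * c * p"
  have w0: "w \<noteq> 0" using c by (simp add: w_def)
  have wp: "w * p = w" by (simp add: w_def mult.assoc pp)
  have pw: "p * w = 0" by (simp add: w_def algebra_simps pp) (simp add: pp flip: mult.assoc)
  define u where "u = (1 / norm w) *\<^sub>R w"
  have up: "u * p = u" and pu: "p * u = 0" by (simp_all add: u_def wp pw)
  have uu: "star u * u = p"
    using minimal_projection_positive[OF p wp] w0 by (simp add: u_def power2_eq_square)
  have psu: "p * star u = star u" using up by (metis sp star_mult)
  have sup: "star u * p = 0" using pu by (metis sp star_mult star_zero)
  define x where "x = p + u * star u"
  have xp: "x * p = p" by (simp add: x_def distrib_right pp mult.assoc sup)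
  have xu: "x * u = u" by (simp add: x_def distrib_right pu mult.assoc uu up)
  have "x * x = x * p + (x * u) * star u" by (subst (2) x_def) (simp only: distrib_left mult.assoc)
  also have "\<dots> = x" unfolding xp xu by (simp only: x_def)
  finally have xx: "x * x = x" .
  have sx: "star x = x" by (simp add: x_def star_add star_mult sp)
  have px: "positive x" using positive_square[OF sx] xx by simp
  have ppos: "positive p" using positive_square[OF sp] pp by simp
  define d where "d m = inverse (real (Suc m))" for m
  have d0: "d m > 0" for m by (simp add: d_def)
  have dlim: "d \<longlonglongrightarrow> 0" unfolding d_def by (rule LIMSEQ_inverse_real_of_nat)
  have "\<forall>m. \<exists>r g h v. exact_columns_for 2 x p {p, u, star u} (d m) r g h v"
    using exact_columns_for_exists[OF tza px ppos p0 _ d0] by simp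
  then obtain r g h V where C: "\<And>m. exact_columns_for 2 x p {p, u, star u} (d m) (r m) (g m) (h m) (V m)" by metis
  note C = C[unfolded exact_columns_for_def]
  have r1: "norm (r m i) \<le> 1" if "i < 2" for m i using C that by blast
  have com: "asym_commutes (\<lambda>m. r m i) b" if "i < 2" "b \<in> {p, u, star u}" for i b
    using C that r1 unfolding d_def by (intro asym_commutesI) blast+
  have hh: "h m * h m = (\<Sum>i<2. r m i * star (r m i))" and sh: "star (h m) = h m"
    and orth: "i < 2 \<Longrightarrow> j < 2 \<Longrightarrow> star (r m i) * r m j = (if i = j then g m * g m else 0)" for m i j
    using C by (auto intro: star_positive)
  have rr: "(\<lambda>m. r m i) \<asymp> (\<lambda>m. r m i)" if "i < 2" for i
    using r1[OF that] by (intro asym_refl BseqI')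
  note AI = asym_sum asym_mult asym_const asym_star rr
  \<comment> \<open>Compressed to \<open>p\<close>, the columns become scalars. Two scalars of
    asymptotically equal modulus whose product tends to 0 must both tend to 0: an order zero map
    from the two by two matrices has no room in a one-dimensional corner.\<close>
  define \<omega> where "\<omega> m i = p * r m i * p" for m i
  have \<omega>p: "\<exists>z. \<omega> m i = z *\<^sub>C p" for m i using p unfolding \<omega>_def minimal_projection_def by blast
  have pp': "p * (p * z) = p * z" for z by (simp add: pp flip: mult.assoc)
  have left: "(\<lambda>m. star (\<omega> m i) * \<omega> m j) \<asymp> (\<lambda>m. if i = j then p * (g m * g m) * p else 0)" if "i < 2" "j < 2" for i j
  proof -
    have "(\<lambda>m. star (\<omega> m i) * \<omega> m j) = (\<lambda>m. p * star (r m i) * (p * r m j) * p)"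
      by (simp add: \<omega>_def star_mult sp mult.assoc pp')
    also have "\<dots> \<asymp> (\<lambda>m. p * star (r m i) * (r m j * p) * p)"
      by (intro AI that asym_sym[OF com[unfolded asym_commutes_def]]) simp
    also have "\<dots> = (\<lambda>m. p * (star (r m i) * r m j) * p)" by (simp add: mult.assoc pp)
    finally show ?thesis by (cases "i = j") (simp_all add: orth that)
  qed
  have right: "(\<lambda>m. p * r m i * p * star (r m i) * p) = (\<lambda>m. \<omega> m i * star (\<omega> m i))" for i
    by (simp add: \<omega>_def star_mult sp mult.assoc pp')
  have null: "X \<asymp> (\<lambda>m. 0)" if "(\<lambda>m. star (X m) * X m) \<asymp> (\<lambda>m. 0)" for X :: "nat \<Rightarrow> 'a"
  proof -
    have "(\<lambda>m. norm (star (X m) * X m)) \<longlonglongrightarrow> 0" using that by (intro tendsto_norm_zero) (simp add: asym_null)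
    then have "(\<lambda>m. (norm (X m))\<^sup>2) \<longlonglongrightarrow> 0" by (simp add: cstar_identity)
    from tendsto_real_sqrt[OF this] show ?thesis by (simp add: asym_null tendsto_norm_zero_iff)
  qed
  define P where "P i m = star (\<omega> m i) * \<omega> m i" for i m
  have PP: "P 0 \<asymp> P 1" "P 1 \<asymp> P 0" "P 0 \<asymp> P 0" "P 1 \<asymp> P 1"
    using left[of 0 0] left[of 1 1] unfolding P_def[abs_def] by (auto intro: asym_trans asym_sym)
  have "(\<lambda>m. star (star (\<omega> m 0) * \<omega> m 1) * (star (\<omega> m 0) * \<omega> m 1)) \<asymp> (\<lambda>m. star 0 * 0)"
    using left[of 0 1] by (intro asym_mult asym_star) auto
  moreover have "star (star (\<omega> m 0) * \<omega> m 1) * (star (\<omega> m 0) * \<omega> m 1) = P 0 m * P 1 m" for m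
  proof -
    obtain z w where "\<omega> m 0 = z *\<^sub>C p" "\<omega> m 1 = w *\<^sub>C p" using \<omega>p by metis
    then show ?thesis
      by (simp add: P_def star_mult star_scaleC scaleC_mult_left scaleC_mult_right scaleC_scaleC pp sp mult_ac)
  qed
  ultimately have P01: "(\<lambda>m. P 0 m * P 1 m) \<asymp> (\<lambda>m. 0)" by simp
  have "(\<lambda>m. \<omega> m i) \<asymp> (\<lambda>m. 0)" if "P i \<asymp> P 0" "P i \<asymp> P 1" for i
  proof (rule null)
    have "(\<lambda>m. star (P i m) * P i m) = (\<lambda>m. P i m * P i m)" by (simp add: P_def star_mult)
    also have "\<dots> \<asymp> (\<lambda>m. P 0 m * P 1 m)" by (intro asym_mult that)
    also note P01
    finally have "P i \<asymp> (\<lambda>m. 0)" by (rule null)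
    then show "(\<lambda>m. star (\<omega> m i) * \<omega> m i) \<asymp> (\<lambda>m. 0)" by (simp add: P_def[abs_def])
  qed
  then have "(\<lambda>m. \<omega> m i) \<asymp> (\<lambda>m. 0)" if "i < 2" for i using PP that by (auto simp: less_2_cases_iff)
  then have "(\<lambda>m. \<Sum>i<2. \<omega> m i * star (\<omega> m i)) \<asymp> (\<lambda>m. \<Sum>i<(2::nat). 0 * star 0)"
    by (intro asym_sum asym_mult asym_star) auto
  then have \<omega>0: "(\<lambda>m. \<Sum>i<2. \<omega> m i * star (\<omega> m i)) \<asymp> (\<lambda>m. 0)" by simp
  have hp: "(\<lambda>m. h m * p) \<asymp> (\<lambda>m. 0)"
  proof (rule null)
    have "star (h m * p) * (h m * p) = p * (h m * h m) * p" for m by (simp add: star_mult sp sh mult.assoc)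
    then have "(\<lambda>m. star (h m * p) * (h m * p)) = (\<lambda>m. \<Sum>i<2. p * (p * r m i) * star (r m i) * p)"
      unfolding hh by (simp add: sum_distrib_left sum_distrib_right pp flip: mult.assoc)
    also have "\<dots> \<asymp> (\<lambda>m. \<Sum>i<2. p * (r m i * p) * star (r m i) * p)"
      by (intro AI asym_sym[OF com[unfolded asym_commutes_def]]) auto
    also have "\<dots> = (\<lambda>m. \<Sum>i<2. \<omega> m i * star (\<omega> m i))" using fun_cong[OF right] by (simp flip: mult.assoc)
    also note \<omega>0
    finally show "(\<lambda>m. star (h m * p) * (h m * p)) \<asymp> (\<lambda>m. 0)" .
  qed
  \<comment> \<open>Moving u past the columns brings \<open>star u * u\<close> = p into the middle,
    so the compression to the second projection has the same limit as the compression to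
    \<open>p\<close>.\<close>
  have hu: "(\<lambda>m. h m * u) \<asymp> (\<lambda>m. 0)"
  proof (rule null)
    have "star (h m * u) * (h m * u) = p * (star u * (h m * h m) * u) * p" for m
    proof -
      have "star (h m * u) * (h m * u) = (p * star u) * (h m * h m) * (u * p)"
        unfolding psu up by (simp add: star_mult sh mult.assoc)
      then show ?thesis by (simp only: mult.assoc)
    qed
    then have "(\<lambda>m. star (h m * u) * (h m * u)) = (\<lambda>m. \<Sum>i<2. p * (star u * r m i) * (star (r m i) * u) * p)"
      unfolding hh by (simp add: sum_distrib_left sum_distrib_right mult.assoc)
    also have "\<dots> \<asymp> (\<lambda>m. \<Sum>i<2. p * (r m i * star u) * (u * star (r m i)) * p)"
      by (intro AI asym_sym[OF com[unfolded asym_commutes_def]] asym_commutes_star[unfolded asym_commutes_def]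
          com[unfolded asym_commutes_def]) auto
    also have "\<dots> = (\<lambda>m. \<Sum>i<2. \<omega> m i * star (\<omega> m i))"
    proof -
      have "p * (r m i * star u) * (u * star (r m i)) * p = p * r m i * (star u * u) * star (r m i) * p" for m i
        by (simp only: mult.assoc)
      then show ?thesis using fun_cong[OF right] by (simp add: uu)
    qed
    also note \<omega>0
    finally show "(\<lambda>m. star (h m * u) * (h m * u)) \<asymp> (\<lambda>m. 0)" .
  qed
  have ineq: "1 \<le> 2 * d m + (norm (h m * p) + norm (h m * u))" for m
  proof -
    define v where "v = V m"
    have v: "emb (x * x - x * h m * x) \<preceq> (2 * d m) *\<^sub>R 1 + emb (v * p * star v)" using C by (simp add: v_def)
    \<comment> \<open>\<alpha> and \<beta> are the coordinates of v p along p and u. For a unit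
      vector k in the span of p and u that is orthogonal to v p, compression by k removes the rank
      one term v p (star v) and leaves p below 2 d p plus the compression of h, which tends to
      0.\<close>
    obtain \<alpha> where \<alpha>: "p * v * p = \<alpha> *\<^sub>C p" using p unfolding minimal_projection_def by blast
    obtain \<beta> where "p * (star u * v) * p = \<beta> *\<^sub>C p" using p unfolding minimal_projection_def by blast
    then have \<beta>: "star u * v * p = \<beta> *\<^sub>C p" by (simp add: psu flip: mult.assoc)
    obtain \<gamma> \<kappa> where \<gamma>: "(cmod \<gamma>)\<^sup>2 + (cmod \<kappa>)\<^sup>2 = 1" "cnj \<gamma> * \<alpha> + cnj \<kappa> * \<beta> = 0"
      using unit_annihilator by blast
    define k where "k = \<gamma> *\<^sub>C p + \<kappa> *\<^sub>C u"
    have sk: "star k = cnj \<gamma> *\<^sub>C p + cnj \<kappa> *\<^sub>C star u" by (simp add: k_def star_add star_scaleC sp)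
    have kk: "star k * k = p"
    proof -
      have "star k * k = (cnj \<gamma> * \<gamma>) *\<^sub>C p + (cnj \<kappa> * \<kappa>) *\<^sub>C p" unfolding sk
        by (simp add: k_def algebra_simps scaleC_mult_left scaleC_mult_right scaleC_scaleC scaleC_add_right pp pu sup uu)
      also have "\<dots> = (of_real ((cmod \<gamma>)\<^sup>2 + (cmod \<kappa>)\<^sup>2)) *\<^sub>C p"
        by (simp only: of_real_add complex_norm_square scaleC_add_left mult.commute)
      finally show ?thesis using \<gamma>(1) by simp
    qed
    have kvp: "star k * v * p = 0"
    proof -
      have "star k * v * p = cnj \<gamma> *\<^sub>C (p * v * p) + cnj \<kappa> *\<^sub>C (star u * v * p)" unfolding sk
        by (simp add: distrib_right scaleC_mult_left)
      also have "\<dots> = (cnj \<gamma> * \<alpha> + cnj \<kappa> * \<beta>) *\<^sub>C p" by (simp add: \<alpha> \<beta> scaleC_scaleC scaleC_add_left)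
      finally show ?thesis using \<gamma>(2) by simp
    qed
    have xk: "x * k = k" by (simp add: k_def distrib_left scaleC_mult_right xp xu)
    have kx: "star k * x = star k" using xk by (metis star_mult sx)
    have "star (emb k) * emb (x * x - x * h m * x) * emb k = emb (p - star k * h m * k)"
    proof -
      have "star k * (x * x - x * h m * x) * k = star k * (x * (x * k)) - (star k * x) * h m * (x * k)"
        by (simp add: algebra_simps)
      then have "star k * (x * x - x * h m * x) * k = p - star k * h m * k" by (simp add: xk kx kk)
      then show ?thesis by (metis emb_simps(5,8))
    qed
    moreover have "star (emb k) * ((2 * d m) *\<^sub>R 1 + emb (v * p * star v)) * emb k = emb ((2 * d m) *\<^sub>R p)"
    proof -
      have "star k * (v * p * star v) * k = (star k * v * p) * (star v * k)" by (simp only: mult.assoc)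
      then have 0: "star k * (v * p * star v) * k = 0" by (simp add: kvp)
      have "star (emb k) * ((2 * d m) *\<^sub>R 1 + emb (v * p * star v)) * emb k
        = emb ((2 * d m) *\<^sub>R (star k * k) + star k * (v * p * star v) * k)"
        by (simp add: emb_simps algebra_simps)
      then show ?thesis by (simp add: 0 kk)
    qed
    ultimately have "emb (p - star k * h m * k) \<preceq> emb ((2 * d m) *\<^sub>R p)"
      using ple_conj[OF v, of "emb k"] by simp
    then have "emb p \<preceq> emb ((2 * d m) *\<^sub>R p + star k * h m * k)"
      by (simp add: ple_def emb_simps algebra_simps)
    then have "norm (emb p) \<le> norm (emb ((2 * d m) *\<^sub>R p + star k * h m * k))"
      using ppos by (intro norm_mono) (simp_all add: positive_emb_iff)
    then have "1 \<le> norm ((2 * d m) *\<^sub>R p + star k * (h m * k))" by (simp add: np mult.assoc)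
    also have "\<dots> \<le> norm ((2 * d m) *\<^sub>R p) + norm (star k * (h m * k))" by (rule norm_triangle_ineq)
    also have "norm ((2 * d m) *\<^sub>R p) = 2 * d m" using d0[of m] by (simp add: np)
    also have "norm (star k * (h m * k)) \<le> norm (h m * k)"
    proof -
      have "(norm k)\<^sup>2 = 1" using cstar_identity[of k] by (simp add: kk np)
      then have "norm (star k) = 1" using norm_ge_zero[of k] by (auto simp: power2_eq_1_iff simp del: norm_ge_zero)
      then show ?thesis using norm_mult_ineq[of "star k" "h m * k"] by simp
    qed
    also have "norm (h m * k) \<le> norm (h m * p) + norm (h m * u)"
    proof -
      have "(cmod \<gamma>)\<^sup>2 \<le> 1\<^sup>2" "(cmod \<kappa>)\<^sup>2 \<le> 1\<^sup>2"
        using \<gamma>(1) zero_le_power2[of "cmod \<gamma>"] zero_le_power2[of "cmod \<kappa>"] unfolding power_one by linarith+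
      then have "cmod \<gamma> \<le> 1" "cmod \<kappa> \<le> 1" using power2_le_imp_le zero_le_one by blast+
      then have "cmod \<gamma> * norm (h m * p) \<le> norm (h m * p)" "cmod \<kappa> * norm (h m * u) \<le> norm (h m * u)"
        by (simp_all add: mult_left_le_one_le)
      moreover have "norm (h m * k) \<le> cmod \<gamma> * norm (h m * p) + cmod \<kappa> * norm (h m * u)"
        unfolding k_def distrib_left scaleC_mult_right norm_scaleC[symmetric] by (rule norm_triangle_ineq)
      ultimately show ?thesis by linarith
    qed
    finally show ?thesis by simp
  qed
  have "(\<lambda>m. 2 * d m + (norm (h m * p) + norm (h m * u))) \<longlonglongrightarrow> 2 * 0 + (0 + 0)"
    using hp hu by (intro tendsto_intros dlim tendsto_norm_zero) (auto simp: asym_null)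
  then have "1 \<le> (0::real)" using ineq by (intro LIMSEQ_le_const[of _ 0 1]) auto
  then show False by simp
qed

lemma emb_mult_emb_range: "\<exists>a. emb b * u * emb c = emb a"
  using uscal_eq_0_iff[of "emb b * u * emb c"] by auto

section \<open>Orthogonal elements in hereditary subalgebras, and equivalent copies\<close>

definition her_pair :: "'a::cstar_algebra \<Rightarrow> bool" where
  "her_pair a \<longleftrightarrow> (\<exists>b1 b2. positive b1 \<and> positive b2 \<and> b1 \<noteq> 0 \<and> b2 \<noteq> 0 \<and> b1 * b2 = 0 \<and>
     (\<exists>c. b1 = a * c * a) \<and> (\<exists>c. b2 = a * c * a))"

text \<open>If the functions \<open>t\<^sup>4 (t - s)\<^sub>+\<close> and \<open>t\<^sup>4 (s - t)\<^sub>+\<close> never give two nonzero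
  elements, then the spectrum of \<open>a\<close> is contained in \<open>{0, 1}\<close>.\<close>

lemma projection_of_no_her_pair:
  fixes a :: "'a::cstar_algebra"
  assumes a: "positive a" and na: "norm a = 1" and no: "\<not> her_pair a"
  shows "a * a = a"
proof -
  let ?a = "emb a"
  have pa: "positive ?a" using a by (simp add: positive_emb_iff)
  have sa: "star ?a = ?a" by (rule star_positive[OF pa])
  have rs: "0 \<le> t \<and> t \<le> 1" if "t \<in> rspec ?a" for t
    using positive_rspec[OF pa that] rspec_le[OF that] na by simp
  \<comment> \<open>Four factors of t: two bring k(a) from the unitization into the algebra as c = a
    k(a) a, and two more write the result as a c a.\<close>
  define q where "q t = t * t * t * t" for t :: real
  define f where "f s t = max (t - s) 0" for s t :: real
  define g where "g s t = max (s - t) 0" for s t :: real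
  have q: "continuous_on UNIV q" unfolding q_def by (intro continuous_intros)
  have f: "continuous_on UNIV (f s)" for s unfolding f_def by (intro continuous_intros)
  have g: "continuous_on UNIV (g s)" for s unfolding g_def by (intro continuous_intros)
  have qa: "ucfc q ?a = ?a * ?a * ?a * ?a"
    unfolding q_def by (simp add: ucfc_mult[OF sa] ucfc_id[OF sa] continuous_intros continuous_on_id)
  have her: "\<exists>b. emb b = ucfc (\<lambda>t. q t * k t) ?a \<and> (\<exists>c. b = a * c * a) \<and> positive b"
    if k: "continuous_on UNIV k" and k0: "\<And>t. k t \<ge> 0" for k
  proof -
    obtain c where c: "?a * ucfc k ?a * ?a = emb c" using emb_mult_emb_range by blast
    have kc: "?a * ucfc k ?a = ucfc k ?a * ?a" by (rule ucfc_commute[OF sa k refl])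
    have "ucfc (\<lambda>t. q t * k t) ?a = ?a * ?a * ?a * (?a * ucfc k ?a)"
      by (simp add: ucfc_mult[OF sa q k] qa mult.assoc)
    also have "\<dots> = ?a * ?a * ?a * (ucfc k ?a * ?a)" by (simp only: kc)
    also have "\<dots> = ?a * ?a * (?a * ucfc k ?a) * ?a" by (simp only: mult.assoc)
    also have "\<dots> = ?a * ?a * (ucfc k ?a * ?a) * ?a" by (simp only: kc)
    also have "\<dots> = ?a * (?a * ucfc k ?a * ?a) * ?a" by (simp only: mult.assoc)
    also have "\<dots> = emb (a * c * a)" unfolding c by (simp add: emb_simps)
    finally have e: "ucfc (\<lambda>t. q t * k t) ?a = emb (a * c * a)" .
    have "positive (ucfc (\<lambda>t. q t * k t) ?a)"
      by (rule positive_ucfc[OF sa continuous_on_mult[OF q k]]) (use rs k0 in \<open>auto simp: q_def\<close>)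
    then have "positive (a * c * a)" by (simp add: e positive_emb_iff)
    with e show ?thesis by metis
  qed
  have zero: "ucfc (\<lambda>t. q t * f s t) ?a = 0 \<or> ucfc (\<lambda>t. q t * g s t) ?a = 0" for s
  proof -
    obtain b1 where b1: "emb b1 = ucfc (\<lambda>t. q t * f s t) ?a" "\<exists>c. b1 = a * c * a" "positive b1"
      using her[OF f] by (auto simp: f_def)
    obtain b2 where b2: "emb b2 = ucfc (\<lambda>t. q t * g s t) ?a" "\<exists>c. b2 = a * c * a" "positive b2"
      using her[OF g] by (auto simp: g_def)
    have "emb b1 * emb b2 = ucfc (\<lambda>t. (q t * f s t) * (q t * g s t)) ?a"
      unfolding b1 b2 by (rule ucfc_mult[OF sa continuous_on_mult[OF q f] continuous_on_mult[OF q g], symmetric])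
    also have "(\<lambda>t. (q t * f s t) * (q t * g s t)) = (\<lambda>t. 0)" by (auto simp: f_def g_def max_def)
    finally have "emb (b1 * b2) = 0" by (simp add: emb_simps ucfc_const[OF sa])
    then have "b1 = 0 \<or> b2 = 0" using no b1(2,3) b2(2,3) unfolding her_pair_def by (metis emb_eq_0_iff)
    then show ?thesis using b1(1) b2(1) by (metis emb_eq_0_iff)
  qed
  have sq: "norm (w * w) = 1" if "norm w = 1" "star w = w" for w :: "'a uz"
    using cstar_identity[of w] that by simp
  have n8: "norm (?a * ?a * ?a * ?a * (?a * ?a * ?a * ?a)) = 1"
  proof -
    have "norm ((?a * ?a) * (?a * ?a) * ((?a * ?a) * (?a * ?a))) = 1"
      using na sa by (intro sq) (auto simp: star_mult)
    then show ?thesis by (simp add: mult.assoc)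
  qed
  have n3: "norm (?a * ?a * ?a) \<le> 1"
    using norm_mult_ineq[of "?a * ?a" ?a] sq[OF _ sa] na by simp
  \<comment> \<open>If the other product were zero, then a^5 would have norm at most s < 1, although
    a^8 has norm 1. Letting s tend to 1 in the conclusion gives a^4 (1 - a) = 0.\<close>
  have zg: "ucfc (\<lambda>t. q t * g s t) ?a = 0" if s: "0 < s" "s < 1" for s
  proof (rule ccontr)
    assume "\<not> ?thesis"
    then have z: "ucfc (\<lambda>t. q t * f s t) ?a = 0" using zero by blast
    have "norm (ucfc (\<lambda>t. q t * t) ?a - ucfc (\<lambda>t. q t * f s t) ?a) \<le> s"
    proof (rule ucfc_diff_norm_le[OF sa continuous_on_mult[OF q continuous_on_id] continuous_on_mult[OF q f]])
      fix t assume "t \<in> rspec ?a"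
      then have t: "0 \<le> t" "t \<le> 1" using rs by auto
      have q1: "0 \<le> q t" "q t \<le> 1" using t by (auto simp: q_def intro!: mult_le_one)
      have d: "0 \<le> t - f s t" "t - f s t \<le> s" using t s by (auto simp: f_def max_def)
      have "0 \<le> q t * (t - f s t)" using q1 d by simp
      moreover have "q t * (t - f s t) \<le> 1 * s" by (rule mult_mono[OF q1(2) d(2) _ d(1)]) simp
      ultimately show "\<bar>q t * t - q t * f s t\<bar> \<le> s" by (simp add: right_diff_distrib)
    qed
    then have n5: "norm (?a * ?a * ?a * ?a * ?a) \<le> s"
      using z by (simp add: ucfc_mult[OF sa q continuous_on_id] qa ucfc_id[OF sa])
    have "1 = norm ((?a * ?a * ?a * ?a * ?a) * (?a * ?a * ?a))" using n8 by (simp add: mult.assoc)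
    also have "\<dots> \<le> s * 1" by (rule order_trans[OF norm_mult_ineq mult_mono[OF n5 n3]]) (use s in auto)
    finally show False using s by simp
  qed
  have "norm (ucfc (\<lambda>t. q t * (1 - t)) ?a) \<le> e" if e: "e > 0" for e
  proof -
    define s where "s = max (1 - e) (1/2)"
    have s: "0 < s" "s < 1" "1 - s \<le> e" using e by (auto simp: s_def)
    have c1: "continuous_on UNIV (\<lambda>t::real. 1 - t)" by (intro continuous_intros)
    have "norm (ucfc (\<lambda>t. q t * (1 - t)) ?a - ucfc (\<lambda>t. q t * g s t) ?a) \<le> 1 - s"
    proof (rule ucfc_diff_norm_le[OF sa continuous_on_mult[OF q c1] continuous_on_mult[OF q g]])
      fix t assume "t \<in> rspec ?a"
      then have t: "0 \<le> t" "t \<le> 1" using rs by auto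
      have q1: "0 \<le> q t" "q t \<le> 1" using t by (auto simp: q_def intro!: mult_le_one)
      have d: "0 \<le> (1 - t) - g s t" "(1 - t) - g s t \<le> 1 - s" using t s by (auto simp: g_def max_def)
      have "0 \<le> q t * ((1 - t) - g s t)" using q1 d by simp
      moreover have "q t * ((1 - t) - g s t) \<le> 1 * (1 - s)" by (rule mult_mono[OF q1(2) d(2) _ d(1)]) simp
      ultimately show "\<bar>q t * (1 - t) - q t * g s t\<bar> \<le> 1 - s" by (simp add: right_diff_distrib)
    qed
    then show ?thesis using zg[OF s(1,2)] s(3) by simp
  qed
  then have "norm (ucfc (\<lambda>t. q t * (1 - t)) ?a) \<le> 0" by (rule field_le_epsilon) simp
  moreover have "ucfc (\<lambda>t. q t * (1 - t)) ?a = ?a * ?a * ?a * ?a * (1 - ?a)"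
    by (simp add: ucfc_mult[OF sa q] qa ucfc_diff[OF sa] ucfc_id[OF sa] ucfc_const[OF sa] continuous_intros continuous_on_id)
  ultimately have z4: "?a * ?a * ?a * ?a * (1 - ?a) = 0" by simp
  define w where "w = ?a * (1 - ?a)"
  have sw: "star w = w" by (simp add: w_def star_mult star_diff sa algebra_simps)
  have "w * w * (w * w) = (?a * ?a * ?a * ?a * (1 - ?a)) * ((1 - ?a) * (1 - ?a) * (1 - ?a))"
    by (simp add: w_def algebra_simps)
  then have "(w * w) * star (w * w) = 0" using z4 by (simp add: star_mult sw)
  then have "w * star w = 0" unfolding sw by (simp only: mult_star_self_eq_0_iff)
  then have "w = 0" by (simp only: mult_star_self_eq_0_iff)
  then have "emb (a * a) = emb a" by (simp add: w_def algebra_simps emb_simps)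
  then show ?thesis by (simp only: emb_inject)
qed

lemma her_pair_scaleR: "r \<noteq> 0 \<Longrightarrow> her_pair (r *\<^sub>R a) \<Longrightarrow> her_pair a"
proof -
  assume r: "r \<noteq> 0" "her_pair (r *\<^sub>R a)"
  have "\<exists>d. (r *\<^sub>R a) * c * (r *\<^sub>R a) = a * d * a" for c
    by (intro exI[of _ "(r * r) *\<^sub>R c"]) simp
  then show ?thesis using r(2) unfolding her_pair_def by metis
qed

lemma her_pair_sub:
  assumes "her_pair b" "b = a * c * a" shows "her_pair a"
proof -
  have "\<exists>e. b * d * b = a * e * a" for d
    unfolding assms(2) by (intro exI[of _ "c * a * d * a * c"]) (simp only: mult.assoc)
  then show ?thesis using assms(1) unfolding her_pair_def by metis
qed

text \<open>Without such a pair, \<open>a\<close> is a multiple of a projection p, and for positive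
  b every nonzero p b p is a multiple of a projection r below p. Then r and p - r would form a pair
  unless r = p, so p b p is a multiple of p and p is minimal.\<close>

lemma her_pair_exists:
  fixes a :: "'a::cstar_algebra"
  assumes nomin: "\<And>p::'a. \<not> minimal_projection p" and a: "positive a" "a \<noteq> 0"
  shows "her_pair a"
proof (rule ccontr)
  assume no: "\<not> her_pair a"
  have unit: "((1 / norm b) *\<^sub>R b) * ((1 / norm b) *\<^sub>R b) = (1 / norm b) *\<^sub>R b" if "positive b" "b \<noteq> 0" "\<not> her_pair b" for b :: 'a
    using that her_pair_scaleR[of "1 / norm b" b]
    by (intro projection_of_no_her_pair positive_scaleR) auto
  define p where "p = (1 / norm a) *\<^sub>R a"
  have pp: "p * p = p" unfolding p_def by (rule unit[OF a no])
  have ppos: "positive p" unfolding p_def using a by (intro positive_scaleR) auto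
  have sp: "star p = p" by (rule star_positive[OF ppos])
  have p0: "p \<noteq> 0" using a by (simp add: p_def)
  have nop: "\<not> her_pair p" using no her_pair_scaleR[of "1 / norm a" a] a by (auto simp: p_def)
  have scal: "\<exists>z. p * b * p = z *\<^sub>C p" if b: "positive b" for b
  proof (cases "p * b * p = 0")
    case True then show ?thesis by (intro exI[of _ 0]) simp
  next
    case False
    have bpos: "positive (p * b * p)" using positive_conj[OF b, of p] by (simp add: sp)
    have nob: "\<not> her_pair (p * b * p)" using nop her_pair_sub by blast
    define r where "r = (1 / norm (p * b * p)) *\<^sub>R (p * b * p)"
    have rr: "r * r = r" unfolding r_def by (rule unit[OF bpos False nob])
    have rpos: "positive r" unfolding r_def using bpos by (intro positive_scaleR) auto
    have "p * (p * b * p) = p * b * p" "(p * b * p) * p = p * b * p" by (metis mult.assoc pp)+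
    then have pr: "p * r = r" "r * p = r" by (simp_all add: r_def)
    have r0: "r \<noteq> 0" using False by (simp add: r_def)
    have "(p - r) * (p - r) = p - r" by (simp add: algebra_simps pr pp rr)
    moreover have "star (p - r) = p - r" using sp star_positive[OF rpos] by (simp add: star_diff)
    ultimately have "positive (p - r)" by (metis positive_square)
    moreover have "r * (p - r) = 0" by (simp add: algebra_simps pr rr)
    moreover have "r = p * r * p" "p - r = p * (p - r) * p" by (simp_all add: algebra_simps pr pp)
    ultimately have "p - r = 0" using nop rpos r0 unfolding her_pair_def by metis
    moreover have "norm (p * b * p) *\<^sub>R r = p * b * p" using False by (simp add: r_def)
    ultimately have "p * b * p = norm (p * b * p) *\<^sub>R p" by (metis eq_iff_diff_eq_0)
    then show ?thesis by (metis scaleC_of_real)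
  qed
  have "\<exists>z. p * b * p = z *\<^sub>C p" for b
  proof -
    \<comment> \<open>Polarization: the values for c = 1 and c = -\<i> are scalar multiples of p,
      and the first plus \<i> times the second isolates twice p b p.\<close>
    let ?A = "\<lambda>c. star (p + c *\<^sub>C b) * (p + c *\<^sub>C b)"
    obtain z1 z2 w where z: "p * ?A 1 * p = z1 *\<^sub>C p" "p * ?A (- \<i>) * p = z2 *\<^sub>C p" "p * (star b * b) * p = w *\<^sub>C p"
      using scal positive_star_mult by metis
    define X where "X = p * b * p"
    define Y where "Y = p * star b * p"
    have pp': "p * (p * x) = p * x" for x by (simp add: pp flip: mult.assoc)
    have "p * ?A c * p = p + c *\<^sub>C X + cnj c *\<^sub>C Y + (cnj c * c) *\<^sub>C (p * (star b * b) * p)" for c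
      by (simp add: X_def Y_def star_add star_scaleC sp distrib_left distrib_right scaleC_mult_left scaleC_mult_right
          scaleC_scaleC scaleC_add_right mult.assoc pp pp' add_ac mult.commute)
    from this[of 1] this[of "- \<i>"]
    have A: "z1 *\<^sub>C p = p + X + Y + w *\<^sub>C p" "z2 *\<^sub>C p = p + (- \<i>) *\<^sub>C X + \<i> *\<^sub>C Y + w *\<^sub>C p"
      unfolding z by simp_all
    have "(z1 + \<i> * z2) *\<^sub>C p = z1 *\<^sub>C p + \<i> *\<^sub>C (z2 *\<^sub>C p)" by (simp add: scaleC_add_left scaleC_scaleC)
    also have "\<dots> = 2 *\<^sub>R X + ((1 + \<i>) * (1 + w)) *\<^sub>C p"
      unfolding A by (simp add: scaleC_add_right scaleC_diff_right scaleC_add_left scaleC_scaleC scaleC_minus_left algebra_simps scaleR_2)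
    finally have "2 *\<^sub>R X = (z1 + \<i> * z2 - (1 + \<i>) * (1 + w)) *\<^sub>C p" by (simp add: scaleC_diff_left)
    then have "X = (1 / 2) *\<^sub>R ((z1 + \<i> * z2 - (1 + \<i>) * (1 + w)) *\<^sub>C p)" by (metis scaleR_half_double scaleR_2 scaleR_scaleR)
    then show ?thesis unfolding X_def by (metis scaleC_of_real scaleC_scaleC)
  qed
  then show False using nomin[of p] p0 sp pp by (simp add: minimal_projection_def)
qed

text \<open>One element of the pair is kept and the other is divided further; orthogonality and the
  form a c a pass through \<open>b2\<close>.\<close>

lemma her_many:
  fixes a :: "'a::cstar_algebra"
  assumes nomin: "\<And>p::'a. \<not> minimal_projection p"
  shows "positive a \<Longrightarrow> a \<noteq> 0 \<Longrightarrow> \<exists>b::nat \<Rightarrow> 'a. (\<forall>i<N. positive (b i) \<and> b i \<noteq> 0 \<and> (\<exists>c. b i = a * c * a)) \<and>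
    (\<forall>i<N. \<forall>j<N. i \<noteq> j \<longrightarrow> b i * b j = 0)"
proof (induction N arbitrary: a)
  case (Suc N)
  obtain b1 b2 where b: "positive b1" "positive b2" "b1 \<noteq> 0" "b2 \<noteq> 0" "b1 * b2 = 0" "\<exists>c. b1 = a * c * a" "\<exists>c. b2 = a * c * a"
    using her_pair_exists[OF nomin Suc.prems] unfolding her_pair_def by blast
  obtain c2 where c2: "b2 = a * c2 * a" using b(7) by blast
  from Suc.IH[OF b(2,4)] obtain e where
    E: "\<forall>i<N. positive (e i) \<and> e i \<noteq> 0 \<and> (\<exists>c. e i = b2 * c * b2)" "\<forall>i<N. \<forall>j<N. i \<noteq> j \<longrightarrow> e i * e j = 0"
    by (elim exE conjE)
  have e: "positive (e i) \<and> e i \<noteq> 0 \<and> (\<exists>c. e i = b2 * c * b2)" "j < N \<Longrightarrow> i \<noteq> j \<Longrightarrow> e i * e j = 0"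
    if "i < N" for i j
    using E that by blast+
  have b21: "b2 * b1 = 0" using b(1,2,5) by (metis star_mult star_positive star_zero)
  have be: "b1 * e i = 0 \<and> e i * b1 = 0" if i: "i < N" for i
  proof -
    obtain c where "e i = b2 * c * b2" using e(1)[OF i] by blast
    then have "b1 * e i = (b1 * b2) * c * b2" "e i * b1 = b2 * c * (b2 * b1)" by (simp_all only: mult.assoc)
    then show ?thesis by (simp add: b(5) b21)
  qed
  have ea: "\<exists>c. e i = a * c * a" if i: "i < N" for i
  proof -
    obtain c where "e i = b2 * c * b2" using e(1)[OF i] by blast
    then have "e i = a * (c2 * a * c * a * c2) * a" unfolding c2 by (simp only: mult.assoc)
    then show ?thesis by blast
  qed
  show ?case
  proof (intro exI[of _ "\<lambda>i. if i = N then b1 else e i"] conjI allI impI)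
    fix i assume i: "i < Suc N"
    show "positive (if i = N then b1 else e i)" "(if i = N then b1 else e i) \<noteq> 0" "\<exists>c. (if i = N then b1 else e i) = a * c * a"
      using i b e ea by (cases "i = N"; simp)+
  next
    fix i j assume ij: "i < Suc N" "j < Suc N" "i \<noteq> j"
    then show "(if i = N then b1 else e i) * (if j = N then b1 else e j) = 0"
      using be e(2) by (cases "i = N"; cases "j = N") auto
  qed
qed simp

text \<open>The orthogonal elements of \<open>her_many\<close> need not be equivalent. Simplicity
  connects the next one to the copies already found, after which all copies are cut down to a common
  modulus. That T_i starts with a factor \<open>a\<close> on the left places the copies in the
  hereditary subalgebra.\<close>

lemma splitting:
  fixes a :: "'a::cstar_algebra"
  assumes simple: "simple_cstar TYPE('a)" and nomin: "\<And>p::'a. \<not> minimal_projection p"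
    and a: "positive a" "a \<noteq> 0" and N: "N \<ge> 1"
  obtains T :: "nat \<Rightarrow> 'a" and h where "positive h" "h \<noteq> 0" "\<And>i. i < N \<Longrightarrow> \<exists>r. T i = a * r"
    "\<And>i j. i < N \<Longrightarrow> j < N \<Longrightarrow> star (T i) * T j = (if i = j then h * h else (0::'a))"
proof -
  from her_many[OF nomin a, of N] obtain b where
    B: "\<forall>i<N. positive (b i) \<and> b i \<noteq> 0 \<and> (\<exists>c. b i = a * c * a)" "\<forall>i<N. \<forall>j<N. i \<noteq> j \<longrightarrow> b i * b j = 0"
    by (elim exE conjE)
  have b: "positive (b i) \<and> b i \<noteq> 0 \<and> (\<exists>c. b i = a * c * a)" "j < N \<Longrightarrow> i \<noteq> j \<Longrightarrow> b i * b j = 0"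
    if "i < N" for i j
    using B that by blast+
  have sb: "star (b i) = b i" if "i < N" for i using b(1)[OF that] star_positive by blast
  have "1 \<le> k \<Longrightarrow> k \<le> N \<Longrightarrow> \<exists>T h. positive h \<and> h \<noteq> 0 \<and> (\<forall>i<k. \<exists>r. T i = b i * r) \<and>
    (\<forall>i<k. \<forall>j<k. star (T i) * T j = (if i = j then h * h else (0::'a)))" for k
  proof (induction k rule: nat_induct_at_least)
    case base
    have 0: "positive (b 0)" "b 0 \<noteq> 0" using b(1)[of 0] N by auto
    have "b 0 * b 0 \<noteq> 0" using star_mult_self_eq_0_iff[of "b 0"] 0(2) sb[of 0] N by auto
    then show ?case
      using 0 sb[of 0] N
      by (intro exI[of _ "\<lambda>_. b 0 * b 0"] exI[of _ "b 0 * b 0"]) (auto simp: star_mult mult.assoc intro: positive_square)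
  next
    case (Suc k)
    then have kN: "k < N" by simp
    from Suc.IH[OF less_imp_le[OF kN]] obtain T h where h: "positive h" "h \<noteq> 0"
      and r0: "\<forall>i<k. \<exists>r. T i = b i * r" and T0: "\<forall>i<k. \<forall>j<k. star (T i) * T j = (if i = j then h * h else (0::'a))"
      by (elim exE conjE)
    have sh: "star h = h" by (rule star_positive[OF h(1)])
    obtain c where c: "b k * c * h \<noteq> 0" using simple_connecting[OF simple _ h(2)] b(1)[OF kN] by blast
    define s where "s = b k * c * h"
    define e where "e = star c * (b k * b k) * c"
    define d where "d = h * e * h"
    have sd: "d = star s * s" by (simp add: d_def e_def s_def star_mult sh sb[OF kN] mult.assoc)
    have d: "positive d" "d \<noteq> 0" using c unfolding sd s_def[symmetric] by simp_all
    have se: "star e = e" by (simp add: e_def star_mult sb[OF kN] mult.assoc)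
    have pd: "positive (emb d)" using d(1) by (simp add: positive_emb_iff)
    obtain w where w: "psqrt (emb d) = emb w" using uscal_psqrt_emb[OF pd] uscal_eq_0_iff by blast
    have "emb (w * w) = emb d" using psqrt_square[OF pd] unfolding w by (simp only: emb_simps)
    then have ww: "w * w = d" by (simp only: emb_inject)
    have "emb (star w) = emb w" using star_psqrt[OF pd] unfolding w by (simp only: emb_simps)
    then have sw: "star w = w" by (simp only: emb_inject)
    \<comment> \<open>Here d = h e h = (star s) s and w is its square root. The old columns give h e
      (h^2) e h = d^2 and the new one gives w (star s) s w = d^2, so all moduli agree.\<close>
    define T' where "T' i = (if i = k then s * w else T i * e * h)" for i
    have zero: "star (T' k) * T' i = 0" if i: "i < k" for i
    proof -
      obtain r where r: "T i = b i * r" using r0 i by blast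
      have "star (T' k) * T' i = w * h * star c * (b k * b i) * r * e * h"
        using i by (simp add: T'_def s_def r star_mult sw sh sb[OF kN] mult.assoc)
      then show ?thesis using b(2)[OF kN, of i] i kN by simp
    qed
    show ?case
    proof (rule exI[of _ T'], rule exI[of _ d], intro conjI allI impI d)
      fix i assume i: "i < Suc k"
      show "\<exists>r. T' i = b i * r"
      proof (cases "i = k")
        case True
        then have "T' i = b i * (c * h * w)" by (simp add: T'_def s_def mult.assoc)
        then show ?thesis by blast
      next
        case False
        then have "i < k" using i by simp
        then obtain r where "T i = b i * r" using r0 by blast
        then have "T' i = b i * (r * e * h)" using False by (simp add: T'_def mult.assoc)
        then show ?thesis by blast
      qed
    next
      fix i j assume ij: "i < Suc k" "j < Suc k"
      show "star (T' i) * T' j = (if i = j then d * d else 0)"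
      proof (cases "i = k"; cases "j = k")
        assume "i = k" "j = k"
        have "star (T' k) * T' k = w * (star s * s) * w" by (simp add: T'_def star_mult sw mult.assoc)
        also have "\<dots> = w * (w * w) * w" by (simp only: sd[symmetric] ww)
        also have "\<dots> = (w * w) * (w * w)" by (simp only: mult.assoc)
        finally show ?thesis using \<open>i = k\<close> \<open>j = k\<close> by (simp add: ww)
      next
        assume "i = k" "j \<noteq> k"
        then show ?thesis using zero[of j] ij by simp
      next
        assume "i \<noteq> k" "j = k"
        then have "star (star (T' k) * T' i) = 0" using zero[of i] ij by simp
        then show ?thesis using \<open>i \<noteq> k\<close> \<open>j = k\<close> by (simp add: star_mult)
      next
        assume n: "i \<noteq> k" "j \<noteq> k"
        then have ij': "i < k" "j < k" using ij by auto
        have "star (T' i) * T' j = h * e * (star (T i) * T j) * e * h"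
          using n by (simp add: T'_def star_mult se sh mult.assoc)
        also have "\<dots> = (if i = j then d * d else 0)" using T0 ij' by (simp add: d_def mult.assoc)
        finally show ?thesis .
      qed
    qed
  qed
  from this[OF N order_refl] obtain T h where h: "positive h" "h \<noteq> 0"
    and r: "\<forall>i<N. \<exists>r. T i = b i * r" and T: "\<forall>i<N. \<forall>j<N. star (T i) * T j = (if i = j then h * h else (0::'a))"
    by (elim exE conjE)
  show ?thesis
  proof (rule that[of h T, OF h])
    fix i assume i: "i < N"
    obtain r c where "T i = b i * r" "b i = a * c * a" using r b(1) i by blast
    then have "T i = a * (c * a * r)" by (simp add: mult.assoc)
    then show "\<exists>r. T i = a * r" by blast
  qed (use T in blast)
qed

section \<open>Transfer along a Morita context\<close>

text \<open>u = c / (c + \<tau>) is an approximate unit for c with an explicit error: c (1 - u)^2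
  \<le> \<tau>. The factorization u = g c g, with g the inverse square root of c + \<tau>, allows u
  to be written again as a sum of inner products when c is one.\<close>

lemma tikhonov:
  fixes c :: "'u::cstar_algebra_1"
  assumes c: "positive c" and \<tau>: "\<tau> > 0"
  defines "u \<equiv> ucfc (\<lambda>t. \<bar>t\<bar> / (\<bar>t\<bar> + \<tau>)) c" and "g \<equiv> ucfc (\<lambda>t. 1 / sqrt (\<bar>t\<bar> + \<tau>)) c"
  shows "positive u" "norm u \<le> 1" "norm ((1 - u) * c * (1 - u)) \<le> \<tau>" "u = g * c * g" "star g = g"
proof -
  have sc: "star c = c" using c by (rule star_positive)
  have nz: "\<bar>t\<bar> + \<tau> > 0" for t using \<tau> by (simp add: add_nonneg_pos)
  define fu where "fu t = \<bar>t\<bar> / (\<bar>t\<bar> + \<tau>)" for t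
  define fg where "fg t = 1 / sqrt (\<bar>t\<bar> + \<tau>)" for t
  have fu: "continuous_on UNIV fu" unfolding fu_def
    by (intro continuous_intros) (metis nz less_irrefl)
  have fg: "continuous_on UNIV fg" unfolding fg_def
    by (intro continuous_intros) (metis nz less_irrefl real_sqrt_eq_zero_cancel_iff)
  have u: "u = ucfc fu c" and g: "g = ucfc fg c" by (simp_all add: u_def g_def fu_def[abs_def] fg_def[abs_def])
  show "positive u" unfolding u by (rule positive_ucfc[OF sc fu]) (use nz in \<open>simp add: fu_def less_imp_le\<close>)
  show "norm u \<le> 1" unfolding u
  proof (rule ucfc_norm_le[OF sc fu])
    show "\<bar>fu t\<bar> \<le> 1" for t using nz[of t] \<tau> by (simp add: fu_def)
  qed
  show "star g = g" unfolding g by (rule star_ucfc[OF sc fg])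
  have rs: "t \<ge> 0" if "t \<in> rspec c" for t using positive_rspec[OF c that] .
  have c1: "continuous_on UNIV (\<lambda>t. 1 - fu t)" by (intro continuous_intros fu)
  have "norm (ucfc (\<lambda>t. (1 - fu t) * t * (1 - fu t)) c) \<le> \<tau>"
  proof (rule ucfc_norm_le[OF sc continuous_on_mult[OF continuous_on_mult[OF c1 continuous_on_id] c1]])
    fix t assume "t \<in> rspec c"
    then have t: "t \<ge> 0" by (rule rs)
    have a: "1 - fu t = \<tau> / (t + \<tau>)" using t \<tau> by (simp add: fu_def field_simps)
    have r: "0 \<le> \<tau> / (t + \<tau>)" "\<tau> / (t + \<tau>) \<le> 1" using t \<tau> by auto
    have "(1 - fu t) * t * (1 - fu t) = \<tau> * (t / (t + \<tau>)) * (\<tau> / (t + \<tau>))" unfolding a by simp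
    also have "\<dots> \<le> \<tau> * 1 * 1" using t \<tau> r by (intro mult_mono) auto
    finally have le: "(1 - fu t) * t * (1 - fu t) \<le> \<tau>" by simp
    have "0 \<le> (1 - fu t) * t * (1 - fu t)" unfolding a by (intro mult_nonneg_nonneg r t)
    from abs_of_nonneg[OF this] le show "\<bar>(1 - fu t) * t * (1 - fu t)\<bar> \<le> \<tau>" by (rule ord_eq_le_trans)
  qed
  also have "ucfc (\<lambda>t. (1 - fu t) * t * (1 - fu t)) c = (1 - u) * c * (1 - u)"
    by (simp only: ucfc_mult[OF sc continuous_on_mult[OF c1 continuous_on_id] c1] ucfc_mult[OF sc c1 continuous_on_id]
        ucfc_id[OF sc] ucfc_diff[OF sc continuous_on_const fu] ucfc_const[OF sc] u scaleR_one)
  finally show "norm ((1 - u) * c * (1 - u)) \<le> \<tau>" .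
  have "ucfc fu c = ucfc (\<lambda>t. fg t * t * fg t) c"
  proof (rule ucfc_cong[OF sc fu continuous_on_mult[OF continuous_on_mult[OF fg continuous_on_id] fg]])
    fix t assume "t \<in> rspec c"
    then have "t \<ge> 0" by (rule rs)
    then show "fu t = fg t * t * fg t" using nz[of t] by (simp add: fu_def fg_def)
  qed
  also have "\<dots> = g * c * g" unfolding g
    by (simp only: ucfc_mult[OF sc continuous_on_mult[OF fg continuous_on_id] fg] ucfc_mult[OF sc fg continuous_on_id]
        ucfc_id[OF sc])
  finally show "u = g * c * g" unfolding u .
qed

lemma uscal_tikhonov:
  assumes "positive (emb c)" "\<tau> > 0" shows "uscal (ucfc (\<lambda>t. \<bar>t\<bar> / (\<bar>t\<bar> + \<tau>)) (emb c)) = 0"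
proof -
  have "\<bar>t\<bar> + \<tau> \<noteq> 0" for t using assms(2) by (metis abs_ge_zero add_nonneg_pos less_irrefl)
  then show ?thesis by (subst uscal_ucfc) (use assms star_positive in \<open>auto intro!: continuous_intros\<close>)
qed

text \<open>The carrier \<open>X\<close> need not be complete, and only the right inner product has to be full: this
  is what the corners of a stabilization provide at once.\<close>

locale morita_context =
  fixes X :: "'x::complex_normed_vector set"
    and la :: "'a::cstar_algebra \<Rightarrow> 'x \<Rightarrow> 'x" and ra :: "'x \<Rightarrow> 'b::cstar_algebra \<Rightarrow> 'x"
    and lip :: "'x \<Rightarrow> 'x \<Rightarrow> 'a" and rip :: "'x \<Rightarrow> 'x \<Rightarrow> 'b"
  assumes X_0: "0 \<in> X" and X_add: "x \<in> X \<Longrightarrow> y \<in> X \<Longrightarrow> x + y \<in> X" and X_scaleC: "x \<in> X \<Longrightarrow> c *\<^sub>C x \<in> X"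
    and la_X: "x \<in> X \<Longrightarrow> la a x \<in> X" and ra_X: "x \<in> X \<Longrightarrow> ra x b \<in> X"
    and la_add: "x \<in> X \<Longrightarrow> la (a + a') x = la a x + la a' x"
    and la_scaleC: "x \<in> X \<Longrightarrow> la (c *\<^sub>C a) x = c *\<^sub>C la a x"
    and la_mult: "x \<in> X \<Longrightarrow> la (a * a') x = la a (la a' x)"
    and la_add_right: "x \<in> X \<Longrightarrow> y \<in> X \<Longrightarrow> la a (x + y) = la a x + la a y"
    and la_scaleC_right: "x \<in> X \<Longrightarrow> la a (c *\<^sub>C x) = c *\<^sub>C la a x"
    and ra_add: "x \<in> X \<Longrightarrow> ra x (b + b') = ra x b + ra x b'"
    and ra_scaleC: "x \<in> X \<Longrightarrow> ra x (c *\<^sub>C b) = c *\<^sub>C ra x b"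
    and ra_mult: "x \<in> X \<Longrightarrow> ra x (b * b') = ra (ra x b) b'"
    and ra_scaleC_left: "x \<in> X \<Longrightarrow> ra (c *\<^sub>C x) b = c *\<^sub>C ra x b"
    and ra_add_left: "x \<in> X \<Longrightarrow> y \<in> X \<Longrightarrow> ra (x + y) b = ra x b + ra y b"
    and la_ra: "x \<in> X \<Longrightarrow> ra (la a x) b = la a (ra x b)"
    and rip_add: "x \<in> X \<Longrightarrow> y \<in> X \<Longrightarrow> z \<in> X \<Longrightarrow> rip x (y + z) = rip x y + rip x z"
    and rip_scaleC: "x \<in> X \<Longrightarrow> y \<in> X \<Longrightarrow> rip x (c *\<^sub>C y) = c *\<^sub>C rip x y"
    and rip_ra: "x \<in> X \<Longrightarrow> y \<in> X \<Longrightarrow> rip x (ra y b) = rip x y * b"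
    and star_rip: "x \<in> X \<Longrightarrow> y \<in> X \<Longrightarrow> star (rip x y) = rip y x"
    and rip_positive: "x \<in> X \<Longrightarrow> positive (rip x x)"
    and rip_la: "x \<in> X \<Longrightarrow> y \<in> X \<Longrightarrow> rip (la a x) y = rip x (la (star a) y)"
    and lip_add: "x \<in> X \<Longrightarrow> y \<in> X \<Longrightarrow> z \<in> X \<Longrightarrow> lip (x + y) z = lip x z + lip y z"
    and lip_scaleC: "x \<in> X \<Longrightarrow> y \<in> X \<Longrightarrow> lip (c *\<^sub>C x) y = c *\<^sub>C lip x y"
    and lip_la: "x \<in> X \<Longrightarrow> y \<in> X \<Longrightarrow> lip (la a x) y = a * lip x y"
    and star_lip: "x \<in> X \<Longrightarrow> y \<in> X \<Longrightarrow> star (lip x y) = lip y x"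
    and lip_positive: "x \<in> X \<Longrightarrow> positive (lip x x)"
    and lip_ra: "x \<in> X \<Longrightarrow> y \<in> X \<Longrightarrow> lip (ra x b) y = lip x (ra y (star b))"
    and link: "x \<in> X \<Longrightarrow> y \<in> X \<Longrightarrow> z \<in> X \<Longrightarrow> la (lip x y) z = ra x (rip y z)"
    and full: "closure (span {rip x y | x y. x \<in> X \<and> y \<in> X}) = UNIV"
begin

text \<open>The actions are extended to the unitizations so that elements such as 1 - u and inverse
  square roots may act on the module.\<close>

definition ula :: "'a uz \<Rightarrow> 'x \<Rightarrow> 'x" where "ula u x = la (ubase u) x + uscal u *\<^sub>C x"
definition ura :: "'x \<Rightarrow> 'b uz \<Rightarrow> 'x" where "ura x v = ra x (ubase v) + uscal v *\<^sub>C x"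

lemma ura_X [simp]: "x \<in> X \<Longrightarrow> ura x v \<in> X" and ula_X [simp]: "x \<in> X \<Longrightarrow> ula u x \<in> X"
  by (simp_all add: ula_def ura_def X_add X_scaleC la_X ra_X)

lemma la_zero: "x \<in> X \<Longrightarrow> la 0 x = 0" and ra_zero: "x \<in> X \<Longrightarrow> ra x 0 = 0"
  using la_scaleC[of x 0 0] ra_scaleC[of x 0 0] by simp_all

lemma rip_zero: "x \<in> X \<Longrightarrow> rip x 0 = 0" "x \<in> X \<Longrightarrow> rip 0 x = 0"
  using rip_scaleC[of x x 0] star_rip[of x 0] by (simp_all add: X_0)

lemma rip_add_left: "x \<in> X \<Longrightarrow> y \<in> X \<Longrightarrow> z \<in> X \<Longrightarrow> rip (x + y) z = rip x z + rip y z"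
  by (metis X_add rip_add star_add star_rip)

lemma rip_scaleC_left: "x \<in> X \<Longrightarrow> y \<in> X \<Longrightarrow> rip (c *\<^sub>C x) y = cnj c *\<^sub>C rip x y"
  by (metis X_scaleC rip_scaleC star_rip star_scaleC)

lemma lip_add_right: "x \<in> X \<Longrightarrow> y \<in> X \<Longrightarrow> z \<in> X \<Longrightarrow> lip x (y + z) = lip x y + lip x z"
  by (metis X_add lip_add star_add star_lip)

lemma lip_scaleC_right: "x \<in> X \<Longrightarrow> y \<in> X \<Longrightarrow> lip x (c *\<^sub>C y) = cnj c *\<^sub>C lip x y"
  by (metis X_scaleC lip_scaleC star_lip star_scaleC)

lemma ula_emb [simp]: "ula (emb a) x = la a x" and ura_emb [simp]: "ura x (emb b) = ra x b"
  by (simp_all add: ula_def ura_def)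

lemma ula_one: "x \<in> X \<Longrightarrow> ula 1 x = x" and ura_one: "x \<in> X \<Longrightarrow> ura x 1 = x"
  by (simp_all add: ula_def ura_def one_uz_def la_zero ra_zero)

lemma ula_add: "x \<in> X \<Longrightarrow> ula (u + v) x = ula u x + ula v x"
  by (simp add: ula_def ubase_linear la_add scaleC_add_left)

lemma ula_scaleC: "x \<in> X \<Longrightarrow> ula (c *\<^sub>C u) x = c *\<^sub>C ula u x"
  by (simp add: ula_def ubase_linear la_scaleC scaleC_add_right scaleC_scaleC)

lemma ula_mult: "x \<in> X \<Longrightarrow> ula (u * v) x = ula u (ula v x)"
  by (simp add: ula_def times_uz_def la_add la_scaleC la_mult la_add_right la_scaleC_right la_X X_scaleC
      scaleC_add_right scaleC_scaleC add_ac)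

lemma ura_mult: "x \<in> X \<Longrightarrow> ura x (u * v) = ura (ura x u) v"
  by (simp add: ura_def times_uz_def ra_add ra_scaleC ra_mult ra_X X_scaleC ra_scaleC_left ra_add_left
      scaleC_add_right scaleC_scaleC add_ac mult.commute)

lemma ura_add: "x \<in> X \<Longrightarrow> ura x (u + v) = ura x u + ura x v"
  by (simp add: ura_def ubase_linear ra_add scaleC_add_left)

lemma ura_scaleC: "x \<in> X \<Longrightarrow> ura x (c *\<^sub>C u) = c *\<^sub>C ura x u"
  by (simp add: ura_def ubase_linear ra_scaleC scaleC_add_right scaleC_scaleC)

lemma rip_ula: "x \<in> X \<Longrightarrow> y \<in> X \<Longrightarrow> rip (ula u x) y = rip x (ula (star u) y)"
  by (simp add: ula_def rip_add_left rip_add rip_scaleC rip_scaleC_left rip_la la_X X_scaleC ubase_linear)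

lemma lip_ura: "x \<in> X \<Longrightarrow> y \<in> X \<Longrightarrow> lip (ura x u) y = lip x (ura y (star u))"
  by (simp add: ura_def lip_add_right lip_add lip_scaleC lip_scaleC_right lip_ra ra_X X_scaleC ubase_linear)

lemma emb_rip_ura: "x \<in> X \<Longrightarrow> y \<in> X \<Longrightarrow> emb (rip x (ura y v)) = emb (rip x y) * v"
  by (subst (2) uz_decompose[of v])
    (simp add: ura_def rip_add rip_scaleC rip_ra ra_X X_scaleC emb_simps distrib_left scaleC_mult_right)

lemma emb_lip_ula: "x \<in> X \<Longrightarrow> y \<in> X \<Longrightarrow> emb (lip (ula u x) y) = u * emb (lip x y)"
  by (subst (2) uz_decompose[of u])
    (simp add: ula_def lip_add lip_scaleC lip_la la_X X_scaleC emb_simps distrib_right scaleC_mult_left)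

lemma emb_rip_ura_left: "x \<in> X \<Longrightarrow> y \<in> X \<Longrightarrow> emb (rip (ura x v) y) = star v * emb (rip x y)"
proof -
  assume xy: "x \<in> X" "y \<in> X"
  have "emb (rip (ura x v) y) = star (emb (rip y (ura x v)))" using xy by (simp add: star_rip flip: emb_simps(8))
  also have "\<dots> = star v * star (emb (rip y x))" using xy by (simp only: emb_rip_ura star_mult)
  also have "star (emb (rip y x)) = emb (rip x y)" using xy by (simp add: star_rip flip: emb_simps(8))
  finally show ?thesis .
qed

lemma rip_ula_positive:
  assumes y: "y \<in> X" and u: "positive u" shows "positive (rip y (ula u y))"
proof -
  obtain g where g: "u = star g * g" using u by (auto simp: positive_def)
  have "rip y (ula u y) = rip (ula g y) (ula g y)" using y by (simp add: g ula_mult rip_ula[of y "ula g y"])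
  then show ?thesis using y rip_positive[of "ula g y"] by simp
qed

lemma lip_ura_positive:
  assumes y: "y \<in> X" and u: "positive u" shows "positive (lip (ura y u) y)"
proof -
  obtain g where g: "u = star g * g" using u by (auto simp: positive_def)
  have "lip (ura (ura y (star g)) g) y = lip (ura y (star g)) (ura y (star g))" using y by (simp add: lip_ura)
  then show ?thesis using y lip_positive[of "ura y (star g)"] by (simp add: g ura_mult)
qed

lemma uscaleR_scaleC: "r *\<^sub>R u = complex_of_real r *\<^sub>C (u::'c::complex_normed_vector)"
  by (simp add: scaleC_of_real)

lemma diff_scaleC: "u - v = u + complex_of_real (-1) *\<^sub>C (v::'c::complex_normed_vector)"
  using scaleC_of_real[of "-1" v] by simp

lemma rip_ula_diff: "x \<in> X \<Longrightarrow> y \<in> X \<Longrightarrow> rip x (ula (u - v) y) = rip x (ula u y) - rip x (ula v y)"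
  by (simp only: diff_scaleC ula_add ula_scaleC rip_add rip_scaleC X_scaleC ula_X)

lemma rip_ula_scaleR: "x \<in> X \<Longrightarrow> y \<in> X \<Longrightarrow> rip x (ula (r *\<^sub>R u) y) = r *\<^sub>R rip x (ula u y)"
  by (simp add: uscaleR_scaleC ula_scaleC rip_scaleC)

lemma rip_ula_mono:
  assumes y: "y \<in> X" and u: "u \<preceq> v" shows "emb (rip y (ula u y)) \<preceq> emb (rip y (ula v y))"
  using rip_ula_positive[OF y u[unfolded ple_def]] y
  by (simp add: rip_ula_diff ple_def positive_emb_iff flip: emb_simps(2))

lemma lip_ura_mono:
  assumes y: "y \<in> X" and u: "u \<preceq> v" shows "emb (lip (ura y u) y) \<preceq> emb (lip (ura y v) y)"
proof -
  have "lip (ura y (v - u)) y = lip (ura y v) y - lip (ura y u) y"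
    using y by (simp only: diff_scaleC ura_add ura_scaleC lip_add lip_scaleC X_scaleC ura_X)
  then show ?thesis using lip_ura_positive[OF y u[unfolded ple_def]]
    by (simp add: ple_def positive_emb_iff flip: emb_simps(2))
qed

lemma norm_rip_ula_le:
  assumes y: "y \<in> X" shows "norm (rip (ula u y) (ula u y)) \<le> (norm u)\<^sup>2 * norm (rip y y)"
proof -
  have e: "rip (ula u y) (ula u y) = rip y (ula (star u * u) y)" using y by (simp add: ula_mult rip_ula)
  have "star u * u \<preceq> (norm u)\<^sup>2 *\<^sub>R 1" by (rule ple_norm) (simp_all add: star_mult cstar_identity)
  from rip_ula_mono[OF y this] have "emb (rip y (ula (star u * u) y)) \<preceq> emb ((norm u)\<^sup>2 *\<^sub>R rip y y)"
    using y by (simp add: rip_ula_scaleR ula_one)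
  moreover have "positive (rip y (ula (star u * u) y))" by (rule rip_ula_positive[OF y]) simp
  ultimately have "norm (emb (rip y (ula (star u * u) y))) \<le> norm (emb ((norm u)\<^sup>2 *\<^sub>R rip y y))"
    by (intro norm_mono) (simp_all add: positive_emb_iff)
  then show ?thesis unfolding e by simp
qed

text \<open>By the linking identity the square of \<open>rip x x\<close> is
  \<open>rip x (la (lip x x) x)\<close>, which is at most norm(lip x x) times
  \<open>rip x x\<close>; the same computation with the sides exchanged gives the other
  inequality.\<close>

lemma norm_lip_eq: "norm (lip x x) = norm (rip x x)" if x: "x \<in> X"
proof -
  have pr: "positive (emb (rip x x))" "positive (emb (lip x x))"
    using rip_positive[OF x] lip_positive[OF x] by (simp_all add: positive_emb_iff)
  have "(norm (rip x x))\<^sup>2 = norm (star (rip x x) * rip x x)" by (simp add: cstar_identity)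
  also have "star (rip x x) * rip x x = rip x (ula (emb (lip x x)) x)"
    using x by (simp add: star_rip link rip_ra)
  also have "norm \<dots> \<le> norm (lip x x) * norm (rip x x)"
  proof -
    have "emb (lip x x) \<preceq> norm (lip x x) *\<^sub>R 1" by (rule ple_norm[OF star_positive[OF pr(2)]]) simp
    from rip_ula_mono[OF x this]
    have "norm (emb (rip x (ula (emb (lip x x)) x))) \<le> norm (emb (norm (lip x x) *\<^sub>R rip x x))"
      using rip_ula_positive[OF x pr(2)] x by (intro norm_mono) (simp_all add: positive_emb_iff rip_ula_scaleR ula_one)
    then show ?thesis by simp
  qed
  finally have 1: "norm (rip x x) * norm (rip x x) \<le> norm (lip x x) * norm (rip x x)" by (simp add: power2_eq_square)
  have "(norm (lip x x))\<^sup>2 = norm (star (lip x x) * lip x x)" by (simp add: cstar_identity)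
  also have "star (lip x x) * lip x x = lip (ura x (emb (rip x x))) x"
    using x by (simp add: star_lip flip: link lip_la)
  also have "norm \<dots> \<le> norm (rip x x) * norm (lip x x)"
  proof -
    have "emb (rip x x) \<preceq> norm (rip x x) *\<^sub>R 1" by (rule ple_norm[OF star_positive[OF pr(1)]]) simp
    from lip_ura_mono[OF x this]
    have "norm (emb (lip (ura x (emb (rip x x))) x)) \<le> norm (emb (lip (ura x (norm (rip x x) *\<^sub>R 1)) x))"
      using lip_ura_positive[OF x pr(1)] by (intro norm_mono) (simp_all add: positive_emb_iff)
    moreover have "lip (ura x (norm (rip x x) *\<^sub>R 1)) x = norm (rip x x) *\<^sub>R lip x x"
      using x by (simp add: uscaleR_scaleC ura_scaleC lip_scaleC ura_one)
    ultimately show ?thesis by simp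
  qed
  finally have 2: "norm (lip x x) * norm (lip x x) \<le> norm (rip x x) * norm (lip x x)" by (simp add: power2_eq_square)
  have "norm (rip x x) \<le> norm (lip x x)"
    using 1 by (cases "norm (rip x x) = 0") (auto simp: mult_le_cancel_right)
  moreover have "norm (lip x x) \<le> norm (rip x x)"
    using 2 by (cases "norm (lip x x) = 0") (auto simp: mult_le_cancel_right)
  ultimately show ?thesis by simp
qed

text \<open>The linking identity turns \<open>star (rip x y) * rip x y\<close> into
  \<open>rip y (la (lip x x) y)\<close>, in which \<open>lip x x\<close> may be replaced by its
  norm.\<close>

lemma cauchy_schwarz:
  assumes x: "x \<in> X" and y: "y \<in> X" shows "(norm (rip x y))\<^sup>2 \<le> norm (rip x x) * norm (rip y y)"
proof -
  have p: "positive (emb (lip x x))" using lip_positive[OF x] by (simp add: positive_emb_iff)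
  have "(norm (rip x y))\<^sup>2 = norm (star (rip x y) * rip x y)" by (simp add: cstar_identity)
  also have "star (rip x y) * rip x y = rip y (ula (emb (lip x x)) y)"
    using x y by (simp add: star_rip link rip_ra)
  also have "norm \<dots> \<le> norm (lip x x) * norm (rip y y)"
  proof -
    have "emb (lip x x) \<preceq> norm (lip x x) *\<^sub>R 1" by (rule ple_norm[OF star_positive[OF p]]) simp
    from rip_ula_mono[OF y this]
    have "norm (emb (rip y (ula (emb (lip x x)) y))) \<le> norm (emb (norm (lip x x) *\<^sub>R rip y y))"
      using rip_ula_positive[OF y p] y by (intro norm_mono) (simp_all add: positive_emb_iff rip_ula_scaleR ula_one)
    then show ?thesis by simp
  qed
  finally show ?thesis unfolding norm_lip_eq[OF x] .
qed

text \<open>The Hilbert module norm. All estimates in this locale refer to it rather than to the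
  ambient \<open>norm\<close> on the carrier type.\<close>

definition xnorm :: "'x \<Rightarrow> real" where "xnorm x = sqrt (norm (rip x x))"

lemma norm_rip_le: "x \<in> X \<Longrightarrow> y \<in> X \<Longrightarrow> norm (rip x y) \<le> xnorm x * xnorm y"
  using real_sqrt_le_mono[OF cauchy_schwarz] by (simp add: xnorm_def real_sqrt_mult)

lemma xnorm_ula_le: "y \<in> X \<Longrightarrow> xnorm (ula u y) \<le> norm u * xnorm y"
  using real_sqrt_le_mono[OF norm_rip_ula_le] by (simp add: xnorm_def real_sqrt_mult)

lemma xnorm_nonneg [simp]: "0 \<le> xnorm x"
  by (simp add: xnorm_def)

lemma bounded_linear_rip_ula:
  assumes x: "x \<in> X" and y: "y \<in> X" shows "bounded_linear (\<lambda>u. rip x (ula u y))"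
proof (rule bounded_linear_intro[where K = "xnorm x * xnorm y"])
  fix u
  have "norm (rip x (ula u y)) \<le> xnorm x * xnorm (ula u y)" using x y by (intro norm_rip_le) auto
  also have "\<dots> \<le> xnorm x * (norm u * xnorm y)" using y by (intro mult_left_mono xnorm_ula_le) auto
  finally show "norm (rip x (ula u y)) \<le> norm u * (xnorm x * xnorm y)" by (simp add: mult_ac)
qed (use x y in \<open>auto simp: ula_add rip_add rip_ula_scaleR\<close>)

section \<open>Approximate units built from inner products\<close>

lemma emb_lip_ula_ula: "x \<in> X \<Longrightarrow> emb (lip (ula u x) (ula u x)) = u * emb (lip x x) * star u"
proof -
  assume x: "x \<in> X"
  have "emb (lip x (ula u x)) = star (emb (lip (ula u x) x))" using x by (simp add: star_lip flip: emb_simps(8))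
  also have "\<dots> = star (emb (lip x x)) * star u" using x by (simp only: emb_lip_ula star_mult)
  also have "star (emb (lip x x)) = emb (lip x x)" using x by (simp add: star_lip flip: emb_simps(8))
  finally show ?thesis using x by (simp add: emb_lip_ula mult.assoc)
qed

lemma emb_rip_ura_ura: "x \<in> X \<Longrightarrow> emb (rip (ura x v) (ura x v)) = star v * emb (rip x x) * v"
  by (simp add: emb_rip_ura emb_rip_ura_left mult.assoc)

text \<open>Apply \<open>tikhonov\<close> to c, the sum of all \<open>lip (x k) (x k)\<close>. Each
  summand is at most c, so conjugation with 1 - u makes it at most \<delta>, and the left and right
  norms of a vector agree.\<close>

lemma left_approx_unit:
  assumes x: "\<And>k. k < (N::nat) \<Longrightarrow> x k \<in> X" and \<delta>: "\<delta> > 0"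
  obtains u where "positive u" "norm u \<le> 1" "\<And>k. k < N \<Longrightarrow> norm (rip (ula (1 - emb u) (x k)) (ula (1 - emb u) (x k))) \<le> \<delta>"
proof -
  define c where "c = (\<Sum>k<N. lip (x k) (x k))"
  have pl: "positive (emb (lip (x k) (x k)))" if "k < N" for k using x[OF that] lip_positive by (simp add: positive_emb_iff)
  have c: "positive (emb c)" unfolding c_def emb_sum by (intro positive_sum pl) simp
  let ?U = "ucfc (\<lambda>t. \<bar>t\<bar> / (\<bar>t\<bar> + \<delta>)) (emb c)"
  note U = tikhonov[OF c \<delta>]
  obtain u where u: "?U = emb u" using uscal_tikhonov[OF c \<delta>] uscal_eq_0_iff by blast
  have sU: "star (1 - emb u) = 1 - emb u" using star_positive[OF U(1)] by (simp add: u star_diff)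
  show ?thesis
  proof (rule that[of u])
    show "positive u" "norm u \<le> 1" using U(1,2) by (simp_all add: u positive_emb_iff)
    fix k assume k: "k < N"
    let ?w = "ula (1 - emb u) (x k)"
    have "emb (lip (x k) (x k)) \<preceq> emb c"
    proof -
      have "emb c - emb (lip (x k) (x k)) = (\<Sum>l\<in>{..<N} - {k}. emb (lip (x l) (x l)))"
        unfolding c_def emb_sum by (subst sum.remove[of "{..<N}" k]) (use k in auto)
      moreover have "positive (\<Sum>l\<in>{..<N} - {k}. emb (lip (x l) (x l)))" by (intro positive_sum pl) auto
      ultimately show ?thesis by (simp add: ple_def)
    qed
    from ple_conj[OF this, of "1 - emb u"]
    have le: "emb (lip ?w ?w) \<preceq> (1 - emb u) * emb c * (1 - emb u)"
      using x[OF k] by (simp add: emb_lip_ula_ula sU)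
    have "norm (rip ?w ?w) = norm (emb (lip ?w ?w))" using x[OF k] by (simp add: norm_lip_eq)
    also have "\<dots> \<le> norm ((1 - emb u) * emb c * (1 - emb u))"
      using le x[OF k] lip_positive by (intro norm_mono) (simp_all add: positive_emb_iff)
    also have "\<dots> \<le> \<delta>" using U(3) by (simp add: u)
    finally show "norm (rip ?w ?w) \<le> \<delta>" .
  qed
qed

lemma rip_sums_dense:
  assumes "\<delta> > 0"
  shows "\<exists>(V :: 'b set) x w. finite V \<and> (\<forall>v\<in>V. x v \<in> X \<and> w v \<in> X) \<and> norm (b - (\<Sum>v\<in>V. rip (x v) (w v))) < \<delta>"
proof -
  let ?S = "{rip x y | x y. x \<in> X \<and> y \<in> X}"
  obtain c where c: "c \<in> span ?S" "dist c b < \<delta>" using full closure_approachable[of b "span ?S"] assms by auto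
  from c(1) obtain V r where V: "finite V" "V \<subseteq> ?S" "c = (\<Sum>v\<in>V. r v *\<^sub>R v)" unfolding span_explicit by blast
  from V(2) have "\<forall>v\<in>V. \<exists>x y. x \<in> X \<and> y \<in> X \<and> v = rip x y" by blast
  then obtain x y where xy: "\<forall>v\<in>V. x v \<in> X \<and> y v \<in> X \<and> v = rip (x v) (y v)" by metis
  have "c = (\<Sum>v\<in>V. rip (x v) (complex_of_real (r v) *\<^sub>C y v))"
    unfolding V(3) using xy by (intro sum.cong refl) (metis rip_scaleC scaleC_of_real)
  then show ?thesis using V(1) xy c(2) X_scaleC
    by (intro exI[of _ V] exI[of _ x] exI[of _ "\<lambda>v. complex_of_real (r v) *\<^sub>C y v"])
      (simp add: dist_norm norm_minus_commute)
qed

text \<open>Given finitely many vectors whose inner products approximate F, let h be the sum of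
  their squares and replace each vector u by u g, with g the inverse square root of h + \<tau>. The
  squares of the new vectors add up to h / (h + \<tau>), which is at most 1 and almost a unit on
  F.\<close>

lemma right_approx_unit:
  assumes F: "finite (F :: 'b set)" and \<delta>: "\<delta> > 0"
  obtains N x where "N \<ge> 1" "\<And>k::nat. k < N \<Longrightarrow> x k \<in> X" "emb (\<Sum>k<N. rip (x k) (x k)) \<preceq> 1"
    "\<And>b. b \<in> F \<Longrightarrow> norm ((\<Sum>k<N. rip (x k) (x k)) * b - b) \<le> \<delta> \<and> norm (b * (\<Sum>k<N. rip (x k) (x k)) - b) \<le> \<delta>"
proof -
  define F' where "F' = F \<union> star ` F"
  have F': "finite F'" using F by (simp add: F'_def)
  have "\<delta> / 3 > 0" using \<delta> by simp
  from rip_sums_dense[OF this] obtain V z w where V: "\<And>b. finite (V b :: 'b set)" "\<And>b v. v \<in> V b \<Longrightarrow> z b v \<in> X \<and> w b v \<in> X"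
    and close: "\<And>b. norm (b - (\<Sum>v\<in>V b. rip (z b v) (w b v))) < \<delta> / 3" by metis
  \<comment> \<open>The vector 0 guarantees a nonempty family, as \<open>splitting\<close> is
    applied with its size.\<close>
  define U where "U = insert 0 (\<Union>b\<in>F'. z b ` V b)"
  have U: "finite U" "U \<subseteq> X" using F' V X_0 by (auto simp: U_def)
  \<comment> \<open>\<tau> is chosen so that (1 - E) shrinks every left vector to \<delta> / (3 C),
    which costs \<delta> / 3 after summation against the right vectors. The other two thirds pay for
    replacing b by a finite sum, since 1 - E has norm at most 2.\<close>
  define C where "C = 1 + (\<Sum>b\<in>F'. \<Sum>u\<in>V b. xnorm (w b u))"
  have C: "C > 0" by (simp add: C_def add_pos_nonneg sum_nonneg)
  define \<tau> where "\<tau> = (\<delta> / (3 * C))\<^sup>2"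
  have \<tau>: "\<tau> > 0" using C \<delta> by (simp add: \<tau>_def)
  define h where "h = (\<Sum>u\<in>U. rip u u)"
  have pr: "positive (emb (rip u u))" if "u \<in> U" for u using that U rip_positive by (auto simp: positive_emb_iff)
  have h: "positive (emb h)" unfolding h_def emb_sum by (intro positive_sum pr)
  define E where "E = ucfc (\<lambda>t. \<bar>t\<bar> / (\<bar>t\<bar> + \<tau>)) (emb h)"
  define g where "g = ucfc (\<lambda>t. 1 / sqrt (\<bar>t\<bar> + \<tau>)) (emb h)"
  note T = tikhonov[OF h \<tau>, folded E_def g_def]
  define e where "e = (\<Sum>u\<in>U. rip (ura u g) (ura u g))"
  have eE: "emb e = E"
  proof -
    have "emb e = (\<Sum>u\<in>U. g * emb (rip u u) * g)" unfolding e_def emb_sum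
      using U T(5) by (intro sum.cong refl) (auto simp: emb_rip_ura_ura)
    also have "\<dots> = g * emb h * g" by (simp add: h_def emb_sum sum_distrib_left sum_distrib_right)
    finally show ?thesis using T(4) by simp
  qed
  have sE: "star E = E" by (rule star_positive[OF T(1)])
  have xn: "xnorm (ura u (1 - E)) \<le> \<delta> / (3 * C)" if u: "u \<in> U" for u
  proof -
    have uX: "u \<in> X" using u U by auto
    have "emb (rip u u) \<preceq> emb h"
    proof -
      have "emb h - emb (rip u u) = (\<Sum>v\<in>U - {u}. emb (rip v v))"
        unfolding h_def emb_sum by (subst sum.remove[of U u]) (use u U in auto)
      moreover have "positive (\<Sum>v\<in>U - {u}. emb (rip v v))" by (intro positive_sum pr) auto
      ultimately show ?thesis by (simp add: ple_def)
    qed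
    from ple_conj[OF this, of "1 - E"]
    have le: "emb (rip (ura u (1 - E)) (ura u (1 - E))) \<preceq> (1 - E) * emb h * (1 - E)"
      using uX by (simp add: emb_rip_ura_ura sE star_diff)
    have "norm (rip (ura u (1 - E)) (ura u (1 - E))) = norm (emb (rip (ura u (1 - E)) (ura u (1 - E))))" by simp
    also have "\<dots> \<le> norm ((1 - E) * emb h * (1 - E))"
      using le uX rip_positive by (intro norm_mono) (simp_all add: positive_emb_iff)
    also have "\<dots> \<le> \<tau>" by (rule T(3))
    finally have "xnorm (ura u (1 - E)) \<le> sqrt \<tau>" unfolding xnorm_def by (rule real_sqrt_le_mono)
    then show ?thesis using C \<delta> by (simp add: \<tau>_def)
  qed
  have left: "norm (e * b - b) \<le> \<delta>" if b: "b \<in> F'" for b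
  proof -
    let ?b = "\<Sum>v\<in>V b. rip (z b v) (w b v)"
    have "norm ((1 - E) * emb ?b) \<le> (\<Sum>u\<in>V b. \<delta> / (3 * C) * xnorm (w b u))"
      unfolding emb_sum sum_distrib_left
    proof (rule sum_norm_le)
      fix v assume v: "v \<in> V b"
      then have zX: "z b v \<in> X" "w b v \<in> X" "z b v \<in> U" using V(2) b by (auto simp: U_def)
      have "(1 - E) * emb (rip (z b v) (w b v)) = emb (rip (ura (z b v) (1 - E)) (w b v))"
        using zX by (simp add: emb_rip_ura_left star_diff sE)
      then have "norm ((1 - E) * emb (rip (z b v) (w b v))) \<le> xnorm (ura (z b v) (1 - E)) * xnorm (w b v)"
        using zX norm_rip_le by simp
      also have "\<dots> \<le> \<delta> / (3 * C) * xnorm (w b v)" by (intro mult_right_mono xn zX) simp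
      finally show "norm ((1 - E) * emb (rip (z b v) (w b v))) \<le> \<delta> / (3 * C) * xnorm (w b v)" .
    qed
    also have "\<dots> = \<delta> / (3 * C) * (\<Sum>u\<in>V b. xnorm (w b u))" by (simp add: sum_distrib_left)
    also have "\<dots> \<le> \<delta> / (3 * C) * C"
    proof (rule mult_left_mono)
      have "(\<Sum>u\<in>V b. xnorm (w b u)) \<le> (\<Sum>b\<in>F'. \<Sum>u\<in>V b. xnorm (w b u))"
        using b F' by (intro member_le_sum) (auto intro: sum_nonneg)
      then show "(\<Sum>u\<in>V b. xnorm (w b u)) \<le> C" by (simp add: C_def)
    qed (use C \<delta> in simp)
    also have "\<dots> = \<delta> / 3" using C by simp
    finally have 1: "norm ((1 - E) * emb ?b) \<le> \<delta> / 3" .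
    have "norm (1 - E) \<le> 2" using norm_triangle_ineq4[of 1 E] T(2) by simp
    then have "norm ((1 - E) * emb (b - ?b)) \<le> 2 * (\<delta> / 3)"
      using order_trans[OF norm_mult_ineq mult_mono] close[of b] by (metis (no_types, lifting) less_imp_le norm_emb norm_ge_zero zero_le_numeral)
    moreover have "emb (e * b - b) = - ((1 - E) * emb (b - ?b) + (1 - E) * emb ?b)"
      by (simp add: emb_simps eE algebra_simps)
    ultimately have "norm (emb (e * b - b)) \<le> 2 * (\<delta> / 3) + \<delta> / 3"
      using 1 by (simp only: norm_minus_cancel norm_triangle_mono)
    then show ?thesis by simp
  qed
  obtain f where f: "bij_betw f {0..<card U} U" using ex_bij_betw_nat_finite[OF U(1)] by blast
  define x where "x k = ura (f k) g" for k
  have ex: "e = (\<Sum>k<card U. rip (x k) (x k))"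
    unfolding e_def x_def lessThan_atLeast0 by (rule sum.reindex_bij_betw[OF f, symmetric])
  have se: "star e = e" using sE unfolding eE[symmetric] by (simp only: star_emb_iff)
  show ?thesis
  proof (rule that[of "card U" x])
    show "card U \<ge> 1" using U(1) by (simp add: U_def card_gt_0_iff Suc_le_eq)
    show "x k \<in> X" if "k < card U" for k
      using f that U by (auto simp: x_def bij_betw_def intro!: ura_X)
    show "emb (\<Sum>k<card U. rip (x k) (x k)) \<preceq> 1"
      unfolding ex[symmetric] eE using ple_norm[OF sE T(2)] by simp
    fix b assume b: "b \<in> F"
    have "star (e * star b - star b) = b * e - b" by (simp add: star_diff star_mult se)
    then have "norm (b * e - b) \<le> \<delta>" using left[of "star b"] b by (metis F'_def UnCI image_eqI norm_star)
    then show "norm ((\<Sum>k<card U. rip (x k) (x k)) * b - b) \<le> \<delta> \<and> norm (b * (\<Sum>k<card U. rip (x k) (x k)) - b) \<le> \<delta>"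
      unfolding ex[symmetric] using left[of b] b by (simp add: F'_def)
  qed
qed

section \<open>The positive map \<theta> and its approximate multiplicativity\<close>

lemma rip_la_mult:
  assumes "x \<in> X" "y \<in> X" "z \<in> X" "w \<in> X"
  shows "rip x (la a y) * rip z w = rip x (la (a * lip y z) w)"
  using assms by (simp add: la_mult la_X link flip: la_ra rip_ra)

definition theta :: "nat \<Rightarrow> (nat \<Rightarrow> 'x) \<Rightarrow> 'a uz \<Rightarrow> 'b" where
  "theta N x u = (\<Sum>k<N. rip (x k) (ula u (x k)))"

context
  fixes N :: nat and x :: "nat \<Rightarrow> 'x"
  assumes x: "\<And>k. k < N \<Longrightarrow> x k \<in> X"
begin

lemma bounded_linear_theta: "bounded_linear (theta N x)"
  unfolding theta_def by (intro bounded_linear_sum bounded_linear_rip_ula) (auto intro: x)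

lemma theta_positive: "positive u \<Longrightarrow> positive (theta N x u)"
  unfolding theta_def by (intro positive_sum_cstar rip_ula_positive) (auto intro: x)

lemma theta_diff: "theta N x (u - v) = theta N x u - theta N x v"
  using linear_diff[OF bounded_linear.linear[OF bounded_linear_theta]] .

lemma theta_mono: "u \<preceq> v \<Longrightarrow> emb (theta N x u) \<preceq> emb (theta N x v)"
  using theta_positive[of "v - u"] by (simp add: ple_def theta_diff positive_emb_iff flip: emb_simps(2))

lemma star_theta: "star (theta N x u) = theta N x (star u)"
  unfolding theta_def star_sum
proof (rule sum.cong)
  fix k assume "k \<in> {..<N}"
  then have "x k \<in> X" using x by simp
  then show "star (rip (x k) (ula u (x k))) = rip (x k) (ula (star u) (x k))" by (simp add: star_rip rip_ula)
qed simp

lemma theta_one: "theta N x 1 = (\<Sum>k<N. rip (x k) (x k))"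
  unfolding theta_def by (intro sum.cong refl) (use x in \<open>simp add: ula_one\<close>)

lemma bounded_linear_rip_la: "k < N \<Longrightarrow> l < N \<Longrightarrow> bounded_linear (\<lambda>a. rip (x k) (la a (x l)))"
  using bounded_linear_compose[OF bounded_linear_rip_ula bounded_linear_emb, of "x k" "x l"] x by simp

lemma theta_emb: "theta N x (emb a) = (\<Sum>k<N. rip (x k) (la a (x k)))"
  by (simp add: theta_def)

text \<open>\<theta>(a) \<theta>(c) is the sum over k and l of \<open>rip (x k)\<close> against a
  \<open>lip (x k) (x l)\<close> c acting on \<open>x l\<close>. Once c has been moved to the left
  of the inner product, the sum regroups as \<theta>(a c) \<theta>(1).\<close>

lemma theta_mult_asym:
  assumes a: "Bseq a" and c: "Bseq c"
    and com: "\<And>k l. k < N \<Longrightarrow> l < N \<Longrightarrow> asym_commutes c (lip (x k) (x l))"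
  shows "(\<lambda>m. theta N x (emb (a m)) * theta N x (emb (c m))) \<asymp> (\<lambda>m. theta N x (emb (a m * c m)) * theta N x 1)"
proof -
  have "(\<lambda>m. theta N x (emb (a m)) * theta N x (emb (c m)))
    = (\<lambda>m. \<Sum>k<N. \<Sum>l<N. rip (x k) (la (a m * (lip (x k) (x l) * c m)) (x l)))"
    unfolding theta_emb sum_product
    by (intro ext sum.cong refl) (use x in \<open>simp add: rip_la_mult la_X mult.assoc flip: la_mult\<close>)
  also have "\<dots> \<asymp> (\<lambda>m. \<Sum>k<N. \<Sum>l<N. rip (x k) (la (a m * (c m * lip (x k) (x l))) (x l)))"
  proof (intro asym_sum)
    fix k l assume "k \<in> {..<N}" "l \<in> {..<N}"
    then have k: "k < N" "l < N" by auto
    show "(\<lambda>m. rip (x k) (la (a m * (lip (x k) (x l) * c m)) (x l)))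
      \<asymp> (\<lambda>m. rip (x k) (la (a m * (c m * lip (x k) (x l))) (x l)))"
      by (rule asym_bounded_linear[OF bounded_linear_rip_la[OF k] asym_mult[OF asym_refl[OF a]
          asym_sym[OF com[OF k, unfolded asym_commutes_def]]]])
  qed
  also have "\<dots> = (\<lambda>m. theta N x (emb (a m * c m)) * theta N x 1)"
    unfolding theta_emb theta_one sum_product
    by (intro ext sum.cong refl) (use x in \<open>simp add: rip_la_mult mult.assoc\<close>)
  finally show ?thesis .
qed

text \<open>The element b is absorbed into the inner product of \<open>ra (x k) b\<close> with
  \<open>x l\<close>, and c is moved past it. Since \<theta>(1) is almost a unit for b, this says
  that \<theta>(c) almost commutes with b.\<close>

lemma theta_commutes_asym:
  assumes c: "Bseq c" and com: "\<And>k l. k < N \<Longrightarrow> l < N \<Longrightarrow> asym_commutes c (lip (ra (x k) b) (x l))"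
  shows "(\<lambda>m. theta N x 1 * b * theta N x (emb (c m))) \<asymp> (\<lambda>m. theta N x (emb (c m)) * b * theta N x 1)"
proof -
  have "(\<lambda>m. theta N x 1 * b * theta N x (emb (c m)))
    = (\<lambda>m. \<Sum>k<N. \<Sum>l<N. rip (x k) (la (lip (ra (x k) b) (x l) * c m) (x l)))"
    unfolding theta_emb theta_one sum_distrib_right unfolding sum_distrib_left
    by (intro ext sum.cong refl) (use x in \<open>simp add: la_mult la_X link ra_X flip: rip_ra la_ra\<close>)
  also have "\<dots> \<asymp> (\<lambda>m. \<Sum>k<N. \<Sum>l<N. rip (x k) (la (c m * lip (ra (x k) b) (x l)) (x l)))"
  proof (intro asym_sum asym_bounded_linear[OF bounded_linear_rip_la])
    fix k l assume "k \<in> {..<N}" "l \<in> {..<N}"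
    then show "(\<lambda>m. lip (ra (x k) b) (x l) * c m) \<asymp> (\<lambda>m. c m * lip (ra (x k) b) (x l))"
      using asym_sym[OF com[unfolded asym_commutes_def]] by simp
  qed auto
  also have "\<dots> = (\<lambda>m. theta N x (emb (c m)) * b * theta N x 1)"
    unfolding theta_emb theta_one sum_distrib_right unfolding sum_distrib_left
    by (intro ext sum.cong refl) (use x in \<open>simp add: la_mult la_X link ra_X flip: rip_ra la_ra\<close>)
  finally show ?thesis .
qed

end

end

lemma positive_square_le:
  fixes a :: "'u::cstar_algebra_1"
  assumes a: "positive a" shows "a * a \<preceq> norm a *\<^sub>R a"
proof -
  have s: "psqrt a * psqrt a = a" "star (psqrt a) = psqrt a" using a by (simp_all add: psqrt_square star_psqrt)
  have "a \<preceq> norm a *\<^sub>R 1" by (rule ple_norm[OF star_positive[OF a]]) simp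
  from ple_conj[OF this, of "psqrt a"] have "psqrt a * a * psqrt a \<preceq> norm a *\<^sub>R a" by (simp add: s)
  moreover have "psqrt a * a * psqrt a = a * a"
    using s(1) by (metis mult.assoc)
  ultimately show ?thesis by simp
qed

text \<open>The difference of the two sides is (2 u - 1) m (2 u - 1). It splits m along an
  approximate unit u that need not commute with m.\<close>

lemma ple_split:
  fixes m :: "'u::cstar_algebra_1"
  assumes m: "positive m" and u: "star u = u"
  shows "m \<preceq> 2 *\<^sub>R (u * m * u) + 2 *\<^sub>R ((1 - u) * m * (1 - u))"
proof -
  have "positive (star (u - (1 - u)) * m * (u - (1 - u)))" by (rule positive_conj[OF m])
  moreover have "star (u - (1 - u)) = u - (1 - u)" by (simp add: star_diff u)
  moreover have "2 *\<^sub>R (u * m * u) + 2 *\<^sub>R ((1 - u) * m * (1 - u)) - m = (u - (1 - u)) * m * (u - (1 - u))"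
    by (simp add: algebra_simps scaleR_2)
  ultimately show ?thesis by (simp add: ple_def)
qed

context morita_context
begin

lemma rip_sum: "x \<in> X \<Longrightarrow> (\<And>i. i \<in> I \<Longrightarrow> y i \<in> X) \<Longrightarrow> rip x (\<Sum>i\<in>I. y i) = (\<Sum>i\<in>I. rip x (y i))"
  and X_sum: "(\<And>i. i \<in> I \<Longrightarrow> y i \<in> X) \<Longrightarrow> (\<Sum>i\<in>I. y i) \<in> X"
proof (induction I rule: infinite_finite_induct)
  case (insert i I)
  {
    case 1
    then show ?case using insert by (simp add: rip_add)
  next
    case 2
    then show ?case using insert by (simp add: X_add)
  }
qed (auto simp: rip_zero X_0)

lemma rip_sum_left:
  assumes "x \<in> X" "\<And>i. i \<in> I \<Longrightarrow> y i \<in> X" shows "rip (\<Sum>i\<in>I. y i) x = (\<Sum>i\<in>I. rip (y i) x)"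
proof -
  have "star (rip x (\<Sum>i\<in>I. y i)) = (\<Sum>i\<in>I. star (rip x (y i)))" using assms by (simp add: rip_sum star_sum)
  then show ?thesis using assms by (simp add: star_rip X_sum)
qed

lemma ra_sum: "x \<in> X \<Longrightarrow> ra x (\<Sum>i\<in>I. b i) = (\<Sum>i\<in>I. ra x (b i))"
  by (induction I rule: infinite_finite_induct) (auto simp: ra_zero ra_add)

text \<open>With z = y a q, the inner product of z with itself is (star q) a \<open>rip y y\<close>
  a q. Replacing \<open>rip y y\<close> by its norm and one factor a by its norm leaves a multiple
  of (star q) a q.\<close>

lemma rip_compress_le:
  assumes y: "y \<in> X" and a: "positive a"
  shows "emb (rip (ra (ra y a) q) (ra (ra y a) q))
    \<preceq> emb ((sqrt (norm (rip y y) * norm a) *\<^sub>R star q) * a * star (sqrt (norm (rip y y) * norm a) *\<^sub>R star q))"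
proof -
  let ?a = "emb a" and ?r = "rip y y"
  have pa: "positive ?a" using a by (simp add: positive_emb_iff)
  have sa: "star ?a = ?a" by (rule star_positive[OF pa])
  have "emb ?r \<preceq> norm ?r *\<^sub>R 1"
    using y rip_positive by (intro ple_norm star_positive) (simp_all add: positive_emb_iff)
  from ple_conj[OF this, of ?a] have "?a * emb ?r * ?a \<preceq> norm ?r *\<^sub>R (?a * ?a)" by (simp add: sa)
  also have "\<dots> \<preceq> norm ?r *\<^sub>R (norm ?a *\<^sub>R ?a)" by (intro ple_scaleR positive_square_le pa) simp
  finally have "?a * emb ?r * ?a \<preceq> (norm ?r * norm a) *\<^sub>R ?a" by simp
  from ple_conj[OF this, of "emb q"]
  have "star (emb q) * (?a * emb ?r * ?a) * emb q \<preceq> (norm ?r * norm a) *\<^sub>R (star (emb q) * ?a * emb q)" by simp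
  moreover have "emb (rip (ra (ra y a) q) (ra (ra y a) q)) = star (emb q) * (?a * emb ?r * ?a) * emb q"
    using emb_rip_ura_ura[of "ra y a" "emb q"] emb_rip_ura_ura[of y ?a] y by (simp add: ra_X sa)
  moreover have "emb ((sqrt (norm ?r * norm a) *\<^sub>R star q) * a * star (sqrt (norm ?r * norm a) *\<^sub>R star q))
    = (norm ?r * norm a) *\<^sub>R (star (emb q) * ?a * emb q)"
    by (simp add: emb_simps star_scaleR)
  ultimately show ?thesis by simp
qed

text \<open>The vectors z_k = T_k (star v) x_k have orthogonal left factors, so the inner product of
  their sum with itself is the sum of N terms that defines \<theta>(v S (star v)). As T_k starts
  with the inner product of y a with itself, linking writes the sum as (y a) q with a single q, to
  which \<open>rip_compress_le\<close> applies. Thus N summands fit under one copy of a.\<close>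

lemma theta_compress_le:
  fixes N :: nat
  assumes x: "\<And>k. k < N \<Longrightarrow> x k \<in> X" and y: "y \<in> X" and a: "positive a"
    and T: "\<And>k. k < N \<Longrightarrow> \<exists>r. T k = lip (ra y a) (ra y a) * r"
    and orth: "\<And>k l. k < N \<Longrightarrow> l < N \<Longrightarrow> star (T k) * T l = (if k = l then S else 0)"
  shows "\<exists>w. emb (theta N x (emb (v * S * star v))) \<preceq> emb (w * a * star w)"
proof -
  let ?\<eta> = "ra y a"
  define z where "z k = la (T k * star v) (x k)" for k
  have zX: "z k \<in> X" if "k < N" for k using x that by (simp add: z_def la_X)
  have \<eta>: "?\<eta> \<in> X" using y by (rule ra_X)
  have "rip (z k) (z l) = (if k = l then rip (x k) (la (v * S * star v) (x k)) else 0)" if kl: "k < N" "l < N" for k l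
  proof -
    have "rip (z k) (z l) = rip (x k) (la (v * (star (T k) * T l) * star v) (x l))"
      using x kl by (simp add: z_def rip_la la_X star_mult mult.assoc flip: la_mult)
    then show ?thesis using x kl by (simp add: orth la_zero rip_zero)
  qed
  then have zz: "(\<Sum>k<N. \<Sum>l<N. rip (z k) (z l)) = (\<Sum>k<N. \<Sum>l<N. if k = l then rip (x k) (la (v * S * star v) (x k)) else 0)"
    by (intro sum.cong refl) auto
  have "rip (\<Sum>k<N. z k) (\<Sum>k<N. z k) = (\<Sum>k<N. rip (z k) (\<Sum>l<N. z l))"
    using zX by (intro rip_sum_left X_sum) auto
  also have "\<dots> = (\<Sum>k<N. \<Sum>l<N. rip (z k) (z l))" using zX by (intro sum.cong refl rip_sum) auto
  also note zz
  finally have "rip (\<Sum>k<N. z k) (\<Sum>k<N. z k) = (\<Sum>k<N. \<Sum>l<N. if k = l then rip (x k) (la (v * S * star v) (x k)) else 0)" .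
  then have \<theta>: "rip (\<Sum>k<N. z k) (\<Sum>k<N. z k) = theta N x (emb (v * S * star v))"
    using x by (simp add: theta_emb)
  obtain r where r: "\<And>k. k < N \<Longrightarrow> T k = lip ?\<eta> ?\<eta> * r k" using T by metis
  define q where "q = (\<Sum>k<N. rip ?\<eta> (la (r k * star v) (x k)))"
  have "z k = ra ?\<eta> (rip ?\<eta> (la (r k * star v) (x k)))" if "k < N" for k
  proof -
    have "z k = la (lip ?\<eta> ?\<eta> * (r k * star v)) (x k)" by (simp add: z_def r that mult.assoc)
    also have "\<dots> = la (lip ?\<eta> ?\<eta>) (la (r k * star v) (x k))" using x that by (intro la_mult)
    also have "\<dots> = ra ?\<eta> (rip ?\<eta> (la (r k * star v) (x k)))" using x that by (intro link la_X \<eta>)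
    finally show ?thesis .
  qed
  then have "(\<Sum>k<N. z k) = ra ?\<eta> q" using \<eta> by (simp add: q_def ra_sum)
  then show ?thesis using rip_compress_le[OF y a, of q] \<theta> by metis
qed

lemma lip_eq_0_iff: "x \<in> X \<Longrightarrow> lip x x = 0 \<longleftrightarrow> rip x x = 0"
  using norm_lip_eq[of x] by (metis norm_eq_zero)

lemma rip_mult_eq_0:
  assumes "\<And>x y. x \<in> X \<Longrightarrow> y \<in> X \<Longrightarrow> rip x y * a = 0" shows "b * a = 0"
proof -
  have "b \<in> closure (span {rip x y | x y. x \<in> X \<and> y \<in> X})" using full by simp
  moreover have "closure (span {rip x y | x y. x \<in> X \<and> y \<in> X}) \<subseteq> {b. b * a = 0}"
  proof (rule closure_minimal)
    show "closed {b. b * a = 0}" by (intro closed_Collect_eq continuous_intros)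
    show "span {rip x y | x y. x \<in> X \<and> y \<in> X} \<subseteq> {b. b * a = 0}"
      using assms by (intro span_minimal) (auto simp: Real_Vector_Spaces.subspace_def distrib_right)
  qed
  ultimately show ?thesis by auto
qed

text \<open>If every y a had norm 0, Cauchy-Schwarz would give \<open>rip x y * a = 0\<close> for
  all x and y, and fullness would give \<open>star a * a = 0\<close>.\<close>

lemma nonzero_compression:
  assumes "a \<noteq> 0" obtains y where "y \<in> X" "lip (ra y a) (ra y a) \<noteq> 0"
proof (rule ccontr)
  assume nt: "\<not> thesis"
  note noc = that
  have z: "rip (ra y a) (ra y a) = 0" if y: "y \<in> X" for y using nt noc[OF y] lip_eq_0_iff[OF ra_X[OF y]] by blast
  have "rip x y * a = 0" if "x \<in> X" "y \<in> X" for x y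
  proof -
    have "norm (rip x (ra y a)) \<le> xnorm x * xnorm (ra y a)" using that by (intro norm_rip_le ra_X)
    then show ?thesis using z that by (simp add: xnorm_def rip_ra)
  qed
  then have "star a * a = 0" by (rule rip_mult_eq_0)
  then show False using assms by simp
qed

end

lemma asym_norm_eventually:
  assumes "X \<asymp> Y" "\<epsilon> > 0" shows "\<forall>\<^sub>F m in sequentially. norm (X m - Y m) < \<epsilon>"
  using assms order_tendstoD(2)[OF tendsto_norm_zero] unfolding asym_def by blast

lemma ple_one_norm_le: "positive u \<Longrightarrow> u \<preceq> (1::'u::cstar_algebra_1) \<Longrightarrow> norm u \<le> 1"
  using norm_le_of_ple[of u 1] by simp

context morita_context
begin

text \<open>The order of choices matters: the vectors x_k depend on F and x; S depends on a and on
  the number of vectors; the approximate unit xA depends on the vectors. Only then are columns in A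
  chosen, almost commuting with all the inner products involved and with 1 - h small on xA relative
  to S.\<close>

lemma almost_columns_transfer:
  assumes simple: "simple_cstar TYPE('a)" and tza: "tracially_Z_absorbing TYPE('a)"
    and x: "positive x" and a: "positive a" "a \<noteq> 0" and F: "finite F" and e: "\<epsilon> > 0" and n: "n \<ge> 1"
  shows "\<exists>Y. almost_columns n (x :: 'b) a F \<epsilon> Y"
proof -
  define B where "B = 1 + norm x"
  have B: "B \<ge> 1" "norm x \<le> B" by (simp_all add: B_def)
  \<comment> \<open>The failure of E to be a unit contributes 4 \<delta> to the commutators and 2 B
    \<delta> to the final inequality; as B \<ge> 1, the factor 8 B keeps these below \<epsilon>/2
    and \<epsilon>/4.\<close>
  define \<delta> where "\<delta> = \<epsilon> / (8 * B)"
  have \<delta>: "\<delta> > 0" "8 * \<delta> \<le> \<epsilon>" "8 * (B * \<delta>) = \<epsilon>" using e B by (simp_all add: \<delta>_def field_simps)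
  \<comment> \<open>\<open>x\<close> joins F because the final inequality is conjugated by x, and E
    has to be almost a unit for it as well.\<close>
  obtain N xs where N: "N \<ge> (1::nat)" and xs: "\<And>k::nat. k < N \<Longrightarrow> xs k \<in> X"
    and e1: "emb (\<Sum>k<N. rip (xs k) (xs k)) \<preceq> 1"
    and ex: "\<And>b. b \<in> insert x F \<Longrightarrow> norm ((\<Sum>k<N. rip (xs k) (xs k)) * b - b) \<le> \<delta> \<and> norm (b * (\<Sum>k<N. rip (xs k) (xs k)) - b) \<le> \<delta>"
    using right_approx_unit[of "insert x F" \<delta>] F \<delta> by auto
  define \<theta> where "\<theta> = theta N xs"
  define E where "E = \<theta> 1"
  have E: "E = (\<Sum>k<N. rip (xs k) (xs k))" unfolding E_def \<theta>_def by (rule theta_one) (rule xs)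
  note e1 = e1[folded E] and ex = ex[folded E]
  have \<theta>pos: "positive (\<theta> u)" if "positive u" for u unfolding \<theta>_def by (rule theta_positive[OF xs that])
  have \<theta>mono: "emb (\<theta> u) \<preceq> emb (\<theta> v)" if "u \<preceq> v" for u v unfolding \<theta>_def by (rule theta_mono[OF xs that])
  have \<theta>lin: "bounded_linear \<theta>" unfolding \<theta>_def by (rule bounded_linear_theta[OF xs])
  note \<theta>l = bounded_linear.linear[OF \<theta>lin]
  have \<theta>star: "star (\<theta> u) = \<theta> (star u)" for u unfolding \<theta>_def by (rule star_theta[OF xs])
  have norm\<theta>: "norm (\<theta> u) \<le> 1" if "positive u" "u \<preceq> 1" for u
  proof -
    have "emb (\<theta> u) \<preceq> 1" using \<theta>mono[OF that(2)] e1 unfolding E_def by (rule ple_trans)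
    with \<theta>pos[OF that(1)] have "norm (emb (\<theta> u)) \<le> 1" by (intro ple_one_norm_le) (simp_all add: positive_emb_iff)
    then show ?thesis by simp
  qed
  have nE: "norm E \<le> 1" unfolding E_def using norm\<theta>[of 1] positive_square[of "1 :: 'a uz"] by (simp add: ple_refl)
  obtain y where y: "y \<in> X" "lip (ra y a) (ra y a) \<noteq> 0" using nonzero_compression[OF a(2)] .
  have a0: "positive (lip (ra y a) (ra y a))" using y by (intro lip_positive ra_X)
  have nomin: "\<not> minimal_projection (p::'a)" for p using no_minimal_projection[OF simple tza] .
  obtain T and s :: 'a where s: "positive s" "s \<noteq> 0" and T: "\<And>i. i < N \<Longrightarrow> \<exists>r. T i = lip (ra y a) (ra y a) * r"
    and orth: "\<And>i j. i < N \<Longrightarrow> j < N \<Longrightarrow> star (T i) * T j = (if i = j then s * s else 0)"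
    by (rule splitting[OF simple nomin a0 y(2) N]) (rule that)
  define S where "S = s * s"
  have ss: "star s = s" by (rule star_positive[OF s(1)])
  have S: "positive S" "S \<noteq> 0"
    using s positive_square[of s] star_mult_self_eq_0_iff[of s] by (simp_all add: S_def ss)
  \<comment> \<open>N vectors contribute \<delta>' each; the splitting, the passage from h^2 to h,
    and the conjugation by x multiply the sum by 2, 2 and at most B^2, which gives
    \<epsilon>/4.\<close>
  define \<delta>' where "\<delta>' = \<epsilon> / (16 * real N * B\<^sup>2)"
  have \<delta>': "\<delta>' > 0" "4 * real N * \<delta>' * B\<^sup>2 = \<epsilon> / 4" using e B N by (simp_all add: \<delta>'_def field_simps)
  obtain xA where xA: "positive xA" "\<And>k. k < N \<Longrightarrow> norm (rip (ula (1 - emb xA) (xs k)) (ula (1 - emb xA) (xs k))) \<le> \<delta>'"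
    by (rule left_approx_unit[OF xs \<delta>'(1)]) (assumption, rule that)
  \<comment> \<open>The first family makes \<theta> almost multiplicative on the columns; the second
    makes their images almost commute with F.\<close>
  define FA where "FA = (\<lambda>(k, l). lip (xs k) (xs l)) ` ({..<N} \<times> {..<N})
    \<union> (\<lambda>(b, k, l). lip (ra (xs k) b) (xs l)) ` (F \<times> {..<N} \<times> {..<N})"
  have FA: "finite FA" using F by (simp add: FA_def)
  define d where "d m = inverse (real (Suc m))" for m
  have d: "d m > 0" for m by (simp add: d_def)
  have dlim: "d \<longlonglongrightarrow> 0" unfolding d_def by (rule LIMSEQ_inverse_real_of_nat)
  have "\<forall>m. \<exists>r g h v. exact_columns_for n xA S FA (d m) r g h v"
    using exact_columns_for_exists[OF tza xA(1) S FA d n] by blast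
  then obtain r g h v where C: "\<And>m. exact_columns_for n xA S FA (d m) (r m) (g m) (h m) (v m)" by metis
  note C' = C[unfolded exact_columns_for_def]
  have nr: "norm (r m i) \<le> 1" if "i < n" for m i using C' that by blast
  have g: "star (g m) = g m" "norm (g m) \<le> 1" for m using C' by blast+
  have h: "positive (h m)" "norm (h m) \<le> 1" "(\<Sum>i<n. r m i * star (r m i)) = h m * h m" for m using C' by blast+
  have sh: "star (h m) = h m" for m by (rule star_positive[OF h(1)])
  have com: "asym_commutes (\<lambda>m. r m i) b" if "i < n" "b \<in> FA" for i b
    using C' that nr unfolding d_def by (intro asym_commutesI) blast+
  have com1: "asym_commutes (\<lambda>m. r m i) (lip (xs k) (xs l))" if "i < n" "k < N" "l < N" for i k l
    using that by (intro com) (auto simp: FA_def)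
  have com2: "asym_commutes (\<lambda>m. star (r m i)) (lip (xs k) (xs l))" if "i < n" "k < N" "l < N" for i k l
    by (intro asym_commutes_star) (use that xs in \<open>simp add: star_lip com1\<close>)
  have com3: "asym_commutes (\<lambda>m. r m i) (lip (ra (xs k) b) (xs l))" if "i < n" "k < N" "l < N" "b \<in> F" for i k l b
    using that by (intro com) (force simp: FA_def)+
  have Br: "Bseq (\<lambda>m. r m i)" "Bseq (\<lambda>m. star (r m i))" if "i < n" for i
    using nr[OF that] by (auto intro!: BseqI'[where K = 1] simp: norm_star)
  define Y where "Y m i = \<theta> (emb (r m i))" for m i
  have Ystar: "star (Y m i) = \<theta> (emb (star (r m i)))" for m i by (simp add: Y_def \<theta>star emb_simps)
  \<comment> \<open>The common value that the images of all columns approach; the factor E is the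
    multiplicativity defect of \<theta>.\<close>
  define D where "D m = \<theta> (emb (g m * g m)) * E" for m
  have sq: "positive (emb (b * b))" "emb (b * b) \<preceq> 1" if "star b = b" "norm b \<le> 1" for b :: 'a
  proof -
    show p: "positive (emb (b * b))" using that positive_square[of b] by (simp add: positive_emb_iff)
    have "norm (b * b) \<le> 1" using norm_mult_ineq[of b b] that(2) by (meson mult_le_one norm_ge_zero order_trans)
    then show "emb (b * b) \<preceq> 1" using ple_norm[OF star_positive[OF p], of 1] by simp
  qed
  have nD: "norm (D m) \<le> 1" for m
    unfolding D_def using norm_mult_ineq mult_le_one[OF norm\<theta>[OF sq] norm_ge_zero nE] g by (meson order_trans)
  have YY: "(\<lambda>m. star (Y m i) * Y m j) \<asymp> (\<lambda>m. if i = j then D m else 0)" if ij: "i < n" "j < n" for i j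
  proof -
    have "(\<lambda>m. \<theta> (emb (star (r m i))) * \<theta> (emb (r m j))) \<asymp> (\<lambda>m. \<theta> (emb (star (r m i) * r m j)) * \<theta> 1)"
      unfolding \<theta>_def using ij by (intro theta_mult_asym xs Br com1) auto
    moreover have "star (r m i) * r m j = (if i = j then g m * g m else 0)" for m using C' ij by blast
    ultimately have "(\<lambda>m. star (Y m i) * Y m j) \<asymp> (\<lambda>m. \<theta> (emb (if i = j then g m * g m else 0)) * E)"
      unfolding Ystar by (simp only: Y_def E_def)
    also have "\<dots> = (\<lambda>m. if i = j then D m else 0)" by (rule ext, cases "i = j") (simp_all add: D_def linear_0[OF \<theta>l] emb_simps(4))
    finally show ?thesis .
  qed
  have Yb: "(\<lambda>m. E * b * Y m i) \<asymp> (\<lambda>m. Y m i * b * E)" if "i < n" "b \<in> F" for i b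
    unfolding Y_def E_def \<theta>_def using that by (intro theta_commutes_asym xs Br com3) auto
  have HH: "(\<lambda>m. \<Sum>i<n. Y m i * star (Y m i)) \<asymp> (\<lambda>m. \<theta> (emb (h m * h m)) * E)"
  proof -
    have "(\<lambda>m. \<Sum>i<n. Y m i * star (Y m i)) \<asymp> (\<lambda>m. \<Sum>i<n. \<theta> (emb (r m i * star (r m i))) * E)"
      unfolding Ystar unfolding Y_def E_def \<theta>_def by (intro asym_sum theta_mult_asym xs Br com2) auto
    also have "\<dots> = (\<lambda>m. \<theta> (emb (h m * h m)) * E)"
      by (simp only: sum_distrib_right[symmetric] linear_sum[OF \<theta>l, symmetric] emb_sum[symmetric] h(3))
    finally show ?thesis .
  qed
  define \<epsilon>' where "\<epsilon>' = min 1 (\<epsilon> / 2)"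
  have e': "\<epsilon>' > 0" "\<epsilon>' \<le> 1" "2 * \<epsilon>' \<le> \<epsilon>" using e by (auto simp: \<epsilon>'_def)
  have ev1: "\<forall>\<^sub>F m in sequentially. \<forall>i\<in>{..<n}. \<forall>j\<in>{..<n}. norm (star (Y m i) * Y m j - (if i = j then D m else 0)) < \<epsilon>'"
    using asym_norm_eventually[OF YY e'(1)] by (intro eventually_ball_finite ballI) auto
  have ev2: "\<forall>\<^sub>F m in sequentially. \<forall>i\<in>{..<n}. \<forall>b\<in>F. norm (E * b * Y m i - Y m i * b * E) < \<epsilon> / 2"
    using asym_norm_eventually[OF Yb, of _ _ "\<epsilon> / 2"] e F by (intro eventually_ball_finite ballI) auto
  define \<eta> where "\<eta> = \<epsilon> / (4 * B\<^sup>2)"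
  have \<eta>: "\<eta> > 0" "\<eta> * B\<^sup>2 = \<epsilon> / 4" using e B by (simp_all add: \<eta>_def field_simps)
  have ev3: "\<forall>\<^sub>F m in sequentially. norm ((\<Sum>i<n. Y m i * star (Y m i)) - \<theta> (emb (h m * h m)) * E) < \<eta>"
    by (rule asym_norm_eventually[OF HH \<eta>(1)])
  have ev4: "\<forall>\<^sub>F m in sequentially. d m < \<eta> / 8" by (rule order_tendstoD[OF dlim]) (use \<eta> in simp)
  obtain m where m: "\<forall>i\<in>{..<n}. \<forall>j\<in>{..<n}. norm (star (Y m i) * Y m j - (if i = j then D m else 0)) < \<epsilon>'"
    "\<forall>i\<in>{..<n}. \<forall>b\<in>F. norm (E * b * Y m i - Y m i * b * E) < \<epsilon> / 2"
    "norm ((\<Sum>i<n. Y m i * star (Y m i)) - \<theta> (emb (h m * h m)) * E) < \<eta>" "d m < \<eta> / 8"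
    using eventually_happens'[OF _ eventually_conj[OF ev1 eventually_conj[OF ev2 eventually_conj[OF ev3 ev4]]]] by auto
  have nY2: "(norm (Y m i))\<^sup>2 \<le> 1 + \<epsilon>'" if "i < n" for i
  proof -
    have "norm (star (Y m i) * Y m i - D m) < \<epsilon>'" using bspec[OF bspec[OF m(1)], of i i] that by simp
    then have "norm (star (Y m i) * Y m i) \<le> 1 + \<epsilon>'"
      using nD[of m] norm_triangle_ineq2[of "star (Y m i) * Y m i" "D m"] by linarith
    then show ?thesis by (simp add: cstar_identity)
  qed
  let ?H = "\<Sum>i<n. Y m i * star (Y m i)"
  show ?thesis
    unfolding almost_columns_def
  proof (intro exI[of _ "Y m"] conjI allI ballI impI)
    fix i j assume ij: "i < n" "j < n"
    show "norm (star (Y m i) * Y m j - (if i = j then star (Y m 0) * Y m 0 else 0)) \<le> \<epsilon>"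
    proof (cases "i = j")
      case True
      define A where "A = star (Y m i) * Y m j"
      define A0 where "A0 = star (Y m 0) * Y m 0"
      have "norm (A - D m) < \<epsilon>'" using bspec[OF bspec[OF m(1)], of i j] ij True by (simp add: A_def)
      moreover have "norm (A0 - D m) < \<epsilon>'" using bspec[OF bspec[OF m(1)], of 0 0] n by (simp add: A0_def)
      ultimately have "norm ((A - D m) - (A0 - D m)) \<le> \<epsilon>'  + \<epsilon>'" by (intro norm_triangle_le_diff add_mono less_imp_le)
      then have "norm (A - A0) \<le> \<epsilon>" using e'(3) by simp
      then show ?thesis using True by (simp only: A_def A0_def if_True simp_thms)
    next
      case False
      then have "norm (star (Y m i) * Y m j) < \<epsilon>'" using bspec[OF bspec[OF m(1)], of i j] ij by simp
      also have "\<epsilon>' \<le> \<epsilon>" using e' by simp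
      finally show ?thesis using False by simp
    qed
  next
    fix i b assume i: "i < n" and b: "b \<in> F"
    have "(norm (Y m i))\<^sup>2 \<le> 2\<^sup>2" using nY2[OF i] e'(2) by simp
    then have nY: "norm (Y m i) \<le> 2" by (rule power2_le_imp_le) simp
    have "Y m i * b - b * Y m i = - (Y m i * (b * E - b)) + ((E * b - b) * Y m i - (E * b * Y m i - Y m i * b * E))"
      by (simp add: algebra_simps)
    also have "norm \<dots> \<le> 2 * \<delta> + (\<delta> * 2 + \<epsilon> / 2)"
    proof -
      have "norm (Y m i * (b * E - b)) \<le> norm (Y m i) * norm (b * E - b)" by (rule norm_mult_ineq)
      also have "\<dots> \<le> 2 * \<delta>" using nY ex b by (intro mult_mono) auto
      finally have n1: "norm (- (Y m i * (b * E - b))) \<le> 2 * \<delta>" by simp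
      have "norm ((E * b - b) * Y m i) \<le> norm (E * b - b) * norm (Y m i)" by (rule norm_mult_ineq)
      also have "\<dots> \<le> \<delta> * 2" using nY ex b \<delta> by (intro mult_mono) auto
      finally have n2: "norm ((E * b - b) * Y m i) \<le> \<delta> * 2" .
      have n3: "norm (E * b * Y m i - Y m i * b * E) \<le> \<epsilon> / 2" using m(2) i b by (simp add: less_imp_le)
      show ?thesis by (rule norm_triangle_mono[OF n1 norm_triangle_le_diff[OF add_mono[OF n2 n3]]])
    qed
    also have "\<dots> \<le> \<epsilon>" using \<delta> by simp
    finally show "norm (Y m i * b - b * Y m i) \<le> \<epsilon>" .
  next
    have "(norm (Y m 0))\<^sup>2 \<le> 1 + \<epsilon>'" using nY2[of 0] n by simp
    also have "\<dots> \<le> 1 + 2 * \<epsilon> + \<epsilon>\<^sup>2" using e e' zero_le_power2[of \<epsilon>] by linarith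
    also have "\<dots> = (1 + \<epsilon>)\<^sup>2" by (simp add: power2_eq_square algebra_simps)
    finally have "(norm (Y m 0))\<^sup>2 \<le> (1 + \<epsilon>)\<^sup>2" .
    then show "norm (Y m 0) \<le> 1 + \<epsilon>" by (rule power2_le_imp_le) (use e in simp)
  next
    \<comment> \<open>The columns control only xA k xA, not k. \<open>ple_split\<close> separates k
      into this part and a part supported on 1 - xA, where \<theta> is small because 1 - xA almost
      kills every x_k.\<close>
    define k where "k = 1 - emb (h m)"
    have k: "positive k"
    proof -
      have "emb (h m) \<preceq> 1 *\<^sub>R 1" using h(2)[of m] sh by (intro ple_norm) (simp_all add: star_emb_iff)
      then show ?thesis by (simp add: k_def ple_def)
    qed
    have su: "star (emb xA) = emb xA" using star_positive[OF xA(1)] by (simp add: star_emb_iff)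
    let ?u = "1 - emb xA"
    let ?W = "emb xA * k * emb xA"
    have "\<exists>w. emb (\<theta> (emb (v m * S * star (v m)))) \<preceq> emb (w * a * star w)"
      unfolding \<theta>_def by (rule theta_compress_le[OF xs y(1) a(1) T orth[folded S_def]])
    then obtain w where w: "emb (\<theta> (emb (v m * S * star (v m)))) \<preceq> emb (w * a * star w)" ..
    have "?W \<preceq> (2 * d m) *\<^sub>R 1 + emb (v m * S * star (v m))"
    proof -
      have "?W = emb (xA * xA - xA * h m * xA)" by (simp add: k_def emb_simps algebra_simps)
      then show ?thesis using C'[of m] by metis
    qed
    from \<theta>mono[OF this] have "emb (\<theta> ?W) \<preceq> (2 * d m) *\<^sub>R emb E + emb (\<theta> (emb (v m * S * star (v m))))"
      by (simp add: linear_add[OF \<theta>l] linear_scale[OF \<theta>l] emb_simps E_def)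
    also have "\<dots> \<preceq> (2 * d m) *\<^sub>R 1 + emb (w * a * star w)"
      using e1 d[of m] w by (intro ple_add_mono ple_scaleR) auto
    finally have W1: "emb (\<theta> ?W) \<preceq> (2 * d m) *\<^sub>R 1 + emb (w * a * star w)" .
    have W2: "emb (\<theta> (?u * k * ?u)) \<preceq> (real N * \<delta>') *\<^sub>R 1"
    proof -
      have s1: "star ?u = ?u" by (simp add: star_diff su)
      have "k \<preceq> 1" using h(1)[of m] by (simp add: k_def ple_def positive_emb_iff)
      from ple_conj[OF this, of ?u] have "?u * k * ?u \<preceq> ?u * ?u"
        by (simp add: s1)
      from \<theta>mono[OF this] have "emb (\<theta> (?u * k * ?u)) \<preceq> emb (\<theta> (?u * ?u))" .
      also have "\<dots> \<preceq> (real N * \<delta>') *\<^sub>R 1"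
      proof (rule ple_norm)
        show "star (emb (\<theta> (?u * ?u))) = emb (\<theta> (?u * ?u))"
          by (simp add: star_emb_iff \<theta>star star_mult s1)
        have "\<theta> (?u * ?u) = (\<Sum>k<N. rip (ula ?u (xs k)) (ula ?u (xs k)))"
          unfolding \<theta>_def theta_def by (intro sum.cong refl) (use xs in \<open>simp add: ula_mult rip_ula s1\<close>)
        also have "norm \<dots> \<le> (\<Sum>k<N. \<delta>')" using xA(2) by (intro sum_norm_le) auto
        finally show "norm (emb (\<theta> (?u * ?u))) \<le> real N * \<delta>'" by simp
      qed
      finally show ?thesis .
    qed
    define \<kappa> where "\<kappa> = 4 * d m + 2 * (real N * \<delta>')"
    have \<kappa>: "2 * \<kappa> * B\<^sup>2 \<le> \<epsilon> / 2"
    proof -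
      have "8 * d m * B\<^sup>2 \<le> \<eta> * B\<^sup>2" using m(4) by (intro mult_right_mono) auto
      then show ?thesis using \<delta>'(2) \<eta>(2) by (simp add: \<kappa>_def algebra_simps)
    qed
    have W: "emb (\<theta> k) \<preceq> \<kappa> *\<^sub>R 1 + 2 *\<^sub>R emb (w * a * star w)"
    proof -
      have "emb (\<theta> k) \<preceq> 2 *\<^sub>R emb (\<theta> ?W) + 2 *\<^sub>R emb (\<theta> (?u * k * ?u))"
        using \<theta>mono[OF ple_split[OF k su]] by (simp add: linear_add[OF \<theta>l] linear_scale[OF \<theta>l] emb_simps)
      also have "\<dots> \<preceq> 2 *\<^sub>R ((2 * d m) *\<^sub>R 1 + emb (w * a * star w)) + 2 *\<^sub>R ((real N * \<delta>') *\<^sub>R 1)"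
        by (intro ple_add_mono ple_scaleR W1 W2) auto
      finally show ?thesis by (simp add: \<kappa>_def algebra_simps)
    qed
    let ?x = "emb x" and ?h = "emb (h m * h m)"
    have sx: "star ?x = ?x" using star_positive[OF x] by (simp add: star_emb_iff)
    \<comment> \<open>The columns sum to h^2: 1 - h^2 equals 2 (1 - h) minus the square of 1 -
      h.\<close>
    have "1 - ?h \<preceq> 2 *\<^sub>R k"
    proof -
      have "2 *\<^sub>R k - (1 - ?h) = star k * k"
        unfolding star_positive[OF k] by (simp add: k_def emb_simps algebra_simps scaleR_2)
      then show ?thesis by (simp add: ple_def)
    qed
    from \<theta>mono[OF this] have "emb (\<theta> (1 - ?h)) \<preceq> 2 *\<^sub>R emb (\<theta> k)" by (simp add: linear_scale[OF \<theta>l] emb_simps)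
    also have "\<dots> \<preceq> 2 *\<^sub>R (\<kappa> *\<^sub>R 1 + 2 *\<^sub>R emb (w * a * star w))" by (intro ple_scaleR W) simp
    finally have "star ?x * emb (\<theta> (1 - ?h)) * ?x \<preceq> star ?x * (2 *\<^sub>R (\<kappa> *\<^sub>R 1 + 2 *\<^sub>R emb (w * a * star w))) * ?x"
      by (rule ple_conj)
    then have "?x * emb (\<theta> (1 - ?h)) * ?x \<preceq> ?x * (2 *\<^sub>R (\<kappa> *\<^sub>R 1 + 2 *\<^sub>R emb (w * a * star w))) * ?x"
      unfolding sx .
    also have "\<dots> = (2 * \<kappa>) *\<^sub>R (?x * ?x) + emb ((2 *\<^sub>R (x * w)) * a * star (2 *\<^sub>R (x * w)))"
      using star_positive[OF x] by (simp add: algebra_simps emb_simps star_scaleR star_mult)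
    finally have M1: "?x * emb (\<theta> (1 - ?h)) * ?x
      \<preceq> (2 * \<kappa>) *\<^sub>R (?x * ?x) + emb ((2 *\<^sub>R (x * w)) * a * star (2 *\<^sub>R (x * w)))" .
    have "(2 * \<kappa>) *\<^sub>R (?x * ?x) \<preceq> (2 * \<kappa>) *\<^sub>R (B\<^sup>2 *\<^sub>R 1)"
    proof (intro ple_scaleR ple_norm)
      have "norm (?x * ?x) \<le> norm x * norm x" using norm_mult_ineq[of ?x ?x] by simp
      also have "\<dots> \<le> B * B" using B by (intro mult_mono) auto
      finally show "norm (?x * ?x) \<le> B\<^sup>2" by (simp add: power2_eq_square)
      show "0 \<le> 2 * \<kappa>" using d[of m] \<delta>'(1) by (simp add: \<kappa>_def less_imp_le)
    qed (simp add: star_mult sx)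
    also have "\<dots> \<preceq> (\<epsilon> / 2) *\<^sub>R 1" using \<kappa> positive_square[of "1 :: 'b uz"] by (simp add: ple_scaleR_left)
    finally have M: "?x * emb (\<theta> (1 - ?h)) * ?x \<preceq> (\<epsilon> / 2) *\<^sub>R 1 + emb ((2 *\<^sub>R (x * w)) * a * star (2 *\<^sub>R (x * w)))"
      using ple_trans[OF M1 ple_add_mono[OF _ ple_refl]] by blast
    \<comment> \<open>The error of replacing 1 - H by \<theta>(1 - h^2). Three terms bound it: two
      uses of E as a unit for x give 2 B \<delta>, and the closeness of H to \<theta>(h^2) E gives
      B^2 \<eta>; each of the two amounts is \<epsilon>/4.\<close>
    define R where "R = x * x - x * ?H * x - x * \<theta> (1 - ?h) * x"
    have R: "emb R \<preceq> (\<epsilon> / 2) *\<^sub>R 1"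
    proof (rule ple_norm)
      have "star ?H = ?H" by (simp add: star_sum star_mult)
      then show "star (emb R) = emb R" using star_positive[OF x]
        by (simp add: star_emb_iff R_def star_diff star_mult \<theta>star star_emb_iff sh mult.assoc emb_simps(8)[symmetric])
      have "R = (x - x * E) * x - (x * \<theta> ?h * (E * x - x) + x * (?H - \<theta> ?h * E) * x)"
        by (simp add: R_def linear_diff[OF \<theta>l] algebra_simps flip: E_def)
      also have "norm \<dots> \<le> \<delta> * B + (B * \<delta> + B * \<eta> * B)"
      proof (intro norm_triangle_le_diff norm_triangle_mono add_mono)
        have "norm ((x - x * E) * x) \<le> norm (x - x * E) * norm x" by (rule norm_mult_ineq)
        also have "\<dots> \<le> \<delta> * B" using ex[of x] B \<delta> by (intro mult_mono) (auto simp: norm_minus_commute)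
        finally show "norm ((x - x * E) * x) \<le> \<delta> * B" .
        have "norm (x * \<theta> ?h * (E * x - x)) \<le> norm (x * \<theta> ?h) * norm (E * x - x)" by (rule norm_mult_ineq)
        also have "\<dots> \<le> (B * 1) * \<delta>"
        proof (intro mult_mono)
          have "norm (x * \<theta> ?h) \<le> norm x * norm (\<theta> ?h)" by (rule norm_mult_ineq)
          also have "\<dots> \<le> B * 1" using B norm\<theta>[OF sq[OF sh h(2)]] by (intro mult_mono) auto
          finally show "norm (x * \<theta> ?h) \<le> B * 1" .
        qed (use ex[of x] B in auto)
        finally show "norm (x * \<theta> ?h * (E * x - x)) \<le> B * \<delta>" by simp
        have "norm (x * (?H - \<theta> ?h * E) * x) \<le> norm (x * (?H - \<theta> ?h * E)) * norm x" by (rule norm_mult_ineq)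
        also have "\<dots> \<le> (norm x * norm (?H - \<theta> ?h * E)) * norm x" by (intro mult_right_mono norm_mult_ineq) simp
        also have "\<dots> \<le> B * \<eta> * B" using B m(3) \<eta> by (intro mult_mono) auto
        finally show "norm (x * (?H - \<theta> ?h * E) * x) \<le> B * \<eta> * B" .
      qed
      also have "\<dots> \<le> \<epsilon> / 2" using \<delta>(3) \<eta>(2) by (simp add: power2_eq_square mult_ac)
      finally show "norm (emb R) \<le> \<epsilon> / 2" by simp
    qed
    have "emb (x * x - x * ?H * x) = emb R + ?x * emb (\<theta> (1 - ?h)) * ?x" by (simp add: R_def emb_simps)
    also have "\<dots> \<preceq> (\<epsilon> / 2) *\<^sub>R 1 + ((\<epsilon> / 2) *\<^sub>R 1 + emb ((2 *\<^sub>R (x * w)) * a * star (2 *\<^sub>R (x * w))))"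
      by (rule ple_add_mono[OF R M])
    also have "\<dots> = \<epsilon> *\<^sub>R 1 + emb ((2 *\<^sub>R (x * w)) * a * star (2 *\<^sub>R (x * w)))"
      by (simp add: scaleR_add_left[symmetric] add.assoc[symmetric])
    finally show "\<exists>w. emb (x * x - x * ?H * x) \<preceq> \<epsilon> *\<^sub>R 1 + emb (w * a * star w)" by blast
  qed
qed

text \<open>If B is one-dimensional with unit u, then B acts on \<xi> = y u by scalars. Linking then
  shows that p = \<open>lip \<xi> \<xi>\<close> satisfies p a p = scalar times p for every a, so a
  multiple of p is a minimal projection of A, which \<open>no_minimal_projection\<close>
  excludes.\<close>

lemma minimal_projection_of_complex:
  assumes "cstar_isomorphic TYPE('b) TYPE(complex)"
  shows "\<exists>p :: 'a. minimal_projection p"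
proof -
  obtain \<sigma> :: "'b \<Rightarrow> complex" where \<sigma>: "star_hom \<sigma>" "bij \<sigma>" using assms by (auto simp: cstar_isomorphic_def)
  have \<sigma>m: "\<sigma> (b * c) = \<sigma> b * \<sigma> c" "\<sigma> (z *\<^sub>C b) = z * \<sigma> b" for b c z
    using \<sigma>(1) by (simp_all add: star_hom_def scaleC_complex_def)
  obtain u where u: "\<sigma> u = 1" using \<sigma>(2) by (metis bij_pointE)
  have inj: "b = c" if "\<sigma> b = \<sigma> c" for b c using \<sigma>(2) that by (metis bij_is_inj injD)
  have uu: "u * u = u" by (rule inj) (simp add: \<sigma>m u)
  have bu: "b = \<sigma> b *\<^sub>C u" for b by (rule inj) (simp add: \<sigma>m u)
  have "u \<noteq> 0" using u \<sigma>m(2)[of 0 u] by auto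
  then obtain y where y: "y \<in> X" "lip (ra y u) (ra y u) \<noteq> 0" by (rule nonzero_compression)
  define \<xi> where "\<xi> = ra y u"
  have \<xi>: "\<xi> \<in> X" "lip \<xi> \<xi> \<noteq> 0" using y by (simp_all add: \<xi>_def ra_X)
  have \<xi>u: "ra \<xi> b = \<sigma> b *\<^sub>C \<xi>" for b
  proof -
    have "ra \<xi> b = ra \<xi> (\<sigma> b *\<^sub>C u)" by (subst (1) bu) simp
    also have "\<dots> = \<sigma> b *\<^sub>C ra \<xi> u" using \<xi> by (simp add: ra_scaleC)
    also have "ra \<xi> u = \<xi>" unfolding \<xi>_def using y by (simp add: uu flip: ra_mult)
    finally show ?thesis .
  qed
  define p where "p = lip \<xi> \<xi>"
  have sp: "star p = p" using \<xi> by (simp add: p_def star_lip)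
  have pap: "p * a * p = \<sigma> (rip \<xi> (la a \<xi>)) *\<^sub>C p" for a
  proof -
    have "p * a * p = lip (la p (la a \<xi>)) \<xi>" using \<xi> by (simp add: p_def lip_la la_X mult.assoc)
    also have "la p (la a \<xi>) = \<sigma> (rip \<xi> (la a \<xi>)) *\<^sub>C \<xi>" using \<xi> by (simp add: p_def link la_X \<xi>u)
    finally show ?thesis using \<xi> by (simp add: lip_scaleC p_def)
  qed
  define c where "c = \<sigma> (rip \<xi> \<xi>)"
  have pp: "p * p = c *\<^sub>C p"
  proof -
    have "p * p = lip (la p \<xi>) \<xi>" using \<xi> by (simp add: p_def lip_la)
    also have "la p \<xi> = c *\<^sub>C \<xi>" using \<xi> by (simp add: p_def link \<xi>u c_def)
    finally show ?thesis using \<xi> by (simp add: lip_scaleC p_def)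
  qed
  have p0: "p \<noteq> 0" using \<xi> by (simp add: p_def)
  have "star p * p \<noteq> 0" using p0 by simp
  then have c: "c \<noteq> 0" using pp by (auto simp: sp)
  have "star (p * p) = p * p" by (simp add: star_mult sp)
  then have "cnj c *\<^sub>C p = c *\<^sub>C p" by (simp add: pp star_scaleC sp)
  then have cc: "cnj c = c" using scaleC_cancel[OF p0] by blast
  have "minimal_projection (inverse c *\<^sub>C p)"
    unfolding minimal_projection_def
  proof (intro conjI allI)
    show "inverse c *\<^sub>C p \<noteq> 0" using scaleC_cancel[OF p0, of "inverse c" 0] c by simp
    show "star (inverse c *\<^sub>C p) = inverse c *\<^sub>C p" using cc by (simp add: star_scaleC sp)
    show "(inverse c *\<^sub>C p) * (inverse c *\<^sub>C p) = inverse c *\<^sub>C p"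
      using c by (simp add: scaleC_mult_left scaleC_mult_right scaleC_scaleC pp)
    fix a
    show "\<exists>z. (inverse c *\<^sub>C p) * a * (inverse c *\<^sub>C p) = z *\<^sub>C inverse c *\<^sub>C p"
      by (simp add: scaleC_mult_left scaleC_mult_right scaleC_scaleC pap) (metis mult.commute)
  qed
  then show ?thesis ..
qed

theorem tracially_Z_absorbing_transfer:
  assumes simple: "simple_cstar TYPE('a)" and tza: "tracially_Z_absorbing TYPE('a)"
  shows "tracially_Z_absorbing TYPE('b)"
proof (rule tracially_Z_absorbing_of_almost_columns)
  show "\<not> cstar_isomorphic TYPE('b) TYPE(complex)"
    using minimal_projection_of_complex no_minimal_projection[OF simple tza] by blast
qed (rule almost_columns_transfer[OF simple tza])

end

lemma morita_context_of_bimodule: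
  assumes "imprimitivity_bimodule la ra lip rip"
  shows "morita_context UNIV la ra lip rip"
  using assms
  unfolding imprimitivity_bimodule_def left_hilbert_module_def right_hilbert_module_def full_ip_def morita_context_def
  by simp

lemma tracially_Z_absorbing_morita:
  assumes "simple_cstar TYPE('a::cstar_algebra)" "tracially_Z_absorbing TYPE('a)"
    and "morita_equivalent TYPE('x::complex_banach) TYPE('a) TYPE('b::cstar_algebra)"
  shows "tracially_Z_absorbing TYPE('b)"
proof -
  obtain la ra and lip :: "'x \<Rightarrow> 'x \<Rightarrow> 'a" and rip :: "'x \<Rightarrow> 'x \<Rightarrow> 'b" where
    "imprimitivity_bimodule la ra lip rip"
    using assms(3) unfolding morita_equivalent_def by blast
  then interpret morita_context UNIV la ra lip rip by (rule morita_context_of_bimodule)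
  show ?thesis using assms(1,2) by (rule tracially_Z_absorbing_transfer)
qed

section \<open>Injective homomorphisms\<close>

text \<open>An injective homomorphism is isometric and reflects positivity. Its range is therefore
  closed, and inner products computed in a larger algebra can be pulled back to a corner.\<close>

locale injective_star_hom =
  fixes \<phi> :: "'a::cstar_algebra \<Rightarrow> 'b::cstar_algebra"
  assumes hom: "star_hom \<phi>" and inj: "inj \<phi>"
begin

lemma hom_simps: "\<phi> (x + y) = \<phi> x + \<phi> y" "\<phi> (c *\<^sub>C x) = c *\<^sub>C \<phi> x" "\<phi> (x * y) = \<phi> x * \<phi> y" "\<phi> (star x) = star (\<phi> x)"
  using hom by (simp_all add: star_hom_def)

lemma hom_scaleR: "\<phi> (r *\<^sub>R x) = r *\<^sub>R \<phi> x"
  using hom_simps(2)[of "complex_of_real r" x] by (simp add: scaleC_of_real)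

lemma hom_0: "\<phi> 0 = 0"
  using hom_scaleR[of 0 0] by simp

lemma hom_diff: "\<phi> (x - y) = \<phi> x - \<phi> y"
  using hom_simps(1)[of "x - y" y] by simp

lemma hom_eq_iff: "\<phi> x = \<phi> y \<longleftrightarrow> x = y"
  using inj by (auto dest: injD)

definition uhom :: "'a uz \<Rightarrow> 'b uz" where "uhom u = emb (\<phi> (ubase u)) + uscal u *\<^sub>C 1"

lemma uhom_emb: "uhom (emb a) = emb (\<phi> a)"
  by (simp add: uhom_def)

lemma uhom_simps: "uhom (u + v) = uhom u + uhom v" "uhom (u - v) = uhom u - uhom v"
  "uhom (u * v) = uhom u * uhom v" "uhom (star u) = star (uhom u)" "uhom (r *\<^sub>R 1) = r *\<^sub>R 1"
  by (simp_all add: uhom_def ubase_linear hom_simps hom_diff scaleC_add_left scaleC_diff_left star_scaleC)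
    (simp_all add: times_uz_def one_uz_def emb_def uz_defs star_uz_def hom_simps hom_0 scaleC_of_real)

lemma uhom_positive: "positive u \<Longrightarrow> positive (uhom u)"
  unfolding positive_def using uhom_simps(3,4) by metis

lemma uhom_psqrt:
  assumes "positive u" "positive v" "uhom u = v * v" shows "uhom (psqrt u) = v"
proof -
  have "uhom (psqrt u) = psqrt (uhom (psqrt u) * uhom (psqrt u))"
    using assms(1) by (intro psqrt_mult_self[symmetric] uhom_positive positive_psqrt)
  also have "\<dots> = psqrt (v * v)" using assms by (simp add: psqrt_square flip: uhom_simps(3))
  finally show ?thesis using assms(2) by (simp add: psqrt_mult_self)
qed

lemma norm_hom_positive_le: "positive h \<Longrightarrow> norm (\<phi> h) \<le> norm h"
proof -
  assume h: "positive h"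
  have p: "positive (emb h)" using h by (simp add: positive_emb_iff)
  have "emb h \<preceq> norm h *\<^sub>R 1" by (rule ple_norm[OF star_positive[OF p]]) simp
  then have "positive (uhom (norm h *\<^sub>R 1 - emb h))" unfolding ple_def by (rule uhom_positive)
  then have "emb (\<phi> h) \<preceq> norm h *\<^sub>R 1" unfolding ple_def by (simp add: uhom_simps uhom_emb)
  moreover have "positive (emb (\<phi> h))" using uhom_positive[OF p] by (simp add: uhom_emb)
  ultimately have "norm (emb (\<phi> h)) \<le> norm h" by (intro norm_le_of_ple)
  then show ?thesis by simp
qed

lemma uscal_psqrt_square:
  assumes "positive u" "uscal u = complex_of_real (r * r)" "r \<ge> 0" shows "uscal (psqrt u) = complex_of_real r"
proof -
  obtain y where y: "psqrt u = star y * y" using positive_psqrt[OF assms(1)] by (auto simp: positive_def)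
  define q where "q = (cmod (uscal y))\<^sup>2"
  have q: "uscal (psqrt u) = complex_of_real q" unfolding y q_def
    by (simp only: uscal_simps complex_norm_square mult.commute)
  have "uscal (psqrt u * psqrt u) = complex_of_real (r * r)" using assms by (simp add: psqrt_square)
  then have "complex_of_real (q * q) = complex_of_real (r * r)" by (simp add: q)
  then have "q * q = r * r" by (simp only: of_real_eq_iff)
  then have "q\<^sup>2 = r\<^sup>2" by (simp add: power2_eq_square)
  moreover have "q \<ge> 0" by (simp add: q_def)
  ultimately have "q = r" using assms(3) by simp
  then show ?thesis using q by simp
qed

text \<open>Put v = r - h and let |v| be the square root of v^2. Its image is the positive square
  root of the square of the image of v, hence the image of v itself. The scalar parts of |v| and v
  are both r, so |v| - v lies in the algebra, where \<phi> is injective; hence v = |v|.\<close>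

lemma positive_reflect:
  assumes r: "r \<ge> 0" and sa: "star h = h" and p: "positive (r *\<^sub>R 1 - emb (\<phi> h))"
  shows "positive (r *\<^sub>R 1 - emb h)"
proof -
  define v where "v = r *\<^sub>R 1 - emb h"
  have sv: "star v = v" using sa by (simp add: v_def star_diff star_scaleR star_emb_iff)
  have pv: "positive (v * v)" using positive_square[OF sv] .
  have "uhom (psqrt (v * v)) = uhom v"
  proof (rule uhom_psqrt[OF pv])
    show "positive (uhom v)" using p by (simp add: v_def uhom_simps uhom_emb)
  qed (simp add: uhom_simps)
  moreover have "uscal (psqrt (v * v)) = complex_of_real r"
    by (rule uscal_psqrt_square[OF pv _ r]) (simp add: v_def)
  then have "uscal (psqrt (v * v) - v) = 0" by (simp add: v_def)
  then obtain k where k: "psqrt (v * v) - v = emb k" using uscal_eq_0_iff by blast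
  ultimately have "emb (\<phi> k) = 0" by (metis uhom_emb uhom_simps(2) diff_self)
  then have "k = 0" using hom_eq_iff[of k 0] by (simp add: hom_0)
  then have "psqrt (v * v) = v" using k by (simp add: emb_simps)
  then show ?thesis using positive_psqrt[OF pv] by (simp add: v_def)
qed

lemma hom_positive_iff: "positive (\<phi> h) \<longleftrightarrow> positive h"
proof
  assume p: "positive (\<phi> h)"
  have "\<phi> (star h) = \<phi> h" using star_positive[OF p] by (simp add: hom_simps)
  then have sa: "star h = h" by (simp add: hom_eq_iff)
  have "positive (0 *\<^sub>R 1 - emb (- h))"
  proof (rule positive_reflect)
    have "\<phi> (- h) = - \<phi> h" using hom_diff[of 0 h] by (simp add: hom_0)
    then show "positive (0 *\<^sub>R 1 - emb (\<phi> (- h)))" using p by (simp add: emb_simps positive_emb_iff)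
  qed (simp_all add: sa star_uminus)
  then show "positive h" by (simp add: emb_simps positive_emb_iff)
next
  assume "positive h"
  then show "positive (\<phi> h)" unfolding positive_def by (metis hom_simps(3,4))
qed

lemma norm_hom: "norm (\<phi> a) = norm a"
proof -
  have eq: "norm (\<phi> h) = norm h" if h: "positive h" for h
  proof (rule antisym[OF norm_hom_positive_le[OF h]])
    have p: "positive (emb (\<phi> h))" using h by (simp add: positive_emb_iff hom_positive_iff)
    have "emb (\<phi> h) \<preceq> norm (\<phi> h) *\<^sub>R 1" by (rule ple_norm[OF star_positive[OF p]]) simp
    then have "emb h \<preceq> norm (\<phi> h) *\<^sub>R 1"
      unfolding ple_def by (intro positive_reflect star_positive h) simp
    then have "norm (emb h) \<le> norm (\<phi> h)" using h by (intro norm_le_of_ple) (simp_all add: positive_emb_iff)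
    then show "norm h \<le> norm (\<phi> h)" by simp
  qed
  have "(norm (\<phi> a))\<^sup>2 = norm (\<phi> (star a * a))" by (simp add: hom_simps cstar_identity)
  also have "\<dots> = (norm a)\<^sup>2" using eq[OF positive_star_mult[of a]] by (simp add: cstar_identity)
  finally show ?thesis by simp
qed

lemma closed_range: "closed (range \<phi>)"
proof -
  have "bounded_linear \<phi>"
    by (rule bounded_linear_intro[where K = 1]) (simp_all add: hom_simps hom_scaleR norm_hom)
  then have "complete (range \<phi>)"
    using complete_isometric_image[of 1 UNIV \<phi>] norm_hom by (auto simp: complete_UNIV)
  then show ?thesis by (rule complete_imp_closed)
qed

end

section \<open>Compact operators\<close>

abbreviation nth2 :: "ell2 \<Rightarrow> nat \<Rightarrow> complex" where "nth2 \<equiv> ell2_nth"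

lemma ell2_eqI: "(\<And>n. nth2 x n = nth2 y n) \<Longrightarrow> x = y"
  by (metis ell2_nth_inverse ext)

lemma nth2_simps [simp]: "nth2 0 n = 0" "nth2 (x + y) n = nth2 x n + nth2 y n" "nth2 (c *\<^sub>C x) n = c * nth2 x n"
  by (simp_all add: zero_ell2.rep_eq plus_ell2.rep_eq scaleC_ell2.rep_eq)

lemma nth2_uminus [simp]: "nth2 (- x) n = - nth2 x n"
  by (simp add: uminus_ell2_def)

lemma nth2_diff [simp]: "nth2 (x - y) n = nth2 x n - nth2 y n"
  unfolding minus_ell2_def nth2_simps nth2_uminus by simp

lemma nth2_sum [simp]: "nth2 (\<Sum>i\<in>I. f i) n = (\<Sum>i\<in>I. nth2 (f i) n)"
  by (induction I rule: infinite_finite_induct) auto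

lemma summable_nth2: "summable (\<lambda>n. (cmod (nth2 x n))\<^sup>2)"
  using ell2_nth by simp

lemma norm_ell2_square: "(norm x)\<^sup>2 = (\<Sum>n. (cmod (nth2 x n))\<^sup>2)"
  by (simp add: norm_ell2.rep_eq suminf_nonneg summable_nth2)

lemma nth2_Abs: "summable (\<lambda>n. (cmod (f n))\<^sup>2) \<Longrightarrow> nth2 (Abs_ell2 f) n = f n"
  by (simp add: Abs_ell2_inverse)

lemma sum_nth2_le: "finite I \<Longrightarrow> (\<Sum>n\<in>I. (cmod (nth2 x n))\<^sup>2) \<le> (norm x)\<^sup>2"
  unfolding norm_ell2_square by (rule sum_le_suminf[OF summable_nth2]) auto

lemma norm_nth2_le: "cmod (nth2 x n) \<le> norm x"
  by (rule power2_le_imp_le) (use sum_nth2_le[of "{n}" x] in auto)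

lemma norm_ell2_le:
  assumes "\<And>N. (\<Sum>n<N. (cmod (nth2 x n))\<^sup>2) \<le> K\<^sup>2" "K \<ge> 0" shows "norm x \<le> K"
  using suminf_le_const[OF summable_nth2 assms(1)] unfolding norm_ell2_square[symmetric]
  by (rule power2_le_imp_le) (rule assms(2))

lemma sums_inner: "(\<lambda>n. nth2 x n * cnj (nth2 y n)) sums ell2_inner x y"
  and norm_inner_le: "cmod (ell2_inner x y) \<le> norm x * norm y"
proof -
  have B: "(\<Sum>n<N. cmod (nth2 x n * cnj (nth2 y n))) \<le> norm x * norm y" for N
  proof -
    have "(\<Sum>n<N. cmod (nth2 x n * cnj (nth2 y n))) = (\<Sum>n<N. \<bar>cmod (nth2 x n)\<bar> * \<bar>cmod (nth2 y n)\<bar>)"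
      by (simp add: norm_mult)
    also have "\<dots> \<le> L2_set (\<lambda>n. cmod (nth2 x n)) {..<N} * L2_set (\<lambda>n. cmod (nth2 y n)) {..<N}"
      by (rule L2_set_mult_ineq)
    also have "\<dots> \<le> norm x * norm y"
      unfolding L2_set_def by (intro mult_mono real_le_lsqrt sum_nth2_le) (auto intro: sum_nonneg)
    finally show ?thesis .
  qed
  have s: "summable (\<lambda>n. cmod (nth2 x n * cnj (nth2 y n)))"
    by (rule summableI_nonneg_bounded[OF _ B]) simp
  show "(\<lambda>n. nth2 x n * cnj (nth2 y n)) sums ell2_inner x y"
    unfolding ell2_inner_def by (rule summable_sums[OF summable_norm_cancel[OF s]])
  have "cmod (ell2_inner x y) \<le> (\<Sum>n. cmod (nth2 x n * cnj (nth2 y n)))"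
    unfolding ell2_inner_def by (rule summable_norm[OF s])
  also have "\<dots> \<le> norm x * norm y" by (rule suminf_le_const[OF s B])
  finally show "cmod (ell2_inner x y) \<le> norm x * norm y" .
qed

lemma inner_eqI: "(\<lambda>n. nth2 x n * cnj (nth2 y n)) sums c \<Longrightarrow> ell2_inner x y = c"
  using sums_inner sums_unique2 by blast

lemma inner_add: "ell2_inner (x + y) z = ell2_inner x z + ell2_inner y z"
  using sums_add[OF sums_inner sums_inner, of x z y z] by (intro inner_eqI) (simp add: algebra_simps)

lemma inner_add_right: "ell2_inner z (x + y) = ell2_inner z x + ell2_inner z y"
  using sums_add[OF sums_inner sums_inner, of z x z y] by (intro inner_eqI) (simp add: algebra_simps)

lemma inner_diff_right: "ell2_inner z (x - y) = ell2_inner z x - ell2_inner z y"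
  using inner_add_right[of z "x - y" y] by simp

lemma inner_scaleC: "ell2_inner (c *\<^sub>C x) z = c * ell2_inner x z"
  using sums_mult[OF sums_inner, of c x z] by (intro inner_eqI) (simp add: algebra_simps)

lemma inner_scaleC_right: "ell2_inner z (c *\<^sub>C x) = cnj c * ell2_inner z x"
  using sums_mult[OF sums_inner, of "cnj c" z x] by (intro inner_eqI) (simp add: algebra_simps)

lemma inner_commute: "ell2_inner y x = cnj (ell2_inner x y)"
  using sums_cnj[THEN iffD2, OF sums_inner[of x y]] by (intro inner_eqI) (simp add: mult.commute)

lemma inner_self: "ell2_inner x x = complex_of_real ((norm x)\<^sup>2)"
proof (rule inner_eqI)
  have "(\<lambda>n. complex_of_real ((cmod (nth2 x n))\<^sup>2)) sums complex_of_real ((norm x)\<^sup>2)"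
    unfolding norm_ell2_square by (intro sums_of_real summable_sums summable_nth2)
  then show "(\<lambda>n. nth2 x n * cnj (nth2 x n)) sums complex_of_real ((norm x)\<^sup>2)"
    by (simp only: complex_norm_square)
qed

lemma inner_ext: "(\<And>z. ell2_inner z x = ell2_inner z y) \<Longrightarrow> x = y"
proof -
  assume "\<And>z. ell2_inner z x = ell2_inner z y"
  then have "ell2_inner (x - y) (x - y) = 0" by (simp add: inner_diff_right)
  then show ?thesis by (simp add: inner_self)
qed

definition ket :: "nat \<Rightarrow> ell2" where "ket k = Abs_ell2 (\<lambda>n. if n = k then 1 else 0)"

lemma nth2_ket: "nth2 (ket k) n = (if n = k then 1 else 0)"
proof -
  have "summable (\<lambda>n. (cmod (if n = k then 1 else 0 :: complex))\<^sup>2)"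
    by (rule summable_finite[of "{k}"]) auto
  then show ?thesis unfolding ket_def by (rule nth2_Abs)
qed

lemma inner_ket: "ell2_inner x (ket k) = nth2 x k"
proof (rule inner_eqI)
  have "(\<lambda>n. if n = k then nth2 x k else 0) sums nth2 x k" by (rule sums_single)
  then show "(\<lambda>n. nth2 x n * cnj (nth2 (ket k) n)) sums nth2 x k"
    by (rule sums_cong[THEN iffD1, rotated]) (simp add: nth2_ket)
qed

lemma norm_ket [simp]: "norm (ket k) = 1"
proof -
  have "complex_of_real ((norm (ket k))\<^sup>2) = 1" by (simp only: inner_self[symmetric] inner_ket nth2_ket if_True simp_thms)
  then have "(norm (ket k))\<^sup>2 = 1" by (metis of_real_1 of_real_eq_iff)
  then show ?thesis by (simp add: power2_eq_1_iff) (metis norm_not_less_zero less_minus_one_simps(1))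
qed

lemma tail_tendsto_0: "(\<lambda>N. norm (x - (\<Sum>k<N. nth2 x k *\<^sub>C ket k))) \<longlonglongrightarrow> 0"
proof -
  have e: "(norm (x - (\<Sum>k<N. nth2 x k *\<^sub>C ket k)))\<^sup>2 = (\<Sum>n. (cmod (nth2 x (n + N)))\<^sup>2)" for N
  proof -
    let ?y = "x - (\<Sum>k<N. nth2 x k *\<^sub>C ket k)"
    have y: "nth2 ?y n = (if n < N then 0 else nth2 x n)" for n by (simp add: nth2_ket mult_delta_right)
    have "(norm ?y)\<^sup>2 = (\<Sum>n. (cmod (nth2 ?y (n + N)))\<^sup>2) + (\<Sum>n<N. (cmod (nth2 ?y n))\<^sup>2)"
      unfolding norm_ell2_square by (rule suminf_split_initial_segment[OF summable_nth2])
    then show ?thesis unfolding y by simp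
  qed
  have "(\<lambda>N. \<Sum>n. (cmod (nth2 x (n + N)))\<^sup>2) \<longlonglongrightarrow> 0"
    using suminf_exist_split2[OF summable_nth2] by simp
  then have "(\<lambda>N. (norm (x - (\<Sum>k<N. nth2 x k *\<^sub>C ket k)))\<^sup>2) \<longlonglongrightarrow> 0" unfolding e .
  from tendsto_real_sqrt[OF this] show ?thesis by simp
qed

lemma ket_expansion: "(\<lambda>N. \<Sum>k<N. nth2 x k *\<^sub>C ket k) \<longlonglongrightarrow> x"
  using tail_tendsto_0[of x] unfolding tendsto_dist_iff[of _ x] dist_norm
  by (simp add: norm_minus_commute)

lemma tendsto_inner: "(f \<longlongrightarrow> x) F \<Longrightarrow> ((\<lambda>n. ell2_inner (f n) y) \<longlongrightarrow> ell2_inner x y) F"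
proof -
  have "bounded_linear (\<lambda>x. ell2_inner x y)"
    by (rule bounded_linear_intro[where K = "norm y"])
      (simp_all add: inner_add norm_inner_le scaleC_of_real[symmetric] inner_scaleC scaleC_complex_def del: scaleC_of_real)
  then show "(f \<longlongrightarrow> x) F \<Longrightarrow> ?thesis" by (rule bounded_linear.tendsto)
qed

text \<open>Completeness turns total boundedness of a closed set into compactness; this is how
  \<open>compact_op_adjoint\<close> concludes.\<close>

instance ell2 :: complete_space
proof
  fix X :: "nat \<Rightarrow> ell2" assume X: "Cauchy X"
  have "Cauchy (\<lambda>m. nth2 (X m) n)" for n
    unfolding Cauchy_def dist_norm
  proof (intro allI impI)
    fix e :: real assume "e > 0"
    then obtain M where M: "\<And>m k. m \<ge> M \<Longrightarrow> k \<ge> M \<Longrightarrow> norm (X m - X k) < e"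
      using X unfolding Cauchy_def dist_norm by blast
    show "\<exists>M. \<forall>m\<ge>M. \<forall>k\<ge>M. norm (nth2 (X m) n - nth2 (X k) n) < e"
      using M norm_nth2_le[of "X _ - X _" n] by (metis nth2_diff order_le_less_trans)
  qed
  then have "\<exists>l. (\<lambda>m. nth2 (X m) n) \<longlonglongrightarrow> l" for n
    using Cauchy_convergent convergent_def by blast
  then obtain l where l: "\<And>n. (\<lambda>m. nth2 (X m) n) \<longlonglongrightarrow> l n" by metis
  have dist: "\<exists>M. \<forall>m\<ge>M. \<forall>N. (\<Sum>n<N. (cmod (nth2 (X m) n - l n))\<^sup>2) \<le> e\<^sup>2" if "e > 0" for e
  proof -
    obtain M where M: "\<And>m k. m \<ge> M \<Longrightarrow> k \<ge> M \<Longrightarrow> norm (X m - X k) < e"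
      using X \<open>e > 0\<close> unfolding Cauchy_def dist_norm by blast
    show ?thesis
    proof (intro exI[of _ M] allI impI)
      fix m N assume m: "m \<ge> M"
      have "(\<lambda>k. \<Sum>n<N. (cmod (nth2 (X m) n - nth2 (X k) n))\<^sup>2) \<longlonglongrightarrow> (\<Sum>n<N. (cmod (nth2 (X m) n - l n))\<^sup>2)"
        by (intro tendsto_intros l)
      then show "(\<Sum>n<N. (cmod (nth2 (X m) n - l n))\<^sup>2) \<le> e\<^sup>2"
      proof (rule LIMSEQ_le_const2, intro exI[of _ M] allI impI)
        fix k assume k: "k \<ge> M"
        have "(\<Sum>n<N. (cmod (nth2 (X m - X k) n))\<^sup>2) \<le> (norm (X m - X k))\<^sup>2" by (rule sum_nth2_le) simp
        also have "\<dots> \<le> e\<^sup>2" using M[OF m k] by (intro power_mono) auto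
        finally show "(\<Sum>n<N. (cmod (nth2 (X m) n - nth2 (X k) n))\<^sup>2) \<le> e\<^sup>2" by simp
      qed
    qed
  qed
  obtain M where M: "\<And>N. (\<Sum>n<N. (cmod (nth2 (X M) n - l n))\<^sup>2) \<le> 1\<^sup>2" using dist[of 1] by auto
  have "summable (\<lambda>n. (cmod (nth2 (X M) n - l n))\<^sup>2)"
    by (rule summableI_nonneg_bounded[OF _ M]) simp
  then have y: "nth2 (Abs_ell2 (\<lambda>n. nth2 (X M) n - l n)) n = nth2 (X M) n - l n" for n by (rule nth2_Abs)
  define x where "x = X M - Abs_ell2 (\<lambda>n. nth2 (X M) n - l n)"
  have x: "nth2 x n = l n" for n by (simp add: x_def y)
  have "X \<longlonglongrightarrow> x"
  proof (rule LIMSEQ_I)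
    fix e :: real assume "e > 0"
    then obtain M where M: "\<And>m N. m \<ge> M \<Longrightarrow> (\<Sum>n<N. (cmod (nth2 (X m) n - l n))\<^sup>2) \<le> (e / 2)\<^sup>2"
      using dist[of "e / 2"] by auto
    have "norm (X m - x) < e" if "m \<ge> M" for m
    proof -
      have "norm (X m - x) \<le> e / 2" using M[OF that] \<open>e > 0\<close> by (intro norm_ell2_le) (simp_all add: x)
      then show ?thesis using \<open>e > 0\<close> by simp
    qed
    then show "\<exists>M. \<forall>m\<ge>M. norm (X m - x) < e" by blast
  qed
  then show "convergent X" by (rule convergentI)
qed

text \<open>The type \<open>ell2 \<Rightarrow>\<^sub>L ell2\<close> consists of bounded real-linear
  maps; this predicate singles out the complex-linear ones.\<close>

definition clinear_op :: "(ell2 \<Rightarrow>\<^sub>L ell2) \<Rightarrow> bool" where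
  "clinear_op T \<longleftrightarrow> (\<forall>c x. blinfun_apply T (c *\<^sub>C x) = c *\<^sub>C blinfun_apply T x)"

lemma blinfun_apply_Blinfun_clinear:
  assumes "\<And>x y. F (x + y) = F x + F y" "\<And>c x. F (c *\<^sub>C x) = c *\<^sub>C F x" "\<And>x. norm (F x) \<le> K * norm x"
  shows "blinfun_apply (Blinfun F) = F" "clinear_op (Blinfun F)"
proof -
  have "bounded_linear F"
    by (rule bounded_linear_intro[where K = K])
      (use assms in \<open>simp_all add: mult.commute scaleC_of_real[symmetric] del: scaleC_of_real\<close>)
  then show "blinfun_apply (Blinfun F) = F" by (rule bounded_linear_Blinfun_apply)
  then show "clinear_op (Blinfun F)" using assms(2) by (simp add: clinear_op_def)
qed

section \<open>Compact operators and adjoints\<close>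

lemma compact_ops_clinear: "T \<in> compact_ops \<Longrightarrow> clinear_op T"
  by (simp add: compact_ops_def clinear_op_def)

lemma compact_opsI:
  assumes "clinear_op T" "compact K" "blinfun_apply T ` cball 0 1 \<subseteq> K" shows "T \<in> compact_ops"
proof -
  have "closure (blinfun_apply T ` cball 0 1) \<subseteq> K"
    using assms(2,3) by (intro closure_minimal compact_imp_closed)
  then have "closure (blinfun_apply T ` cball 0 1) = K \<inter> closure (blinfun_apply T ` cball 0 1)" by blast
  moreover have "compact (K \<inter> closure (blinfun_apply T ` cball 0 1))" using assms(2) by (intro compact_Int_closed closed_closure)
  ultimately show ?thesis using assms(1) by (simp add: compact_ops_def clinear_op_def)
qed

lemma clinear_compose: "clinear_op S \<Longrightarrow> clinear_op T \<Longrightarrow> clinear_op (S o\<^sub>L T)"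
  by (simp add: clinear_op_def)

lemma compact_compose_left:
  assumes L: "clinear_op L" and T: "T \<in> compact_ops" shows "L o\<^sub>L T \<in> compact_ops"
proof (rule compact_opsI)
  show "clinear_op (L o\<^sub>L T)" using L compact_ops_clinear[OF T] by (rule clinear_compose)
  show "compact (blinfun_apply L ` closure (blinfun_apply T ` cball 0 1))"
    using T by (intro compact_continuous_image) (auto simp: compact_ops_def intro: continuous_intros)
  show "blinfun_apply (L o\<^sub>L T) ` cball 0 1 \<subseteq> blinfun_apply L ` closure (blinfun_apply T ` cball 0 1)"
    using closure_subset[of "blinfun_apply T ` cball 0 1"] by auto
qed

lemma compact_compose_right:
  assumes L: "clinear_op L" and T: "T \<in> compact_ops" shows "T o\<^sub>L L \<in> compact_ops"
proof (rule compact_opsI)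
  let ?r = "norm L + 1"
  have r: "?r > 0" by (simp add: add_nonneg_pos)
  show "clinear_op (T o\<^sub>L L)" using compact_ops_clinear[OF T] L by (rule clinear_compose)
  show "compact ((\<lambda>x. ?r *\<^sub>R x) ` closure (blinfun_apply T ` cball 0 1))"
    using T by (intro compact_continuous_image continuous_intros) (auto simp: compact_ops_def)
  show "blinfun_apply (T o\<^sub>L L) ` cball 0 1 \<subseteq> (\<lambda>x. ?r *\<^sub>R x) ` closure (blinfun_apply T ` cball 0 1)"
  proof clarsimp
    fix x :: ell2 assume x: "norm x \<le> 1"
    define y where "y = inverse ?r *\<^sub>R blinfun_apply L x"
    have "norm (blinfun_apply L x) \<le> norm L * 1" using norm_blinfun[of L x] x by (meson mult_left_mono norm_ge_zero order_trans)
    then have "norm (blinfun_apply L x) \<le> ?r" by simp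
    then have "norm y \<le> 1" using r by (simp add: y_def field_simps)
    then have "blinfun_apply T y \<in> closure (blinfun_apply T ` cball 0 1)" by (intro closure_subset[THEN subsetD]) simp
    moreover have "blinfun_apply T (blinfun_apply L x) = ?r *\<^sub>R blinfun_apply T y"
      using r by (simp add: y_def blinfun.scaleR_right)
    ultimately show "blinfun_apply T (blinfun_apply L x) \<in> (\<lambda>x. ?r *\<^sub>R x) ` closure (blinfun_apply T ` cball 0 1)" by blast
  qed
qed

text \<open>The coordinates of the adjoint at y must be u_k, the inner product of y with T applied
  to \<open>ket k\<close>. Testing T on the truncated vector with these same coordinates bounds
  their square sum by the square of norm(T) norm(y).\<close>

lemma adjoint_exists:
  assumes T: "clinear_op T"
  obtains S where "\<And>x y. ell2_inner (blinfun_apply T x) y = ell2_inner x (blinfun_apply S y)" "clinear_op S"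
proof -
  let ?T = "blinfun_apply T"
  define u where "u y k = ell2_inner y (?T (ket k))" for y k
  have T_sum: "?T (\<Sum>k<N. c k *\<^sub>C ket k) = (\<Sum>k<N. c k *\<^sub>C ?T (ket k))" for N c
    using T by (simp add: blinfun.sum_right clinear_op_def)
  have inner_sum: "ell2_inner (\<Sum>k<N. f k) z = (\<Sum>k<N. ell2_inner (f k) z)" for N :: nat and f z
  proof (induction N)
    case 0 show ?case using inner_scaleC[of 0 0 z] by simp
  qed (simp add: inner_add)
  have le: "(\<Sum>k<N. (cmod (u y k))\<^sup>2) \<le> (norm T * norm y)\<^sup>2" for y N
  proof -
    define x where "x = (\<Sum>k<N. u y k *\<^sub>C ket k)"
    define s where "s = (\<Sum>k<N. (cmod (u y k))\<^sup>2)"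
    have s: "s \<ge> 0" by (simp add: s_def sum_nonneg)
    have nx: "(norm x)\<^sup>2 = s"
    proof -
      have "nth2 x n = (if n < N then u y n else 0)" for n by (simp add: x_def nth2_ket mult_delta_right)
      then have "complex_of_real ((norm x)\<^sup>2) = complex_of_real s"
        unfolding inner_self[symmetric] x_def inner_sum
        by (simp add: inner_scaleC inner_commute[of "ket _"] inner_ket s_def complex_norm_square x_def flip: of_real_power)
      then show ?thesis by (simp only: of_real_eq_iff)
    qed
    have "ell2_inner (?T x) y = complex_of_real s"
      unfolding x_def T_sum inner_sum
      by (simp add: inner_scaleC inner_commute[of "?T _"] s_def complex_norm_square flip: u_def of_real_power)
    then have "s = cmod (ell2_inner (?T x) y)" using s by simp
    also have "\<dots> \<le> norm (?T x) * norm y" by (rule norm_inner_le)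
    also have "\<dots> \<le> (norm T * norm x) * norm y" by (intro mult_right_mono norm_blinfun) simp
    also have "norm x = sqrt s" using nx by (metis abs_norm_cancel real_sqrt_abs)
    finally have "sqrt s * sqrt s \<le> (norm T * norm y) * sqrt s" using s by (simp add: mult_ac)
    then have "sqrt s \<le> norm T * norm y" using s by (cases "s = 0") (auto dest: mult_right_le_imp_le simp del: real_sqrt_mult_self)
    then have "(sqrt s)\<^sup>2 \<le> (norm T * norm y)\<^sup>2" using s by (intro power_mono) auto
    then show ?thesis using s by (simp add: s_def)
  qed
  define F where "F y = Abs_ell2 (u y)" for y
  have F: "nth2 (F y) k = u y k" for y k
    unfolding F_def by (rule nth2_Abs, rule summableI_nonneg_bounded[OF _ le]) simp
  have lin: "F (x + y) = F x + F y" "F (c *\<^sub>C x) = c *\<^sub>C F x" for x y c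
    by (auto intro!: ell2_eqI simp: F u_def inner_add inner_scaleC)
  have bound: "norm (F y) \<le> norm T * norm y" for y
    by (rule norm_ell2_le) (simp_all add: F le)
  note B = blinfun_apply_Blinfun_clinear[OF lin bound]
  show ?thesis
  proof (rule that[OF _ B(2)])
    fix x y
    have "(\<lambda>N. ell2_inner (?T (\<Sum>k<N. nth2 x k *\<^sub>C ket k)) y) \<longlonglongrightarrow> ell2_inner (?T x) y"
      by (intro tendsto_inner blinfun.tendsto tendsto_const ket_expansion)
    moreover have "ell2_inner (?T (\<Sum>k<N. nth2 x k *\<^sub>C ket k)) y = (\<Sum>k<N. nth2 x k * cnj (nth2 (F y) k))" for N
      unfolding T_sum inner_sum by (simp add: inner_scaleC F u_def inner_commute[of "?T _"])
    ultimately have "(\<lambda>k. nth2 x k * cnj (nth2 (F y) k)) sums ell2_inner (?T x) y" by (simp add: sums_def)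
    then show "ell2_inner (?T x) y = ell2_inner x (blinfun_apply (Blinfun F) y)" unfolding B(1) by (rule inner_eqI[symmetric])
  qed
qed

lemma op_adjoint_eqI:
  assumes "\<And>x y. ell2_inner (blinfun_apply T x) y = ell2_inner x (blinfun_apply S y)" shows "op_adjoint T = S"
  unfolding op_adjoint_def
proof (rule the_equality)
  fix S' assume "\<forall>x y. ell2_inner (blinfun_apply T x) y = ell2_inner x (blinfun_apply S' y)"
  then have "blinfun_apply S' y = blinfun_apply S y" for y using assms by (intro inner_ext) metis
  then show "S' = S" by (intro blinfun_eqI)
qed (use assms in blast)

lemma inner_op_adjoint: "clinear_op T \<Longrightarrow> ell2_inner (blinfun_apply T x) y = ell2_inner x (blinfun_apply (op_adjoint T) y)"
  and clinear_op_adjoint: "clinear_op T \<Longrightarrow> clinear_op (op_adjoint T)"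
  using adjoint_exists op_adjoint_eqI by metis+

text \<open>Schauder's theorem on \<open>\<ell>\<^sup>2\<close>: \<open>\<parallel>T\<^sup>* y\<parallel>\<^sup>2 \<le> \<parallel>T T\<^sup>* y\<parallel> \<parallel>y\<parallel>\<close>.\<close>

lemma compact_op_adjoint:
  assumes T: "T \<in> compact_ops" shows "op_adjoint T \<in> compact_ops"
proof -
  let ?S = "op_adjoint T"
  note cT = compact_ops_clinear[OF T] and cS = clinear_op_adjoint[OF compact_ops_clinear[OF T]]
  let ?A = "blinfun_apply ?S ` cball 0 1"
  have "T o\<^sub>L ?S \<in> compact_ops" by (rule compact_compose_right[OF cS T])
  then have "compact (closure (blinfun_apply (T o\<^sub>L ?S) ` cball 0 1))" by (simp add: compact_ops_def)
  then have tb: "\<exists>k. finite k \<and> closure (blinfun_apply (T o\<^sub>L ?S) ` cball 0 1) \<subseteq> (\<Union>x\<in>k. ball x e)" if "e > 0" for e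
    using that unfolding compact_eq_totally_bounded by blast
  have "\<exists>k. finite k \<and> closure ?A \<subseteq> (\<Union>x\<in>k. ball x e)" if e: "e > 0" for e
  proof -
    \<comment> \<open>For v a difference of two points of the unit ball whose images under T S lie
      in one \<delta>-ball, the squared norm of S v is at most 2 \<delta> times 2, which is
      (e/2)^2.\<close>
    define \<delta> where "\<delta> = (e / 2)\<^sup>2 / 4"
    have \<delta>: "\<delta> > 0" using e by (simp add: \<delta>_def)
    obtain k where k: "finite k" "closure (blinfun_apply (T o\<^sub>L ?S) ` cball 0 1) \<subseteq> (\<Union>x\<in>k. ball x \<delta>)" using tb[OF \<delta>] by blast
    define c where "c z = (SOME y. y \<in> cball 0 1 \<and> blinfun_apply T (blinfun_apply ?S y) \<in> ball z \<delta>)" for z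
    have "?A \<subseteq> (\<Union>z\<in>k. cball (blinfun_apply ?S (c z)) (e / 2))"
    proof clarify
      fix y :: ell2 assume y: "y \<in> cball 0 1"
      then have "blinfun_apply (T o\<^sub>L ?S) y \<in> closure (blinfun_apply (T o\<^sub>L ?S) ` cball 0 1)"
        by (intro closure_subset[THEN subsetD] imageI)
      then have "blinfun_apply (T o\<^sub>L ?S) y \<in> (\<Union>x\<in>k. ball x \<delta>)" using k(2) by (rule rev_subsetD)
      then obtain z where z: "z \<in> k" "blinfun_apply T (blinfun_apply ?S y) \<in> ball z \<delta>" by auto
      with y have c: "c z \<in> cball 0 1" "blinfun_apply T (blinfun_apply ?S (c z)) \<in> ball z \<delta>"
        unfolding c_def by (metis (mono_tags, lifting) someI_ex)+
      let ?v = "y - c z"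
      have v: "norm ?v \<le> 2" using y c(1) norm_triangle_ineq4[of y "c z"] by simp
      have "norm (blinfun_apply T (blinfun_apply ?S y) - blinfun_apply T (blinfun_apply ?S (c z))) \<le> \<delta> + \<delta>"
        using z(2) c(2) dist_triangle_less_add by (metis dist_commute dist_norm less_imp_le mem_ball)
      then have TS: "norm (blinfun_apply T (blinfun_apply ?S ?v)) \<le> 2 * \<delta>" by (simp add: blinfun.diff_right)
      have "complex_of_real ((norm (blinfun_apply ?S ?v))\<^sup>2) = ell2_inner (blinfun_apply T (blinfun_apply ?S ?v)) ?v"
        by (simp only: inner_self[symmetric] inner_op_adjoint[OF cT])
      then have "(norm (blinfun_apply ?S ?v))\<^sup>2 = cmod (ell2_inner (blinfun_apply T (blinfun_apply ?S ?v)) ?v)"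
        by (metis norm_of_real abs_of_nonneg zero_le_power2)
      also have "\<dots> \<le> norm (blinfun_apply T (blinfun_apply ?S ?v)) * norm ?v" by (rule norm_inner_le)
      also have "\<dots> \<le> (2 * \<delta>) * 2" using TS v \<delta> by (intro mult_mono) auto
      also have "\<dots> = (e / 2)\<^sup>2" by (simp add: \<delta>_def)
      finally have "norm (blinfun_apply ?S ?v) \<le> e / 2" by (rule power2_le_imp_le) (use e in simp)
      then show "blinfun_apply ?S y \<in> (\<Union>z\<in>k. cball (blinfun_apply ?S (c z)) (e / 2))"
        using z(1) by (auto simp: dist_norm blinfun.diff_right norm_minus_commute)
    qed
    then have "closure ?A \<subseteq> (\<Union>z\<in>k. cball (blinfun_apply ?S (c z)) (e / 2))"
      using k(1) by (intro closure_minimal closed_UN) auto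
    also have "\<dots> \<subseteq> (\<Union>x\<in>(\<lambda>z. blinfun_apply ?S (c z)) ` k. ball x e)" using e by force
    finally show ?thesis using k(1) by (meson finite_imageI)
  qed
  then have "compact (closure ?A)" unfolding compact_eq_totally_bounded by (simp add: complete_eq_closed)
  then show ?thesis using cS by (simp add: compact_ops_def clinear_op_def)
qed

section \<open>Matrix units, diagonal operators and tails of compact operators\<close>

definition matrix_unit_op :: "nat \<Rightarrow> nat \<Rightarrow> (ell2 \<Rightarrow>\<^sub>L ell2)" where
  "matrix_unit_op i j = Blinfun (\<lambda>x. nth2 x j *\<^sub>C ket i)"

lemma matrix_unit_op_apply: "blinfun_apply (matrix_unit_op i j) x = nth2 x j *\<^sub>C ket i"
  and clinear_matrix_unit_op: "clinear_op (matrix_unit_op i j)"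
proof -
  have "norm (nth2 x j *\<^sub>C ket i) \<le> 1 * norm x" for x by (simp add: norm_scaleC norm_nth2_le)
  note B = blinfun_apply_Blinfun_clinear[OF _ _ this]
  show "blinfun_apply (matrix_unit_op i j) x = nth2 x j *\<^sub>C ket i"
    unfolding matrix_unit_op_def by (subst B(1)) (simp_all add: scaleC_add_left scaleC_scaleC)
  show "clinear_op (matrix_unit_op i j)"
    unfolding matrix_unit_op_def by (rule B(2)) (simp_all add: scaleC_add_left scaleC_scaleC)
qed

lemma compact_matrix_unit_op: "matrix_unit_op i j \<in> compact_ops"
proof (rule compact_opsI[OF clinear_matrix_unit_op])
  have "bounded_linear (\<lambda>c. c *\<^sub>C ket i)"
    by (rule bounded_linear_intro[where K = 1])
      (simp_all add: scaleC_add_left norm_scaleC scaleR_conv_of_real scaleC_of_real flip: scaleC_scaleC)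
  then show "compact ((\<lambda>c. c *\<^sub>C ket i) ` cball 0 1)"
    by (intro compact_continuous_image compact_cball linear_continuous_on)
  show "blinfun_apply (matrix_unit_op i j) ` cball 0 1 \<subseteq> (\<lambda>c. c *\<^sub>C ket i) ` cball 0 1"
  proof clarsimp
    fix x :: ell2 assume "norm x \<le> 1"
    then have "cmod (nth2 x j) \<le> 1" using norm_nth2_le[of x j] by simp
    then show "blinfun_apply (matrix_unit_op i j) x \<in> (\<lambda>c. c *\<^sub>C ket i) ` cball 0 1"
      unfolding matrix_unit_op_apply by auto
  qed
qed

lemma op_adjoint_matrix_unit_op: "op_adjoint (matrix_unit_op i j) = matrix_unit_op j i"
  by (rule op_adjoint_eqI)
    (simp add: matrix_unit_op_apply inner_scaleC inner_scaleC_right inner_ket inner_commute[of "ket i"])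

lemma matrix_unit_op_compose: "matrix_unit_op i j o\<^sub>L matrix_unit_op j k = matrix_unit_op i k"
  by (rule blinfun_eqI) (simp add: matrix_unit_op_apply nth2_ket)

lemma matrix_unit_op_corner:
  assumes "clinear_op T"
  shows "matrix_unit_op i i o\<^sub>L (T o\<^sub>L matrix_unit_op i i) = nth2 (blinfun_apply T (ket i)) i *\<^sub>C matrix_unit_op i i"
  by (rule blinfun_eqI)
    (use assms in \<open>simp add: matrix_unit_op_apply clinear_op_def scaleC_blinfun.rep_eq scaleC_scaleC mult.commute\<close>)

definition diag_op :: "(nat \<Rightarrow> real) \<Rightarrow> (ell2 \<Rightarrow>\<^sub>L ell2)" where
  "diag_op f = Blinfun (\<lambda>x. Abs_ell2 (\<lambda>k. complex_of_real (f k) * nth2 x k))"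

lemma diag_op_nth:
  assumes f: "\<And>k. \<bar>f k\<bar> \<le> M" shows "nth2 (blinfun_apply (diag_op f) x) k = complex_of_real (f k) * nth2 x k"
  and clinear_diag_op: "clinear_op (diag_op f)"
proof -
  let ?F = "\<lambda>x. Abs_ell2 (\<lambda>k. complex_of_real (f k) * nth2 x k)"
  have M: "M \<ge> 0" using f[of 0] abs_ge_zero order_trans by blast
  have le: "(\<Sum>k<N. (cmod (complex_of_real (f k) * nth2 x k))\<^sup>2) \<le> (M * norm x)\<^sup>2" for N x
  proof -
    have "(\<Sum>k<N. (cmod (complex_of_real (f k) * nth2 x k))\<^sup>2) \<le> (\<Sum>k<N. M\<^sup>2 * (cmod (nth2 x k))\<^sup>2)"
      unfolding norm_mult norm_of_real power_mult_distrib
      by (intro sum_mono mult_right_mono power_mono f) auto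
    also have "\<dots> \<le> M\<^sup>2 * (norm x)\<^sup>2" unfolding sum_distrib_left[symmetric] by (intro mult_left_mono sum_nth2_le) auto
    finally show ?thesis by (simp add: power_mult_distrib)
  qed
  have nth: "nth2 (?F x) k = complex_of_real (f k) * nth2 x k" for x k
    by (rule nth2_Abs, rule summableI_nonneg_bounded[OF _ le]) simp
  have bound: "norm (?F x) \<le> M * norm x" for x by (rule norm_ell2_le) (use M le in \<open>simp_all add: nth\<close>)
  have add: "?F (x + y) = ?F x + ?F y" for x y by (rule ell2_eqI) (simp only: nth, simp add: nth distrib_left)
  have scale: "?F (c *\<^sub>C x) = c *\<^sub>C ?F x" for c x by (rule ell2_eqI) (simp only: nth, simp add: nth mult.left_commute)
  note B = blinfun_apply_Blinfun_clinear[of ?F, OF add scale bound, folded diag_op_def]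
  show "nth2 (blinfun_apply (diag_op f) x) k = complex_of_real (f k) * nth2 x k" unfolding B(1) by (rule nth)
  show "clinear_op (diag_op f)" by (rule B(2))
qed

definition tail_op :: "nat \<Rightarrow> (ell2 \<Rightarrow>\<^sub>L ell2)" where "tail_op n = diag_op (\<lambda>k. if k < n then 0 else 1)"

lemma nth2_tail_op: "nth2 (blinfun_apply (tail_op n) z) k = (if k < n then 0 else nth2 z k)"
  unfolding tail_op_def by (subst diag_op_nth[where M = 1]) auto

lemma clinear_tail_op: "clinear_op (tail_op n)"
  unfolding tail_op_def by (rule clinear_diag_op[where M = 1]) auto

definition tail :: "nat \<Rightarrow> ell2 \<Rightarrow> real" where "tail n z = norm (blinfun_apply (tail_op n) z)"

lemma tail_nonneg [simp]: "tail n z \<ge> 0"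
  by (simp add: tail_def)

lemma tail_square_split: "(norm z)\<^sup>2 = (tail n z)\<^sup>2 + (\<Sum>k<n. (cmod (nth2 z k))\<^sup>2)"
proof -
  let ?y = "blinfun_apply (tail_op n) z"
  have "(norm ?y)\<^sup>2 = (\<Sum>k. (cmod (nth2 ?y (k + n)))\<^sup>2) + (\<Sum>k<n. (cmod (nth2 ?y k))\<^sup>2)"
    unfolding norm_ell2_square by (rule suminf_split_initial_segment[OF summable_nth2])
  then have "(tail n z)\<^sup>2 = (\<Sum>k. (cmod (nth2 z (k + n)))\<^sup>2)" unfolding nth2_tail_op tail_def by simp
  moreover have "(norm z)\<^sup>2 = (\<Sum>k. (cmod (nth2 z (k + n)))\<^sup>2) + (\<Sum>k<n. (cmod (nth2 z k))\<^sup>2)"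
    unfolding norm_ell2_square by (rule suminf_split_initial_segment[OF summable_nth2])
  ultimately show ?thesis by simp
qed

lemma tail_le_norm: "tail n z \<le> norm z"
  by (rule power2_le_imp_le) (simp_all add: tail_square_split[of z n] sum_nonneg)

lemma tail_Suc: "(tail n z)\<^sup>2 = (cmod (nth2 z n))\<^sup>2 + (tail (Suc n) z)\<^sup>2"
  using tail_square_split[of z n] tail_square_split[of z "Suc n"] by simp

lemma tail_antimono: "tail (Suc n) z \<le> tail n z"
  by (rule power2_le_imp_le) (simp_all add: tail_Suc[of n z])

lemma tail_triangle: "tail n x \<le> tail n y + norm (x - y)"
proof -
  have "tail n x = norm (blinfun_apply (tail_op n) y + blinfun_apply (tail_op n) (x - y))"
    by (simp add: tail_def blinfun.diff_right)
  also have "\<dots> \<le> tail n y + tail n (x - y)" unfolding tail_def by (rule norm_triangle_ineq)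
  finally show ?thesis using tail_le_norm[of n "x - y"] by simp
qed

lemma tail_tendsto: "(\<lambda>n. tail n z) \<longlonglongrightarrow> 0"
proof -
  have "blinfun_apply (tail_op n) z = z - (\<Sum>k<n. nth2 z k *\<^sub>C ket k)" for n
    by (rule ell2_eqI) (simp add: nth2_tail_op nth2_ket mult_delta_right)
  then show ?thesis unfolding tail_def using tail_tendsto_0[of z] by simp
qed

lemma tail_uniform:
  assumes K: "compact K" and e: "e > 0" shows "\<forall>\<^sub>F n in sequentially. \<forall>z\<in>K. tail n z \<le> e"
proof -
  obtain k where k: "finite k" "K \<subseteq> (\<Union>x\<in>k. ball x (e / 2))"
    using K e unfolding compact_eq_totally_bounded by (meson half_gt_zero)
  have "\<forall>\<^sub>F n in sequentially. \<forall>x\<in>k. tail n x < e / 2"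
    using e k(1) by (intro eventually_ball_finite ballI order_tendstoD(2)[OF tail_tendsto]) auto
  then show ?thesis
  proof (rule eventually_mono, intro ballI)
    fix n z assume n: "\<forall>x\<in>k. tail n x < e / 2" and "z \<in> K"
    then obtain x where "x \<in> k" "norm (z - x) < e / 2" using k(2) by (auto simp: dist_norm norm_minus_commute)
    then show "tail n z \<le> e" using n tail_triangle[of n z x] by fastforce
  qed
qed

text \<open>|z_n|^2 is the difference of the squares of two consecutive tails, hence at most the
  difference of the tails times 2 \<rho>_n. After division by \<rho>_n the sum telescopes.\<close>

lemma weighted_tail_le:
  assumes \<rho>: "\<And>n. \<rho> n > 0" "\<And>n. tail n z \<le> \<rho> n"
  shows "(\<Sum>n<M. if n < N then 0 else (cmod (nth2 z n))\<^sup>2 / \<rho> n) \<le> 2 * tail N z"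
proof -
  have le: "(cmod (nth2 z n))\<^sup>2 / \<rho> n \<le> 2 * (tail n z - tail (Suc n) z)" for n
  proof -
    have "(cmod (nth2 z n))\<^sup>2 = (tail n z - tail (Suc n) z) * (tail n z + tail (Suc n) z)"
      using tail_Suc[of n z] by (simp add: power2_eq_square algebra_simps)
    also have "\<dots> \<le> (tail n z - tail (Suc n) z) * (2 * \<rho> n)"
      using tail_antimono[of n z] \<rho>(2)[of n] by (intro mult_left_mono) auto
    finally show ?thesis using \<rho>(1)[of n] by (simp add: divide_le_eq mult_ac)
  qed
  have "(\<Sum>n<M. if n < N then 0 else (cmod (nth2 z n))\<^sup>2 / \<rho> n) \<le> 2 * (if M \<le> N then 0 else tail N z - tail M z)"
  proof (induction M)
    case (Suc M)
    then show ?case using le[of M] by (cases "M < N"; cases "M = N") auto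
  qed simp
  also have "\<dots> \<le> 2 * tail N z" by simp
  finally show ?thesis .
qed

text \<open>The diagonal weight \<open>1 / \<surd>\<rho>\<close>, where \<open>\<rho>\<close> bounds the tails of the image of the unit ball,
  can be absorbed by a compact operator.\<close>

lemma weighted_compact:
  assumes T: "T \<in> compact_ops"
  obtains \<rho> W where "\<And>n. \<rho> n > (0::real)" "\<And>m n. m \<le> n \<Longrightarrow> \<rho> n \<le> \<rho> m" "\<rho> \<longlonglongrightarrow> 0" "W \<in> compact_ops"
    "\<And>x k. nth2 (blinfun_apply W x) k = complex_of_real (1 / sqrt (\<rho> k)) * nth2 (blinfun_apply T x) k"
proof -
  let ?T = "blinfun_apply T"
  define K where "K = closure (?T ` cball 0 1)"
  have K: "compact K" using T by (simp add: compact_ops_def K_def)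
  have TK: "?T x \<in> K" if "norm x \<le> 1" for x unfolding K_def by (intro closure_subset[THEN subsetD]) (use that in simp)
  have K0: "K \<noteq> {}" using TK[of 0] by auto
  obtain B where B: "\<And>z. z \<in> K \<Longrightarrow> norm z \<le> B" using compact_imp_bounded[OF K] by (auto simp: bounded_iff)
  have bdd: "bdd_above ((\<lambda>z. tail n z) ` K)" for n
    using B tail_le_norm order_trans by (intro bdd_aboveI2[where M = B]) blast
  \<comment> \<open>The second term keeps \<rho> positive, so that 1 / sqrt(\<rho>) is defined;
    \<rho> still decreases to 0 because tails are uniformly small on a compact set.\<close>
  define \<rho> where "\<rho> n = (SUP z\<in>K. tail n z) + inverse (real (Suc n))" for n
  have sup0: "(SUP z\<in>K. tail n z) \<ge> 0" for n
    using order_trans[OF tail_nonneg cSUP_upper[OF TK[of 0] bdd]] by simp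
  have \<rho>: "\<rho> n > 0" for n using sup0[of n] by (simp add: \<rho>_def add_nonneg_pos)
  have tail\<rho>: "tail n z \<le> \<rho> n" if "z \<in> K" for n z
    using cSUP_upper[OF that bdd, of n] by (simp add: \<rho>_def add_increasing2)
  have mono1: "\<rho> (Suc n) \<le> \<rho> n" for n
  proof -
    have "(SUP z\<in>K. tail (Suc n) z) \<le> (SUP z\<in>K. tail n z)"
      by (rule cSUP_mono[OF K0 bdd]) (use tail_antimono in blast)
    moreover have "inverse (real (Suc (Suc n))) \<le> inverse (real (Suc n))" by (intro le_imp_inverse_le) auto
    ultimately show ?thesis by (simp only: \<rho>_def add_mono)
  qed
  have mono: "\<rho> n \<le> \<rho> m" if "m \<le> n" for m n
    using mono1 that by (rule lift_Suc_antimono_le)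
  have "(\<lambda>n. SUP z\<in>K. tail n z) \<longlonglongrightarrow> 0"
  proof (rule tendstoI)
    fix e :: real assume e: "e > 0"
    from tail_uniform[OF K, of "e / 2"] e have "\<forall>\<^sub>F n in sequentially. \<forall>z\<in>K. tail n z \<le> e / 2" by simp
    then show "\<forall>\<^sub>F n in sequentially. dist (SUP z\<in>K. tail n z) 0 < e"
    proof (rule eventually_mono)
      fix n assume "\<forall>z\<in>K. tail n z \<le> e / 2"
      then have "(SUP z\<in>K. tail n z) \<le> e / 2" by (intro cSUP_least K0) auto
      then show "dist (SUP z\<in>K. tail n z) 0 < e" using sup0[of n] e by simp
    qed
  qed
  from tendsto_add[OF this LIMSEQ_inverse_real_of_nat] have \<rho>lim: "\<rho> \<longlonglongrightarrow> 0" by (simp add: \<rho>_def[abs_def])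
  define d where "d k = 1 / sqrt (\<rho> k)" for k
  have d2: "(d k)\<^sup>2 = 1 / \<rho> k" for k using \<rho>[of k] by (simp add: d_def power_divide)
  define c where "c z k = complex_of_real (d k) * nth2 z k" for z k
  have c2: "(cmod (c z k))\<^sup>2 = (cmod (nth2 z k))\<^sup>2 / \<rho> k" for z k
    using d2[of k] by (simp add: c_def norm_mult power_mult_distrib)
  have part: "(\<Sum>k<M. (cmod (if k < N then 0 else c z k))\<^sup>2) \<le> (sqrt (2 * tail N z))\<^sup>2" if z: "z \<in> K" for z M N
  proof -
    have "(\<Sum>k<M. (cmod (if k < N then 0 else c z k))\<^sup>2) = (\<Sum>k<M. if k < N then 0 else (cmod (nth2 z k))\<^sup>2 / \<rho> k)"
      by (intro sum.cong refl) (simp add: c2)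
    also have "\<dots> \<le> 2 * tail N z" by (rule weighted_tail_le[OF \<rho> tail\<rho>[OF z]])
    finally show ?thesis by simp
  qed
  define D where "D z = Abs_ell2 (c z)" for z
  have sumK: "summable (\<lambda>k. (cmod (c z k))\<^sup>2)" if z: "z \<in> K" for z
    by (rule summableI_nonneg_bounded[where x = "(sqrt (2 * tail 0 z))\<^sup>2"]) (use part[OF z, where N = 0] in simp_all)
  have sumT: "summable (\<lambda>k. (cmod (c (?T x) k))\<^sup>2)" for x
  proof -
    define r where "r = norm x + 1"
    have r: "r > 0" "norm x \<le> r" by (simp_all add: r_def add_nonneg_pos)
    have "?T (inverse r *\<^sub>R x) \<in> K" by (rule TK) (use r in \<open>simp add: field_simps\<close>)
    from summable_mult[OF sumK[OF this], of "r\<^sup>2"] have "summable (\<lambda>k. r\<^sup>2 * (cmod (c (?T (inverse r *\<^sub>R x)) k))\<^sup>2)" .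
    moreover have "r\<^sup>2 * (cmod (c (?T (inverse r *\<^sub>R x)) k))\<^sup>2 = (cmod (c (?T x) k))\<^sup>2" for k
    proof -
      have "nth2 (?T (inverse r *\<^sub>R x)) k = complex_of_real (inverse r) * nth2 (?T x) k"
        unfolding blinfun.scaleR_right by (simp only: scaleC_of_real[symmetric] nth2_simps)
      then have "c (?T x) k = complex_of_real r * c (?T (inverse r *\<^sub>R x)) k" using r by (simp add: c_def flip: of_real_mult)
      then show ?thesis using r by (simp add: norm_mult power_mult_distrib del: of_real_add)
    qed
    ultimately show ?thesis by simp
  qed
  have nthK: "nth2 (D z) k = c z k" if "z \<in> K" for z k unfolding D_def by (rule nth2_Abs[OF sumK[OF that]])
  have nthT: "nth2 (D (?T x)) k = c (?T x) k" for x k unfolding D_def by (rule nth2_Abs[OF sumT])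
  have Tc: "?T (a *\<^sub>C x) = a *\<^sub>C ?T x" for a x using compact_ops_clinear[OF T] by (simp add: clinear_op_def)
  have lin1: "D (?T (x + y)) = D (?T x) + D (?T y)" for x y
    by (rule ell2_eqI) (simp only: nthT nth2_simps, simp add: c_def blinfun.add_right algebra_simps)
  have lin2: "D (?T (a *\<^sub>C x)) = a *\<^sub>C D (?T x)" for x a
    by (rule ell2_eqI) (simp only: nthT nth2_simps, simp add: c_def Tc)
  have DK: "norm (D z) \<le> sqrt (2 * B)" if z: "z \<in> K" for z
  proof -
    have "norm (D z) \<le> sqrt (2 * tail 0 z)"
    proof (rule norm_ell2_le)
      show "(\<Sum>n<N. (cmod (nth2 (D z) n))\<^sup>2) \<le> (sqrt (2 * tail 0 z))\<^sup>2" for N using part[OF z, where M = N and N = 0] by (simp add: nthK z)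
    qed simp
    also have "\<dots> \<le> sqrt (2 * B)" using tail_le_norm[of 0 z] B[OF z] by simp
    finally show ?thesis .
  qed
  have bound: "norm (D (?T x)) \<le> sqrt (2 * B) * norm x" for x
  proof (cases "x = 0")
    case True
    then show ?thesis using lin2[of 0 0] by simp
  next
    case False
    then have n: "norm x > 0" by simp
    have "x = complex_of_real (norm x) *\<^sub>C (inverse (norm x) *\<^sub>R x)" using n by (simp add: scaleC_of_real)
    then have "D (?T x) = complex_of_real (norm x) *\<^sub>C D (?T (inverse (norm x) *\<^sub>R x))" using lin2 by metis
    moreover have "norm (D (?T (inverse (norm x) *\<^sub>R x))) \<le> sqrt (2 * B)" using n by (intro DK TK) simp
    ultimately show ?thesis by (simp add: norm_scaleC mult.commute[of "norm x"] mult_right_mono)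
  qed
  define W where "W = Blinfun (\<lambda>x. D (?T x))"
  have W: "blinfun_apply W = (\<lambda>x. D (?T x))" "clinear_op W"
    unfolding W_def using blinfun_apply_Blinfun_clinear[of "\<lambda>x. D (?T x)", OF lin1 lin2 bound] by auto
  \<comment> \<open>The weight is an unbounded operator in general, but on the compact set K it is a
    uniform limit of finite sums, by the estimate on weighted tails. Hence D(K) is compact.\<close>
  have cont: "continuous_on K D"
  proof (rule uniform_limit_theorem[where F = sequentially and f = "\<lambda>N z. \<Sum>k<N. c z k *\<^sub>C ket k"])
    have bl: "bounded_linear (\<lambda>z. c z k *\<^sub>C ket k)" for k
    proof (rule bounded_linear_intro[where K = "\<bar>d k\<bar>"])
      show "c (r *\<^sub>R x) k *\<^sub>C ket k = r *\<^sub>R c x k *\<^sub>C ket k" for r x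
        by (simp add: c_def scaleC_scaleC mult_ac flip: scaleC_of_real)
      show "norm (c x k *\<^sub>C ket k) \<le> norm x * \<bar>d k\<bar>" for x
        using norm_nth2_le[of x k] by (simp add: c_def norm_scaleC norm_mult mult.commute[of "norm x"] mult_left_mono)
    qed (simp add: c_def distrib_left scaleC_add_left)
    show "\<forall>\<^sub>F N in sequentially. continuous_on K (\<lambda>z. \<Sum>k<N. c z k *\<^sub>C ket k)"
      by (intro always_eventually allI continuous_on_sum linear_continuous_on bl)
    show "uniform_limit K (\<lambda>N z. \<Sum>k<N. c z k *\<^sub>C ket k) D sequentially"
    proof (rule uniform_limitI)
      fix e :: real assume e: "e > 0"
      from tail_uniform[OF K, of "e\<^sup>2 / 8"] e have "\<forall>\<^sub>F n in sequentially. \<forall>z\<in>K. tail n z \<le> e\<^sup>2 / 8" by simp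
      then show "\<forall>\<^sub>F N in sequentially. \<forall>z\<in>K. dist (\<Sum>k<N. c z k *\<^sub>C ket k) (D z) < e"
      proof (rule eventually_mono, intro ballI)
        fix N z assume N: "\<forall>z\<in>K. tail N z \<le> e\<^sup>2 / 8" and z: "z \<in> K"
        have "nth2 (D z - (\<Sum>k<N. c z k *\<^sub>C ket k)) n = (if n < N then 0 else c z n)" for n
          by (simp add: nthK[OF z] nth2_ket mult_delta_right)
        then have "norm (D z - (\<Sum>k<N. c z k *\<^sub>C ket k)) \<le> sqrt (2 * tail N z)"
          using part[OF z, where N = N] by (intro norm_ell2_le) (simp_all only: real_sqrt_ge_zero mult_nonneg_nonneg tail_nonneg zero_le_numeral)
        also have "\<dots> \<le> sqrt ((e / 2)\<^sup>2)" using bspec[OF N z] by (intro real_sqrt_le_mono) (simp add: power_divide)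
        also have "\<dots> < e" using e by simp
        finally show "dist (\<Sum>k<N. c z k *\<^sub>C ket k) (D z) < e" by (simp add: dist_norm norm_minus_commute)
      qed
    qed
  qed simp
  have "W \<in> compact_ops"
  proof (rule compact_opsI[OF W(2)])
    show "compact (D ` K)" using cont K by (rule compact_continuous_image)
    show "blinfun_apply W ` cball 0 1 \<subseteq> D ` K" unfolding W(1) using TK by auto
  qed
  then show ?thesis using \<rho> mono \<rho>lim nthT by (intro that[of \<rho> W]) (simp_all add: W(1) c_def d_def)
qed

text \<open>The difference of the two sides is kept in the form G' G with G compact and G' its
  adjoint, because a stabilization map provides only algebraic relations on compact operators and no
  continuity in the operator. Applying it to this identity bounds the norm of the tail by
  sqrt(\<rho>_n) times a constant.\<close>

lemma tail_op_dominated: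
  assumes T: "T \<in> compact_ops"
  obtains \<rho> W where "\<And>n. \<rho> n > (0::real)" "\<rho> \<longlonglongrightarrow> 0" "W \<in> compact_ops"
    "\<And>n. \<exists>G\<in>compact_ops. complex_of_real (\<rho> n) *\<^sub>C (op_adjoint W o\<^sub>L W)
      = (op_adjoint (tail_op n o\<^sub>L T) o\<^sub>L (tail_op n o\<^sub>L T)) + (op_adjoint G o\<^sub>L G)"
proof -
  obtain \<rho> W where \<rho>: "\<And>n. \<rho> n > (0::real)" "\<And>m n. m \<le> n \<Longrightarrow> \<rho> n \<le> \<rho> m" "\<rho> \<longlonglongrightarrow> 0" and W: "W \<in> compact_ops"
    "\<And>x k. nth2 (blinfun_apply W x) k = complex_of_real (1 / sqrt (\<rho> k)) * nth2 (blinfun_apply T x) k"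
    using weighted_compact[OF T] by metis
  show ?thesis
  proof (rule that[OF \<rho>(1,3) W(1)])
    fix n :: nat
    define q where "q k = (if k < n then 0 else 1 :: real)" for k
    \<comment> \<open>The solution of q_k + g_k^2 / \<rho>_k = \<rho>_n / \<rho>_k. The radicand is
      nonnegative because \<rho> is decreasing and q_k vanishes for k < n.\<close>
    define g where "g k = sqrt (\<rho> n - q k * \<rho> k)" for k
    have pos: "0 \<le> \<rho> n - q k * \<rho> k" for k using \<rho>(1)[of n] \<rho>(2)[of n k] by (auto simp: q_def)
    have g: "\<bar>g k\<bar> \<le> sqrt (\<rho> n)" for k
      unfolding g_def using pos[of k] \<rho>(1)[of k] by (auto simp: q_def intro!: real_sqrt_le_mono)
    define G where "G = diag_op g o\<^sub>L W"
    have G: "G \<in> compact_ops" unfolding G_def by (rule compact_compose_left[OF clinear_diag_op[OF g] W(1)])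
    let ?Q = "tail_op n o\<^sub>L T"
    have Q: "?Q \<in> compact_ops" by (rule compact_compose_left[OF clinear_tail_op T])
    let ?i = "\<lambda>S x y. ell2_inner (blinfun_apply S x) (blinfun_apply S y)"
    let ?c = "\<lambda>S x y k. nth2 (blinfun_apply S x) k * cnj (nth2 (blinfun_apply S y) k)"
    have key: "?i ?Q x y + ?i G x y = \<rho> n * ?i W x y" for x y
    proof (rule sums_unique2)
      show "(\<lambda>k. ?c ?Q x y k + ?c G x y k) sums (?i ?Q x y + ?i G x y)"
        by (intro sums_add sums_inner)
      have "?c ?Q x y k + ?c G x y k = \<rho> n * ?c W x y k" for k
      proof -
        define w where "w = 1 / sqrt (\<rho> k)"
        have w: "w * w = 1 / \<rho> k" using \<rho>(1)[of k] by (simp add: w_def)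
        have gg: "g k * g k = \<rho> n - q k * \<rho> k" using pos[of k] by (simp add: g_def)
        have "?c ?Q x y k = complex_of_real (q k) * ?c T x y k"
          by (simp add: nth2_tail_op q_def)
        moreover have "?c G x y k = complex_of_real ((g k * g k) * (w * w)) * ?c T x y k"
          by (simp add: G_def diag_op_nth[OF g] W(2) flip: w_def)
        moreover have "?c W x y k = complex_of_real (w * w) * ?c T x y k"
          by (simp add: W(2) flip: w_def)
        moreover have "q k + (g k * g k) * (w * w) = \<rho> n * (w * w)" unfolding w gg using \<rho>(1)[of k] by (simp add: field_simps)
        then have "complex_of_real (q k) + complex_of_real ((g k * g k) * (w * w)) = complex_of_real (\<rho> n) * complex_of_real (w * w)"
          by (metis of_real_add of_real_mult)
        ultimately show ?thesis by (metis distrib_right mult.assoc)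
      qed
      then show "(\<lambda>k. ?c ?Q x y k + ?c G x y k) sums (\<rho> n * ?i W x y)"
        using sums_mult[OF sums_inner] by simp
    qed
    have "complex_of_real (\<rho> n) *\<^sub>C (op_adjoint W o\<^sub>L W) = (op_adjoint ?Q o\<^sub>L ?Q) + (op_adjoint G o\<^sub>L G)"
    proof (rule blinfun_eqI, rule inner_ext)
      fix y x
      show "ell2_inner x (blinfun_apply (complex_of_real (\<rho> n) *\<^sub>C (op_adjoint W o\<^sub>L W)) y)
        = ell2_inner x (blinfun_apply ((op_adjoint ?Q o\<^sub>L ?Q) + (op_adjoint G o\<^sub>L G)) y)"
        using key[of x y]
        by (simp add: scaleC_blinfun.rep_eq blinfun.add_left inner_scaleC_right inner_add_right del: blinfun_apply_blinfun_compose)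
          (simp add: blinfun_apply_blinfun_compose[of "op_adjoint _"] del: blinfun_apply_blinfun_compose
            flip: inner_op_adjoint[OF compact_ops_clinear[OF W(1)]] inner_op_adjoint[OF compact_ops_clinear[OF Q]]
              inner_op_adjoint[OF compact_ops_clinear[OF G]])
    qed
    then show "\<exists>G\<in>compact_ops. complex_of_real (\<rho> n) *\<^sub>C (op_adjoint W o\<^sub>L W) = (op_adjoint ?Q o\<^sub>L ?Q) + (op_adjoint G o\<^sub>L G)"
      using G by blast
  qed
qed

section \<open>Stable isomorphism\<close>

lemma span_subset_subspace:
  "(\<And>x. x \<in> S \<Longrightarrow> f x \<in> V) \<Longrightarrow> Real_Vector_Spaces.subspace V \<Longrightarrow> linear f \<Longrightarrow> x \<in> span S \<Longrightarrow> f x \<in> V"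
  using span_minimal[of S "f -` V"] linear_subspace_vimage[of f V] by blast

lemma closure_subset_closed:
  assumes "\<And>x. x \<in> S \<Longrightarrow> f x \<in> V" "closed V" "continuous_on UNIV f" "x \<in> closure S" shows "f x \<in> V"
proof -
  have "closed (f -` V)" using assms(2,3) by (rule closed_vimage)
  then have "closure S \<subseteq> f -` V" using assms(1) by (intro closure_minimal) auto
  then show ?thesis using assms(4) by blast
qed

lemma (in injective_star_hom) subspace_range: "Real_Vector_Spaces.subspace (range \<phi>)"
proof (rule Real_Vector_Spaces.subspaceI)
  show "0 \<in> range \<phi>" using hom_0 by (metis rangeI)
  show "x + y \<in> range \<phi>" if "x \<in> range \<phi>" "y \<in> range \<phi>" for x y
    using that by (auto simp flip: hom_simps(1))
  show "r *\<^sub>R x \<in> range \<phi>" if "x \<in> range \<phi>" for r x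
    using that by (auto simp flip: hom_scaleR)
qed

lemma linear_mult_both: "linear (\<lambda>c. x * c * (y :: 'a::real_normed_algebra))"
  by (rule linearI) (simp_all add: algebra_simps)

definition head_op :: "nat \<Rightarrow> (ell2 \<Rightarrow>\<^sub>L ell2)" where "head_op n = diag_op (\<lambda>k. if k < n then 1 else 0)"

lemma nth2_head_op: "nth2 (blinfun_apply (head_op n) z) k = (if k < n then nth2 z k else 0)"
  unfolding head_op_def by (subst diag_op_nth[where M = 1]) auto

lemma clinear_head_op: "clinear_op (head_op n)"
  unfolding head_op_def by (rule clinear_diag_op[where M = 1]) auto

section \<open>The corner of a stabilization given by a rank one projection\<close>

locale stabilization =
  fixes t :: "'a::cstar_algebra \<Rightarrow> (ell2 \<Rightarrow>\<^sub>L ell2) \<Rightarrow> 'c::cstar_algebra"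
  assumes stab: "is_stabilization t"
begin

lemma t_add: "T \<in> compact_ops \<Longrightarrow> t (a + b) T = t a T + t b T"
  and t_add_op: "S \<in> compact_ops \<Longrightarrow> T \<in> compact_ops \<Longrightarrow> t a (S + T) = t a S + t a T"
  and t_scaleC: "T \<in> compact_ops \<Longrightarrow> t (c *\<^sub>C a) T = c *\<^sub>C t a T"
  and t_scaleC_op: "T \<in> compact_ops \<Longrightarrow> t a (c *\<^sub>C T) = c *\<^sub>C t a T"
  and t_mult: "S \<in> compact_ops \<Longrightarrow> T \<in> compact_ops \<Longrightarrow> t a S * t b T = t (a * b) (S o\<^sub>L T)"
  and t_star: "T \<in> compact_ops \<Longrightarrow> star (t a T) = t (star a) (op_adjoint T)"
  and t_dense: "closure (span {t a T | a T. T \<in> compact_ops}) = UNIV"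
  using stab unfolding is_stabilization_def by (elim conjE; simp)+

definition corner :: "'a \<Rightarrow> 'c" where "corner a = t a (matrix_unit_op 0 0)"

lemma corner_hom: "star_hom corner"
  unfolding star_hom_def corner_def
  by (simp add: t_add t_scaleC t_mult t_star compact_matrix_unit_op matrix_unit_op_compose op_adjoint_matrix_unit_op)

lemma corner_eq_0: "corner a = 0 \<Longrightarrow> a = 0"
proof -
  assume a: "corner a = 0"
  have ind: "(\<forall>i<n. T i \<in> compact_ops) \<Longrightarrow> (\<forall>c :: nat \<Rightarrow> complex. (\<Sum>i<n. c i *\<^sub>C T i) = 0 \<longrightarrow> (\<forall>i<n. c i = 0)) \<Longrightarrow>
    (\<Sum>i<n. t (a i) (T i)) = 0 \<Longrightarrow> (\<forall>i<n. a i = 0)" for n :: nat and a T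
    using stab unfolding is_stabilization_def by (elim conjE) simp
  have "c = 0" if "c *\<^sub>C matrix_unit_op 0 0 = 0" for c
  proof -
    have "blinfun_apply (c *\<^sub>C matrix_unit_op 0 0) (ket 0) = 0" by (simp add: that)
    then have "nth2 (c *\<^sub>C ket 0) 0 = 0" by (simp add: scaleC_blinfun.rep_eq matrix_unit_op_apply nth2_ket)
    then show ?thesis by (simp add: nth2_ket)
  qed
  then show "a = 0" using ind[of "Suc 0" "\<lambda>_. matrix_unit_op 0 0" "\<lambda>_. a"] a
    by (simp add: compact_matrix_unit_op corner_def)
qed

sublocale injective_star_hom corner
proof
  have "corner (x - y) = corner x - corner y" for x y
    using corner_hom unfolding star_hom_def by (metis add_diff_cancel_right' diff_add_cancel)
  then show "inj corner" using corner_eq_0 by (intro injI) (metis eq_iff_diff_eq_0)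
qed (rule corner_hom)

text \<open>On elementary tensors this holds because the compression of an operator to a rank one
  projection is scalar. It extends to all of the stabilization by density, the range of
  \<open>corner\<close> being closed.\<close>

lemma corner_compress: "\<exists>b. corner a * c * corner a' = corner b"
proof -
  have gen: "corner a * t d T * corner a' \<in> range corner" if T: "T \<in> compact_ops" for d T
  proof -
    note cT = compact_ops_clinear[OF T]
    let ?p = "matrix_unit_op 0 0" and ?z = "nth2 (blinfun_apply T (ket 0)) 0"
    have "corner a * t d T * corner a' = t a ?p * (t d T * t a' ?p)"
      by (simp only: corner_def mult.assoc)
    also have "t d T * t a' ?p = t (d * a') (T o\<^sub>L ?p)" by (intro t_mult compact_matrix_unit_op T)
    also have "t a ?p * t (d * a') (T o\<^sub>L ?p) = t (a * (d * a')) (?p o\<^sub>L (T o\<^sub>L ?p))"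
      by (intro t_mult compact_matrix_unit_op compact_compose_right T clinear_matrix_unit_op)
    also have "\<dots> = corner (?z *\<^sub>C (a * (d * a')))"
      unfolding matrix_unit_op_corner[OF cT] by (simp add: corner_def t_scaleC t_scaleC_op compact_matrix_unit_op)
    finally show ?thesis by blast
  qed
  have "corner a * c * corner a' \<in> range corner"
  proof (rule closure_subset_closed[where f = "\<lambda>c. corner a * c * corner a'", OF _ closed_range])
    show "c \<in> closure (span {t a T | a T. T \<in> compact_ops})" by (simp add: t_dense)
    show "continuous_on UNIV (\<lambda>c. corner a * c * corner a')" by (intro continuous_intros)
    show "corner a * x * corner a' \<in> range corner" if "x \<in> span {t a T | a T. T \<in> compact_ops}" for x
      by (rule span_subset_subspace[OF _ subspace_range linear_mult_both that]) (use gen in auto)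
  qed
  then show ?thesis by blast
qed

lemma norm_t_tail:
  assumes T: "T \<in> compact_ops" shows "(\<lambda>n. norm (t a (tail_op n o\<^sub>L T))) \<longlonglongrightarrow> 0"
proof -
  obtain \<rho> W where \<rho>: "\<And>n. \<rho> n > (0::real)" "\<rho> \<longlonglongrightarrow> 0" and W: "W \<in> compact_ops"
    and dom: "\<And>n. \<exists>G\<in>compact_ops. complex_of_real (\<rho> n) *\<^sub>C (op_adjoint W o\<^sub>L W)
      = (op_adjoint (tail_op n o\<^sub>L T) o\<^sub>L (tail_op n o\<^sub>L T)) + (op_adjoint G o\<^sub>L G)"
    by (rule tail_op_dominated[OF T]) (rule that)
  have sq: "star (t a S) * t a S = t (star a * a) (op_adjoint S o\<^sub>L S)" and sq': "op_adjoint S o\<^sub>L S \<in> compact_ops"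
    if "S \<in> compact_ops" for S
    using that by (simp_all add: t_star t_mult compact_op_adjoint compact_compose_right compact_ops_clinear)
  have le: "norm (t a (tail_op n o\<^sub>L T)) \<le> sqrt (\<rho> n) * norm (t a W)" for n
  proof -
    let ?Q = "tail_op n o\<^sub>L T"
    have Q: "?Q \<in> compact_ops" by (rule compact_compose_left[OF clinear_tail_op T])
    obtain G where G: "G \<in> compact_ops" and e: "complex_of_real (\<rho> n) *\<^sub>C (op_adjoint W o\<^sub>L W)
      = (op_adjoint ?Q o\<^sub>L ?Q) + (op_adjoint G o\<^sub>L G)" using dom by blast
    have "\<rho> n *\<^sub>R (star (t a W) * t a W) = t (star a * a) (complex_of_real (\<rho> n) *\<^sub>C (op_adjoint W o\<^sub>L W))"
      unfolding t_scaleC_op[OF sq'[OF W]] unfolding scaleC_of_real sq[OF W] ..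
    also have "\<dots> = star (t a ?Q) * t a ?Q + star (t a G) * t a G"
      unfolding e using Q G by (simp add: sq sq' t_add_op)
    finally have "\<rho> n *\<^sub>R (star (t a W) * t a W) = star (t a ?Q) * t a ?Q + star (t a G) * t a G" .
    then have "emb (\<rho> n *\<^sub>R (star (t a W) * t a W)) - emb (star (t a ?Q) * t a ?Q) = emb (star (t a G) * t a G)"
      by (simp add: emb_simps)
    then have "emb (star (t a ?Q) * t a ?Q) \<preceq> emb (\<rho> n *\<^sub>R (star (t a W) * t a W))"
      unfolding ple_def using positive_emb_iff positive_star_mult by metis
    then have "norm (emb (star (t a ?Q) * t a ?Q)) \<le> norm (emb (\<rho> n *\<^sub>R (star (t a W) * t a W)))"
      by (rule norm_mono[rotated]) (simp only: positive_emb_iff positive_star_mult)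
    then have "(norm (t a ?Q))\<^sup>2 \<le> \<rho> n * (norm (t a W))\<^sup>2"
      using \<rho>(1)[of n] by (simp only: norm_emb norm_scaleR cstar_identity abs_of_pos)
    also have "\<dots> = (sqrt (\<rho> n) * norm (t a W))\<^sup>2" using \<rho>(1)[of n] by (simp add: power_mult_distrib)
    finally show ?thesis by (rule power2_le_imp_le) (use \<rho>(1)[of n] in simp)
  qed
  have "(\<lambda>n. sqrt (\<rho> n) * norm (t a W)) \<longlonglongrightarrow> sqrt 0 * norm (t a W)" by (intro tendsto_intros \<rho>)
  then have "(\<lambda>n. sqrt (\<rho> n) * norm (t a W)) \<longlonglongrightarrow> 0" by simp
  then show ?thesis by (rule Lim_null_comparison[rotated]) (use le in simp)
qed

text \<open>The corner generates the whole stabilization as an ideal. Finite rank truncations of T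
  are handled with matrix units, and T itself as their limit by \<open>norm_t_tail\<close>.\<close>

lemma corner_annihilator:
  assumes c: "\<And>a d. corner a * d * c = 0" shows "c = 0"
proof -
  let ?e = matrix_unit_op
  \<comment> \<open>Row n of T factors through the corner as e_n0 e_00 (e_0n T). Spreading the three
    operators over three tensors needs a product of three algebra elements, since there is no unit
    to fill in.\<close>
  have fin: "t (a1 * (a2 * a3)) (head_op n o\<^sub>L T) * c = 0" if T: "T \<in> compact_ops" for a1 a2 a3 T n
  proof (induction n)
    let ?P = head_op
    {
      case 0
      have "?P 0 o\<^sub>L T = 0 *\<^sub>C T" by (intro blinfun_eqI ell2_eqI) (simp add: nth2_head_op)
      then show ?case using T by (simp only: t_scaleC_op) simp
    next
      case (Suc n)
      have "?P (Suc n) o\<^sub>L T = (?P n o\<^sub>L T) + (?e n 0 o\<^sub>L (?e 0 0 o\<^sub>L (?e 0 n o\<^sub>L T)))"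
        by (intro blinfun_eqI ell2_eqI) (auto simp: nth2_head_op blinfun.add_left matrix_unit_op_apply nth2_ket less_Suc_eq)
      moreover have "t (a1 * (a2 * a3)) (?e n 0 o\<^sub>L (?e 0 0 o\<^sub>L (?e 0 n o\<^sub>L T))) = t a1 (?e n 0) * (corner a2 * t a3 (?e 0 n o\<^sub>L T))"
        unfolding corner_def
        by (simp add: t_mult compact_matrix_unit_op compact_compose_left clinear_matrix_unit_op T)
      moreover have "(t a1 (?e n 0) * (corner a2 * t a3 (?e 0 n o\<^sub>L T))) * c = 0"
        using c by (simp add: mult.assoc)
      ultimately show ?case using Suc T
        by (simp add: t_add_op compact_compose_left clinear_head_op clinear_matrix_unit_op distrib_right)
    }
  qed
  have zero3: "t (a1 * (a2 * a3)) T * c = 0" if T: "T \<in> compact_ops" for a1 a2 a3 T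
  proof -
    let ?a = "a1 * (a2 * a3)"
    have "t ?a T * c = t ?a (tail_op n o\<^sub>L T) * c" for n
    proof -
      let ?P = "head_op n"
      have "T = (?P o\<^sub>L T) + (tail_op n o\<^sub>L T)"
        by (intro blinfun_eqI ell2_eqI) (simp add: blinfun.add_left nth2_tail_op nth2_head_op)
      then have "t ?a T = t ?a ((?P o\<^sub>L T) + (tail_op n o\<^sub>L T))" by (rule arg_cong)
      also have "\<dots> = t ?a (?P o\<^sub>L T) + t ?a (tail_op n o\<^sub>L T)"
        using T by (intro t_add_op compact_compose_left clinear_head_op clinear_tail_op)
      finally show ?thesis using fin[OF T, of a1 a2 a3 n] by (simp add: distrib_right)
    qed
    then have "norm (t ?a T * c) \<le> norm (t ?a (tail_op n o\<^sub>L T)) * norm c" for n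
      by (metis norm_mult_ineq)
    moreover have "(\<lambda>n. norm (t ?a (tail_op n o\<^sub>L T)) * norm c) \<longlonglongrightarrow> 0"
      using tendsto_mult_left_zero[OF norm_t_tail[OF T]] .
    ultimately have "norm (t ?a T * c) \<le> 0" by (intro LIMSEQ_le_const) auto
    then show ?thesis by simp
  qed
  \<comment> \<open>The product x (star x) x of a tensor x has a triple product in its first
    component. Two uses of the C*-identity then remove the extra factors and leave x c = 0.\<close>
  have zero: "t a T * c = 0" if T: "T \<in> compact_ops" for a T
  proof -
    let ?x = "t a T"
    have ad: "op_adjoint T \<in> compact_ops" by (rule compact_op_adjoint[OF T])
    have "?x * (star ?x * ?x) = t (a * (star a * a)) (T o\<^sub>L (op_adjoint T o\<^sub>L T))"
      using T ad by (simp add: t_star t_mult compact_compose_right compact_ops_clinear)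
    then have "?x * (star ?x * ?x) * c = 0"
      using zero3[of "T o\<^sub>L (op_adjoint T o\<^sub>L T)" a "star a" a] T ad
      by (simp add: compact_compose_right compact_ops_clinear clinear_compose)
    then have "star c * (star ?x * (?x * (star ?x * ?x) * c)) = 0" by simp
    then have "star (star ?x * ?x * c) * (star ?x * ?x * c) = 0" by (simp add: star_mult mult.assoc)
    then have "star ?x * ?x * c = 0" by (simp only: star_mult_self_eq_0_iff)
    then have "star c * (star ?x * ?x * c) = 0" by simp
    then have "star (?x * c) * (?x * c) = 0" by (simp add: star_mult mult.assoc)
    then show ?thesis by (simp only: star_mult_self_eq_0_iff)
  qed
  have "star c * c \<in> {0}"
  proof (rule closure_subset_closed[where f = "\<lambda>x. x * c"])
    show "star c \<in> closure (span {t a T | a T. T \<in> compact_ops})" by (simp add: t_dense)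
    show "continuous_on UNIV (\<lambda>x. x * c)" by (intro continuous_intros)
    have "linear (\<lambda>x. x * c)" by (rule linearI) (simp_all add: distrib_right)
    then show "x * c \<in> {0}" if "x \<in> span {t a T | a T. T \<in> compact_ops}" for x
      by (rule span_subset_subspace[where f = "\<lambda>x. x * c", rotated 2, OF _ that])
        (use zero in \<open>auto simp: Real_Vector_Spaces.subspace_def\<close>)
  qed simp
  then show ?thesis by simp
qed

end

section \<open>The bimodule between two corners of one algebra\<close>

lemma subspace_closure:
  fixes V :: "'a::real_normed_vector set"
  assumes V: "Real_Vector_Spaces.subspace V" shows "Real_Vector_Spaces.subspace (closure V)"
proof (rule Real_Vector_Spaces.subspaceI)
  have V': "0 \<in> V" "\<And>x y. x \<in> V \<Longrightarrow> y \<in> V \<Longrightarrow> x + y \<in> V" "\<And>r x. x \<in> V \<Longrightarrow> r *\<^sub>R x \<in> V"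
    using V by (auto simp: Real_Vector_Spaces.subspace_def)
  note cl = closure_subset[THEN subsetD]
  show "0 \<in> closure V" by (intro cl V')
  have *: "x + y \<in> closure V" if "x \<in> V" "y \<in> closure V" for x y
    by (rule closure_subset_closed[where f = "\<lambda>y. x + y", OF _ closed_closure _ that(2)])
      (use that in \<open>auto intro!: cl V' continuous_intros\<close>)
  show "x + y \<in> closure V" if "x \<in> closure V" "y \<in> closure V" for x y
    by (rule closure_subset_closed[where f = "\<lambda>x. x + y", OF _ closed_closure _ that(1)])
      (use that in \<open>auto intro!: * continuous_intros\<close>)
  show "r *\<^sub>R x \<in> closure V" if "x \<in> closure V" for r x
    by (rule closure_subset_closed[where f = "\<lambda>x. r *\<^sub>R x", OF _ closed_closure _ that])
      (auto intro!: cl V' continuous_intros)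
qed

text \<open>The situation after identifying the two stabilizations: both algebras are corners of one
  algebra, and \<open>left_annihilator\<close> says that the first corner generates it as an ideal.
  The bimodule is the algebraic span of \<phi>(A) C \<psi>(B), with products in the large algebra as
  actions and inner products.\<close>

locale linked_corners = l: injective_star_hom \<phi> + r: injective_star_hom \<psi>
  for \<phi> :: "'a::cstar_algebra \<Rightarrow> 'c::cstar_algebra" and \<psi> :: "'b::cstar_algebra \<Rightarrow> 'c" +
  assumes left_corner: "\<exists>b. \<phi> a * c * \<phi> a' = \<phi> b" and right_corner: "\<exists>b. \<psi> d * c * \<psi> d' = \<psi> b"
    and left_annihilator: "(\<And>a d. \<phi> a * d * c = 0) \<Longrightarrow> c = 0"
    and simple: "simple_cstar TYPE('b)"
begin

definition gens :: "'c set" where "gens = {\<phi> a * c * \<psi> b | a c b. True}"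
definition X :: "'c set" where "X = span gens"

lemma gensI: "\<phi> a * c * \<psi> b \<in> gens"
  by (auto simp: gens_def)

lemma subspace_X: "Real_Vector_Spaces.subspace X"
  by (simp add: X_def)

lemma X_linear:
  assumes "linear f" "Real_Vector_Spaces.subspace V" "\<And>a c b. f (\<phi> a * c * \<psi> b) \<in> V" "x \<in> X"
  shows "f x \<in> V"
  by (rule span_subset_subspace[OF _ assms(2,1) assms(4)[unfolded X_def]]) (use assms(3) in \<open>auto simp: gens_def\<close>)

lemma linear_star: "linear (star :: 'c \<Rightarrow> 'c)"
  using bounded_linear_star by (rule bounded_linear.linear)

lemma linear_mult_left: "linear (\<lambda>x. y * x :: 'c)" and linear_mult_right: "linear (\<lambda>x. x * y :: 'c)"
  by (auto intro!: linearI simp: algebra_simps)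

lemma linear_scaleC: "linear (\<lambda>x. c *\<^sub>C x :: 'c)"
  using bounded_linear_scaleC by (rule bounded_linear.linear)

lemma left_inner: assumes x: "x \<in> X" and y: "y \<in> X" shows "x * star y \<in> range \<phi>"
proof (rule X_linear[OF linear_mult_right l.subspace_range _ x])
  fix a c b
  have "linear (\<lambda>y. \<phi> a * c * \<psi> b * star y)"
    using linear_compose[OF linear_star linear_mult_left, of "\<phi> a * c * \<psi> b"] by (simp add: o_def)
  then show "\<phi> a * c * \<psi> b * star y \<in> range \<phi>"
  proof (rule X_linear[OF _ l.subspace_range _ y])
    fix a' c' b'
    have "\<phi> a * c * \<psi> b * star (\<phi> a' * c' * \<psi> b') = \<phi> a * (c * \<psi> b * star (\<psi> b') * star c') * \<phi> (star a')"
      by (simp add: star_mult l.hom_simps mult.assoc)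
    then show "\<phi> a * c * \<psi> b * star (\<phi> a' * c' * \<psi> b') \<in> range \<phi>"
      using left_corner[of a "c * \<psi> b * star (\<psi> b') * star c'" "star a'"] by auto
  qed
qed

lemma right_inner: assumes x: "x \<in> X" and y: "y \<in> X" shows "star x * y \<in> range \<psi>"
proof (rule X_linear[OF linear_mult_left r.subspace_range _ y])
  fix a c b
  have "linear (\<lambda>x. star x * (\<phi> a * c * \<psi> b))"
    using linear_compose[OF linear_star linear_mult_right, of "\<phi> a * c * \<psi> b"] by (simp add: o_def)
  then show "star x * (\<phi> a * c * \<psi> b) \<in> range \<psi>"
  proof (rule X_linear[OF _ r.subspace_range _ x])
    fix a' c' b'
    have "star (\<phi> a' * c' * \<psi> b') * (\<phi> a * c * \<psi> b) = \<psi> (star b') * (star c' * star (\<phi> a') * \<phi> a * c) * \<psi> b"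
      by (simp add: star_mult r.hom_simps mult.assoc)
    then show "star (\<phi> a' * c' * \<psi> b') * (\<phi> a * c * \<psi> b) \<in> range \<psi>"
      using right_corner[of "star b'" "star c' * star (\<phi> a') * \<phi> a * c" b] by auto
  qed
qed

definition lip :: "'c \<Rightarrow> 'c \<Rightarrow> 'a" where "lip x y = inv_into UNIV \<phi> (x * star y)"
definition rip :: "'c \<Rightarrow> 'c \<Rightarrow> 'b" where "rip x y = inv_into UNIV \<psi> (star x * y)"

lemma lip: "x \<in> X \<Longrightarrow> y \<in> X \<Longrightarrow> \<phi> (lip x y) = x * star y"
  unfolding lip_def using left_inner by (rule f_inv_into_f)

lemma rip: "x \<in> X \<Longrightarrow> y \<in> X \<Longrightarrow> \<psi> (rip x y) = star x * y"
  unfolding rip_def using right_inner by (rule f_inv_into_f)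

lemma X_closed: "0 \<in> X" "x \<in> X \<Longrightarrow> y \<in> X \<Longrightarrow> x + y \<in> X" "x \<in> X \<Longrightarrow> c *\<^sub>C x \<in> X" "x \<in> X \<Longrightarrow> \<phi> a * x \<in> X" "x \<in> X \<Longrightarrow> x * \<psi> b \<in> X"
proof -
  show "0 \<in> X" "x \<in> X \<Longrightarrow> y \<in> X \<Longrightarrow> x + y \<in> X"
    using subspace_X by (auto simp: Real_Vector_Spaces.subspace_def)
  have gX: "\<phi> a * c * \<psi> b \<in> X" for a c b unfolding X_def by (rule span_base[OF gensI])
  show "c *\<^sub>C x \<in> X" if "x \<in> X"
  proof (rule X_linear[OF linear_scaleC subspace_X _ that])
    show "c *\<^sub>C (\<phi> a * d * \<psi> b) \<in> X" for a d b using gX[of "c *\<^sub>C a" d b] by (simp add: l.hom_simps scaleC_mult_left)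
  qed
  show "\<phi> a * x \<in> X" if "x \<in> X"
  proof (rule X_linear[OF linear_mult_left subspace_X _ that])
    show "\<phi> a * (\<phi> a' * d * \<psi> b) \<in> X" for a' d b using gX[of "a * a'" d b] by (simp add: l.hom_simps mult.assoc)
  qed
  show "x * \<psi> b \<in> X" if "x \<in> X"
  proof (rule X_linear[OF linear_mult_right subspace_X _ that])
    show "\<phi> a' * d * \<psi> b' * \<psi> b \<in> X" for a' d b' using gX[of a' d "b' * b"] by (simp add: r.hom_simps mult.assoc)
  qed
qed

text \<open>The closed span is an ideal of the simple algebra B. If it were zero, all of \<phi>(A) C
  \<psi>(B) would vanish, and since \<phi>(A) generates the large algebra, \<psi>(B) would vanish
  too; then B = 0 and the claim holds trivially.\<close>

lemma rip_full: "closure (span {rip x y | x y. x \<in> X \<and> y \<in> X}) = UNIV"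
proof -
  let ?S = "{rip x y | x y. x \<in> X \<and> y \<in> X}"
  have sub: "Real_Vector_Spaces.subspace (closure (span ?S))" by (rule subspace_closure) simp
  have ext: "f b \<in> closure (span ?S)"
    if f: "bounded_linear f" and g: "\<And>x y. x \<in> X \<Longrightarrow> y \<in> X \<Longrightarrow> f (rip x y) \<in> ?S" and b: "b \<in> closure (span ?S)" for f b
  proof (rule closure_subset_closed[where f = f, OF _ closed_closure _ b])
    show "continuous_on UNIV f" using f by (rule linear_continuous_on)
    show "f x \<in> closure (span ?S)" if "x \<in> span ?S" for x
    proof (rule span_subset_subspace[OF _ sub bounded_linear.linear[OF f] that])
      fix x assume "x \<in> ?S"
      then have "f x \<in> span ?S" using g by (intro span_base) auto
      then show "f x \<in> closure (span ?S)" by (rule closure_subset[THEN subsetD])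
    qed
  qed
  have "closed_ideal (closure (span ?S))"
    unfolding closed_ideal_def
  proof (intro conjI ballI allI)
    show "0 \<in> closure (span ?S)" "\<And>x y. x \<in> closure (span ?S) \<Longrightarrow> y \<in> closure (span ?S) \<Longrightarrow> x + y \<in> closure (span ?S)"
      using sub by (auto simp: Real_Vector_Spaces.subspace_def)
    fix b c and z :: complex assume b: "b \<in> closure (span ?S)"
    show "z *\<^sub>C b \<in> closure (span ?S)"
    proof (rule ext[OF bounded_linear_scaleC _ b])
      fix x y assume "x \<in> X" "y \<in> X"
      moreover from this have "z *\<^sub>C rip x y = rip x (z *\<^sub>C y)"
        by (subst r.hom_eq_iff[symmetric]) (simp add: rip X_closed r.hom_simps scaleC_mult_right)
      ultimately show "z *\<^sub>C rip x y \<in> ?S" using X_closed by blast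
    qed
    show "c * b \<in> closure (span ?S)"
    proof (rule ext[OF bounded_linear_mult_right _ b])
      fix x y assume "x \<in> X" "y \<in> X"
      moreover from this have "c * rip x y = rip (x * \<psi> (star c)) y" using X_closed(5)[of x "star c"]
        by (subst r.hom_eq_iff[symmetric]) (simp add: rip X_closed r.hom_simps star_mult mult.assoc)
      ultimately show "c * rip x y \<in> ?S" using X_closed by blast
    qed
    show "b * c \<in> closure (span ?S)"
    proof (rule ext[OF bounded_linear_mult_left _ b])
      fix x y assume "x \<in> X" "y \<in> X"
      moreover from this have "rip x y * c = rip x (y * \<psi> c)"
        by (subst r.hom_eq_iff[symmetric]) (simp add: rip X_closed r.hom_simps mult.assoc)
      ultimately show "rip x y * c \<in> ?S" using X_closed by blast
    qed
  qed simp
  then have "closure (span ?S) = {0} \<or> closure (span ?S) = UNIV" using simple by (simp add: simple_cstar_def)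
  moreover have "closure (span ?S) = UNIV" if z: "closure (span ?S) = {0}"
  proof -
    have "x = 0" if "x \<in> X" for x
    proof -
      have "rip x x \<in> closure (span ?S)" using that by (intro closure_subset[THEN subsetD] span_base) blast
      then have "star x * x = 0" using z rip[OF that that] r.hom_0 by simp
      then show ?thesis by simp
    qed
    then have "\<phi> a * c * \<psi> b = 0" for a c b unfolding X_def using span_base[OF gensI] by blast
    then have "\<psi> b = 0" for b by (rule left_annihilator)
    then have "b = 0" for b :: 'b using r.hom_eq_iff[of b 0] r.hom_0 by simp
    then show ?thesis unfolding z by auto
  qed
  ultimately show ?thesis by blast
qed

sublocale morita_context X "\<lambda>a x. \<phi> a * x" "\<lambda>x b. x * \<psi> b" lip rip
proof
  show "closure (span {rip x y | x y. x \<in> X \<and> y \<in> X}) = UNIV" by (rule rip_full)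
  fix x y z :: 'c
  assume x: "x \<in> X" and y: "y \<in> X"
  show "positive (lip x x)" using l.hom_positive_iff[of "lip x x"] lip[OF x x] by simp
  show "positive (rip x x)" using r.hom_positive_iff[of "rip x x"] rip[OF x x] by simp
  show "star (lip x y) = lip y x" and "star (rip x y) = rip y x"
    using x y by (simp_all add: lip rip l.hom_simps r.hom_simps star_mult flip: l.hom_eq_iff r.hom_eq_iff)
  show "lip (\<phi> a * x) y = a * lip x y" for a
    using x y by (simp add: lip X_closed l.hom_simps mult.assoc flip: l.hom_eq_iff)
  show "rip x (y * \<psi> b) = rip x y * b" for b
    using x y by (simp add: rip X_closed r.hom_simps mult.assoc flip: r.hom_eq_iff)
  show "rip (\<phi> a * x) y = rip x (\<phi> (star a) * y)" for a
    using x y X_closed(4)[OF y, of "star a"]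
    by (simp add: rip X_closed l.hom_simps star_mult mult.assoc flip: r.hom_eq_iff)
  show "lip (x * \<psi> b) y = lip x (y * \<psi> (star b))" for b
    using x y X_closed(5)[OF y, of "star b"]
    by (simp add: lip X_closed r.hom_simps star_mult mult.assoc flip: l.hom_eq_iff)
  show "lip (c *\<^sub>C x) y = c *\<^sub>C lip x y" for c
    using x y by (simp add: lip X_closed l.hom_simps scaleC_mult_left flip: l.hom_eq_iff)
  show "rip x (c *\<^sub>C y) = c *\<^sub>C rip x y" for c
    using x y by (simp add: rip X_closed r.hom_simps scaleC_mult_right flip: r.hom_eq_iff)
  assume z: "z \<in> X"
  show "lip (x + y) z = lip x z + lip y z"
    using x y z by (simp add: lip X_closed l.hom_simps distrib_right flip: l.hom_eq_iff)
  show "rip x (y + z) = rip x y + rip x z"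
    using x y z by (simp add: rip X_closed r.hom_simps distrib_left flip: r.hom_eq_iff)
  show "\<phi> (lip x y) * z = x * \<psi> (rip y z)" using x y z by (simp add: lip rip mult.assoc)
qed (simp_all add: X_closed l.hom_simps r.hom_simps algebra_simps scaleC_mult_left scaleC_mult_right)

end

lemma tracially_Z_absorbing_stable:
  assumes simple: "simple_cstar TYPE('a::cstar_algebra)" "simple_cstar TYPE('b::cstar_algebra)"
    and st: "stably_isomorphic TYPE('c::cstar_algebra) TYPE('d::cstar_algebra) TYPE('a) TYPE('b)"
    and tza: "tracially_Z_absorbing TYPE('a)"
  shows "tracially_Z_absorbing TYPE('b)"
proof -
  obtain s :: "'a \<Rightarrow> (ell2 \<Rightarrow>\<^sub>L ell2) \<Rightarrow> 'c" and t :: "'b \<Rightarrow> (ell2 \<Rightarrow>\<^sub>L ell2) \<Rightarrow> 'd" and \<pi> :: "'c \<Rightarrow> 'd" where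
    s: "is_stabilization s" and t: "is_stabilization t" and \<pi>: "star_hom \<pi>" "bij \<pi>"
    using st unfolding stably_isomorphic_def cstar_isomorphic_def by blast
  interpret s: stabilization s by standard (rule s)
  interpret t: stabilization t by standard (rule t)
  interpret \<pi>: injective_star_hom \<pi> by standard (use \<pi> in \<open>auto simp: bij_def\<close>)
  define \<rho> where "\<rho> = inv_into UNIV \<pi>"
  have \<pi>\<rho>: "\<pi> (\<rho> d) = d" for d unfolding \<rho>_def using \<pi>(2) by (simp add: f_inv_into_f bij_is_surj)
  \<comment> \<open>The corner of the second stabilization is pulled back along the isomorphism, so
    that both corners lie in the first stabilization.\<close>
  define \<psi> where "\<psi> b = \<rho> (t.corner b)" for b
  have \<pi>\<psi>: "\<pi> (\<psi> b) = t.corner b" for b by (simp add: \<psi>_def \<pi>\<rho>)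
  interpret linked_corners s.corner \<psi>
  proof
    show "star_hom \<psi>" unfolding star_hom_def
      by (simp add: \<pi>.hom_simps \<pi>\<psi> t.hom_simps flip: \<pi>.hom_eq_iff)
    show "inj \<psi>" by (rule injI) (metis \<pi>\<psi> t.hom_eq_iff)
    show "\<exists>b. s.corner a * c * s.corner a' = s.corner b" for a c a' by (rule s.corner_compress)
    show "\<exists>b. \<psi> d * c * \<psi> d' = \<psi> b" for d c d'
      using t.corner_compress[of d "\<pi> c" d'] by (simp add: \<pi>.hom_simps \<pi>\<psi> flip: \<pi>.hom_eq_iff)
    show "c = 0" if "\<And>a d. s.corner a * d * c = 0" for c using that by (rule s.corner_annihilator)
    show "simple_cstar TYPE('b)" by (rule simple)
  qed
  show ?thesis by (rule tracially_Z_absorbing_transfer[OF assms(1) tza])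
qed

theorem corollary4p12:
  assumes "simple_cstar TYPE('a::cstar_algebra)"
    and "simple_cstar TYPE('b::cstar_algebra)"
  shows "(stably_isomorphic TYPE('c::cstar_algebra) TYPE('d::cstar_algebra) TYPE('a) TYPE('b) \<and>
            tracially_Z_absorbing TYPE('a) \<longrightarrow> tracially_Z_absorbing TYPE('b)) \<and>
         (sigma_unital TYPE('a) \<and> sigma_unital TYPE('b) \<and>
            morita_equivalent TYPE('x::complex_banach) TYPE('a) TYPE('b) \<and>
            tracially_Z_absorbing TYPE('a) \<longrightarrow> tracially_Z_absorbing TYPE('b))"
  using tracially_Z_absorbing_stable[OF assms] tracially_Z_absorbing_morita[OF assms(1)] by blast

end
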